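(* For every $m>\tfrac52$, the Madelung transform $$\Phi:G^m\to\mathcal{U}^{m-1},\qquad \Phi(\varphi,\tau)=\sqrt{\varphi_x}\,e^{\mathrm{i}\tau/2},$$ is a magnetomorphism between the magnetic systems $(G^m,\mathcal{G}^{\dot H^1},\Phi^*\mathrm{d}\alpha)$ and $(\mathcal{U}^{m-1},\mathcal{G}^{L^2},\mathrm{d}\alpha)$.
   Context: **Magnetic systems and magnetomorphisms.** A magnetic system $(M,g,\sigma)$ is a (possibly infinite-dimensional) manifold $M$ with a (weak or strong) Riemannian metric $g$ and a closed two-form $\sigma$. A magnetomorphism $\Phi:(M_1,g_1,\sigma_1)\to(M_2,g_2,\sigma_2)$ is a diffeomorphism with $\Phi^*g_2=g_1$ and $\Phi^*\sigma_2=\sigma_1$. **The group $G^m$.** $\mathbb{S}^1=\mathbb{R}/\mathbb{Z}$, $\mathbb{S}^1_{4\pi}=\mathbb{R}/4\pi\mathbb{Z}$. $\mathrm{Diff}^m_0(\mathbb{S}^1)$ is the group of orientation-preserving diffeomorphisms of $\mathbb{S}^1$ of Sobolev class $H^m$ fixing the point $0$, and $G^m=\mathrm{Diff}^m_0(\mathbb{S}^1)\rtimes H^{m-1}(\mathbb{S}^1,\mathbb{S}^1_{4\pi})$. Its tangent space at $(\varphi,\tau)$ consists of pairs $(U_1,U_2)\in H^m(\mathbb{S}^1,\mathbb{R})\times H^{m-1}(\mathbb{S}^1,\mathbb{R})$ with $U_1(0)=0$. The metric is $$\mathcal{G}^{\dot H^1}_{(\varphi,\tau)}\big((U_1,U_2),(V_1,V_2)\big)=\frac14\int_{\mathbb{S}^1}\Big(\frac{U_{1x}V_{1x}}{\varphi_x}+U_2V_2\,\varphi_x\Big)\mathrm{d}x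 .$$ **The target.** $\mathcal{U}^{m-1}=\{f\in H^{m-1}(\mathbb{S}^1,\mathbb{C}):\|f\|_{L^2}=1,\ f(x)\neq 0\ \forall x\in\mathbb{S}^1\}$ (an open subset of the $L^2$-unit sphere in $H^{m-1}(\mathbb{S}^1,\mathbb{C})$), with metric $\mathcal{G}^{L^2}=\mathrm{Re}\langle\cdot,\cdot\rangle_{L^2}$ and one-form $\alpha_f(F)=\tfrac12\mathrm{Re}\langle\mathrm{i}f,F\rangle_{L^2}$. *)

theory Defs
  imports "HOL-Analysis.Analysis" "HOL-Library.Function_Algebras"
begin

text \<open>Function spaces are real vector spaces with pointwise operations.\<close>

instantiation "fun" :: (type, real_vector) real_vector
begin
definition scaleR_fun_def: "r *\<^sub>R f = (\<lambda>x. r *\<^sub>R f x)"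
instance
  by standard (simp_all add: scaleR_fun_def fun_eq_iff scaleR_add_right scaleR_add_left)
end

lemma scaleR_fun_apply [simp]: "(r *\<^sub>R f) x = r *\<^sub>R f x"
  by (simp add: scaleR_fun_def)


section \<open>Calculus on Banach spaces given by a carrier and a norm\<close>

text \<open>The Sobolev space of order \<open>s\<close> depends on a real number \<open>s\<close>, so it cannot be a type of class
  \<^class>\<open>banach\<close>. Normed spaces are therefore linear subspaces of a type of class
  \<^class>\<open>real_vector\<close> with an explicit norm.\<close>

record 'e nspace =
  vecs :: "'e set"
  vnorm :: "'e \<Rightarrow> real"

definition banach_nspace :: "'e::real_vector nspace \<Rightarrow> bool" where
  "banach_nspace E \<longleftrightarrow>
     subspace (vecs E) \<and>
     (\<forall>x\<in>vecs E. 0 \<le> vnorm E x \<and> (vnorm E x = 0 \<longleftrightarrow> x = 0)) \<and>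
     (\<forall>x\<in>vecs E. \<forall>r. vnorm E (r *\<^sub>R x) = \<bar>r\<bar> * vnorm E x) \<and>
     (\<forall>x\<in>vecs E. \<forall>y\<in>vecs E. vnorm E (x + y) \<le> vnorm E x + vnorm E y) \<and>
     (\<forall>X. (\<forall>n::nat. X n \<in> vecs E) \<and>
          (\<forall>\<epsilon>>0. \<exists>N. \<forall>i\<ge>N. \<forall>j\<ge>N. vnorm E (X i - X j) < \<epsilon>)
        \<longrightarrow> (\<exists>x\<in>vecs E. (\<lambda>n. vnorm E (X n - x)) \<longlonglongrightarrow> 0))"

definition real_nspace :: "real nspace" where
  "real_nspace = \<lparr>vecs = UNIV, vnorm = abs\<rparr>"

definition prod_nspace :: "'e nspace \<Rightarrow> 'f nspace \<Rightarrow> ('e \<times> 'f) nspace" where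
  "prod_nspace E F = \<lparr>vecs = vecs E \<times> vecs F,
     vnorm = (\<lambda>(x, y). sqrt ((vnorm E x)\<^sup>2 + (vnorm F y)\<^sup>2))\<rparr>"

definition open_in :: "'e::real_vector nspace \<Rightarrow> 'e set \<Rightarrow> bool" where
  "open_in E W \<longleftrightarrow> W \<subseteq> vecs E \<and>
     (\<forall>x\<in>W. \<exists>\<epsilon>>0. \<forall>y\<in>vecs E. vnorm E (y - x) < \<epsilon> \<longrightarrow> y \<in> W)"

definition lin_on :: "'e::real_vector set \<Rightarrow> ('e \<Rightarrow> 'f::real_vector) \<Rightarrow> bool" where
  "lin_on V L \<longleftrightarrow> (\<forall>x\<in>V. \<forall>y\<in>V. L (x + y) = L x + L y) \<and> (\<forall>x\<in>V. \<forall>r. L (r *\<^sub>R x) = r *\<^sub>R L x)"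

text \<open>A \<open>k\<close>-linear map takes its arguments as a list of length \<open>k\<close>.\<close>

definition tuples :: "'e nspace \<Rightarrow> nat \<Rightarrow> 'e list set" where
  "tuples E k = {vs. length vs = k \<and> set vs \<subseteq> vecs E}"

definition bounded_multilinear ::
    "'e::real_vector nspace \<Rightarrow> 'f::real_vector nspace \<Rightarrow> nat \<Rightarrow> ('e list \<Rightarrow> 'f) \<Rightarrow> bool" where
  "bounded_multilinear E F k L \<longleftrightarrow>
     (\<forall>vs\<in>tuples E k. L vs \<in> vecs F) \<and>
     (\<forall>vs\<in>tuples E k. \<forall>i<k. lin_on (vecs E) (\<lambda>v. L (vs[i := v]))) \<and>
     (\<exists>C. \<forall>vs\<in>tuples E k. vnorm F (L vs) \<le> C * prod_list (map (vnorm E) vs))"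

text \<open>Infinitely Frechet differentiable maps on an open set \<open>W\<close>: \<open>D x\<close> restricted to lists of
  length \<open>k\<close> is the \<open>k\<close>-th derivative at \<open>x\<close>, and \<open>h # vs \<mapsto> D x (h # vs)\<close> is the derivative of
  \<open>x \<mapsto> D x\<close> with respect to the operator norm of \<open>k\<close>-linear maps.\<close>

definition smooth_on ::
    "'e::real_vector nspace \<Rightarrow> 'f::real_vector nspace \<Rightarrow> 'e set \<Rightarrow> ('e \<Rightarrow> 'f) \<Rightarrow> bool" where
  "smooth_on E F W f \<longleftrightarrow> (\<exists>D.
     (\<forall>x\<in>W. D x [] = f x) \<and>
     (\<forall>x\<in>W. \<forall>k. bounded_multilinear E F k (D x)) \<and>
     (\<forall>x\<in>W. \<forall>k. \<forall>\<epsilon>>0. \<exists>\<delta>>0. \<forall>h\<in>vecs E. vnorm E h < \<delta> \<longrightarrow> x + h \<in> W \<longrightarrow>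
        (\<forall>vs\<in>tuples E k. vnorm F (D (x + h) vs - D x vs - D x (h # vs))
            \<le> \<epsilon> * vnorm E h * prod_list (map (vnorm E) vs))))"

text \<open>The value at \<open>v\<close> of the derivative of \<open>f\<close> at \<open>x\<close>. It is only applied to smooth maps, where the
  directional derivative is the value of the Frechet derivative.\<close>

definition dderiv :: "'f::real_vector nspace \<Rightarrow> ('e::real_vector \<Rightarrow> 'f) \<Rightarrow> 'e \<Rightarrow> 'e \<Rightarrow> 'f" where
  "dderiv F f x v = (THE w. w \<in> vecs F \<and>
     ((\<lambda>t::real. vnorm F ((f (x + t *\<^sub>R v) - f x) /\<^sub>R t - w)) \<longlongrightarrow> 0) (at 0))"


section \<open>Smooth Banach manifolds\<close>

text \<open>The tangent spaces consist of concrete vectors of a type \<open>'v\<close>. A chart comes with its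
  differential \<open>cdiff c p\<close>, an isomorphism from the tangent space at \<open>p\<close> to the model space;
  \<open>is_manifold\<close> demands that the differentials of two charts are related by the derivative of the
  transition map.\<close>

record ('p, 'v, 'e) chart =
  cdom :: "'p set"
  cmap :: "'p \<Rightarrow> 'e"
  cdiff :: "'p \<Rightarrow> 'v \<Rightarrow> 'e"
  cmodel :: "'e nspace"

record ('p, 'v, 'e) manifold =
  points :: "'p set"
  tangent :: "'p \<Rightarrow> 'v set"
  atlas :: "('p, 'v, 'e) chart set"

definition cinv :: "('p, 'v, 'e) chart \<Rightarrow> 'e \<Rightarrow> 'p" where
  "cinv c = inv_into (cdom c) (cmap c)"

definition open_subset :: "('p, 'v, 'e::real_vector) manifold \<Rightarrow> 'p set \<Rightarrow> bool" where
  "open_subset M A \<longleftrightarrow> A \<subseteq> points M \<and>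
     (\<forall>c\<in>atlas M. open_in (cmodel c) (cmap c ` (A \<inter> cdom c)))"

definition is_manifold :: "('p, 'v::real_vector, 'e::real_vector) manifold \<Rightarrow> bool" where
  "is_manifold M \<longleftrightarrow>
     points M = (\<Union>c\<in>atlas M. cdom c) \<and>
     (\<forall>p\<in>points M. subspace (tangent M p)) \<and>
     (\<forall>c\<in>atlas M. banach_nspace (cmodel c) \<and> inj_on (cmap c) (cdom c) \<and>
        (\<forall>p\<in>cdom c. lin_on (tangent M p) (cdiff c p) \<and>
                     bij_betw (cdiff c p) (tangent M p) (vecs (cmodel c)))) \<and>
     (\<forall>c\<in>atlas M. \<forall>d\<in>atlas M.
        open_in (cmodel c) (cmap c ` (cdom c \<inter> cdom d)) \<and>
        smooth_on (cmodel c) (cmodel d) (cmap c ` (cdom c \<inter> cdom d)) (cmap d \<circ> cinv c) \<and>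
        (\<forall>p\<in>cdom c \<inter> cdom d. \<forall>v\<in>tangent M p.
           cdiff d p v = dderiv (cmodel d) (cmap d \<circ> cinv c) (cmap c p) (cdiff c p v))) \<and>
     (\<forall>p\<in>points M. \<forall>q\<in>points M. p \<noteq> q \<longrightarrow>
        (\<exists>A B. open_subset M A \<and> open_subset M B \<and> p \<in> A \<and> q \<in> B \<and> A \<inter> B = {}))"

definition chart_at :: "('p, 'v, 'e) manifold \<Rightarrow> 'p \<Rightarrow> ('p, 'v, 'e) chart" where
  "chart_at M p = (SOME c. c \<in> atlas M \<and> p \<in> cdom c)"

definition smooth_map ::
    "('p, 'v, 'e::real_vector) manifold \<Rightarrow> ('q, 'w, 'f::real_vector) manifold \<Rightarrow> ('p \<Rightarrow> 'q) \<Rightarrow> bool"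
  where
  "smooth_map M N f \<longleftrightarrow> f ` points M \<subseteq> points N \<and>
     (\<forall>c\<in>atlas M. \<forall>d\<in>atlas N.
        open_in (cmodel c) (cmap c ` {p \<in> cdom c. f p \<in> cdom d}) \<and>
        smooth_on (cmodel c) (cmodel d) (cmap c ` {p \<in> cdom c. f p \<in> cdom d})
          (cmap d \<circ> f \<circ> cinv c))"

definition diffeomorphism ::
    "('p, 'v, 'e::real_vector) manifold \<Rightarrow> ('q, 'w, 'f::real_vector) manifold \<Rightarrow> ('p \<Rightarrow> 'q) \<Rightarrow> bool"
  where
  "diffeomorphism M N f \<longleftrightarrow> bij_betw f (points M) (points N) \<and>
     smooth_map M N f \<and> smooth_map N M (inv_into (points M) f)"

text \<open>The tangent map, computed in arbitrary charts around \<open>p\<close> and \<open>f p\<close>.\<close>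

definition tangent_map ::
    "('p, 'v, 'e::real_vector) manifold \<Rightarrow> ('q, 'w, 'f::real_vector) manifold \<Rightarrow> ('p \<Rightarrow> 'q)
      \<Rightarrow> 'p \<Rightarrow> 'v \<Rightarrow> 'w" where
  "tangent_map M N f p v =
     (let c = chart_at M p; d = chart_at N (f p) in
       inv_into (tangent N (f p)) (cdiff d (f p))
         (dderiv (cmodel d) (cmap d \<circ> f \<circ> cinv c) (cmap c p) (cdiff c p v)))"


section \<open>Magnetic systems\<close>

type_synonym ('p, 'v) bilinear_field = "'p \<Rightarrow> 'v \<Rightarrow> 'v \<Rightarrow> real"

definition cvec :: "('p, 'v, 'e) manifold \<Rightarrow> ('p, 'v, 'e) chart \<Rightarrow> 'e \<Rightarrow> 'e \<Rightarrow> 'v" where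
  "cvec M c x a = inv_into (tangent M (cinv c x)) (cdiff c (cinv c x)) a"

definition local_bilinear ::
    "('p, 'v, 'e) manifold \<Rightarrow> ('p, 'v, 'e) chart \<Rightarrow> ('p, 'v) bilinear_field
      \<Rightarrow> 'e \<Rightarrow> 'e \<Rightarrow> 'e \<Rightarrow> real" where
  "local_bilinear M c b x a1 a2 = b (cinv c x) (cvec M c x a1) (cvec M c x a2)"

definition smooth_bilinear_field ::
    "('p, 'v::real_vector, 'e::real_vector) manifold \<Rightarrow> ('p, 'v) bilinear_field \<Rightarrow> bool" where
  "smooth_bilinear_field M b \<longleftrightarrow>
     (\<forall>p\<in>points M. \<forall>v\<in>tangent M p.
        lin_on (tangent M p) (\<lambda>w. b p v w) \<and> lin_on (tangent M p) (\<lambda>w. b p w v)) \<and>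
     (\<forall>c\<in>atlas M.
        smooth_on (prod_nspace (cmodel c) (prod_nspace (cmodel c) (cmodel c))) real_nspace
          (cmap c ` cdom c \<times> vecs (cmodel c) \<times> vecs (cmodel c))
          (\<lambda>(x, a1, a2). local_bilinear M c b x a1 a2))"

text \<open>Weak Riemannian metrics: the metric need not induce the topology of the tangent spaces.\<close>

definition riemannian_metric ::
    "('p, 'v::real_vector, 'e::real_vector) manifold \<Rightarrow> ('p, 'v) bilinear_field \<Rightarrow> bool" where
  "riemannian_metric M g \<longleftrightarrow> smooth_bilinear_field M g \<and>
     (\<forall>p\<in>points M. \<forall>v\<in>tangent M p.
        (\<forall>w\<in>tangent M p. g p v w = g p w v) \<and> (v \<noteq> 0 \<longrightarrow> 0 < g p v v))"

text \<open>The vector fields below are constant in the chart, so their Lie brackets vanish in the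
  invariant formula for the exterior derivative.\<close>

definition closed_two_form ::
    "('p, 'v::real_vector, 'e::real_vector) manifold \<Rightarrow> ('p, 'v) bilinear_field \<Rightarrow> bool" where
  "closed_two_form M \<sigma> \<longleftrightarrow> smooth_bilinear_field M \<sigma> \<and>
     (\<forall>p\<in>points M. \<forall>v\<in>tangent M p. \<sigma> p v v = 0) \<and>
     (\<forall>c\<in>atlas M. \<forall>x\<in>cmap c ` cdom c.
        \<forall>a1\<in>vecs (cmodel c). \<forall>a2\<in>vecs (cmodel c). \<forall>a3\<in>vecs (cmodel c).
          dderiv real_nspace (\<lambda>y. local_bilinear M c \<sigma> y a2 a3) x a1
        + dderiv real_nspace (\<lambda>y. local_bilinear M c \<sigma> y a3 a1) x a2
        + dderiv real_nspace (\<lambda>y. local_bilinear M c \<sigma> y a1 a2) x a3 = 0)"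

definition ext_deriv ::
    "('p, 'v, 'e::real_vector) manifold \<Rightarrow> ('p \<Rightarrow> 'v \<Rightarrow> real) \<Rightarrow> ('p, 'v) bilinear_field" where
  "ext_deriv M \<alpha> p v w =
     (let c = chart_at M p; x = cmap c p; a = cdiff c p v; b = cdiff c p w in
        dderiv real_nspace (\<lambda>y. \<alpha> (cinv c y) (cvec M c y b)) x a
      - dderiv real_nspace (\<lambda>y. \<alpha> (cinv c y) (cvec M c y a)) x b)"

definition pullback ::
    "('p, 'v, 'e::real_vector) manifold \<Rightarrow> ('q, 'w, 'f::real_vector) manifold \<Rightarrow> ('p \<Rightarrow> 'q)
      \<Rightarrow> ('q, 'w) bilinear_field \<Rightarrow> ('p, 'v) bilinear_field" where
  "pullback M N f b p v w = b (f p) (tangent_map M N f p v) (tangent_map M N f p w)"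

type_synonym ('p, 'v, 'e) magnetic_data =
  "('p, 'v, 'e) manifold \<times> ('p, 'v) bilinear_field \<times> ('p, 'v) bilinear_field"

definition magnetic_system :: "('p, 'v::real_vector, 'e::real_vector) magnetic_data \<Rightarrow> bool" where
  "magnetic_system = (\<lambda>(M, g, \<sigma>). is_manifold M \<and> riemannian_metric M g \<and> closed_two_form M \<sigma>)"

definition magnetomorphism ::
    "('p, 'v::real_vector, 'e::real_vector) magnetic_data
      \<Rightarrow> ('q, 'w::real_vector, 'f::real_vector) magnetic_data \<Rightarrow> ('p \<Rightarrow> 'q) \<Rightarrow> bool" where
  "magnetomorphism = (\<lambda>(M\<^sub>1, g\<^sub>1, \<sigma>\<^sub>1) (M\<^sub>2, g\<^sub>2, \<sigma>\<^sub>2) \<Phi>.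
     magnetic_system (M\<^sub>1, g\<^sub>1, \<sigma>\<^sub>1) \<and> magnetic_system (M\<^sub>2, g\<^sub>2, \<sigma>\<^sub>2) \<and>
     diffeomorphism M\<^sub>1 M\<^sub>2 \<Phi> \<and>
     (\<forall>p\<in>points M\<^sub>1. \<forall>v\<in>tangent M\<^sub>1 p. \<forall>w\<in>tangent M\<^sub>1 p.
        pullback M\<^sub>1 M\<^sub>2 \<Phi> g\<^sub>2 p v w = g\<^sub>1 p v w \<and>
        pullback M\<^sub>1 M\<^sub>2 \<Phi> \<sigma>\<^sub>2 p v w = \<sigma>\<^sub>1 p v w))"


section \<open>Sobolev spaces on the circle\<close>

text \<open>Functions on the circle of length one are 1-periodic functions on the real line. Only orders
  \<open>s > 1/2\<close> are used, for which every Sobolev class has exactly one continuous representative.\<close>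

definition fourier_coeff :: "(real \<Rightarrow> complex) \<Rightarrow> int \<Rightarrow> complex" where
  "fourier_coeff f k = integral {0..1} (\<lambda>x. f x * cis (- 2 * pi * of_int k * x))"

definition sobolev_term :: "real \<Rightarrow> (real \<Rightarrow> complex) \<Rightarrow> int \<Rightarrow> real" where
  "sobolev_term s f k = (1 + (2 * pi * of_int k)\<^sup>2) powr s * (cmod (fourier_coeff f k))\<^sup>2"

definition sobolev_complex :: "real \<Rightarrow> (real \<Rightarrow> complex) nspace" where
  "sobolev_complex s =
     \<lparr>vecs = {f. continuous_on UNIV f \<and> (\<forall>x. f (x + 1) = f x) \<and> sobolev_term s f summable_on UNIV},
      vnorm = (\<lambda>f. sqrt (infsum (sobolev_term s f) UNIV))\<rparr>"

definition sobolev_real :: "real \<Rightarrow> (real \<Rightarrow> real) nspace" where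
  "sobolev_real s =
     \<lparr>vecs = {u. (\<lambda>x. complex_of_real (u x)) \<in> vecs (sobolev_complex s)},
      vnorm = (\<lambda>u. vnorm (sobolev_complex s) (\<lambda>x. complex_of_real (u x)))\<rparr>"

definition sobolev_real0 :: "real \<Rightarrow> (real \<Rightarrow> real) nspace" where
  "sobolev_real0 s = \<lparr>vecs = {u \<in> vecs (sobolev_real s). u 0 = 0}, vnorm = vnorm (sobolev_real s)\<rparr>"

definition L2_inner :: "(real \<Rightarrow> complex) \<Rightarrow> (real \<Rightarrow> complex) \<Rightarrow> complex" where
  "L2_inner f h = integral {0..1} (\<lambda>x. f x * cnj (h x))"


section \<open>The manifold \<open>G\<^sup>m\<close>\<close>

text \<open>The circle of length \<open>4\<pi>\<close>.\<close>

quotient_type circle4pi = real / "\<lambda>s t::real. \<exists>k::int. s - t = 4 * pi * of_int k"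
proof (rule equivpI)
  show "reflp (\<lambda>s t::real. \<exists>k::int. s - t = 4 * pi * of_int k)"
    by (auto simp: reflp_def intro: exI[of _ 0])
  show "symp (\<lambda>s t::real. \<exists>k::int. s - t = 4 * pi * of_int k)"
  proof (rule sympI)
    fix s t :: real
    assume "\<exists>k::int. s - t = 4 * pi * of_int k"
    then obtain k :: int where "s - t = 4 * pi * of_int k" ..
    then have "t - s = 4 * pi * of_int (- k)"
      by simp
    then show "\<exists>k::int. t - s = 4 * pi * of_int k" ..
  qed
  show "transp (\<lambda>s t::real. \<exists>k::int. s - t = 4 * pi * of_int k)"
  proof (rule transpI)
    fix s t u :: real
    assume "\<exists>k::int. s - t = 4 * pi * of_int k" "\<exists>k::int. t - u = 4 * pi * of_int k"
    then obtain k l :: int where "s - t = 4 * pi * of_int k" "t - u = 4 * pi * of_int l"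
      by blast
    then have "s - u = 4 * pi * of_int (k + l)"
      by (simp add: algebra_simps)
    then show "\<exists>k::int. s - u = 4 * pi * of_int k" ..
  qed
qed

text \<open>The map \<open>\<tau> \<mapsto> exp (\<i> \<tau> / 2)\<close>.\<close>

lift_definition half_exp :: "circle4pi \<Rightarrow> complex" is "\<lambda>t. cis (t / 2)"
proof -
  fix s t :: real
  assume "\<exists>k::int. s - t = 4 * pi * of_int k"
  then obtain k :: int where "s - t = 4 * pi * of_int k" ..
  then have "s / 2 = t / 2 + 2 * pi * of_int k"
    by (simp add: field_simps)
  then have "cis (s / 2) = cis (t / 2) * cis (2 * pi * of_int k)"
    by (simp only: cis_mult)
  then show "cis (s / 2) = cis (t / 2)"
    by simp
qed

text \<open>A circle diffeomorphism fixing \<open>0\<close> is represented by its unique lift to the real line that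
  fixes \<open>0\<close>. As \<open>m > 3/2\<close>, it is of class \<open>C\<^sup>1\<close>, and its inverse is of class \<open>H\<^sup>m\<close> as well.\<close>

definition Diff0 :: "real \<Rightarrow> (real \<Rightarrow> real) set" where
  "Diff0 m = {\<phi>. (\<lambda>x. \<phi> x - x) \<in> vecs (sobolev_real m) \<and> \<phi> 0 = 0 \<and>
     strict_mono \<phi> \<and> bij \<phi> \<and> \<phi> differentiable_on UNIV \<and> inv \<phi> differentiable_on UNIV}"

text \<open>Lifts of \<open>H\<^sup>s\<close> maps from the circle to the circle of length \<open>4\<pi>\<close>; \<open>n\<close> is the winding number.\<close>

definition circle_lifts :: "real \<Rightarrow> (real \<Rightarrow> real) set" where
  "circle_lifts s = {\<theta>. \<exists>n::int. (\<lambda>x. \<theta> x - 4 * pi * of_int n * x) \<in> vecs (sobolev_real s)}"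

definition sobolev_circle :: "real \<Rightarrow> (real \<Rightarrow> circle4pi) set" where
  "sobolev_circle s = {\<tau>. \<exists>\<theta>\<in>circle_lifts s. \<tau> = abs_circle4pi \<circ> \<theta>}"

text \<open>The chart around the map with lift \<open>\<theta>\<close>: the second component \<open>\<tau> = [\<theta> + h]\<close> with
  \<open>sup \<bar>h\<bar> < 2 \<pi>\<close> has coordinate \<open>h\<close>.\<close>

definition circle_coord :: "real \<Rightarrow> (real \<Rightarrow> real) \<Rightarrow> (real \<Rightarrow> circle4pi) \<Rightarrow> (real \<Rightarrow> real) \<Rightarrow> bool" where
  "circle_coord s \<theta> \<tau> h \<longleftrightarrow>
     h \<in> vecs (sobolev_real s) \<and> (\<forall>x. \<bar>h x\<bar> < 2 * pi) \<and> \<tau> = (\<lambda>x. abs_circle4pi (\<theta> x + h x))"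

type_synonym G_point = "(real \<Rightarrow> real) \<times> (real \<Rightarrow> circle4pi)"
type_synonym G_vector = "(real \<Rightarrow> real) \<times> (real \<Rightarrow> real)"

definition G_chart :: "real \<Rightarrow> (real \<Rightarrow> real) \<Rightarrow> (G_point, G_vector, G_vector) chart" where
  "G_chart m \<theta> =
     \<lparr>cdom = {(\<phi>, \<tau>). \<phi> \<in> Diff0 m \<and> (\<exists>h. circle_coord (m - 1) \<theta> \<tau> h)},
      cmap = (\<lambda>(\<phi>, \<tau>). (\<lambda>x. \<phi> x - x, THE h. circle_coord (m - 1) \<theta> \<tau> h)),
      cdiff = (\<lambda>_ U. U),
      cmodel = prod_nspace (sobolev_real0 m) (sobolev_real (m - 1))\<rparr>"

definition G_manifold :: "real \<Rightarrow> (G_point, G_vector, G_vector) manifold" where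
  "G_manifold m =
     \<lparr>points = Diff0 m \<times> sobolev_circle (m - 1),
      tangent = (\<lambda>_. {(U1, U2). U1 \<in> vecs (sobolev_real m) \<and> U1 0 = 0 \<and>
                               U2 \<in> vecs (sobolev_real (m - 1))}),
      atlas = G_chart m ` circle_lifts (m - 1)\<rparr>"

definition H1_metric :: "(G_point, G_vector) bilinear_field" where
  "H1_metric = (\<lambda>(\<phi>, \<tau>) (U1, U2) (V1, V2).
     1 / 4 * integral {0..1} (\<lambda>x. deriv U1 x * deriv V1 x / deriv \<phi> x + U2 x * V2 x * deriv \<phi> x))"


section \<open>The open subset of nowhere vanishing functions in the \<open>L\<^sup>2\<close> sphere\<close>

definition U_points :: "real \<Rightarrow> (real \<Rightarrow> complex) set" where
  "U_points s = {f \<in> vecs (sobolev_complex s). sqrt (Re (L2_inner f f)) = 1 \<and> (\<forall>x. f x \<noteq> 0)}"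

definition U_tangent :: "real \<Rightarrow> (real \<Rightarrow> complex) \<Rightarrow> (real \<Rightarrow> complex) set" where
  "U_tangent s f = {F \<in> vecs (sobolev_complex s). Re (L2_inner f F) = 0}"

definition proj_perp :: "(real \<Rightarrow> complex) \<Rightarrow> (real \<Rightarrow> complex) \<Rightarrow> (real \<Rightarrow> complex)" where
  "proj_perp f0 F = F - Re (L2_inner f0 F) *\<^sub>R f0"

text \<open>The submanifold structure of the unit sphere: near \<open>f0\<close>, the sphere is a graph over the
  tangent space at \<open>f0\<close>.\<close>

definition U_chart :: "real \<Rightarrow> (real \<Rightarrow> complex)
    \<Rightarrow> (real \<Rightarrow> complex, real \<Rightarrow> complex, real \<Rightarrow> complex) chart" where
  "U_chart s f0 =
     \<lparr>cdom = {f \<in> U_points s. 0 < Re (L2_inner f0 f)},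
      cmap = proj_perp f0,
      cdiff = (\<lambda>_. proj_perp f0),
      cmodel = \<lparr>vecs = U_tangent s f0, vnorm = vnorm (sobolev_complex s)\<rparr>\<rparr>"

definition U_manifold :: "real \<Rightarrow> (real \<Rightarrow> complex, real \<Rightarrow> complex, real \<Rightarrow> complex) manifold" where
  "U_manifold s = \<lparr>points = U_points s, tangent = U_tangent s, atlas = U_chart s ` U_points s\<rparr>"

definition L2_metric :: "(real \<Rightarrow> complex, real \<Rightarrow> complex) bilinear_field" where
  "L2_metric f F H = Re (L2_inner F H)"

definition alpha :: "(real \<Rightarrow> complex) \<Rightarrow> (real \<Rightarrow> complex) \<Rightarrow> real" where
  "alpha f F = 1 / 2 * Re (L2_inner (\<lambda>x. \<i> * f x) F)"

definition madelung :: "G_point \<Rightarrow> (real \<Rightarrow> complex)" where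
  "madelung = (\<lambda>(\<phi>, \<tau>) x. complex_of_real (sqrt (deriv \<phi> x)) * half_exp (\<tau> x))"

end

theory Submission
  imports Defs "HOL-Complex_Analysis.Cauchy_Integral_Formula"
begin

text \<open>The Sobolev space \<open>H\<^sup>s\<close> of the circle is a Banach algebra for \<open>s > 1/2\<close>, and for \<open>s > 3/2\<close> composition
  with a holomorphic function is a smooth map on the open set of all \<open>f\<close> in \<open>H\<^sup>s\<close> with values in its domain:
  as \<open>(n \<circ> f)' = (n' \<circ> f) f'\<close>, estimates of the Taylor remainder climb from the supremum norm to \<open>H\<^sup>s\<close>.

  The Madelung transform is injective because \<open>\<bar>\<Phi>(\<phi>, \<tau>)\<bar>\<^sup>2 = \<phi>'\<close>, and surjective because \<open>\<phi>\<close> is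
  recovered by integrating \<open>\<bar>f\<bar>\<^sup>2\<close> and the phase by integrating \<open>f' / f\<close>. In the chart around \<open>\<theta>\<close>, with
  coordinates \<open>(u, h)\<close>, it is \<open>sqrt (1 + u') exp (i (\<theta> + h) / 2)\<close>, and its inverse extends to a smooth map on an
  open subset of \<open>H\<^sup>m\<^sup>-\<^sup>1\<close>. The charts of the sphere are restrictions of smooth maps as well. Hence both
  manifolds are embedded into \<open>H\<^sup>m\<^sup>-\<^sup>1\<close> with the same image, so the transform is a diffeomorphism. Both metrics are
  restrictions of the real \<open>L\<^sup>2\<close> product, the first one by
  \<open>d\<Phi>(U\<^sub>1, U\<^sub>2) = (U\<^sub>1' / (2 \<phi>') + i U\<^sub>2 / 2) \<Phi>\<close>, and both two-forms are restrictions of the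
  constant symplectic form of \<open>L\<^sup>2\<close>, which is closed.\<close>

section \<open>Calculus on normed carriers\<close>

text \<open>The exponent is a real number, so no type can carry the calculus: linear maps are linear
  only on a carrier, and derivatives of all orders are functions on lists. Induction on the order
  would need maps with values in spaces of multilinear maps; the chain rule is therefore proved for
  all orders at once, with the formula of Faa di Bruno. Tangent maps, closedness and the exterior
  derivative are defined through directional derivatives, so the calculus carries the first
  derivative in closed form and asserts only the existence of the others.

  The threshold m > 5/2 means s = m - 1 > 3/2: derivatives of H^s functions lie in H^(s-1) with s -
  1 > 1/2, still an algebra of continuous functions. Square root, exponential, inverse and logarithm
  are applied to complex valued functions, even where the values are real, because a holomorphic
  function brings all its derivatives along.\<close>

definition normed_nspace :: "'e::real_vector nspace \<Rightarrow> bool" where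
  "normed_nspace E \<longleftrightarrow> subspace (vecs E) \<and>
     (\<forall>x\<in>vecs E. 0 \<le> vnorm E x \<and> (vnorm E x = 0 \<longleftrightarrow> x = 0)) \<and>
     (\<forall>x\<in>vecs E. \<forall>r. vnorm E (r *\<^sub>R x) = \<bar>r\<bar> * vnorm E x) \<and>
     (\<forall>x\<in>vecs E. \<forall>y\<in>vecs E. vnorm E (x + y) \<le> vnorm E x + vnorm E y)"

lemma banach_nspace_normed: "banach_nspace E \<Longrightarrow> normed_nspace E"
  by (simp add: banach_nspace_def normed_nspace_def)

context
  fixes E :: "'e::real_vector nspace"
  assumes E: "normed_nspace E"
begin

lemma nspace_subspace: "subspace (vecs E)"
  using E by (simp add: normed_nspace_def)

lemma nspace_0: "0 \<in> vecs E"
  using nspace_subspace by (rule subspace_0)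

lemma nspace_add: "x \<in> vecs E \<Longrightarrow> y \<in> vecs E \<Longrightarrow> x + y \<in> vecs E"
  using nspace_subspace by (rule subspace_add)

lemma nspace_diff: "x \<in> vecs E \<Longrightarrow> y \<in> vecs E \<Longrightarrow> x - y \<in> vecs E"
  using nspace_subspace by (rule subspace_diff)

lemma nspace_scale: "x \<in> vecs E \<Longrightarrow> r *\<^sub>R x \<in> vecs E"
  using nspace_subspace by (rule subspace_scale)

lemma nspace_sum: "(\<And>i. i \<in> I \<Longrightarrow> f i \<in> vecs E) \<Longrightarrow> sum f I \<in> vecs E"
  using nspace_subspace by (rule subspace_sum)

lemma vnorm_nonneg: "x \<in> vecs E \<Longrightarrow> 0 \<le> vnorm E x"
  using E by (simp add: normed_nspace_def)

lemma vnorm_eq_0: "x \<in> vecs E \<Longrightarrow> vnorm E x = 0 \<longleftrightarrow> x = 0"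
  using E by (simp add: normed_nspace_def)

lemma vnorm_0: "vnorm E 0 = 0"
  using vnorm_eq_0 nspace_0 by blast

lemma vnorm_scale: "x \<in> vecs E \<Longrightarrow> vnorm E (r *\<^sub>R x) = \<bar>r\<bar> * vnorm E x"
  using E by (simp add: normed_nspace_def)

lemma vnorm_add: "x \<in> vecs E \<Longrightarrow> y \<in> vecs E \<Longrightarrow> vnorm E (x + y) \<le> vnorm E x + vnorm E y"
  using E by (simp add: normed_nspace_def)

lemma vnorm_minus_commute: "x \<in> vecs E \<Longrightarrow> y \<in> vecs E \<Longrightarrow> vnorm E (x - y) = vnorm E (y - x)"
  using vnorm_scale[of "x - y" "-1"] nspace_diff[of x y] by simp

lemma vnorm_diff: "x \<in> vecs E \<Longrightarrow> y \<in> vecs E \<Longrightarrow> vnorm E (x - y) \<le> vnorm E x + vnorm E y"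
  using vnorm_add[of x "-1 *\<^sub>R y"] vnorm_scale[of y "-1"] nspace_scale[of y "-1"] by simp

lemma prod_vnorm_nonneg: "set vs \<subseteq> vecs E \<Longrightarrow> 0 \<le> prod_list (map (vnorm E) vs)"
  by (induction vs) (auto intro!: mult_nonneg_nonneg vnorm_nonneg)

end

lemma tuples_0 [simp]: "tuples E 0 = {[]}"
  by (auto simp: tuples_def)

lemma tuples_Cons [simp]: "v # vs \<in> tuples E (Suc k) \<longleftrightarrow> v \<in> vecs E \<and> vs \<in> tuples E k"
  by (auto simp: tuples_def)

lemma tuples_SucE:
  assumes "vs \<in> tuples E (Suc k)"
  obtains w ws where "vs = w # ws" "w \<in> vecs E" "ws \<in> tuples E k"
  using assms by (cases vs) (auto simp: tuples_def)

lemma tuples_update: "vs \<in> tuples E k \<Longrightarrow> v \<in> vecs E \<Longrightarrow> vs[i := v] \<in> tuples E k"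
  using set_update_subset_insert[of vs i v] by (auto simp: tuples_def)

lemma tuples_length: "vs \<in> tuples E k \<Longrightarrow> length vs = k"
  by (simp add: tuples_def)

lemma prod_vnorm_tuples: "normed_nspace E \<Longrightarrow> vs \<in> tuples E k \<Longrightarrow> 0 \<le> prod_list (map (vnorm E) vs)"
  by (rule prod_vnorm_nonneg) (auto simp: tuples_def)

section \<open>Linearity on a subset\<close>

lemma lin_onD:
  assumes "lin_on V L"
  shows "x \<in> V \<Longrightarrow> y \<in> V \<Longrightarrow> L (x + y) = L x + L y" and "x \<in> V \<Longrightarrow> L (r *\<^sub>R x) = r *\<^sub>R L x"
  using assms by (auto simp: lin_on_def)

lemma lin_on_diff:
  assumes "lin_on V L" "subspace V" "x \<in> V" "y \<in> V"
  shows "L (x - y) = L x - L y"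
proof -
  have "L (x + (-1) *\<^sub>R y) = L x + (-1) *\<^sub>R L y"
    using lin_onD[OF assms(1)] assms(2-4) by (metis subspace_scale)
  then show ?thesis by simp
qed

lemma lin_on_0: "lin_on V L \<Longrightarrow> subspace V \<Longrightarrow> L 0 = 0"
  using lin_on_diff[of V L 0 0] subspace_0[of V] by simp

lemma lin_on_zero [simp]: "lin_on V (\<lambda>v. 0)"
  by (simp add: lin_on_def)

lemma lin_on_subset: "lin_on V L \<Longrightarrow> U \<subseteq> V \<Longrightarrow> lin_on U L"
  unfolding lin_on_def by blast

lemma lin_on_id [simp]: "lin_on V (\<lambda>v. v)"
  by (simp add: lin_on_def)

lemma lin_on_add: "lin_on V f \<Longrightarrow> lin_on V g \<Longrightarrow> lin_on V (\<lambda>v. f v + g v)"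
  by (auto simp: lin_on_def algebra_simps)

lemma lin_on_sum_list:
  "(\<And>p. p \<in> set P \<Longrightarrow> lin_on V (f p)) \<Longrightarrow> lin_on V (\<lambda>v. \<Sum>p\<leftarrow>P. f p v)"
  by (induction P) (auto intro: lin_on_add)

lemma lin_on_compose: "lin_on V f \<Longrightarrow> f ` V \<subseteq> U \<Longrightarrow> lin_on U g \<Longrightarrow> lin_on V (\<lambda>v. g (f v))"
  unfolding lin_on_def by (auto simp: image_subset_iff)

lemma lin_on_Pair: "lin_on V f \<Longrightarrow> lin_on V g \<Longrightarrow> lin_on V (\<lambda>v. (f v, g v))"
  by (auto simp: lin_on_def)

subsection \<open>Multilinear maps\<close>

text \<open>The constant is a parameter and nonnegative, so that it can be multiplied and compared
  in estimates. Only lists of length \<open>k\<close> are constrained; one function on lists can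
  therefore hold the derivatives of all orders at a point.\<close>

definition multilinear_bound ::
  "'e::real_vector nspace \<Rightarrow> 'f::real_vector nspace \<Rightarrow> nat \<Rightarrow> real \<Rightarrow> ('e list \<Rightarrow> 'f) \<Rightarrow> bool" where
  "multilinear_bound E F k C L \<longleftrightarrow> 0 \<le> C \<and>
     (\<forall>vs\<in>tuples E k. L vs \<in> vecs F) \<and>
     (\<forall>vs\<in>tuples E k. \<forall>i<k. lin_on (vecs E) (\<lambda>v. L (vs[i := v]))) \<and>
     (\<forall>vs\<in>tuples E k. vnorm F (L vs) \<le> C * prod_list (map (vnorm E) vs))"

lemma bounded_multilinear_iff:
  assumes E: "normed_nspace E"
  shows "bounded_multilinear E F k L \<longleftrightarrow> (\<exists>C. multilinear_bound E F k C L)"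
proof
  assume L: "bounded_multilinear E F k L"
  then obtain C where C: "\<And>vs. vs \<in> tuples E k \<Longrightarrow> vnorm F (L vs) \<le> C * prod_list (map (vnorm E) vs)"
    unfolding bounded_multilinear_def by blast
  have "vnorm F (L vs) \<le> max C 0 * prod_list (map (vnorm E) vs)" if "vs \<in> tuples E k" for vs
    using C[OF that] prod_vnorm_tuples[OF E that]
    by (meson max.cobounded1 mult_right_mono order_trans)
  then have "multilinear_bound E F k (max C 0) L"
    using L unfolding bounded_multilinear_def multilinear_bound_def by simp
  then show "\<exists>C. multilinear_bound E F k C L" ..
next
  assume "\<exists>C. multilinear_bound E F k C L"
  then show "bounded_multilinear E F k L"
    unfolding bounded_multilinear_def multilinear_bound_def by blast
qed

text \<open>Prepares inductions on the number of arguments: with the first one frozen, its norm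
  moves into the constant. Both expansions of \<open>L\<close> below run on this.\<close>

lemma multilinear_bound_Cons:
  assumes E: "normed_nspace E" and L: "multilinear_bound E F (Suc k) C L" and v: "v \<in> vecs E"
  shows "multilinear_bound E F k (C * vnorm E v) (\<lambda>vs. L (v # vs))"
proof -
  have "lin_on (vecs E) (\<lambda>w. L (v # vs[i := w]))" if "vs \<in> tuples E k" "i < k" for vs i
  proof -
    have "lin_on (vecs E) (\<lambda>w. L ((v # vs)[Suc i := w]))"
      using L that v unfolding multilinear_bound_def by (metis Suc_less_eq tuples_Cons)
    then show ?thesis by simp
  qed
  then show ?thesis
    using L v vnorm_nonneg[OF E v] unfolding multilinear_bound_def
    by (auto simp: mult.assoc dest!: bspec[where x = "v # _"])
qed

lemma multilinear_bound_head:
  assumes L: "multilinear_bound E F (Suc k) C L" and vs: "vs \<in> tuples E k" and E: "normed_nspace E"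
  shows "lin_on (vecs E) (\<lambda>v. L (v # vs))"
proof -
  have "lin_on (vecs E) (\<lambda>v. L ((0 # vs)[0 := v]))"
    using L vs nspace_0[OF E] unfolding multilinear_bound_def by (metis tuples_Cons zero_less_Suc)
  then show ?thesis by simp
qed

lemma multilinear_boundD:
  assumes "multilinear_bound E F k C L" "vs \<in> tuples E k"
  shows "L vs \<in> vecs F" "vnorm F (L vs) \<le> C * prod_list (map (vnorm E) vs)"
  using assms unfolding multilinear_bound_def by auto

lemma prod_list_mono_norm:
  assumes "normed_nspace E" "\<And>q. q \<in> set Q \<Longrightarrow> a q \<in> vecs E \<and> vnorm E (a q) \<le> (c q :: real)"
  shows "prod_list (map (vnorm E) (map a Q)) \<le> prod_list (map c Q) \<and> 0 \<le> prod_list (map c Q)"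
  using assms(2)
proof (induction Q)
  case (Cons q Q)
  then show ?case
    using vnorm_nonneg[OF assms(1), of "a q"] prod_vnorm_nonneg[OF assms(1), of "map a Q"]
    by (auto intro!: mult_mono mult_nonneg_nonneg intro: order_trans)
qed simp

text \<open>Arguments are given as values along an index list \<open>Q\<close>, so that several
  argument lists of one length can be compared entry by entry. Later \<open>Q\<close> is a list of
  blocks, and \<open>c\<close> bounds the derivative of the inner map on each block.\<close>

lemma multilinear_bound_le:
  assumes E: "normed_nspace E" and L: "multilinear_bound E F (length Q) C L"
    and a: "\<And>q. q \<in> set Q \<Longrightarrow> a q \<in> vecs E \<and> vnorm E (a q) \<le> c q"
  shows "L (map a Q) \<in> vecs F" "vnorm F (L (map a Q)) \<le> C * prod_list (map c Q)"
proof -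
  have t: "map a Q \<in> tuples E (length Q)"
    using a by (auto simp: tuples_def)
  show "L (map a Q) \<in> vecs F" using multilinear_boundD(1)[OF L t] .
  have "C * prod_list (map (vnorm E) (map a Q)) \<le> C * prod_list (map c Q)"
    using prod_list_mono_norm[OF E a, of Q] L by (auto intro!: mult_left_mono simp: multilinear_bound_def)
  then show "vnorm F (L (map a Q)) \<le> C * prod_list (map c Q)"
    using multilinear_boundD(2)[OF L t] by linarith
qed

text \<open>Telescoping: one argument after the other is moved from \<open>a\<close> to
  \<open>b\<close>. Increments are measured relative to the same \<open>c q\<close> that bounds the
  arguments, hence the full product of the \<open>c q\<close> appears in the bound.\<close>

lemma multilinear_lipschitz:
  assumes E: "normed_nspace E" and F: "normed_nspace F"
    and L: "multilinear_bound E F (length Q) C L" and \<eta>: "0 \<le> \<eta>"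
    and ab: "\<And>q. q \<in> set Q \<Longrightarrow> a q \<in> vecs E \<and> b q \<in> vecs E \<and> vnorm E (a q) \<le> c q \<and>
      vnorm E (b q) \<le> c q \<and> vnorm E (b q - a q) \<le> \<eta> * c q"
  shows "vnorm F (L (map b Q) - L (map a Q)) \<le> C * (real (length Q) * \<eta> * prod_list (map c Q))"
  using L ab
proof (induction Q arbitrary: L C)
  case Nil
  then show ?case using vnorm_0[OF F] by simp
next
  case (Cons q Q)
  let ?n = "real (length Q)" and ?P = "prod_list (map c Q)"
  have L: "multilinear_bound E F (Suc (length Q)) C L" using Cons.prems(1) by simp
  have C: "0 \<le> C" using L by (simp add: multilinear_bound_def)
  have q: "a q \<in> vecs E" "b q \<in> vecs E" "vnorm E (a q) \<le> c q" "vnorm E (b q - a q) \<le> \<eta> * c q"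
    using Cons.prems(2)[of q] by auto
  have d: "b q - a q \<in> vecs E" using nspace_diff[OF E] q by simp
  have Q: "\<And>r. r \<in> set Q \<Longrightarrow> a r \<in> vecs E \<and> b r \<in> vecs E \<and> vnorm E (a r) \<le> c r \<and>
      vnorm E (b r) \<le> c r \<and> vnorm E (b r - a r) \<le> \<eta> * c r"
    using Cons.prems(2) by auto
  have P: "0 \<le> ?P" using prod_list_mono_norm[OF E, of Q a c] Q by blast
  have tb: "map b Q \<in> tuples E (length Q)" and ta: "map a Q \<in> tuples E (length Q)"
    using Q by (auto simp: tuples_def)
  note La = multilinear_bound_Cons[OF E L q(1)] and Ld = multilinear_bound_Cons[OF E L d]
  have 1: "vnorm F (L (a q # map b Q) - L (a q # map a Q)) \<le> C * vnorm E (a q) * (?n * \<eta> * ?P)"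
    by (rule Cons.IH[OF La Q]) auto
  have 2: "vnorm F (L ((b q - a q) # map b Q)) \<le> C * vnorm E (b q - a q) * ?P"
    by (rule multilinear_bound_le(2)[OF E Ld]) (use Q in auto)
  have eq: "L ((b q - a q) # map b Q) = L (b q # map b Q) - L (a q # map b Q)"
    by (rule lin_on_diff[OF multilinear_bound_head[OF L tb E] nspace_subspace[OF E]]) (use q in auto)
  have m: "L (b q # map b Q) \<in> vecs F" "L (a q # map b Q) \<in> vecs F" "L (a q # map a Q) \<in> vecs F"
    using multilinear_boundD(1)[OF L] q tb ta by auto
  have "vnorm F (L (b q # map b Q) - L (a q # map a Q))
      \<le> vnorm F (L (b q # map b Q) - L (a q # map b Q)) + vnorm F (L (a q # map b Q) - L (a q # map a Q))"
    using vnorm_add[OF F, of "L (b q # map b Q) - L (a q # map b Q)" "L (a q # map b Q) - L (a q # map a Q)"]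
      nspace_diff[OF F] m by simp
  also have "\<dots> \<le> C * vnorm E (b q - a q) * ?P + C * vnorm E (a q) * (?n * \<eta> * ?P)"
    using 1 2 eq by simp
  also have "\<dots> \<le> C * (\<eta> * c q) * ?P + C * c q * (?n * \<eta> * ?P)"
    by (intro add_mono mult_right_mono mult_left_mono) (use q C P \<eta> in auto)
  also have "\<dots> = C * (real (length (q # Q)) * \<eta> * prod_list (map c (q # Q)))"
    by (simp add: algebra_simps)
  finally show ?case by simp
qed

text \<open>The change of the head gives its linear part, an error of relative size \<epsilon>, and
  a mixed term in which head and tail both change. The mixed terms of all arguments accumulate to at
  most the square of the length times \<eta>^2.\<close>

lemma multilinear_first_order:
  assumes E: "normed_nspace E" and F: "normed_nspace F"
    and L: "multilinear_bound E F (length Q) C L" and \<eta>: "0 \<le> \<eta>" and \<epsilon>: "0 \<le> \<epsilon>"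
    and ab: "\<And>q. q \<in> set Q \<Longrightarrow> a q \<in> vecs E \<and> b q \<in> vecs E \<and> d q \<in> vecs E \<and> vnorm E (a q) \<le> c q \<and>
      vnorm E (b q) \<le> c q \<and> vnorm E (b q - a q) \<le> \<eta> * c q \<and> vnorm E (b q - a q - d q) \<le> \<epsilon> * c q"
  shows "vnorm F (L (map b Q) - L (map a Q) - (\<Sum>i<length Q. L ((map a Q)[i := d (Q ! i)])))
    \<le> C * ((real (length Q) * \<epsilon> + (real (length Q))\<^sup>2 * \<eta>\<^sup>2) * prod_list (map c Q))"
  using L ab
proof (induction Q arbitrary: L C)
  case Nil
  then show ?case using vnorm_0[OF F] by simp
next
  case (Cons q Q)
  let ?n = "real (length Q)" and ?P = "prod_list (map c Q)"
  have L: "multilinear_bound E F (Suc (length Q)) C L" using Cons.prems(1) by simp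
  have C: "0 \<le> C" using L by (simp add: multilinear_bound_def)
  have q: "a q \<in> vecs E" "b q \<in> vecs E" "d q \<in> vecs E" "vnorm E (a q) \<le> c q"
     "vnorm E (b q - a q) \<le> \<eta> * c q" "vnorm E (b q - a q - d q) \<le> \<epsilon> * c q"
    using Cons.prems(2)[of q] by auto
  have D: "b q - a q \<in> vecs E" "b q - a q - d q \<in> vecs E" using nspace_diff[OF E] q by simp_all
  have c: "0 \<le> c q" using vnorm_nonneg[OF E q(1)] q(4) by linarith
  have Q: "\<And>r. r \<in> set Q \<Longrightarrow> a r \<in> vecs E \<and> b r \<in> vecs E \<and> d r \<in> vecs E \<and> vnorm E (a r) \<le> c r \<and>
      vnorm E (b r) \<le> c r \<and> vnorm E (b r - a r) \<le> \<eta> * c r \<and> vnorm E (b r - a r - d r) \<le> \<epsilon> * c r"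
    using Cons.prems(2) by auto
  have P: "0 \<le> ?P" using prod_list_mono_norm[OF E, of Q a c] Q by blast
  have tb: "map b Q \<in> tuples E (length Q)" and ta: "map a Q \<in> tuples E (length Q)"
    using Q by (auto simp: tuples_def)
  have tu: "(map a Q)[i := d (Q ! i)] \<in> tuples E (length Q)" if "i < length Q" for i
    using tuples_update[OF ta] Q that by simp
  note La = multilinear_bound_Cons[OF E L q(1)] and Ld = multilinear_bound_Cons[OF E L D(1)]
    and Lr = multilinear_bound_Cons[OF E L D(2)]
  let ?S = "\<Sum>i<length Q. L (a q # (map a Q)[i := d (Q ! i)])"
  \<comment> \<open>\<open>?T1\<close> varies the tail with the head at \<open>a q\<close>,
    \<open>?T2\<close> varies the tail under the increment of the head and is of second order,
    \<open>?T3\<close> is the error of the linear part of the head.\<close>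
  let ?T1 = "L (a q # map b Q) - L (a q # map a Q) - ?S"
  let ?T2 = "L ((b q - a q) # map b Q) - L ((b q - a q) # map a Q)"
  let ?T3 = "L ((b q - a q - d q) # map a Q)"
  have 1: "vnorm F ?T1 \<le> C * vnorm E (a q) * ((?n * \<epsilon> + ?n\<^sup>2 * \<eta>\<^sup>2) * ?P)"
    by (rule Cons.IH[OF La Q]) auto
  have 2: "vnorm F ?T2 \<le> C * vnorm E (b q - a q) * (?n * \<eta> * ?P)"
    by (rule multilinear_lipschitz[OF E F Ld \<eta>]) (use Q in auto)
  have 3: "vnorm F ?T3 \<le> C * vnorm E (b q - a q - d q) * ?P"
    by (rule multilinear_bound_le(2)[OF E Lr]) (use Q in auto)
  have sub: "subspace (vecs E)" by (rule nspace_subspace[OF E])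
  have e1: "L ((b q - a q) # map b Q) = L (b q # map b Q) - L (a q # map b Q)"
    by (rule lin_on_diff[OF multilinear_bound_head[OF L tb E] sub]) (use q in auto)
  have e2: "L ((b q - a q) # map a Q) = L (b q # map a Q) - L (a q # map a Q)"
    by (rule lin_on_diff[OF multilinear_bound_head[OF L ta E] sub]) (use q in auto)
  have e3: "L ((b q - a q - d q) # map a Q) = L ((b q - a q) # map a Q) - L (d q # map a Q)"
    by (rule lin_on_diff[OF multilinear_bound_head[OF L ta E] sub]) (use q D in auto)
  have m: "L (b q # map b Q) \<in> vecs F" "L (a q # map b Q) \<in> vecs F" "L (a q # map a Q) \<in> vecs F"
    "L ((b q - a q) # map b Q) \<in> vecs F" "L ((b q - a q) # map a Q) \<in> vecs F" "?T3 \<in> vecs F"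
    using multilinear_boundD(1)[OF L] q tb ta D by auto
  have mS: "?S \<in> vecs F"
    by (rule nspace_sum[OF F]) (use multilinear_boundD(1)[OF L] q tu in auto)
  have T: "?T1 \<in> vecs F" "?T2 \<in> vecs F" using nspace_diff[OF F] m mS by auto
  have eq: "L (map b (q # Q)) - L (map a (q # Q))
      - (\<Sum>i<length (q # Q). L ((map a (q # Q))[i := d ((q # Q) ! i)])) = ?T1 + ?T2 + ?T3"
    unfolding e3 e1 e2 by (simp add: lessThan_Suc_eq_insert_0 sum.reindex)
  have "vnorm F (L (map b (q # Q)) - L (map a (q # Q))
      - (\<Sum>i<length (q # Q). L ((map a (q # Q))[i := d ((q # Q) ! i)])))
      \<le> vnorm F ?T1 + vnorm F ?T2 + vnorm F ?T3"
    unfolding eq using vnorm_add[OF F T] vnorm_add[OF F nspace_add[OF F T] m(6)] by linarith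
  also have "\<dots> \<le> C * c q * ((?n * \<epsilon> + ?n\<^sup>2 * \<eta>\<^sup>2) * ?P) + C * (\<eta> * c q) * (?n * \<eta> * ?P) + C * (\<epsilon> * c q) * ?P"
  proof (intro add_mono)
    show "vnorm F ?T1 \<le> C * c q * ((?n * \<epsilon> + ?n\<^sup>2 * \<eta>\<^sup>2) * ?P)"
      by (rule order_trans[OF 1], intro mult_right_mono mult_left_mono) (use q C P \<epsilon> \<eta> in auto)
    show "vnorm F ?T2 \<le> C * (\<eta> * c q) * (?n * \<eta> * ?P)"
      by (rule order_trans[OF 2], intro mult_right_mono mult_left_mono) (use q C P \<epsilon> \<eta> in auto)
    show "vnorm F ?T3 \<le> C * (\<epsilon> * c q) * ?P"
      by (rule order_trans[OF 3], intro mult_right_mono mult_left_mono) (use q C P \<epsilon> \<eta> in auto)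
  qed
  also have "\<dots> = C * (((?n + 1) * \<epsilon> + (?n\<^sup>2 + ?n) * \<eta>\<^sup>2) * (c q * ?P))"
    by (simp add: algebra_simps power2_eq_square)
  \<comment> \<open>Enlarging n^2 + n to (n + 1)^2 closes the induction.\<close>
  also have "\<dots> \<le> C * (((?n + 1) * \<epsilon> + (?n + 1)\<^sup>2 * \<eta>\<^sup>2) * (c q * ?P))"
    by (intro mult_left_mono mult_right_mono add_left_mono) (use C c P in \<open>auto simp: power2_eq_square algebra_simps\<close>)
  finally show ?case by (simp add: add.commute)
qed

subsection \<open>Smooth maps with a given first derivative\<close>

text \<open>The clause with a radius in \<open>smooth_on\<close> becomes an eventual statement along
  this filter, so that several remainder estimates can be combined by
  \<open>eventually_elim\<close>.\<close>

definition increments :: "'e::real_vector nspace \<Rightarrow> 'e set \<Rightarrow> 'e \<Rightarrow> 'e filter" where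
  "increments E W x = inf (filtercomap (vnorm E) (nhds 0)) (principal {h \<in> vecs E. x + h \<in> W})"

lemma eventually_increments:
  assumes E: "normed_nspace E"
  shows "eventually P (increments E W x) \<longleftrightarrow>
    (\<exists>\<delta>>0. \<forall>h\<in>vecs E. vnorm E h < \<delta> \<longrightarrow> x + h \<in> W \<longrightarrow> P h)"
proof
  assume "eventually P (increments E W x)"
  then obtain Q where Q: "eventually Q (nhds (0::real))"
    "\<And>h. Q (vnorm E h) \<Longrightarrow> h \<in> vecs E \<Longrightarrow> x + h \<in> W \<Longrightarrow> P h"
    unfolding increments_def eventually_inf_principal eventually_filtercomap by auto
  then obtain d where "d > 0" "\<And>r. \<bar>r\<bar> < d \<Longrightarrow> Q r"
    unfolding eventually_nhds_metric by (auto simp: dist_real_def)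
  with Q(2) show "\<exists>\<delta>>0. \<forall>h\<in>vecs E. vnorm E h < \<delta> \<longrightarrow> x + h \<in> W \<longrightarrow> P h"
    using vnorm_nonneg[OF E] by (metis abs_of_nonneg)
next
  assume "\<exists>\<delta>>0. \<forall>h\<in>vecs E. vnorm E h < \<delta> \<longrightarrow> x + h \<in> W \<longrightarrow> P h"
  then obtain d where d: "d > 0" "\<And>h. h \<in> vecs E \<Longrightarrow> vnorm E h < d \<Longrightarrow> x + h \<in> W \<Longrightarrow> P h" by blast
  have "eventually (\<lambda>r. r < d) (nhds (0::real))"
    using d(1) by (rule order_tendstoD(2)[OF filterlim_ident])
  then show "eventually P (increments E W x)"
    unfolding increments_def eventually_inf_principal eventually_filtercomap using d(2) by blast
qed

lemma eventually_increments_vecs: "eventually (\<lambda>h. h \<in> vecs E \<and> x + h \<in> W) (increments E W x)"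
  by (auto simp: increments_def eventually_inf_principal)

lemma eventually_increments_small:
  "normed_nspace E \<Longrightarrow> r > 0 \<Longrightarrow> eventually (\<lambda>h. vnorm E h < r) (increments E W x)"
  by (auto simp: eventually_increments)

lemma increments_mono: "W' \<subseteq> W \<Longrightarrow> increments E W' x \<le> increments E W x"
  unfolding increments_def by (intro inf_mono) auto

text \<open>The \<open>k\<close>-linear maps \<open>D x\<close> form the sequence of iterated derivatives of \<open>D x []\<close>.\<close>

definition derivatives ::
  "'e::real_vector nspace \<Rightarrow> 'f::real_vector nspace \<Rightarrow> 'e set \<Rightarrow> ('e \<Rightarrow> 'e list \<Rightarrow> 'f) \<Rightarrow> bool" where
  "derivatives E F W D \<longleftrightarrow>
     (\<forall>x\<in>W. \<forall>k. \<exists>C. multilinear_bound E F k C (D x)) \<and>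
     (\<forall>x\<in>W. \<forall>k. \<forall>\<epsilon>>0. eventually (\<lambda>h. \<forall>vs\<in>tuples E k. vnorm F (D (x + h) vs - D x vs - D x (h # vs))
            \<le> \<epsilon> * vnorm E h * prod_list (map (vnorm E) vs)) (increments E W x))"

lemma derivatives_bound:
  assumes "derivatives E F W D" "x \<in> W"
  obtains C where "multilinear_bound E F k C (D x)"
  using assms unfolding derivatives_def by blast

lemma derivatives_remainder:
  assumes "derivatives E F W D" "x \<in> W" "\<epsilon> > 0"
  shows "eventually (\<lambda>h. \<forall>vs\<in>tuples E k. vnorm F (D (x + h) vs - D x vs - D x (h # vs))
            \<le> \<epsilon> * vnorm E h * prod_list (map (vnorm E) vs)) (increments E W x)"
  using assms unfolding derivatives_def by blast

lemma derivatives_vecs: "derivatives E F W D \<Longrightarrow> x \<in> W \<Longrightarrow> vs \<in> tuples E k \<Longrightarrow> D x vs \<in> vecs F"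
  by (meson derivatives_bound multilinear_boundD(1))

text \<open>The first derivative is part of the data, since \<open>dderiv\<close> has to be
  evaluated in tangent maps and exterior derivatives. Higher derivatives stay existential, as closed
  formulas for them would grow with every composition.\<close>

definition smooth_deriv ::
    "'e::real_vector nspace \<Rightarrow> 'f::real_vector nspace \<Rightarrow> 'e set \<Rightarrow> ('e \<Rightarrow> 'f) \<Rightarrow> ('e \<Rightarrow> 'e \<Rightarrow> 'f) \<Rightarrow> bool" where
  "smooth_deriv E F W f f' \<longleftrightarrow> (\<exists>D. derivatives E F W D \<and>
     (\<forall>x\<in>W. D x [] = f x \<and> (\<forall>v\<in>vecs E. D x [v] = f' x v)))"

lemma smooth_deriv_imp_smooth_on:
  assumes E: "normed_nspace E" and f: "smooth_deriv E F W f f'"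
  shows "smooth_on E F W f"
proof -
  obtain D where D: "derivatives E F W D" "\<forall>x\<in>W. D x [] = f x"
    using f unfolding smooth_deriv_def by blast
  show ?thesis
    unfolding smooth_on_def
    using D unfolding derivatives_def bounded_multilinear_iff[OF E] eventually_increments[OF E] by blast
qed

lemma smooth_deriv_cong:
  assumes "smooth_deriv E F W f f'" "\<And>x. x \<in> W \<Longrightarrow> f x = g x"
    "\<And>x v. x \<in> W \<Longrightarrow> v \<in> vecs E \<Longrightarrow> f' x v = g' x v"
  shows "smooth_deriv E F W g g'"
  using assms unfolding smooth_deriv_def by simp

lemma smooth_deriv_subset:
  assumes "smooth_deriv E F W f f'" "W' \<subseteq> W"
  shows "smooth_deriv E F W' f f'"
proof -
  obtain D where D: "derivatives E F W D" "\<forall>x\<in>W. D x [] = f x \<and> (\<forall>v\<in>vecs E. D x [v] = f' x v)"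
    using assms(1) unfolding smooth_deriv_def by blast
  have "derivatives E F W' D"
    using D(1) assms(2) filter_leD[OF increments_mono[OF assms(2)]] unfolding derivatives_def by (auto simp: subset_iff)
  with D(2) assms(2) show ?thesis
    unfolding smooth_deriv_def by blast
qed

lemma smooth_deriv_vecs:
  assumes "smooth_deriv E F W f f'" "x \<in> W"
  shows "f x \<in> vecs F" "v \<in> vecs E \<Longrightarrow> f' x v \<in> vecs F"
proof -
  obtain D where D: "derivatives E F W D" "D x [] = f x \<and> (\<forall>v\<in>vecs E. D x [v] = f' x v)"
    using assms unfolding smooth_deriv_def by blast
  show "f x \<in> vecs F" "v \<in> vecs E \<Longrightarrow> f' x v \<in> vecs F"
    using derivatives_vecs[OF D(1) assms(2), of "[]" 0] derivatives_vecs[OF D(1) assms(2), of "[v]" "Suc 0"] D(2)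
    by (auto simp: tuples_def)
qed

lemma smooth_deriv_frechet:
  assumes "smooth_deriv E F W f f'" "x \<in> W" "\<epsilon> > 0" "normed_nspace E"
  shows "eventually (\<lambda>h. vnorm F (f (x + h) - f x - f' x h) \<le> \<epsilon> * vnorm E h) (increments E W x)"
proof -
  obtain D where D: "derivatives E F W D" "\<forall>x\<in>W. D x [] = f x \<and> (\<forall>v\<in>vecs E. D x [v] = f' x v)"
    using assms unfolding smooth_deriv_def by blast
  have 1: "eventually (\<lambda>h. vnorm F (D (x + h) [] - D x [] - D x [h]) \<le> \<epsilon> * vnorm E h) (increments E W x)"
    using derivatives_remainder[OF D(1) assms(2,3), of 0] by simp
  show ?thesis
    using 1 eventually_increments_vecs[of E x W] by eventually_elim (use D(2) assms(2) in auto)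
qed

lemma smooth_deriv_bounded:
  assumes "smooth_deriv E F W f f'" "x \<in> W" "normed_nspace E"
  obtains C where "C \<ge> 0" "\<And>v. v \<in> vecs E \<Longrightarrow> vnorm F (f' x v) \<le> C * vnorm E v"
    "lin_on (vecs E) (f' x)"
proof -
  obtain D where D: "derivatives E F W D" "\<forall>x\<in>W. D x [] = f x \<and> (\<forall>v\<in>vecs E. D x [v] = f' x v)"
    using assms unfolding smooth_deriv_def by blast
  obtain C where C: "multilinear_bound E F (Suc 0) C (D x)"
    using derivatives_bound[OF D(1) assms(2)] .
  have "lin_on (vecs E) (\<lambda>v. D x (v # []))"
    by (rule multilinear_bound_head[OF C _ assms(3)]) simp
  then have "lin_on (vecs E) (f' x)"
    using D(2) assms(2) nspace_add[OF assms(3)] nspace_scale[OF assms(3)] unfolding lin_on_def by simp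
  moreover have "vnorm F (f' x v) \<le> C * vnorm E v" if "v \<in> vecs E" for v
    using multilinear_boundD(2)[OF C, of "[v]"] D(2) assms(2) that by (auto simp: tuples_def)
  ultimately show ?thesis
    using C that unfolding multilinear_bound_def by blast
qed

text \<open>The remainder estimate with \<epsilon> = 1 gives a Lipschitz bound at the single point
  \<open>x\<close>. It serves as continuity.\<close>

lemma smooth_deriv_lipschitz:
  assumes f: "smooth_deriv E F W f f'" and x: "x \<in> W" and E: "normed_nspace E" and F: "normed_nspace F"
  obtains C where "C \<ge> 0" "eventually (\<lambda>h. vnorm F (f (x + h) - f x) \<le> C * vnorm E h) (increments E W x)"
proof -
  obtain C where C: "C \<ge> 0" "\<And>v. v \<in> vecs E \<Longrightarrow> vnorm F (f' x v) \<le> C * vnorm E v" "lin_on (vecs E) (f' x)"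
    by (rule smooth_deriv_bounded[OF f x E]) (rule that)
  have "eventually (\<lambda>h. vnorm F (f (x + h) - f x) \<le> (C + 1) * vnorm E h) (increments E W x)"
    using smooth_deriv_frechet[OF f x zero_less_one E] eventually_increments_vecs[of E x W]
  proof eventually_elim
    case (elim h)
    have "f (x + h) \<in> vecs F" "f x \<in> vecs F" "f' x h \<in> vecs F"
      using smooth_deriv_vecs[OF f] elim x by auto
    then have "vnorm F (f (x + h) - f x) \<le> vnorm F (f (x + h) - f x - f' x h) + vnorm F (f' x h)"
      using vnorm_add[OF F, of "f (x + h) - f x - f' x h" "f' x h"] nspace_diff[OF F] by simp
    then show ?case
      using elim C(2)[of h] by (simp add: algebra_simps)
  qed
  then show ?thesis using C(1) that[of "C + 1"] by simp
qed

lemma open_inD: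
  assumes "open_in E W" "x \<in> W"
  shows "x \<in> vecs E" "\<exists>\<epsilon>>0. \<forall>y\<in>vecs E. vnorm E (y - x) < \<epsilon> \<longrightarrow> y \<in> W"
  using assms unfolding open_in_def by auto

lemma open_in_Int: "open_in E A \<Longrightarrow> open_in E B \<Longrightarrow> open_in E (A \<inter> B)"
  unfolding open_in_def
proof (intro conjI ballI)
  fix x assume A: "A \<subseteq> vecs E \<and> (\<forall>x\<in>A. \<exists>\<epsilon>>0. \<forall>y\<in>vecs E. vnorm E (y - x) < \<epsilon> \<longrightarrow> y \<in> A)"
    and B: "B \<subseteq> vecs E \<and> (\<forall>x\<in>B. \<exists>\<epsilon>>0. \<forall>y\<in>vecs E. vnorm E (y - x) < \<epsilon> \<longrightarrow> y \<in> B)" and x: "x \<in> A \<inter> B"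
  then obtain a b where "a > 0" "b > 0" "\<forall>y\<in>vecs E. vnorm E (y - x) < a \<longrightarrow> y \<in> A"
    "\<forall>y\<in>vecs E. vnorm E (y - x) < b \<longrightarrow> y \<in> B" by blast
  then show "\<exists>\<epsilon>>0. \<forall>y\<in>vecs E. vnorm E (y - x) < \<epsilon> \<longrightarrow> y \<in> A \<inter> B"
    by (intro exI[of _ "min a b"]) auto
qed auto

text \<open>The Lipschitz bound keeps \<open>f (x + h)\<close> near \<open>f x\<close>, but it
  speaks only of increments with \<open>x + h\<close> in \<open>W\<close>; the openness of
  \<open>W\<close> supplies that for all small increments.\<close>

lemma smooth_deriv_open_preimage:
  assumes f: "smooth_deriv E F W f f'" and E: "normed_nspace E" and F: "normed_nspace F"
    and W: "open_in E W" and V: "open_in F V"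
  shows "open_in E {x\<in>W. f x \<in> V}"
  unfolding open_in_def
proof (intro conjI ballI)
  show "{x\<in>W. f x \<in> V} \<subseteq> vecs E" using W by (auto simp: open_in_def)
  fix x assume "x \<in> {x\<in>W. f x \<in> V}"
  then have x: "x \<in> W" "f x \<in> V" by auto
  obtain e where e: "e > 0" "\<And>y. y \<in> vecs F \<Longrightarrow> vnorm F (y - f x) < e \<Longrightarrow> y \<in> V"
    using open_inD(2)[OF V x(2)] by blast
  obtain d where d: "d > 0" "\<And>y. y \<in> vecs E \<Longrightarrow> vnorm E (y - x) < d \<Longrightarrow> y \<in> W"
    using open_inD(2)[OF W x(1)] by blast
  obtain C where C: "C \<ge> 0" "eventually (\<lambda>h. vnorm F (f (x + h) - f x) \<le> C * vnorm E h) (increments E W x)"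
    by (rule smooth_deriv_lipschitz[OF f x(1) E F]) (rule that)
  have pos: "0 < e / (C + 1)" using e C by simp
  have "eventually (\<lambda>h. x + h \<in> {x\<in>W. f x \<in> V}) (increments E W x)"
    using C(2) eventually_increments_vecs[of E x W] eventually_increments_small[OF E pos, of W x]
  proof eventually_elim
    fix h assume h: "vnorm F (f (x + h) - f x) \<le> C * vnorm E h" "h \<in> vecs E \<and> x + h \<in> W" "vnorm E h < e / (C + 1)"
    have "C * vnorm E h \<le> (C + 1) * vnorm E h" using vnorm_nonneg[OF E] h by (simp add: algebra_simps)
    also have "\<dots> < e" using h(3) C by (simp add: field_simps)
    finally show "x + h \<in> {x\<in>W. f x \<in> V}"
      using e(2)[of "f (x + h)"] h smooth_deriv_vecs(1)[OF f] by auto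
  qed
  then obtain d' where d': "d' > 0" "\<And>h. h \<in> vecs E \<Longrightarrow> vnorm E h < d' \<Longrightarrow> x + h \<in> W \<Longrightarrow> x + h \<in> {x\<in>W. f x \<in> V}"
    unfolding eventually_increments[OF E] by blast
  show "\<exists>\<epsilon>>0. \<forall>y\<in>vecs E. vnorm E (y - x) < \<epsilon> \<longrightarrow> y \<in> {x\<in>W. f x \<in> V}"
  proof (intro exI[of _ "min d d'"] conjI ballI impI)
    fix y assume y: "y \<in> vecs E" "vnorm E (y - x) < min d d'"
    then show "y \<in> {x\<in>W. f x \<in> V}"
      using d'(2)[of "y - x"] d(2)[of y] nspace_diff[OF E y(1) open_inD(1)[OF W x(1)]] by simp
  qed (use d d' in auto)
qed

text \<open>The description operator in \<open>dderiv\<close> asks for existence and uniqueness.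
  Existence is the Frechet remainder along h = t v divided by t; uniqueness holds because two limits
  differ by at most the sum of two quantities that tend to 0.\<close>

lemma dderiv_eq:
  assumes f: "smooth_deriv E F W f f'" and W: "open_in E W" and E: "normed_nspace E" and F: "normed_nspace F"
    and x: "x \<in> W" and v: "v \<in> vecs E"
  shows "dderiv F f x v = f' x v"
proof -
  let ?q = "\<lambda>t::real. (f (x + t *\<^sub>R v) - f x) /\<^sub>R t"
  have w: "f' x v \<in> vecs F" using smooth_deriv_vecs(2)[OF f x v] .
  have xE: "x \<in> vecs E" using open_inD(1)[OF W x] .
  obtain d where d: "d > 0" "\<And>y. y \<in> vecs E \<Longrightarrow> vnorm E (y - x) < d \<Longrightarrow> y \<in> W"
    using open_inD(2)[OF W x] by blast
  have lin: "lin_on (vecs E) (f' x)" by (rule smooth_deriv_bounded[OF f x E])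
  have nv: "0 \<le> vnorm E v" using vnorm_nonneg[OF E v] .
  have small: "eventually (\<lambda>t::real. \<bar>t\<bar> * vnorm E v < e) (at 0)" if "e > 0" for e
  proof -
    have "((\<lambda>t::real. \<bar>t\<bar> * vnorm E v) \<longlongrightarrow> \<bar>0\<bar> * vnorm E v) (at 0)" by (intro tendsto_intros)
    then show ?thesis using that by (auto intro: order_tendstoD(2))
  qed
  have inW: "eventually (\<lambda>t::real. x + t *\<^sub>R v \<in> W) (at 0)"
    using small[OF d(1)]
  proof eventually_elim
    case (elim t)
    then show ?case using d(2)[of "x + t *\<^sub>R v"] vnorm_scale[OF E v] nspace_add[OF E xE nspace_scale[OF E v]] by simp
  qed
  have inF: "eventually (\<lambda>t::real. ?q t \<in> vecs F) (at 0)"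
    using inW by eventually_elim
      (intro nspace_scale[OF F] nspace_diff[OF F] smooth_deriv_vecs(1)[OF f], use x in auto)
  have lim: "((\<lambda>t::real. vnorm F (?q t - f' x v)) \<longlongrightarrow> 0) (at 0)"
  proof (rule tendstoI)
    fix e :: real assume e: "e > 0"
    \<comment> \<open>The summand 1 in the denominator admits v = 0.\<close>
    define e' where "e' = e / (vnorm E v + 1)"
    have e': "e' > 0" "e' * vnorm E v < e"
      using e nv by (auto simp: e'_def field_simps)
    obtain d' where d': "d' > 0" "\<And>h. h \<in> vecs E \<Longrightarrow> vnorm E h < d' \<Longrightarrow> x + h \<in> W \<Longrightarrow>
        vnorm F (f (x + h) - f x - f' x h) \<le> e' * vnorm E h"
      using smooth_deriv_frechet[OF f x e'(1) E] unfolding eventually_increments[OF E] by blast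
    show "eventually (\<lambda>t::real. dist (vnorm F (?q t - f' x v)) 0 < e) (at 0)"
      using small[OF d'(1)] inW inF eventually_neq_at_within[of 0]
    proof eventually_elim
      case (elim t)
      have h: "t *\<^sub>R v \<in> vecs E" by (rule nspace_scale[OF E v])
      have "vnorm F (f (x + t *\<^sub>R v) - f x - f' x (t *\<^sub>R v)) \<le> e' * (\<bar>t\<bar> * vnorm E v)"
        using d'(2)[OF h] elim vnorm_scale[OF E v] by simp
      moreover have "f (x + t *\<^sub>R v) - f x - f' x (t *\<^sub>R v) = t *\<^sub>R (?q t - f' x v)"
        using elim lin_onD(2)[OF lin v] by (simp add: scaleR_diff_right)
      ultimately have "\<bar>t\<bar> * vnorm F (?q t - f' x v) \<le> e' * (\<bar>t\<bar> * vnorm E v)"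
        using vnorm_scale[OF F nspace_diff[OF F elim(3) w]] by simp
      then have "vnorm F (?q t - f' x v) \<le> e' * vnorm E v"
        using elim(4) by (simp add: mult.left_commute)
      then show ?case
        using e'(2) vnorm_nonneg[OF F nspace_diff[OF F elim(3) w]] by (simp add: dist_real_def)
    qed
  qed
  have unique: "w' = f' x v" if w': "w' \<in> vecs F" "((\<lambda>t::real. vnorm F (?q t - w')) \<longlongrightarrow> 0) (at 0)" for w'
  proof -
    have m: "w' - f' x v \<in> vecs F" using nspace_diff[OF F w'(1) w] .
    have "((\<lambda>t::real. vnorm F (?q t - w') + vnorm F (?q t - f' x v)) \<longlongrightarrow> 0 + 0) (at 0)"
      by (intro tendsto_intros w'(2) lim)
    moreover have "eventually (\<lambda>t::real. vnorm F (w' - f' x v) \<le> vnorm F (?q t - w') + vnorm F (?q t - f' x v)) (at 0)"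
      using inF
    proof eventually_elim
      case (elim t)
      show ?case
        using vnorm_add[OF F, of "w' - ?q t" "?q t - f' x v"] vnorm_minus_commute[OF F w'(1) elim]
          nspace_diff[OF F] w'(1) w elim by simp
    qed
    ultimately have "vnorm F (w' - f' x v) \<le> 0 + 0"
      by (intro tendsto_lowerbound[where F = "at (0::real)"]) auto
    then have "vnorm F (w' - f' x v) = 0" using vnorm_nonneg[OF F m] by simp
    then show ?thesis using vnorm_eq_0[OF F m] by simp
  qed
  show ?thesis
    unfolding dderiv_def
  proof (rule the_equality)
    show "f' x v \<in> vecs F \<and> ((\<lambda>t::real. vnorm F (?q t - f' x v)) \<longlongrightarrow> 0) (at 0)"
      using w lim ..
  qed (rule unique, (erule conjE, assumption)+)
qed

text \<open>By \<open>dderiv_eq\<close> a derivative depends only on the values of the map on an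
  open set. Identities between maps, such as \<open>co i (par i x) = x\<close>, are differentiated
  in this way.\<close>

lemma smooth_deriv_unique:
  assumes "smooth_deriv E F W f f'" "smooth_deriv E F W' g g'" "open_in E W" "open_in E W'"
    "normed_nspace E" "normed_nspace F" "\<And>y. y \<in> W \<inter> W' \<Longrightarrow> f y = g y" "x \<in> W \<inter> W'" "v \<in> vecs E"
  shows "f' x v = g' x v"
proof -
  have f: "smooth_deriv E F (W \<inter> W') f f'"
    by (rule smooth_deriv_subset[OF assms(1)]) blast
  have g: "smooth_deriv E F (W \<inter> W') g g'"
    by (rule smooth_deriv_subset[OF assms(2)]) blast
  have f': "smooth_deriv E F (W \<inter> W') g f'"
    by (rule smooth_deriv_cong[OF f]) (use assms(7) in auto)
  note o = open_in_Int[OF assms(3,4)]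
  show ?thesis
    using dderiv_eq[OF f' o assms(5,6,8,9)] dderiv_eq[OF g o assms(5,6,8,9)] by simp
qed

subsection \<open>Composition\<close>

text \<open>The partitions of \<open>{..<k}\<close> into blocks, as in the formula of Faa di Bruno. The index \<open>0\<close>
  belongs to the newest direction: it forms a block of its own or joins an older block.\<close>

fun index_partitions :: "nat \<Rightarrow> nat list list list" where
  "index_partitions 0 = [[]]"
| "index_partitions (Suc k) = concat (map (\<lambda>P. ([0] # map (map Suc) P) #
      map (\<lambda>i. (map (map Suc) P)[i := 0 # map Suc (P ! i)]) [0..<length P]) (index_partitions k))"

definition blocks :: "'a list \<Rightarrow> nat list list \<Rightarrow> 'a list list" where
  "blocks vs P = map (map ((!) vs)) P"

lemma blocks_new: "blocks (h # vs) ([0] # map (map Suc) P) = [h] # blocks vs P"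
  by (simp add: blocks_def o_def)

lemma blocks_join:
  "i < length P \<Longrightarrow> blocks (h # vs) ((map (map Suc) P)[i := 0 # map Suc (P ! i)]) = (blocks vs P)[i := h # blocks vs P ! i]"
  by (simp add: blocks_def o_def map_update)

lemma length_blocks [simp]: "length (blocks vs P) = length P"
  by (simp add: blocks_def)

lemma mset_concat_update:
  "i < length P \<Longrightarrow> mset (concat (P[i := x # P ! i])) = add_mset x (mset (concat P))"
  by (induction P arbitrary: i) (auto split: nat.split)

text \<open>Equality of multisets says at once that the blocks are disjoint, have no repetitions and
  exhaust the indices; distinctness and the rearrangement of products are read off from it.\<close>

lemma index_partitions_mset: "P \<in> set (index_partitions k) \<Longrightarrow> mset (concat P) = mset [0..<k]"
proof (induction k arbitrary: P)
  case (Suc k)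
  have upt: "mset [0..<Suc k] = add_mset 0 (image_mset Suc (mset [0..<k]))"
    by (metis map_Suc_upt mset.simps(2) mset_map upt_conv_Cons zero_less_Suc)
  let ?join = "\<lambda>R i. (map (map Suc) R)[i := 0 # map Suc (R ! i)]"
  have "P \<in> (\<Union>R\<in>set (index_partitions k). insert ([0] # map (map Suc) R) (?join R ` {0..<length R}))"
    using Suc.prems by simp
  then obtain R where R: "R \<in> set (index_partitions k)"
    "P = [0] # map (map Suc) R \<or> P \<in> ?join R ` {0..<length R}"
    by blast
  have m: "mset (concat (map (map Suc) R)) = image_mset Suc (mset [0..<k])"
    using Suc.IH[OF R(1)] by (metis map_concat mset_map)
  show ?case
    using R(2)
  proof
    assume "P = [0] # map (map Suc) R"
    then show ?thesis using m unfolding upt by simp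
  next
    assume "P \<in> ?join R ` {0..<length R}"
    then obtain i where "i < length R" "P = ?join R i" by auto
    then show ?thesis using m mset_concat_update[of i "map (map Suc) R" 0] unfolding upt by simp
  qed
qed simp

text \<open>Multilinearity of a composite in its i-th direction needs to know that the index i
  occurs in exactly one place of one block.\<close>

lemma distinct_concat_location:
  assumes "distinct (concat P)" "i \<in> set (concat P)"
  obtains q r where "q < length P" "r < length (P ! q)" "P ! q ! r = i"
    "\<And>q'. q' < length P \<Longrightarrow> q' \<noteq> q \<Longrightarrow> i \<notin> set (P ! q')"
    "\<And>r'. r' < length (P ! q) \<Longrightarrow> r' \<noteq> r \<Longrightarrow> P ! q ! r' \<noteq> i"
proof -
  obtain b where "b \<in> set P" "i \<in> set b"
    using assms(2) by auto
  then obtain q where q: "q < length P" "i \<in> set (P ! q)"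
    by (metis in_set_conv_nth)
  obtain r where r: "r < length (P ! q)" "P ! q ! r = i"
    using q(2) by (auto simp: in_set_conv_nth)
  have u: "i \<notin> set (P ! q')" if "q' < length P" "q' \<noteq> q" for q'
  proof -
    have "set (P ! q') \<inter> set (P ! q) = {}"
      using assms(1) that q(1)
    proof (induction P arbitrary: q q')
      case (Cons b P)
      show ?case
      proof (cases q)
        case 0
        then obtain p where p: "q' = Suc p" "p < length P" using Cons.prems by (cases q') auto
        then have "set (P ! p) \<inter> set b = {}" using Cons.prems by (auto simp: disjoint_iff)
        then show ?thesis using 0 p by auto
      next
        case (Suc p)
        show ?thesis
        proof (cases q')
          case 0
          have "set (P ! p) \<inter> set b = {}" using Cons.prems Suc by (auto simp: disjoint_iff)
          then show ?thesis using 0 Suc by auto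
        next
          case (Suc p')
          then show ?thesis using Cons.IH[of p' p] Cons.prems \<open>q = Suc p\<close> by auto
        qed
      qed
    qed simp
    then show ?thesis using q(2) by auto
  qed
  have "distinct (P ! q)" using assms(1) q(1) by (auto simp: distinct_concat_iff)
  then have "\<And>r'. r' < length (P ! q) \<Longrightarrow> r' \<noteq> r \<Longrightarrow> P ! q ! r' \<noteq> i"
    using r by (auto simp: nth_eq_iff_index_eq)
  then show ?thesis using that[OF q(1) r u] by blast
qed

text \<open>Only one slot of the block containing i sees the change. So the dependence on this
  direction is a linear map given by an inner derivative, followed by a linear map given by an outer
  one.\<close>

lemma blocks_update:
  assumes P: "P \<in> set (index_partitions k)" and i: "i < k" "length vs = k"
  obtains q r where "q < length P" "r < length (P ! q)"
    "\<And>v. blocks (vs[i := v]) P = (blocks vs P)[q := (blocks vs P ! q)[r := v]]"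
proof -
  note m = index_partitions_mset[OF P]
  have "distinct (concat P)" using m by (metis distinct_upt mset_eq_imp_distinct_iff)
  moreover have "i \<in> set (concat P)" using m i(1) by (metis atLeast0LessThan lessThan_iff mset_eq_setD set_upt)
  ultimately obtain q r where qr: "q < length P" "r < length (P ! q)" "P ! q ! r = i"
    "\<And>q'. q' < length P \<Longrightarrow> q' \<noteq> q \<Longrightarrow> i \<notin> set (P ! q')"
    "\<And>r'. r' < length (P ! q) \<Longrightarrow> r' \<noteq> r \<Longrightarrow> P ! q ! r' \<noteq> i"
    by (rule distinct_concat_location) blast
  have "blocks (vs[i := v]) P = (blocks vs P)[q := (blocks vs P ! q)[r := v]]" for v
  proof (rule nth_equalityI)
    fix q' assume q': "q' < length (blocks (vs[i := v]) P)"
    show "blocks (vs[i := v]) P ! q' = (blocks vs P)[q := (blocks vs P ! q)[r := v]] ! q'"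
    proof (cases "q' = q")
      case False
      then have "i \<notin> set (P ! q')" using qr(4) q' by simp
      then have "map ((!) (vs[i := v])) (P ! q') = map ((!) vs) (P ! q')"
        by (intro map_cong refl) (metis nth_list_update_neq)
      then show ?thesis using False q' by (simp add: blocks_def)
    next
      case True
      have "map ((!) (vs[i := v])) (P ! q) = (map ((!) vs) (P ! q))[r := v]"
      proof (rule nth_equalityI)
        fix j assume j: "j < length (map ((!) (vs[i := v])) (P ! q))"
        show "map ((!) (vs[i := v])) (P ! q) ! j = (map ((!) vs) (P ! q))[r := v] ! j"
          using j qr(2,3) qr(5)[of j] i by (cases "j = r") simp_all
      qed simp
      then show ?thesis using True qr(1) by (simp add: blocks_def)
    qed
  qed simp
  with qr(1,2) that show ?thesis by blast
qed

lemma blocks_tuples: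
  assumes P: "P \<in> set (index_partitions k)" and vs: "vs \<in> tuples E k" and b: "b \<in> set P"
  shows "map ((!) vs) b \<in> tuples E (length b)"
proof -
  have "set (concat P) = {..<k}"
    using index_partitions_mset[OF P] by (metis mset_eq_setD atLeast0LessThan set_upt)
  then have "set b \<subseteq> {..<k}" using b by auto
  then show ?thesis using vs by (auto simp: tuples_def subset_iff dest: nth_mem)
qed

text \<open>The concatenated blocks are a permutation of all indices, so the norms of the directions
  recombine to the product required in a multilinear bound.\<close>

lemma prod_blocks:
  assumes P: "P \<in> set (index_partitions k)" and vs: "length vs = k"
  shows "prod_list (map (\<lambda>b. prod_list (map f (map ((!) vs) b))) P) = prod_list (map (f :: 'a \<Rightarrow> real) vs)"
proof -
  have "prod_list (map (\<lambda>b. prod_list (map f (map ((!) vs) b))) P) = prod_list (map (\<lambda>j. f (vs ! j)) (concat P))"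
    by (induction P) (simp_all add: o_def)
  also have "\<dots> = prod_mset (image_mset (\<lambda>j. f (vs ! j)) (mset (concat P)))"
    by (metis mset_map prod_mset_prod_list)
  also have "\<dots> = prod_mset (image_mset (\<lambda>j. f (vs ! j)) (mset [0..<k]))"
    using index_partitions_mset[OF P] by simp
  also have "\<dots> = prod_list (map f (map ((!) vs) [0..<k]))"
    by (metis (no_types, lifting) list.map_comp map_eq_conv mset_map o_apply prod_mset_prod_list)
  also have "map ((!) vs) [0..<k] = vs" using vs map_nth by blast
  finally show ?thesis .
qed

definition comp_deriv :: "('e \<Rightarrow> 'f) \<Rightarrow> ('e \<Rightarrow> 'e list \<Rightarrow> 'f) \<Rightarrow> ('f \<Rightarrow> 'f list \<Rightarrow> 'g::real_vector) \<Rightarrow> 'e \<Rightarrow> 'e list \<Rightarrow> 'g" where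
  "comp_deriv f Df Dg x vs = (\<Sum>P\<leftarrow>index_partitions (length vs). Dg (f x) (map (Df x) (blocks vs P)))"

lemma sum_list_concat: "sum_list (map f (concat xs)) = (\<Sum>x\<leftarrow>xs. \<Sum>y\<leftarrow>x. f y)"
  by (induction xs) auto

text \<open>The recursion of \<open>index_partitions\<close> is the product rule: a new singleton
  block differentiates the outer derivative, and joining the i-th block differentiates the i-th
  inner factor. The right side is thus the expected derivative of each summand.\<close>

lemma comp_deriv_Cons:
  "comp_deriv f Df Dg x (h # vs) = (\<Sum>P\<leftarrow>index_partitions (length vs).
     Dg (f x) (Df x [h] # map (Df x) (blocks vs P)) +
     (\<Sum>i<length P. Dg (f x) ((map (Df x) (blocks vs P))[i := Df x (h # blocks vs P ! i)])))"
proof -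
  have "comp_deriv f Df Dg x (h # vs) = (\<Sum>P\<leftarrow>index_partitions (length vs).
     Dg (f x) (map (Df x) (blocks (h # vs) ([0] # map (map Suc) P))) +
     (\<Sum>i\<leftarrow>[0..<length P]. Dg (f x) (map (Df x) (blocks (h # vs) ((map (map Suc) P)[i := 0 # map Suc (P ! i)])))))"
    by (simp add: comp_deriv_def sum_list_concat o_def)
  also have "\<dots> = (\<Sum>P\<leftarrow>index_partitions (length vs).
     Dg (f x) (Df x [h] # map (Df x) (blocks vs P)) +
     (\<Sum>i\<leftarrow>[0..<length P]. Dg (f x) ((map (Df x) (blocks vs P))[i := Df x (h # blocks vs P ! i)])))"
    unfolding blocks_new
    by (intro arg_cong[where f = sum_list] map_cong arg_cong2[where f = "(+)"] refl)
       (auto simp: blocks_join map_update)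
  finally show ?thesis
    by (simp add: interv_sum_list_conv_sum_set_nat atLeast0LessThan)
qed

lemma sum_list_vecs:
  assumes "normed_nspace E" "\<And>p. p \<in> set P \<Longrightarrow> f p \<in> vecs E"
  shows "(\<Sum>p\<leftarrow>P. f p) \<in> vecs E"
  using assms(2) by (induction P) (auto intro: nspace_0[OF assms(1)] nspace_add[OF assms(1)])

lemma vnorm_sum_list:
  assumes "normed_nspace E" "\<And>p. p \<in> set P \<Longrightarrow> f p \<in> vecs E"
  shows "vnorm E (\<Sum>p\<leftarrow>P. f p) \<le> (\<Sum>p\<leftarrow>P. vnorm E (f p))"
  using assms(2)
proof (induction P)
  case Nil
  then show ?case by (simp add: vnorm_0[OF assms(1)])
next
  case (Cons p P)
  then show ?case
    using vnorm_add[OF assms(1), of "f p" "\<Sum>p\<leftarrow>P. f p"] sum_list_vecs[OF assms(1), of P f] by fastforce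
qed

text \<open>For one partition the outer constant times the inner constants of its blocks is a bound,
  by \<open>prod_blocks\<close>; linearity in one direction is \<open>blocks_update\<close>. The sum
  over the partitions inherits both.\<close>

lemma comp_deriv_multilinear:
  assumes E: "normed_nspace E" and F: "normed_nspace F" and G: "normed_nspace G"
    and f: "derivatives E F W Df" and g: "derivatives F G V Dg" and x: "x \<in> W" "f x \<in> V"
  shows "\<exists>C. multilinear_bound E G k C (comp_deriv f Df Dg x)"
proof -
  obtain Cf where Cf: "\<And>l. multilinear_bound E F l (Cf l) (Df x)"
    using f x unfolding derivatives_def by metis
  obtain Cg where Cg: "\<And>l. multilinear_bound F G l (Cg l) (Dg (f x))"
    using g x unfolding derivatives_def by metis
  let ?I = "index_partitions k"
  let ?T = "\<lambda>P vs. Dg (f x) (map (Df x) (blocks vs P))"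
  have T: "?T P vs \<in> vecs G"
    "vnorm G (?T P vs) \<le> Cg (length P) * prod_list (map (\<lambda>b. Cf (length b)) P) * prod_list (map (vnorm E) vs)"
    "i < k \<Longrightarrow> lin_on (vecs E) (\<lambda>v. ?T P (vs[i := v]))"
    if P: "P \<in> set ?I" and vs: "vs \<in> tuples E k" for P vs i
  proof -
    let ?a = "\<lambda>b. Df x (map ((!) vs) b)" and ?c = "\<lambda>b. Cf (length b) * prod_list (map (vnorm E) (map ((!) vs) b))"
    have a: "?a b \<in> vecs F \<and> vnorm F (?a b) \<le> ?c b" if "b \<in> set P" for b
      using multilinear_boundD[OF Cf blocks_tuples[OF P vs that]] by simp
    have eq: "?T P vs = Dg (f x) (map ?a P)" by (simp add: blocks_def o_def)
    show "?T P vs \<in> vecs G" unfolding eq by (rule multilinear_bound_le(1)[OF F Cg a])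
    have "vnorm G (?T P vs) \<le> Cg (length P) * prod_list (map ?c P)"
      unfolding eq by (rule multilinear_bound_le(2)[OF F Cg a])
    also have "prod_list (map ?c P) = prod_list (map (\<lambda>b. Cf (length b)) P) * prod_list (map (vnorm E) vs)"
      unfolding prod_blocks[OF P tuples_length[OF vs], symmetric] by (induction P) simp_all
    finally show "vnorm G (?T P vs) \<le> Cg (length P) * prod_list (map (\<lambda>b. Cf (length b)) P) * prod_list (map (vnorm E) vs)"
      by (simp add: mult.assoc)
    show "lin_on (vecs E) (\<lambda>v. ?T P (vs[i := v]))" if i: "i < k"
    proof -
      obtain q r where qr: "q < length P" "r < length (P ! q)"
        "\<And>v. blocks (vs[i := v]) P = (blocks vs P)[q := (blocks vs P ! q)[r := v]]"
        using blocks_update[OF P i tuples_length[OF vs]] by blast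
      let ?b = "map ((!) vs) (P ! q)"
      have tb: "?b \<in> tuples E (length (P ! q))" by (rule blocks_tuples[OF P vs]) (use qr in simp)
      have ty: "map ?a P \<in> tuples F (length P)" using a by (auto simp: tuples_def)
      have "lin_on (vecs E) (\<lambda>v. Df x (?b[r := v]))"
        using Cf[of "length (P ! q)"] tb qr(2) unfolding multilinear_bound_def by blast
      moreover have "(\<lambda>v. Df x (?b[r := v])) ` vecs E \<subseteq> vecs F"
        using multilinear_boundD(1)[OF Cf tuples_update[OF tb]] by blast
      moreover have "lin_on (vecs F) (\<lambda>w. Dg (f x) ((map ?a P)[q := w]))"
        using Cg[of "length P"] ty qr(1) unfolding multilinear_bound_def by blast
      ultimately have "lin_on (vecs E) (\<lambda>v. Dg (f x) ((map ?a P)[q := Df x (?b[r := v])]))"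
        by (rule lin_on_compose)
      then show ?thesis unfolding qr(3) using qr(1) by (simp add: blocks_def map_update o_def)
    qed
  qed
  have C0: "0 \<le> Cg (length P) * prod_list (map (\<lambda>b. Cf (length b)) P)" for P :: "nat list list"
  proof -
    have "0 \<le> Cf l" "0 \<le> Cg l" for l using Cf[of l] Cg[of l] by (auto simp: multilinear_bound_def)
    then show ?thesis by (intro mult_nonneg_nonneg prod_list_nonneg) auto
  qed
  have "multilinear_bound E G k (\<Sum>P\<leftarrow>?I. Cg (length P) * prod_list (map (\<lambda>b. Cf (length b)) P)) (comp_deriv f Df Dg x)"
    unfolding multilinear_bound_def
  proof (intro conjI ballI allI impI)
    show "0 \<le> (\<Sum>P\<leftarrow>?I. Cg (length P) * prod_list (map (\<lambda>b. Cf (length b)) P))"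
      using C0 by (intro sum_list_nonneg) auto
    fix vs assume vs: "vs \<in> tuples E k"
    have eq: "comp_deriv f Df Dg x vs = (\<Sum>P\<leftarrow>?I. ?T P vs)"
      using tuples_length[OF vs] by (simp add: comp_deriv_def)
    show "comp_deriv f Df Dg x vs \<in> vecs G"
      unfolding eq by (rule sum_list_vecs[OF G]) (use T(1)[OF _ vs] in auto)
    have "vnorm G (comp_deriv f Df Dg x vs) \<le> (\<Sum>P\<leftarrow>?I. vnorm G (?T P vs))"
      unfolding eq by (rule vnorm_sum_list[OF G]) (use T(1)[OF _ vs] in auto)
    also have "\<dots> \<le> (\<Sum>P\<leftarrow>?I. Cg (length P) * prod_list (map (\<lambda>b. Cf (length b)) P) * prod_list (map (vnorm E) vs))"
      using T(2)[OF _ vs] by (intro sum_list_mono) auto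
    finally show "vnorm G (comp_deriv f Df Dg x vs)
        \<le> (\<Sum>P\<leftarrow>?I. Cg (length P) * prod_list (map (\<lambda>b. Cf (length b)) P)) * prod_list (map (vnorm E) vs)"
      by (simp add: sum_list_mult_const)
    fix i assume i: "i < k"
    have "(\<lambda>v. comp_deriv f Df Dg x (vs[i := v])) = (\<lambda>v. \<Sum>P\<leftarrow>?I. ?T P (vs[i := v]))"
      using tuples_length[OF vs] by (simp add: comp_deriv_def)
    then show "lin_on (vecs E) (\<lambda>v. comp_deriv f Df Dg x (vs[i := v]))"
      using T(3)[OF _ vs i] by (simp add: lin_on_sum_list)
  qed
  then show ?thesis ..
qed

text \<open>The outer and the inner variation are separated. \<open>?R1\<close> is the remainder of
  \<open>Dg\<close> at \<open>f x\<close> for the increment \<open>\<kappa>\<close>,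
  \<open>?R2\<close> replaces \<open>\<kappa>\<close> by its linear part \<open>\<mu>\<close>,
  \<open>?R3\<close> moves the inner arguments from \<open>x + h\<close> back to \<open>x\<close>,
  and \<open>?R4\<close> is the first order expansion in the inner arguments. Each is at most a
  constant times \<open>e\<close>, the norm of h and the product of the norms of
  \<open>vs\<close>.\<close>

lemma comp_deriv_remainder_term:
  assumes E: "normed_nspace E" and F: "normed_nspace F" and G: "normed_nspace G"
    and f: "derivatives E F W Df" and g: "derivatives F G V Dg"
    and fV: "\<And>y. y \<in> W \<Longrightarrow> f y = Df y [] \<and> f y \<in> V" and x: "x \<in> W"
    and P: "P \<in> set (index_partitions k)" and \<epsilon>: "\<epsilon> > 0"
  shows "eventually (\<lambda>h. \<forall>vs\<in>tuples E k.
      vnorm G (Dg (f (x + h)) (map (Df (x + h)) (blocks vs P)) - Dg (f x) (map (Df x) (blocks vs P))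
        - (Dg (f x) (Df x [h] # map (Df x) (blocks vs P)) +
           (\<Sum>i<length P. Dg (f x) ((map (Df x) (blocks vs P))[i := Df x (h # blocks vs P ! i)]))))
      \<le> \<epsilon> * vnorm E h * prod_list (map (vnorm E) vs)) (increments E W x)"
proof -
  define n where "n = length P"
  \<comment> \<open>Near \<open>x\<close> the inner derivatives of order l are Lipschitz and
    bounded. One constant for the three bounds keeps the products over the blocks uniform.\<close>
  define B where "B l K \<longleftrightarrow> eventually (\<lambda>h. \<forall>vs\<in>tuples E l. vnorm F (Df (x + h) vs - Df x vs) \<le> vnorm E h * (K * prod_list (map (vnorm E) vs)) \<and>
      vnorm F (Df (x + h) vs) \<le> K * prod_list (map (vnorm E) vs) \<and>
      vnorm F (Df x vs) \<le> K * prod_list (map (vnorm E) vs)) (increments E W x)" for l K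
  have "\<exists>K\<ge>1. B l K" for l
  proof -
    obtain C where C: "multilinear_bound E F l C (Df x)" using derivatives_bound[OF f x] .
    obtain C' where C': "multilinear_bound E F (Suc l) C' (Df x)" using derivatives_bound[OF f x] .
    have C0: "0 \<le> C" "0 \<le> C'" using C C' by (auto simp: multilinear_bound_def)
    define K where "K = C + C' + 1"
    \<comment> \<open>For increments below this radius the Lipschitz term is at most the bare
      product of norms, which adds only 1 to the constant \<open>C\<close>.\<close>
    have pos: "0 < 1 / (C' + 1)" using C0 by simp
    have "eventually (\<lambda>h. \<forall>vs\<in>tuples E l. vnorm F (Df (x + h) vs - Df x vs) \<le> vnorm E h * (K * prod_list (map (vnorm E) vs)) \<and>
      vnorm F (Df (x + h) vs) \<le> K * prod_list (map (vnorm E) vs) \<and>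
      vnorm F (Df x vs) \<le> K * prod_list (map (vnorm E) vs)) (increments E W x)"
      using derivatives_remainder[OF f x zero_less_one, of l] eventually_increments_vecs[of E x W]
        eventually_increments_small[OF E pos, of W x]
    proof (eventually_elim)
      fix h assume h: "\<forall>vs\<in>tuples E l. vnorm F (Df (x + h) vs - Df x vs - Df x (h # vs)) \<le> 1 * vnorm E h * prod_list (map (vnorm E) vs)"
        "h \<in> vecs E \<and> x + h \<in> W" "vnorm E h < 1 / (C' + 1)"
      show "\<forall>vs\<in>tuples E l. vnorm F (Df (x + h) vs - Df x vs) \<le> vnorm E h * (K * prod_list (map (vnorm E) vs)) \<and>
        vnorm F (Df (x + h) vs) \<le> K * prod_list (map (vnorm E) vs) \<and>
        vnorm F (Df x vs) \<le> K * prod_list (map (vnorm E) vs)"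
      proof
        fix vs assume vs: "vs \<in> tuples E l"
        let ?p = "prod_list (map (vnorm E) vs)"
        have p: "0 \<le> ?p" by (rule prod_vnorm_tuples[OF E vs])
        have m: "Df (x + h) vs \<in> vecs F" "Df x vs \<in> vecs F" "Df x (h # vs) \<in> vecs F"
          using derivatives_vecs[OF f _ vs] x h multilinear_boundD(1)[OF C'] vs by auto
        have nh: "0 \<le> vnorm E h" using vnorm_nonneg[OF E] h by blast
        have 1: "vnorm F (Df (x + h) vs - Df x vs) \<le> vnorm F (Df (x + h) vs - Df x vs - Df x (h # vs)) + vnorm F (Df x (h # vs))"
          using vnorm_add[OF F, of "Df (x + h) vs - Df x vs - Df x (h # vs)" "Df x (h # vs)"] nspace_diff[OF F] m by simp
        have 2: "vnorm F (Df x (h # vs)) \<le> C' * (vnorm E h * ?p)"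
          using multilinear_boundD(2)[OF C', of "h # vs"] vs h by simp
        have 3: "vnorm F (Df (x + h) vs - Df x vs) \<le> (C' + 1) * (vnorm E h * ?p)"
          using 1 2 h(1) vs by (auto simp: algebra_simps dest!: bspec[where x = vs])
        have "(C' + 1) * (vnorm E h * ?p) \<le> K * (vnorm E h * ?p)"
          unfolding K_def using C0 nh p by (intro mult_right_mono) auto
        then have 4: "vnorm F (Df (x + h) vs - Df x vs) \<le> vnorm E h * (K * ?p)" using 3 by (simp add: mult_ac)
        have "(C' + 1) * vnorm E h \<le> 1" using h(3) C0 by (simp add: field_simps)
        then have "(C' + 1) * vnorm E h * ?p \<le> 1 * ?p" using p by (rule mult_right_mono)
        then have 5: "vnorm F (Df (x + h) vs - Df x vs) \<le> ?p" using 3 by (simp add: mult_ac)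
        have 6: "vnorm F (Df x vs) \<le> C * ?p" using multilinear_boundD(2)[OF C vs] .
        have "vnorm F (Df (x + h) vs) \<le> vnorm F (Df (x + h) vs - Df x vs) + vnorm F (Df x vs)"
          using vnorm_add[OF F, of "Df (x + h) vs - Df x vs" "Df x vs"] nspace_diff[OF F] m by simp
        then have 7: "vnorm F (Df (x + h) vs) \<le> (C + 1) * ?p" using 5 6 by (simp add: algebra_simps)
        have "C * ?p \<le> K * ?p" "(C + 1) * ?p \<le> K * ?p"
          unfolding K_def using C0 p by (auto intro!: mult_right_mono)
        then show "vnorm F (Df (x + h) vs - Df x vs) \<le> vnorm E h * (K * ?p) \<and>
          vnorm F (Df (x + h) vs) \<le> K * ?p \<and> vnorm F (Df x vs) \<le> K * ?p"
          using 4 6 7 by simp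
      qed
    qed
    moreover have "K \<ge> 1" using C0 by (simp add: K_def)
    ultimately show ?thesis unfolding B_def by blast
  qed
  then obtain K where "\<And>l. K l \<ge> 1 \<and> B l (K l)" by metis
  then have K: "\<And>l. K l \<ge> 1" "\<And>l. eventually (\<lambda>h. \<forall>vs\<in>tuples E l.
      vnorm F (Df (x + h) vs - Df x vs) \<le> vnorm E h * (K l * prod_list (map (vnorm E) vs)) \<and>
      vnorm F (Df (x + h) vs) \<le> K l * prod_list (map (vnorm E) vs) \<and>
      vnorm F (Df x vs) \<le> K l * prod_list (map (vnorm E) vs)) (increments E W x)"
    unfolding B_def by blast+
  define A where "A = prod_list (map (\<lambda>b. K (length b)) P)"
  have "0 \<le> K l" for l using K(1)[of l] by simp
  then have A: "0 \<le> A" unfolding A_def by (auto intro!: prod_list_nonneg)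
  obtain C where C: "multilinear_bound F G n C (Dg (f x))" using derivatives_bound[OF g] fV[OF x] by blast
  obtain C' where C': "multilinear_bound F G (Suc n) C' (Dg (f x))" using derivatives_bound[OF g] fV[OF x] by blast
  have C0: "0 \<le> C" "0 \<le> C'" using C C' by (auto simp: multilinear_bound_def)
  obtain C1 where C1: "multilinear_bound E F (Suc 0) C1 (Df x)" using derivatives_bound[OF f x] .
  have C10: "0 \<le> C1" using C1 by (simp add: multilinear_bound_def)
  \<comment> \<open>The four summands are the constants of \<open>?R1\<close> to \<open>?R4\<close>:
    \<open>K 0\<close> bounds \<open>\<kappa>\<close>, \<open>C'\<close> is the outer constant with
    one more argument, and \<open>C1\<close> bounds \<open>\<mu>\<close>.\<close>
  define Z where "Z = A * (K 0 + C' + C' * C1 * n + C * (real n + (real n)\<^sup>2))"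
  have Z: "0 \<le> Z" unfolding Z_def using A C0 C10 K(1)[of 0] by (intro mult_nonneg_nonneg add_nonneg_nonneg) auto
  define e where "e = \<epsilon> / (Z + 1)"
  have e: "e > 0" "Z * e \<le> \<epsilon>" using Z \<epsilon> by (auto simp: e_def field_simps)
  obtain d where d: "d > 0" "\<And>k ys. k \<in> vecs F \<Longrightarrow> vnorm F k < d \<Longrightarrow> f x + k \<in> V \<Longrightarrow> ys \<in> tuples F n \<Longrightarrow>
      vnorm G (Dg (f x + k) ys - Dg (f x) ys - Dg (f x) (k # ys)) \<le> e * vnorm F k * prod_list (map (vnorm F) ys)"
    using derivatives_remainder[OF g _ e(1), of "f x" n] fV[OF x] unfolding eventually_increments[OF F] by blast
  have K0: "K 0 > 0" using K(1)[of 0] by simp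
  have rem: "eventually (\<lambda>h. \<forall>b\<in>set P. \<forall>vs\<in>tuples E (length b).
      vnorm F (Df (x + h) vs - Df x vs - Df x (h # vs)) \<le> e * vnorm E h * prod_list (map (vnorm E) vs)) (increments E W x)"
    by (rule eventually_ball_finite) (use derivatives_remainder[OF f x e(1)] in auto)
  have lip: "eventually (\<lambda>h. \<forall>b\<in>set P. \<forall>vs\<in>tuples E (length b).
      vnorm F (Df (x + h) vs - Df x vs) \<le> vnorm E h * (K (length b) * prod_list (map (vnorm E) vs)) \<and>
      vnorm F (Df (x + h) vs) \<le> K (length b) * prod_list (map (vnorm E) vs) \<and>
      vnorm F (Df x vs) \<le> K (length b) * prod_list (map (vnorm E) vs)) (increments E W x)"
    by (rule eventually_ball_finite) (use K(2) in auto)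
  \<comment> \<open>Increments below \<open>e\<close> turn the square of their norm into
    \<open>e\<close> times the norm; below \<open>d / K 0\<close> they keep \<open>\<kappa>\<close>
    in the range where the remainder of \<open>Dg\<close> is controlled.\<close>
  have pos: "min e (d / K 0) > 0" using e(1) d(1) K0 by simp
  show ?thesis
    using rem lip K(2)[of 0] derivatives_remainder[OF f x e(1), of 0] eventually_increments_vecs[of E x W]
      eventually_increments_small[OF E pos, of W x]
  proof eventually_elim
    case (elim h)
    have h: "h \<in> vecs E" "x + h \<in> W" "vnorm E h \<le> e" "vnorm E h < d / K 0" using elim(5,6) by auto
    let ?nh = "vnorm E h"
    have nh: "0 \<le> ?nh" by (rule vnorm_nonneg[OF E h(1)])
    define \<kappa> where "\<kappa> = f (x + h) - f x"
    define \<mu> where "\<mu> = Df x [h]"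
    have fF: "f x \<in> vecs F" "f (x + h) \<in> vecs F"
      using derivatives_vecs[OF f, of _ "[]" 0] fV x h by auto
    have \<mu>: "\<mu> \<in> vecs F" "vnorm F \<mu> \<le> C1 * ?nh"
      using multilinear_boundD[OF C1, of "[h]"] h by (auto simp: \<mu>_def tuples_def)
    have \<kappa>: "\<kappa> \<in> vecs F" "vnorm F \<kappa> \<le> K 0 * ?nh" "vnorm F (\<kappa> - \<mu>) \<le> e * ?nh"
      using elim(3,4) fV[OF x] fV[OF h(2)] nspace_diff[OF F fF(2,1)] by (auto simp: \<kappa>_def \<mu>_def mult.commute)
    have "K 0 * ?nh < d" using h(4) K0 by (simp add: field_simps)
    then have \<kappa>d: "vnorm F \<kappa> < d" "f x + \<kappa> = f (x + h)" using \<kappa>(2) by (auto simp: \<kappa>_def)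
    show ?case
    proof
      fix vs assume vs: "vs \<in> tuples E k"
      let ?p = "prod_list (map (vnorm E) vs)"
      have p: "0 \<le> ?p" by (rule prod_vnorm_tuples[OF E vs])
      let ?v = "\<lambda>b. map ((!) vs) b"
      let ?a = "\<lambda>b. Df x (?v b)" and ?b = "\<lambda>b. Df (x + h) (?v b)" and ?d = "\<lambda>b. Df x (h # ?v b)"
      let ?c = "\<lambda>b. K (length b) * prod_list (map (vnorm E) (?v b))"
      have tv: "?v b \<in> tuples E (length b)" if "b \<in> set P" for b using blocks_tuples[OF P vs that] .
      have Pc: "prod_list (map ?c P) = A * ?p"
        unfolding A_def prod_blocks[OF P tuples_length[OF vs], symmetric] by (induction P) simp_all
      have ab: "?a b \<in> vecs F \<and> ?b b \<in> vecs F \<and> ?d b \<in> vecs F \<and> vnorm F (?a b) \<le> ?c b \<and> vnorm F (?b b) \<le> ?c b \<and>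
         vnorm F (?b b - ?a b) \<le> ?nh * ?c b \<and> vnorm F (?b b - ?a b - ?d b) \<le> (e * ?nh) * ?c b" if b: "b \<in> set P" for b
      proof -
        let ?q = "prod_list (map (vnorm E) (?v b))"
        have q: "0 \<le> ?q" by (rule prod_vnorm_tuples[OF E tv[OF b]])
        have "e * ?nh * (1 * ?q) \<le> e * ?nh * ?c b"
          using K(1)[of "length b"] q e(1) nh by (intro mult_left_mono mult_right_mono) auto
        moreover have "h # ?v b \<in> tuples E (Suc (length b))" using tv[OF b] h by simp
        ultimately show ?thesis
          using elim(1,2) b tv[OF b] derivatives_vecs[OF f x] derivatives_vecs[OF f h(2)]
          by (fastforce intro: order_trans)
      qed
      have n: "n = length P" by (simp add: n_def)
      note C = C[unfolded n] and C' = C'[unfolded n]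
      let ?ya = "map ?a P" and ?yb = "map ?b P"
      have tb: "?yb \<in> tuples F n" "?ya \<in> tuples F n" using ab by (auto simp: tuples_def n)
      have pb: "prod_list (map (vnorm F) ?yb) \<le> A * ?p"
        using prod_list_mono_norm[OF F, of P ?b ?c] ab Pc by auto
      have Ap: "0 \<le> A * ?p" using A p by simp
      let ?R1 = "Dg (f x + \<kappa>) ?yb - Dg (f x) ?yb - Dg (f x) (\<kappa> # ?yb)"
      let ?R2 = "Dg (f x) ((\<kappa> - \<mu>) # ?yb)"
      let ?R3 = "Dg (f x) (\<mu> # ?yb) - Dg (f x) (\<mu> # ?ya)"
      let ?S = "\<Sum>i<length P. Dg (f x) (?ya[i := ?d (P ! i)])"
      let ?R4 = "Dg (f x) ?yb - Dg (f x) ?ya - ?S"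
      have "vnorm G ?R1 \<le> e * vnorm F \<kappa> * prod_list (map (vnorm F) ?yb)"
        by (rule d(2)[OF \<kappa>(1) \<kappa>d(1) _ tb(1)]) (use \<kappa>d(2) fV[OF h(2)] in metis)
      also have "\<dots> \<le> e * (K 0 * ?nh) * (A * ?p)"
        using \<kappa>(2) pb e(1) vnorm_nonneg[OF F \<kappa>(1)] Ap K0 nh prod_vnorm_tuples[OF F tb(1)]
        by (intro mult_mono) auto
      finally have 1: "vnorm G ?R1 \<le> e * (K 0 * ?nh) * (A * ?p)" .
      have D: "\<kappa> - \<mu> \<in> vecs F" by (rule nspace_diff[OF F \<kappa>(1) \<mu>(1)])
      have "vnorm G ?R2 \<le> C' * vnorm F (\<kappa> - \<mu>) * prod_list (map ?c P)"
        by (rule multilinear_bound_le(2)[OF F multilinear_bound_Cons[OF F C' D]]) (use ab in auto)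
      also have "\<dots> \<le> C' * (e * ?nh) * (A * ?p)"
        unfolding Pc using \<kappa>(3) C0 Ap by (intro mult_right_mono mult_left_mono) auto
      finally have 2: "vnorm G ?R2 \<le> C' * (e * ?nh) * (A * ?p)" .
      have "vnorm G ?R3 \<le> C' * vnorm F \<mu> * (real (length P) * ?nh * prod_list (map ?c P))"
        by (rule multilinear_lipschitz[OF F G multilinear_bound_Cons[OF F C' \<mu>(1)] nh]) (use ab in auto)
      also have "\<dots> \<le> C' * (C1 * ?nh) * (real n * e * (A * ?p))"
        unfolding Pc n using \<mu>(2) C0 Ap nh h(3) C10 by (intro mult_mono mult_left_mono mult_right_mono) auto
      finally have 3: "vnorm G ?R3 \<le> C' * (C1 * ?nh) * (real n * e * (A * ?p))" .
      have e0: "0 \<le> e * ?nh" using e nh by simp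
      have "vnorm G ?R4 \<le> C * ((real (length P) * (e * ?nh) + (real (length P))\<^sup>2 * ?nh\<^sup>2) * prod_list (map ?c P))"
        by (rule multilinear_first_order[OF F G C nh e0]) (use ab in auto)
      also have "\<dots> \<le> C * ((real n * (e * ?nh) + (real n)\<^sup>2 * (e * ?nh)) * (A * ?p))"
        unfolding Pc n power2_eq_square[of ?nh]
        using C0 Ap nh h(3) by (intro mult_left_mono mult_right_mono add_left_mono) auto
      finally have 4: "vnorm G ?R4 \<le> C * ((real n * (e * ?nh) + (real n)\<^sup>2 * (e * ?nh)) * (A * ?p))" .
      have m1: "Dg (f x + \<kappa>) ?yb \<in> vecs G" "Dg (f x) ?yb \<in> vecs G" "Dg (f x) ?ya \<in> vecs G"
        using derivatives_vecs[OF g _ tb(1)] derivatives_vecs[OF g _ tb(2)] fV[OF x] fV[OF h(2)] \<kappa>d(2) by auto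
      have m2: "Dg (f x) (\<kappa> # ?yb) \<in> vecs G" "?R2 \<in> vecs G" "Dg (f x) (\<mu> # ?yb) \<in> vecs G" "Dg (f x) (\<mu> # ?ya) \<in> vecs G"
        using multilinear_boundD(1)[OF C'] tb \<kappa>(1) \<mu>(1) D n by auto
      have mS: "?S \<in> vecs G"
      proof (rule nspace_sum[OF G])
        fix i assume "i \<in> {..<length P}"
        then have "?ya[i := ?d (P ! i)] \<in> tuples F (length P)"
          using tuples_update[OF tb(2)] ab n by simp
        then show "Dg (f x) (?ya[i := ?d (P ! i)]) \<in> vecs G" by (rule multilinear_boundD(1)[OF C])
      qed
      have m: "?R1 \<in> vecs G" "?R3 \<in> vecs G" "?R4 \<in> vecs G" using nspace_diff[OF G] m1 m2 mS by auto
      have eR2: "?R2 = Dg (f x) (\<kappa> # ?yb) - Dg (f x) (\<mu> # ?yb)"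
        by (rule lin_on_diff[OF multilinear_bound_head[OF C' _ F] nspace_subspace[OF F] \<kappa>(1) \<mu>(1)]) (use tb n in simp)
      have S: "?S = (\<Sum>i<length P. Dg (f x) ((map (Df x) (blocks vs P))[i := Df x (h # blocks vs P ! i)]))"
        by (rule sum.cong) (auto simp: blocks_def o_def)
      have "Dg (f (x + h)) (map (Df (x + h)) (blocks vs P)) - Dg (f x) (map (Df x) (blocks vs P))
        - (Dg (f x) (Df x [h] # map (Df x) (blocks vs P)) +
           (\<Sum>i<length P. Dg (f x) ((map (Df x) (blocks vs P))[i := Df x (h # blocks vs P ! i)])))
        = ?R1 + ?R2 + ?R3 + ?R4"
        unfolding S[symmetric] eR2 \<kappa>d(2) by (simp add: blocks_def o_def \<mu>_def)
      moreover have "vnorm G (?R1 + ?R2 + ?R3 + ?R4) \<le> vnorm G ?R1 + vnorm G ?R2 + vnorm G ?R3 + vnorm G ?R4"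
        using vnorm_add[OF G m(1) m2(2)] vnorm_add[OF G nspace_add[OF G m(1) m2(2)] m(2)]
          vnorm_add[OF G nspace_add[OF G nspace_add[OF G m(1) m2(2)] m(2)] m(3)] by linarith
      moreover have "\<dots> \<le> e * (K 0 * ?nh) * (A * ?p) + C' * (e * ?nh) * (A * ?p)
          + C' * (C1 * ?nh) * (real n * e * (A * ?p)) + C * ((real n * (e * ?nh) + (real n)\<^sup>2 * (e * ?nh)) * (A * ?p))"
        using 1 2 3 4 by linarith
      moreover have "\<dots> = (Z * e) * (?nh * ?p)"
        unfolding Z_def by (simp add: algebra_simps)
      moreover have "\<dots> \<le> \<epsilon> * (?nh * ?p)"
        using e(2) nh p by (intro mult_right_mono) auto
      ultimately show "vnorm G (Dg (f (x + h)) (map (Df (x + h)) (blocks vs P)) - Dg (f x) (map (Df x) (blocks vs P))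
        - (Dg (f x) (Df x [h] # map (Df x) (blocks vs P)) +
           (\<Sum>i<length P. Dg (f x) ((map (Df x) (blocks vs P))[i := Df x (h # blocks vs P ! i)]))))
        \<le> \<epsilon> * ?nh * ?p" by (simp only: mult.assoc)
    qed
  qed
qed

lemma derivatives_compose:
  assumes E: "normed_nspace E" and F: "normed_nspace F" and G: "normed_nspace G"
    and f: "derivatives E F W Df" and g: "derivatives F G V Dg"
    and fV: "\<And>y. y \<in> W \<Longrightarrow> f y = Df y [] \<and> f y \<in> V"
  shows "derivatives E G W (comp_deriv f Df Dg)"
  unfolding derivatives_def
proof (intro conjI ballI allI impI)
  fix x k assume x: "x \<in> W"
  show "\<exists>C. multilinear_bound E G k C (comp_deriv f Df Dg x)"
    using comp_deriv_multilinear[OF E F G f g x] fV[OF x] by blast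
next
  fix x k and \<epsilon> :: real assume x: "x \<in> W" and \<epsilon>: "\<epsilon> > 0"
  let ?I = "index_partitions k"
  \<comment> \<open>Every partition gets the same share of \<epsilon>.\<close>
  define e where "e = \<epsilon> / (length ?I + 1)"
  have e: "e > 0" "length ?I * e \<le> \<epsilon>" using \<epsilon> by (auto simp: e_def field_simps)
  let ?R = "\<lambda>P h vs. Dg (f (x + h)) (map (Df (x + h)) (blocks vs P)) - Dg (f x) (map (Df x) (blocks vs P))
        - (Dg (f x) (Df x [h] # map (Df x) (blocks vs P)) +
           (\<Sum>i<length P. Dg (f x) ((map (Df x) (blocks vs P))[i := Df x (h # blocks vs P ! i)])))"
  have "eventually (\<lambda>h. \<forall>P\<in>set ?I. \<forall>vs\<in>tuples E k. vnorm G (?R P h vs) \<le> e * vnorm E h * prod_list (map (vnorm E) vs))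
     (increments E W x)"
    by (rule eventually_ball_finite) (use comp_deriv_remainder_term[OF E F G f g fV x _ e(1)] in auto)
  then show "eventually (\<lambda>h. \<forall>vs\<in>tuples E k. vnorm G (comp_deriv f Df Dg (x + h) vs - comp_deriv f Df Dg x vs
      - comp_deriv f Df Dg x (h # vs)) \<le> \<epsilon> * vnorm E h * prod_list (map (vnorm E) vs)) (increments E W x)"
    using eventually_increments_vecs[of E x W]
  proof eventually_elim
    case (elim h)
    have h: "h \<in> vecs E" "x + h \<in> W" using elim by auto
    show ?case
    proof
      fix vs assume vs: "vs \<in> tuples E k"
      let ?p = "prod_list (map (vnorm E) vs)"
      have p: "0 \<le> ?p" by (rule prod_vnorm_tuples[OF E vs])
      have len: "length vs = k" using tuples_length[OF vs] .
      have mem: "?R P h vs \<in> vecs G" if P: "P \<in> set ?I" for P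
      proof -
        have t: "blocks vs P ! i \<in> tuples E (length (P ! i))" if "i < length P" for i
          using blocks_tuples[OF P vs, of "P ! i"] that by (simp add: blocks_def)
        have "map (Df y) (blocks vs P) \<in> tuples F (length P)" if "y \<in> W" for y
          using blocks_tuples[OF P vs] derivatives_vecs[OF f that] by (auto simp: tuples_def blocks_def)
        note a = this[OF x] this[OF h(2)]
        have u: "(map (Df x) (blocks vs P))[i := Df x (h # blocks vs P ! i)] \<in> tuples F (length P)" if "i < length P" for i
        proof -
          have "h # blocks vs P ! i \<in> tuples E (Suc (length (P ! i)))" using t[OF that] h by simp
          then show ?thesis using tuples_update[OF a(1)] derivatives_vecs[OF f x] by blast
        qed
        have "Df x [h] \<in> vecs F" using derivatives_vecs[OF f x, of "[h]" "Suc 0"] h by (simp add: tuples_def)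
        then have c: "Df x [h] # map (Df x) (blocks vs P) \<in> tuples F (Suc (length P))" using a by simp
        have V: "f x \<in> V" "f (x + h) \<in> V" using fV[OF x] fV[OF h(2)] by blast+
        show ?thesis
          by (intro nspace_diff[OF G] nspace_add[OF G] nspace_sum[OF G])
             (use derivatives_vecs[OF g V(2) a(2)] derivatives_vecs[OF g V(1) a(1)] derivatives_vecs[OF g V(1) c]
                derivatives_vecs[OF g V(1) u] in auto)
      qed
      have "comp_deriv f Df Dg (x + h) vs - comp_deriv f Df Dg x vs - comp_deriv f Df Dg x (h # vs)
         = (\<Sum>P\<leftarrow>?I. ?R P h vs)"
        unfolding comp_deriv_Cons unfolding comp_deriv_def len by (simp only: sum_list_subtractf)
      then have "vnorm G (comp_deriv f Df Dg (x + h) vs - comp_deriv f Df Dg x vs - comp_deriv f Df Dg x (h # vs))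
         \<le> (\<Sum>P\<leftarrow>?I. vnorm G (?R P h vs))"
        using vnorm_sum_list[OF G, of ?I "\<lambda>P. ?R P h vs"] mem by simp
      also have "\<dots> \<le> (\<Sum>P\<leftarrow>?I. e * vnorm E h * ?p)"
        using elim(1) vs by (intro sum_list_mono) auto
      also have "\<dots> = (length ?I * e) * (vnorm E h * ?p)" by (simp add: sum_list_triv mult_ac)
      also have "\<dots> \<le> \<epsilon> * (vnorm E h * ?p)"
        using e(2) p vnorm_nonneg[OF E h(1)] by (intro mult_right_mono) auto
      finally show "vnorm G (comp_deriv f Df Dg (x + h) vs - comp_deriv f Df Dg x vs - comp_deriv f Df Dg x (h # vs))
        \<le> \<epsilon> * vnorm E h * ?p" by (simp add: mult.assoc)
    qed
  qed
qed

text \<open>The closed form survives because the orders 0 and 1 have only one partition each, the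
  empty one and a single block.\<close>

lemma smooth_deriv_compose:
  assumes E: "normed_nspace E" and F: "normed_nspace F" and G: "normed_nspace G"
    and f: "smooth_deriv E F W f f'" and g: "smooth_deriv F G V g g'" and fV: "f ` W \<subseteq> V"
  shows "smooth_deriv E G W (\<lambda>x. g (f x)) (\<lambda>x v. g' (f x) (f' x v))"
proof -
  obtain Df where Df: "derivatives E F W Df" "\<forall>x\<in>W. Df x [] = f x \<and> (\<forall>v\<in>vecs E. Df x [v] = f' x v)"
    using f unfolding smooth_deriv_def by blast
  obtain Dg where Dg: "derivatives F G V Dg" "\<forall>x\<in>V. Dg x [] = g x \<and> (\<forall>v\<in>vecs F. Dg x [v] = g' x v)"
    using g unfolding smooth_deriv_def by blast
  have "derivatives E G W (comp_deriv f Df Dg)"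
    by (rule derivatives_compose[OF E F G Df(1) Dg(1)]) (use Df(2) fV in auto)
  moreover have "\<forall>x\<in>W. comp_deriv f Df Dg x [] = g (f x) \<and> (\<forall>v\<in>vecs E. comp_deriv f Df Dg x [v] = g' (f x) (f' x v))"
    using Df(2) Dg(2) fV smooth_deriv_vecs[OF f] by (auto simp: comp_deriv_def blocks_def)
  ultimately show ?thesis unfolding smooth_deriv_def by blast
qed

subsection \<open>Linear and bilinear maps, multiplication operators\<close>

definition bounded_linear_on :: "'e::real_vector nspace \<Rightarrow> 'f::real_vector nspace \<Rightarrow> ('e \<Rightarrow> 'f) \<Rightarrow> bool" where
  "bounded_linear_on E F L \<longleftrightarrow> L ` vecs E \<subseteq> vecs F \<and> lin_on (vecs E) L \<and>
     (\<exists>C. \<forall>x\<in>vecs E. vnorm F (L x) \<le> C * vnorm E x)"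

definition bounded_bilinear_on ::
  "'e::real_vector nspace \<Rightarrow> 'f::real_vector nspace \<Rightarrow> 'g::real_vector nspace \<Rightarrow> ('e \<Rightarrow> 'f \<Rightarrow> 'g) \<Rightarrow> bool" where
  "bounded_bilinear_on E F G B \<longleftrightarrow> (\<forall>x\<in>vecs E. \<forall>y\<in>vecs F. B x y \<in> vecs G) \<and>
     (\<forall>x\<in>vecs E. lin_on (vecs F) (B x)) \<and> (\<forall>y\<in>vecs F. lin_on (vecs E) (\<lambda>x. B x y)) \<and>
     (\<exists>C. \<forall>x\<in>vecs E. \<forall>y\<in>vecs F. vnorm G (B x y) \<le> C * vnorm E x * vnorm F y)"

lemma less_2_cases': "(k::nat) = 0 \<or> k = 1 \<or> (\<exists>j. k = Suc (Suc j))"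
  by (cases k; cases "k - 1") auto

lemma multilinear_bound_zero:
  assumes E: "normed_nspace E" and F: "normed_nspace F" and L: "\<And>vs. vs \<in> tuples E k \<Longrightarrow> L vs = 0"
  shows "multilinear_bound E F k 0 L"
proof -
  have "lin_on (vecs E) (\<lambda>v. L (vs[i := v]))" if "vs \<in> tuples E k" for vs i
    unfolding lin_on_def using L tuples_update[OF that] nspace_add[OF E] nspace_scale[OF E] by simp
  then show ?thesis
    using L nspace_0[OF F] vnorm_0[OF F] by (auto simp: multilinear_bound_def)
qed

lemma multilinear_bound_0:
  "0 \<le> C \<Longrightarrow> L [] \<in> vecs F \<Longrightarrow> vnorm F (L []) \<le> C \<Longrightarrow> multilinear_bound E F 0 C L"
  by (simp add: multilinear_bound_def)

lemma multilinear_bound_1: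
  assumes "0 \<le> C" "\<And>v. v \<in> vecs E \<Longrightarrow> L [v] \<in> vecs F \<and> vnorm F (L [v]) \<le> C * vnorm E v" "lin_on (vecs E) (\<lambda>v. L [v])"
  shows "multilinear_bound E F (Suc 0) C L"
  using assms by (auto simp: multilinear_bound_def elim!: tuples_SucE)

lemma smooth_deriv_linear:
  assumes E: "normed_nspace E" and F: "normed_nspace F" and L: "bounded_linear_on E F L" and W: "W \<subseteq> vecs E"
  shows "smooth_deriv E F W L (\<lambda>x v. L v)"
proof -
  obtain C where "\<And>x. x \<in> vecs E \<Longrightarrow> vnorm F (L x) \<le> C * vnorm E x"
    using L unfolding bounded_linear_on_def by blast
  then have C: "vnorm F (L x) \<le> max C 0 * vnorm E x" if "x \<in> vecs E" for x
    using that vnorm_nonneg[OF E that] by (meson max.cobounded1 mult_right_mono order_trans)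
  have LF: "L x \<in> vecs F" if "x \<in> vecs E" for x using L that by (auto simp: bounded_linear_on_def)
  have lin: "lin_on (vecs E) L" using L by (simp add: bounded_linear_on_def)
  define D where "D x vs = (case vs of [] \<Rightarrow> L x | [v] \<Rightarrow> L v | _ \<Rightarrow> 0)" for x vs
  have D2: "D x vs = 0" if "vs \<in> tuples E (Suc (Suc j))" for x vs j
    using that by (auto simp: D_def elim!: tuples_SucE)
  have "derivatives E F W D"
    unfolding derivatives_def
  proof (intro conjI ballI allI impI)
    fix x k assume x: "x \<in> W"
    consider "k = 0" | "k = Suc 0" | j where "k = Suc (Suc j)" using less_2_cases'[of k] by auto
    then show "\<exists>C. multilinear_bound E F k C (D x)"
    proof cases
      case 1
      then show ?thesis
        using x W LF vnorm_nonneg[OF F] by (intro exI[of _ "vnorm F (L x)"]) (auto intro!: multilinear_bound_0 simp: D_def)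
    next
      case 2
      then show ?thesis
        using C LF lin by (intro exI[of _ "max C 0"]) (auto intro!: multilinear_bound_1 simp: D_def)
    next
      case 3
      have "D x vs = 0" if "vs \<in> tuples E k" for vs using D2[of vs j x] that 3 by simp
      then show ?thesis using multilinear_bound_zero[OF E F] by blast
    qed
  next
    fix x k and \<epsilon> :: real assume x: "x \<in> W" and \<epsilon>: "\<epsilon> > 0"
    show "eventually (\<lambda>h. \<forall>vs\<in>tuples E k. vnorm F (D (x + h) vs - D x vs - D x (h # vs))
          \<le> \<epsilon> * vnorm E h * prod_list (map (vnorm E) vs)) (increments E W x)"
      using eventually_increments_vecs
    proof eventually_elim
      case (elim h)
      have "D (x + h) vs - D x vs - D x (h # vs) = 0" if "vs \<in> tuples E k" for vs
      proof (cases vs)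
        case Nil
        then show ?thesis using lin_onD(1)[OF lin, of x h] x W elim by (auto simp: D_def)
      next
        case (Cons w ws)
        then show ?thesis by (auto simp: D_def split: list.split)
      qed
      then show ?case
        using vnorm_nonneg[OF E] elim prod_vnorm_tuples[OF E] \<epsilon> by (auto simp: vnorm_0[OF F] intro!: mult_nonneg_nonneg)
    qed
  qed
  moreover have "\<forall>x\<in>W. D x [] = L x \<and> (\<forall>v\<in>vecs E. D x [v] = L v)" by (simp add: D_def)
  ultimately show ?thesis unfolding smooth_deriv_def by blast
qed

lemma smooth_deriv_const:
  assumes E: "normed_nspace E" and F: "normed_nspace F" and c: "c \<in> vecs F"
  shows "smooth_deriv E F W (\<lambda>x. c) (\<lambda>x v. 0)"
proof -
  define D where "D x vs = (case vs of [] \<Rightarrow> c | _ \<Rightarrow> 0)" for x :: 'a and vs :: "'a list"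
  have "derivatives E F W D"
    unfolding derivatives_def
  proof (intro conjI ballI allI impI)
    fix x k assume x: "x \<in> W"
    show "\<exists>C. multilinear_bound E F k C (D x)"
    proof (cases k)
      case 0
      then show ?thesis
        using c vnorm_nonneg[OF F] by (intro exI[of _ "vnorm F c"]) (auto intro!: multilinear_bound_0 simp: D_def)
    next
      case (Suc j)
      have "D x vs = 0" if "vs \<in> tuples E (Suc j)" for vs using that by (auto simp: D_def elim!: tuples_SucE)
      then show ?thesis using multilinear_bound_zero[OF E F] Suc by blast
    qed
  next
    fix x k and \<epsilon> :: real assume x: "x \<in> W" and \<epsilon>: "\<epsilon> > 0"
    show "eventually (\<lambda>h. \<forall>vs\<in>tuples E k. vnorm F (D (x + h) vs - D x vs - D x (h # vs))
          \<le> \<epsilon> * vnorm E h * prod_list (map (vnorm E) vs)) (increments E W x)"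
      using eventually_increments_vecs
    proof eventually_elim
      case (elim h)
      have "D (x + h) vs - D x vs - D x (h # vs) = 0" for vs by (cases vs) (auto simp: D_def)
      then show ?case
        using vnorm_nonneg[OF E] elim prod_vnorm_tuples[OF E] \<epsilon> by (auto simp: vnorm_0[OF F] intro!: mult_nonneg_nonneg)
    qed
  qed
  moreover have "\<forall>x\<in>W. D x [] = c \<and> (\<forall>v\<in>vecs E. D x [v] = 0)" by (simp add: D_def)
  ultimately show ?thesis unfolding smooth_deriv_def by blast
qed

section \<open>Products of normed carriers\<close>

lemma vecs_prod [simp]: "vecs (prod_nspace E F) = vecs E \<times> vecs F"
  by (simp add: prod_nspace_def)

lemma vnorm_prod: "vnorm (prod_nspace E F) z = sqrt ((vnorm E (fst z))\<^sup>2 + (vnorm F (snd z))\<^sup>2)"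
  by (simp add: prod_nspace_def case_prod_unfold)

lemma subspace_Times: "subspace A \<Longrightarrow> subspace B \<Longrightarrow> subspace (A \<times> B)"
  by (auto simp: subspace_def zero_prod_def)

lemma normed_nspace_prod:
  assumes E: "normed_nspace E" and F: "normed_nspace F"
  shows "normed_nspace (prod_nspace E F)"
  unfolding normed_nspace_def
proof (intro conjI ballI allI)
  show "subspace (vecs (prod_nspace E F))"
    using nspace_subspace[OF E] nspace_subspace[OF F] by (simp add: subspace_Times)
  fix z assume z: "z \<in> vecs (prod_nspace E F)"
  show "0 \<le> vnorm (prod_nspace E F) z" by (simp add: vnorm_prod)
  show "(vnorm (prod_nspace E F) z = 0) = (z = 0)"
    using z vnorm_eq_0[OF E] vnorm_eq_0[OF F] by (auto simp: vnorm_prod sum_power2_eq_zero_iff prod_eq_iff)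
  fix r :: real
  have "(vnorm E (r *\<^sub>R fst z))\<^sup>2 + (vnorm F (r *\<^sub>R snd z))\<^sup>2 = \<bar>r\<bar>\<^sup>2 * ((vnorm E (fst z))\<^sup>2 + (vnorm F (snd z))\<^sup>2)"
    using z vnorm_scale[OF E, of "fst z" r] vnorm_scale[OF F, of "snd z" r]
    by (auto simp: power_mult_distrib algebra_simps)
  then show "vnorm (prod_nspace E F) (r *\<^sub>R z) = \<bar>r\<bar> * vnorm (prod_nspace E F) z"
    by (simp add: vnorm_prod real_sqrt_mult)
next
  fix z w assume z: "z \<in> vecs (prod_nspace E F)" and w: "w \<in> vecs (prod_nspace E F)"
  let ?a = "vnorm E (fst z)" and ?b = "vnorm E (fst w)" and ?c = "vnorm F (snd z)" and ?d = "vnorm F (snd w)"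
  have "sqrt ((vnorm E (fst z + fst w))\<^sup>2 + (vnorm F (snd z + snd w))\<^sup>2) \<le> sqrt ((?a + ?b)\<^sup>2 + (?c + ?d)\<^sup>2)"
    using z w vnorm_add[OF E, of "fst z" "fst w"] vnorm_add[OF F, of "snd z" "snd w"]
      vnorm_nonneg[OF E, of "fst z + fst w"] vnorm_nonneg[OF F, of "snd z + snd w"] nspace_add[OF E] nspace_add[OF F]
    by (auto intro!: add_mono power_mono)
  also have "\<dots> \<le> sqrt (?a\<^sup>2 + ?c\<^sup>2) + sqrt (?b\<^sup>2 + ?d\<^sup>2)" by (rule real_sqrt_sum_squares_triangle_ineq)
  finally show "vnorm (prod_nspace E F) (z + w) \<le> vnorm (prod_nspace E F) z + vnorm (prod_nspace E F) w"
    by (simp add: vnorm_prod)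
qed

lemma vnorm_fst_le: "vnorm E (fst z) \<le> vnorm (prod_nspace E F) z"
  and vnorm_snd_le: "vnorm F (snd z) \<le> vnorm (prod_nspace E F) z"
  unfolding vnorm_prod by (rule real_le_rsqrt; simp)+

lemma vnorm_prod_le:
  "0 \<le> vnorm E (fst z) \<Longrightarrow> 0 \<le> vnorm F (snd z) \<Longrightarrow> vnorm (prod_nspace E F) z \<le> vnorm E (fst z) + vnorm F (snd z)"
  unfolding vnorm_prod by (rule sqrt_sum_squares_le_sum)

lemma banach_nspaceI:
  assumes "normed_nspace E"
    and "\<And>X. (\<And>n::nat. X n \<in> vecs E) \<Longrightarrow> (\<And>\<epsilon>. \<epsilon> > 0 \<Longrightarrow> \<exists>N. \<forall>i\<ge>N. \<forall>j\<ge>N. vnorm E (X i - X j) < \<epsilon>)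
        \<Longrightarrow> \<exists>x\<in>vecs E. (\<lambda>n. vnorm E (X n - x)) \<longlonglongrightarrow> 0"
  shows "banach_nspace E"
proof -
  have "\<forall>X. (\<forall>n::nat. X n \<in> vecs E) \<and> (\<forall>\<epsilon>>0. \<exists>N. \<forall>i\<ge>N. \<forall>j\<ge>N. vnorm E (X i - X j) < \<epsilon>)
        \<longrightarrow> (\<exists>x\<in>vecs E. (\<lambda>n. vnorm E (X n - x)) \<longlonglongrightarrow> 0)"
  proof (intro allI impI, elim conjE, rule assms(2))
    fix X n assume "\<forall>n::nat. X n \<in> vecs E"
    then show "X n \<in> vecs E" ..
  next
    fix X and \<epsilon> :: real
    assume "\<forall>\<epsilon>>0. \<exists>N::nat. \<forall>i\<ge>N. \<forall>j\<ge>N. vnorm E (X i - X j) < \<epsilon>" "\<epsilon> > 0"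
    then show "\<exists>N. \<forall>i\<ge>N. \<forall>j\<ge>N. vnorm E (X i - X j) < \<epsilon>" by blast
  qed
  with assms(1) show ?thesis
    unfolding banach_nspace_def normed_nspace_def by (elim conjE) (intro conjI)
qed

lemma banach_nspace_complete:
  assumes "banach_nspace E" "\<And>n::nat. X n \<in> vecs E" "\<And>\<epsilon>. \<epsilon> > 0 \<Longrightarrow> \<exists>N. \<forall>i\<ge>N. \<forall>j\<ge>N. vnorm E (X i - X j) < \<epsilon>"
  shows "\<exists>x\<in>vecs E. (\<lambda>n. vnorm E (X n - x)) \<longlonglongrightarrow> 0"
proof -
  have "(\<forall>n::nat. X n \<in> vecs E) \<and> (\<forall>\<epsilon>>0. \<exists>N. \<forall>i\<ge>N. \<forall>j\<ge>N. vnorm E (X i - X j) < \<epsilon>)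
        \<longrightarrow> (\<exists>x\<in>vecs E. (\<lambda>n. vnorm E (X n - x)) \<longlonglongrightarrow> 0)"
    using assms(1) unfolding banach_nspace_def by (elim conjE) (erule spec)
  then show ?thesis using assms(2,3) by simp
qed

lemma banach_nspace_prod:
  assumes E: "banach_nspace E" and F: "banach_nspace F"
  shows "banach_nspace (prod_nspace E F)"
proof -
  note nE = banach_nspace_normed[OF E] and nF = banach_nspace_normed[OF F]
  let ?P = "prod_nspace E F"
  show ?thesis
  proof (rule banach_nspaceI[OF normed_nspace_prod[OF nE nF]])
    fix X :: "nat \<Rightarrow> 'a \<times> 'b"
    assume X: "\<And>n. X n \<in> vecs ?P" "\<And>\<epsilon>. \<epsilon> > 0 \<Longrightarrow> \<exists>N. \<forall>i\<ge>N. \<forall>j\<ge>N. vnorm ?P (X i - X j) < \<epsilon>"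
    have XE: "fst (X n) \<in> vecs E" "snd (X n) \<in> vecs F" for n using X(1)[of n] by auto
    have "\<exists>N. \<forall>i\<ge>N. \<forall>j\<ge>N. vnorm E (fst (X i) - fst (X j)) < \<epsilon>" if "\<epsilon> > 0" for \<epsilon>
      using X(2)[OF that] order.strict_trans1[OF vnorm_fst_le[of E "X _ - X _" F]] by (fastforce simp: fst_diff)
    from banach_nspace_complete[OF E XE(1) this]
    obtain a where a: "a \<in> vecs E" "(\<lambda>n. vnorm E (fst (X n) - a)) \<longlonglongrightarrow> 0" by blast
    have "\<exists>N. \<forall>i\<ge>N. \<forall>j\<ge>N. vnorm F (snd (X i) - snd (X j)) < \<epsilon>" if "\<epsilon> > 0" for \<epsilon>
      using X(2)[OF that] order.strict_trans1[OF vnorm_snd_le[of F "X _ - X _" E]] by (fastforce simp: snd_diff)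
    from banach_nspace_complete[OF F XE(2) this]
    obtain b where b: "b \<in> vecs F" "(\<lambda>n. vnorm F (snd (X n) - b)) \<longlonglongrightarrow> 0" by blast
    have "(\<lambda>n. sqrt ((vnorm E (fst (X n) - a))\<^sup>2 + (vnorm F (snd (X n) - b))\<^sup>2)) \<longlonglongrightarrow> sqrt (0\<^sup>2 + 0\<^sup>2)"
      by (intro tendsto_intros a b)
    then have "(\<lambda>n. vnorm ?P (X n - (a, b))) \<longlonglongrightarrow> 0" by (simp add: vnorm_prod)
    then show "\<exists>x\<in>vecs ?P. (\<lambda>n. vnorm ?P (X n - x)) \<longlonglongrightarrow> 0"
      using a(1) b(1) by (intro bexI[of _ "(a, b)"]) auto
  qed
qed

lemma normed_nspace_real: "normed_nspace real_nspace"
  by (auto simp: normed_nspace_def real_nspace_def abs_mult)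

lemma smooth_deriv_Pair:
  assumes E: "normed_nspace E" and F: "normed_nspace F" and G: "normed_nspace G"
    and f: "smooth_deriv E F W f f'" and g: "smooth_deriv E G W g g'"
  shows "smooth_deriv E (prod_nspace F G) W (\<lambda>x. (f x, g x)) (\<lambda>x v. (f' x v, g' x v))"
proof -
  obtain Df where Df: "derivatives E F W Df" "\<forall>x\<in>W. Df x [] = f x \<and> (\<forall>v\<in>vecs E. Df x [v] = f' x v)"
    using f unfolding smooth_deriv_def by blast
  obtain Dg where Dg: "derivatives E G W Dg" "\<forall>x\<in>W. Dg x [] = g x \<and> (\<forall>v\<in>vecs E. Dg x [v] = g' x v)"
    using g unfolding smooth_deriv_def by blast
  let ?D = "\<lambda>x vs. (Df x vs, Dg x vs)"
  have le: "vnorm (prod_nspace F G) (a, b) \<le> vnorm F a + vnorm G b" if "a \<in> vecs F" "b \<in> vecs G" for a b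
    using vnorm_prod_le[of F "(a, b)" G] vnorm_nonneg[OF F] vnorm_nonneg[OF G] that by simp
  have "derivatives E (prod_nspace F G) W ?D"
    unfolding derivatives_def
  proof (intro conjI ballI allI impI)
    fix x k assume x: "x \<in> W"
    obtain A where A: "multilinear_bound E F k A (Df x)" using derivatives_bound[OF Df(1) x] .
    obtain B where B: "multilinear_bound E G k B (Dg x)" using derivatives_bound[OF Dg(1) x] .
    have "vnorm (prod_nspace F G) (?D x vs) \<le> (A + B) * prod_list (map (vnorm E) vs)" if "vs \<in> tuples E k" for vs
      using le[of "Df x vs" "Dg x vs"] multilinear_boundD[OF A that] multilinear_boundD[OF B that] by (simp add: algebra_simps)
    then have "multilinear_bound E (prod_nspace F G) k (A + B) (?D x)"
      using A B unfolding multilinear_bound_def by (auto intro!: lin_on_Pair)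
    then show "\<exists>C. multilinear_bound E (prod_nspace F G) k C (?D x)" ..
  next
    fix x k and \<epsilon> :: real assume x: "x \<in> W" and \<epsilon>: "\<epsilon> > 0"
    then have \<epsilon>2: "\<epsilon> / 2 > 0" by simp
    show "eventually (\<lambda>h. \<forall>vs\<in>tuples E k. vnorm (prod_nspace F G) (?D (x + h) vs - ?D x vs - ?D x (h # vs))
          \<le> \<epsilon> * vnorm E h * prod_list (map (vnorm E) vs)) (increments E W x)"
      using derivatives_remainder[OF Df(1) x \<epsilon>2, of k] derivatives_remainder[OF Dg(1) x \<epsilon>2, of k] eventually_increments_vecs[of E x W]
    proof eventually_elim
      case (elim h)
      show ?case
      proof
        fix vs assume vs: "vs \<in> tuples E k"
        let ?a = "Df (x + h) vs - Df x vs - Df x (h # vs)" and ?b = "Dg (x + h) vs - Dg x vs - Dg x (h # vs)"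
        have hv: "h # vs \<in> tuples E (Suc k)" using vs elim by simp
        have "?a \<in> vecs F" "?b \<in> vecs G"
          using derivatives_vecs[OF Df(1) _ vs] derivatives_vecs[OF Df(1) x hv] derivatives_vecs[OF Dg(1) _ vs]
            derivatives_vecs[OF Dg(1) x hv] x elim by (auto intro!: nspace_diff[OF F] nspace_diff[OF G])
        then have "vnorm (prod_nspace F G) (?a, ?b) \<le> vnorm F ?a + vnorm G ?b" by (rule le)
        also have "\<dots> \<le> \<epsilon> / 2 * vnorm E h * prod_list (map (vnorm E) vs) + \<epsilon> / 2 * vnorm E h * prod_list (map (vnorm E) vs)"
          using elim vs by (intro add_mono) auto
        finally show "vnorm (prod_nspace F G) (?D (x + h) vs - ?D x vs - ?D x (h # vs))
          \<le> \<epsilon> * vnorm E h * prod_list (map (vnorm E) vs)" by simp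
      qed
    qed
  qed
  moreover have "\<forall>x\<in>W. ?D x [] = (f x, g x) \<and> (\<forall>v\<in>vecs E. ?D x [v] = (f' x v, g' x v))"
    using Df(2) Dg(2) by simp
  ultimately show ?thesis unfolding smooth_deriv_def by blast
qed

text \<open>A bilinear map equals its Taylor polynomial of degree two. Its derivatives vanish from
  order three on, and a remainder can be nonzero only at order zero, where it is
  \<open>B (fst h) (snd h)\<close>, quadratic in h.\<close>

lemma smooth_deriv_bilinear:
  assumes E: "normed_nspace E" and F: "normed_nspace F" and G: "normed_nspace G"
    and B: "bounded_bilinear_on E F G B"
  shows "smooth_deriv (prod_nspace E F) G (vecs E \<times> vecs F) (\<lambda>z. B (fst z) (snd z))
    (\<lambda>z v. B (fst v) (snd z) + B (fst z) (snd v))"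
proof -
  let ?P = "prod_nspace E F"
  note P = normed_nspace_prod[OF E F]
  obtain C0 where "\<And>x y. x \<in> vecs E \<Longrightarrow> y \<in> vecs F \<Longrightarrow> vnorm G (B x y) \<le> C0 * vnorm E x * vnorm F y"
    using B unfolding bounded_bilinear_on_def by blast
  then have C0: "vnorm G (B x y) \<le> max C0 0 * vnorm E x * vnorm F y" if "x \<in> vecs E" "y \<in> vecs F" for x y
    using that vnorm_nonneg[OF E that(1)] vnorm_nonneg[OF F that(2)]
    by (meson max.cobounded1 mult_right_mono order_trans)
  define C where "C = max C0 0"
  have C: "0 \<le> C" by (simp add: C_def)
  have bound: "vnorm G (B (fst v) (snd w)) \<le> C * (vnorm ?P v * vnorm ?P w)" if "v \<in> vecs ?P" "w \<in> vecs ?P" for v w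
  proof -
    have "vnorm E (fst v) * vnorm F (snd w) \<le> vnorm ?P v * vnorm ?P w"
      using that vnorm_nonneg[OF E, of "fst v"] vnorm_nonneg[OF F, of "snd w"] vnorm_nonneg[OF P that(1)]
      by (intro mult_mono vnorm_fst_le vnorm_snd_le) auto
    then show ?thesis
      using C0[of "fst v" "snd w"] that C mult_left_mono[of _ _ C] unfolding C_def[symmetric] by (fastforce simp: mult.assoc)
  qed
  have BG: "B x y \<in> vecs G" if "x \<in> vecs E" "y \<in> vecs F" for x y using B that by (simp add: bounded_bilinear_on_def)
  have add: "B (x + x') y = B x y + B x' y" "B (r *\<^sub>R x) y = r *\<^sub>R B x y" if "x \<in> vecs E" "x' \<in> vecs E" "y \<in> vecs F" for x x' y r
    using B that unfolding bounded_bilinear_on_def lin_on_def by auto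
  have add': "B x (y + y') = B x y + B x y'" "B x (r *\<^sub>R y) = r *\<^sub>R B x y" if "x \<in> vecs E" "y \<in> vecs F" "y' \<in> vecs F" for x y y' r
    using B that unfolding bounded_bilinear_on_def lin_on_def by auto
  define D where "D z vs = (case vs of [] \<Rightarrow> B (fst z) (snd z) | [v] \<Rightarrow> B (fst v) (snd z) + B (fst z) (snd v)
     | [v, w] \<Rightarrow> B (fst v) (snd w) + B (fst w) (snd v) | _ \<Rightarrow> 0)" for z vs
  have D3: "D z vs = 0" if "vs \<in> tuples ?P (Suc (Suc (Suc j)))" for z vs j
    using that by (auto simp: D_def elim!: tuples_SucE)
  have sym: "vnorm G (B (fst v) (snd w) + B (fst w) (snd v)) \<le> 2 * C * (vnorm ?P v * vnorm ?P w)"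
    if "v \<in> vecs ?P" "w \<in> vecs ?P" for v w
    using vnorm_add[OF G, of "B (fst v) (snd w)" "B (fst w) (snd v)"] BG that bound[OF that] bound[OF that(2,1)]
    by (auto simp: mult.commute)
  have lin: "lin_on (vecs ?P) (\<lambda>v. B (fst v) (snd w) + B (fst w) (snd v))" if "w \<in> vecs ?P" for w
    using that by (auto simp: lin_on_def add add' algebra_simps)
  have "derivatives ?P G (vecs E \<times> vecs F) D"
    unfolding derivatives_def
  proof (intro conjI ballI allI impI)
    fix z k assume z: "z \<in> vecs E \<times> vecs F"
    consider "k = 0" | "k = Suc 0" | "k = Suc (Suc 0)" | j where "k = Suc (Suc (Suc j))"
      using less_2_cases'[of k] less_2_cases'[of "k - 1"] by fastforce
    then show "\<exists>C. multilinear_bound ?P G k C (D z)"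
    proof cases
      case 1
      then show ?thesis using z BG vnorm_nonneg[OF G]
        by (intro exI[of _ "vnorm G (B (fst z) (snd z))"]) (auto intro!: multilinear_bound_0 simp: D_def)
    next
      case 2
      have "multilinear_bound ?P G (Suc 0) (2 * C * vnorm ?P z) (D z)"
      proof (rule multilinear_bound_1)
        show "0 \<le> 2 * C * vnorm ?P z" using C vnorm_nonneg[OF P] z by simp
        show "lin_on (vecs ?P) (\<lambda>v. D z [v])" using lin[of z] z by (simp add: D_def)
        fix v assume v: "v \<in> vecs ?P"
        show "D z [v] \<in> vecs G \<and> vnorm G (D z [v]) \<le> 2 * C * vnorm ?P z * vnorm ?P v"
          using sym[of v z] v z BG nspace_add[OF G] by (auto simp: D_def mult_ac)
      qed
      then show ?thesis using 2 by blast
    next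
      case 3
      have "lin_on (vecs ?P) (\<lambda>v. D z ([a, b][i := v]))" if "a \<in> vecs ?P" "b \<in> vecs ?P" "i < 2" for a b i
        using that lin[of a] lin[of b] by (auto simp: D_def less_2_cases_iff add.commute)
      then have "multilinear_bound ?P G (Suc (Suc 0)) (2 * C) (D z)"
        using C sym BG nspace_add[OF G] unfolding multilinear_bound_def
        by (fastforce elim!: tuples_SucE simp: D_def numeral_2_eq_2)
      then show ?thesis using 3 by blast
    next
      case 4
      have "D z vs = 0" if "vs \<in> tuples ?P k" for vs using D3[of vs j z] that 4 by simp
      then show ?thesis using multilinear_bound_zero[OF P G] by blast
    qed
  next
    fix z k and \<epsilon> :: real assume z: "z \<in> vecs E \<times> vecs F" and \<epsilon>: "\<epsilon> > 0"
    have pos: "\<epsilon> / (C + 1) > 0" using \<epsilon> C by simp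
    show "eventually (\<lambda>h. \<forall>vs\<in>tuples ?P k. vnorm G (D (z + h) vs - D z vs - D z (h # vs))
          \<le> \<epsilon> * vnorm ?P h * prod_list (map (vnorm ?P) vs)) (increments ?P (vecs E \<times> vecs F) z)"
      using eventually_increments_vecs[of ?P z "vecs E \<times> vecs F"] eventually_increments_small[OF P pos, of "vecs E \<times> vecs F" z]
    proof eventually_elim
      case (elim h)
      have nh: "0 \<le> vnorm ?P h" using vnorm_nonneg[OF P] elim by blast
      have h: "fst h \<in> vecs E" "snd h \<in> vecs F" "fst z \<in> vecs E" "snd z \<in> vecs F" using elim z by auto
      show ?case
      proof
        fix vs assume vs: "vs \<in> tuples ?P k"
        show "vnorm G (D (z + h) vs - D z vs - D z (h # vs)) \<le> \<epsilon> * vnorm ?P h * prod_list (map (vnorm ?P) vs)"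
        proof (cases vs)
          case Nil
          have "D (z + h) vs - D z vs - D z (h # vs) = B (fst h) (snd h)"
            using h nspace_add[OF F h(4,2)] by (simp add: Nil D_def add add' algebra_simps)
          also have "vnorm G \<dots> \<le> C * (vnorm ?P h * vnorm ?P h)" by (rule bound) (use elim in auto)
          also have "\<dots> \<le> (C + 1) * vnorm ?P h * vnorm ?P h" using nh C by (simp add: algebra_simps)
          also have "\<dots> \<le> \<epsilon> * vnorm ?P h"
            using elim(2) C nh by (intro mult_right_mono) (auto simp: field_simps)
          finally show ?thesis by (simp add: Nil)
        next
          case (Cons w ws)
          then have "w \<in> vecs ?P" using vs by (auto simp: tuples_def)
          then have w: "fst w \<in> vecs E" "snd w \<in> vecs F" by auto
          have "D (z + h) vs - D z vs - D z (h # vs) = 0"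
            using h w by (auto simp: Cons D_def add add' algebra_simps split: list.split)
          then show ?thesis using nh \<epsilon> prod_vnorm_tuples[OF P vs] by (simp add: vnorm_0[OF G])
        qed
      qed
    qed
  qed
  moreover have "\<forall>z\<in>vecs E \<times> vecs F. D z [] = B (fst z) (snd z) \<and> (\<forall>v\<in>vecs ?P. D z [v] = B (fst v) (snd z) + B (fst z) (snd v))"
    by (simp add: D_def)
  ultimately show ?thesis unfolding smooth_deriv_def by blast
qed

lemma smooth_deriv_bilinear_compose:
  assumes E: "normed_nspace E" and F: "normed_nspace F" and G: "normed_nspace G" and H: "normed_nspace H"
    and B: "bounded_bilinear_on F G H B" and f: "smooth_deriv E F W f f'" and g: "smooth_deriv E G W g g'"
  shows "smooth_deriv E H W (\<lambda>x. B (f x) (g x)) (\<lambda>x v. B (f' x v) (g x) + B (f x) (g' x v))"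
  using smooth_deriv_compose[OF E normed_nspace_prod[OF F G] H smooth_deriv_Pair[OF E F G f g] smooth_deriv_bilinear[OF F G H B]]
    smooth_deriv_vecs(1)[OF f] smooth_deriv_vecs(1)[OF g] by auto

lemma smooth_deriv_linear_compose:
  assumes E: "normed_nspace E" and F: "normed_nspace F" and G: "normed_nspace G"
    and L: "bounded_linear_on F G L" and f: "smooth_deriv E F W f f'"
  shows "smooth_deriv E G W (\<lambda>x. L (f x)) (\<lambda>x v. L (f' x v))"
  using smooth_deriv_compose[OF E F G f smooth_deriv_linear[OF F G L order_refl]] smooth_deriv_vecs(1)[OF f] by auto

lemma bounded_linear_on_add:
  assumes F: "normed_nspace F"
  shows "bounded_linear_on (prod_nspace F F) F (\<lambda>z. fst z + snd z)"
  unfolding bounded_linear_on_def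
proof (intro conjI exI ballI)
  fix z assume z: "z \<in> vecs (prod_nspace F F)"
  show "vnorm F (fst z + snd z) \<le> 2 * vnorm (prod_nspace F F) z"
    using vnorm_add[OF F, of "fst z" "snd z"] vnorm_fst_le[of F z F] vnorm_snd_le[of F z F] z by auto
qed (auto simp: lin_on_def algebra_simps nspace_add[OF F])

lemma smooth_deriv_add:
  assumes E: "normed_nspace E" and F: "normed_nspace F"
    and f: "smooth_deriv E F W f f'" and g: "smooth_deriv E F W g g'"
  shows "smooth_deriv E F W (\<lambda>x. f x + g x) (\<lambda>x v. f' x v + g' x v)"
  using smooth_deriv_linear_compose[OF E normed_nspace_prod[OF F F] F bounded_linear_on_add[OF F] smooth_deriv_Pair[OF E F F f g]]
  by simp

text \<open>In applications \<open>x\<close> is a function, \<open>N k x\<close> is the composition of the \<open>k\<close>-th derivative of a fixed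
  function with \<open>x\<close>, and the \<open>k\<close>-th derivative of \<open>N 0\<close> multiplies the \<open>k\<close> directions with \<open>N k x\<close>.\<close>

lemma smooth_deriv_algebra:
  fixes E :: "'e::{real_algebra, comm_ring_1} nspace"
  assumes E: "normed_nspace E" and one: "1 \<in> vecs E"
    and times: "\<And>x y. x \<in> vecs E \<Longrightarrow> y \<in> vecs E \<Longrightarrow> x * y \<in> vecs E \<and> vnorm E (x * y) \<le> M * vnorm E x * vnorm E y"
    and N: "\<And>k x. x \<in> W \<Longrightarrow> N k x \<in> vecs E"
    and rem: "\<And>k x \<epsilon>. x \<in> W \<Longrightarrow> \<epsilon> > 0 \<Longrightarrow>
      eventually (\<lambda>h. vnorm E (N k (x + h) - N k x - N (Suc k) x * h) \<le> \<epsilon> * vnorm E h) (increments E W x)"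
  shows "smooth_deriv E E W (N 0) (\<lambda>x v. N 1 x * v)"
proof -
  \<comment> \<open>\<open>M\<close> may be negative; clipping at 0 allows inequalities to be
    multiplied by it.\<close>
  define M' where "M' = max M 0"
  have M: "0 \<le> M'" by (simp add: M'_def)
  have times': "vnorm E (x * y) \<le> M' * vnorm E x * vnorm E y" if "x \<in> vecs E" "y \<in> vecs E" for x y
  proof -
    have "M * vnorm E x * vnorm E y \<le> M' * vnorm E x * vnorm E y"
      using vnorm_nonneg[OF E] that by (auto intro!: mult_right_mono simp: M'_def)
    then show ?thesis using times[OF that] by linarith
  qed
  have prods: "prod_list vs \<in> vecs E" if "set vs \<subseteq> vecs E" for vs
    using that by (induction vs) (auto simp: one times)
  \<comment> \<open>Iterating the product estimate gives a constant that depends only on the number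
    of directions.\<close>
  have bound: "\<exists>K\<ge>0. \<forall>vs\<in>tuples E k. vnorm E (prod_list vs) \<le> K * prod_list (map (vnorm E) vs)" for k
  proof (induction k)
    case 0
    then show ?case using vnorm_nonneg[OF E one] by auto
  next
    case (Suc k)
    then obtain K where K: "K \<ge> 0" "\<And>vs. vs \<in> tuples E k \<Longrightarrow> vnorm E (prod_list vs) \<le> K * prod_list (map (vnorm E) vs)" by blast
    have "vnorm E (prod_list vs) \<le> (M' * K) * prod_list (map (vnorm E) vs)" if vs: "vs \<in> tuples E (Suc k)" for vs
    proof -
      obtain w ws where w: "vs = w # ws" "w \<in> vecs E" "ws \<in> tuples E k" using vs by (rule tuples_SucE)
      have "vnorm E (prod_list vs) \<le> M' * vnorm E w * vnorm E (prod_list ws)"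
        using times'[OF w(2) prods[of ws]] w by (auto simp: tuples_def)
      also have "\<dots> \<le> M' * vnorm E w * (K * prod_list (map (vnorm E) ws))"
        using K(2)[OF w(3)] M vnorm_nonneg[OF E w(2)] by (intro mult_left_mono) auto
      finally show ?thesis by (simp add: w(1) mult_ac)
    qed
    then show ?case using K(1) M by (intro exI[of _ "M' * K"]) auto
  qed
  have lin_prod: "lin_on (vecs E) (\<lambda>v. prod_list (vs[i := v]))" if "i < length vs" for vs :: "'e list" and i
    using that
  proof (induction vs arbitrary: i)
    case (Cons w ws)
    then show ?case by (cases i) (auto simp: lin_on_def algebra_simps)
  qed simp
  let ?D = "\<lambda>x vs. N (length vs) x * prod_list vs"
  have "derivatives E E W ?D"
    unfolding derivatives_def
  proof (intro conjI ballI allI impI)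
    fix x k assume x: "x \<in> W"
    obtain K where K: "K \<ge> 0" "\<And>vs. vs \<in> tuples E k \<Longrightarrow> vnorm E (prod_list vs) \<le> K * prod_list (map (vnorm E) vs)"
      using bound by blast
    have n: "0 \<le> vnorm E (N k x)" by (rule vnorm_nonneg[OF E N[OF x]])
    have "multilinear_bound E E k (M' * vnorm E (N k x) * K) (?D x)"
      unfolding multilinear_bound_def
    proof (intro conjI ballI allI impI)
      show "0 \<le> M' * vnorm E (N k x) * K" using M K n by simp
      fix vs assume vs: "vs \<in> tuples E k"
      have p: "prod_list vs \<in> vecs E" using prods vs by (auto simp: tuples_def)
      show "?D x vs \<in> vecs E" using times N[OF x] p by blast
      have "vnorm E (?D x vs) \<le> M' * vnorm E (N k x) * vnorm E (prod_list vs)"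
        using times'[OF N[OF x] p] tuples_length[OF vs] by simp
      also have "\<dots> \<le> M' * vnorm E (N k x) * (K * prod_list (map (vnorm E) vs))"
        using K(2)[OF vs] M n by (intro mult_left_mono) auto
      finally show "vnorm E (?D x vs) \<le> M' * vnorm E (N k x) * K * prod_list (map (vnorm E) vs)"
        by (simp add: mult.assoc)
      fix i assume "i < k"
      then have "lin_on (vecs E) (\<lambda>v. prod_list (vs[i := v]))" using lin_prod tuples_length[OF vs] by simp
      then show "lin_on (vecs E) (\<lambda>v. ?D x (vs[i := v]))"
        by (simp add: lin_on_def algebra_simps)
    qed
    then show "\<exists>C. multilinear_bound E E k C (?D x)" ..
  next
    fix x k and \<epsilon> :: real assume x: "x \<in> W" and \<epsilon>: "\<epsilon> > 0"
    obtain K where K: "K \<ge> 0" "\<And>vs. vs \<in> tuples E k \<Longrightarrow> vnorm E (prod_list vs) \<le> K * prod_list (map (vnorm E) vs)"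
      using bound by blast
    define e where "e = \<epsilon> / (M' * K + 1)"
    have "0 \<le> M' * K" using M K by simp
    then have e: "e > 0" "M' * K * e \<le> \<epsilon>" using \<epsilon> by (auto simp: e_def field_simps)
    show "eventually (\<lambda>h. \<forall>vs\<in>tuples E k. vnorm E (?D (x + h) vs - ?D x vs - ?D x (h # vs))
          \<le> \<epsilon> * vnorm E h * prod_list (map (vnorm E) vs)) (increments E W x)"
      using rem[OF x e(1), of k] eventually_increments_vecs[of E x W]
    proof eventually_elim
      case (elim h)
      show ?case
      proof
        fix vs assume vs: "vs \<in> tuples E k"
        have p: "prod_list vs \<in> vecs E" using prods vs by (auto simp: tuples_def)
        have nh: "0 \<le> vnorm E h" using vnorm_nonneg[OF E] elim by blast
        let ?R = "N k (x + h) - N k x - N (Suc k) x * h"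
        have R: "?R \<in> vecs E" using N x elim times by (auto intro!: nspace_diff[OF E])
        have "?D (x + h) vs - ?D x vs - ?D x (h # vs) = ?R * prod_list vs"
          using tuples_length[OF vs] by (simp add: algebra_simps)
        then have "vnorm E (?D (x + h) vs - ?D x vs - ?D x (h # vs)) \<le> M' * vnorm E ?R * vnorm E (prod_list vs)"
          using times'[OF R p] by simp
        also have "\<dots> \<le> M' * (e * vnorm E h) * (K * prod_list (map (vnorm E) vs))"
          using elim(1) K(2)[OF vs] M vnorm_nonneg[OF E R] vnorm_nonneg[OF E p] e(1) nh
          by (intro mult_mono mult_left_mono) auto
        also have "\<dots> = (M' * K * e) * (vnorm E h * prod_list (map (vnorm E) vs))" by (simp add: mult_ac)
        also have "\<dots> \<le> \<epsilon> * (vnorm E h * prod_list (map (vnorm E) vs))"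
          using e(2) nh prod_vnorm_tuples[OF E vs] by (intro mult_right_mono) auto
        finally show "vnorm E (?D (x + h) vs - ?D x vs - ?D x (h # vs)) \<le> \<epsilon> * vnorm E h * prod_list (map (vnorm E) vs)"
          by (simp add: mult.assoc)
      qed
    qed
  qed
  moreover have "\<forall>x\<in>W. ?D x [] = N 0 x \<and> (\<forall>v\<in>vecs E. ?D x [v] = N 1 x * v)" by simp
  ultimately show ?thesis unfolding smooth_deriv_def by (intro exI[of _ ?D] conjI)
qed

text \<open>The reals are an algebra over themselves with constant 1, and the multiplication
  operators of \<open>smooth_deriv_algebra\<close> are then the ordinary derivatives.\<close>

lemma smooth_deriv_real:
  fixes N :: "nat \<Rightarrow> real \<Rightarrow> real"
  assumes "\<And>k x. x \<in> W \<Longrightarrow> (N k has_real_derivative N (Suc k) x) (at x)"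
  shows "smooth_deriv real_nspace real_nspace W (N 0) (\<lambda>x v. N 1 x * v)"
proof (rule smooth_deriv_algebra[where M = 1, OF normed_nspace_real])
  fix k x and \<epsilon> :: real assume x: "x \<in> W" and \<epsilon>: "\<epsilon> > 0"
  obtain d where d: "d > 0" "\<And>y. norm (y - x) < d \<Longrightarrow> norm (N k y - N k x - N (Suc k) x * (y - x)) \<le> \<epsilon> * norm (y - x)"
    using assms[OF x, of k] \<epsilon> unfolding has_field_derivative_def has_derivative_at_alt by (metis mult.commute)
  show "eventually (\<lambda>h. vnorm real_nspace (N k (x + h) - N k x - N (Suc k) x * h) \<le> \<epsilon> * vnorm real_nspace h) (increments real_nspace W x)"
    unfolding eventually_increments[OF normed_nspace_real] using d(1) d(2)[of "x + _"]
    by (auto simp: real_nspace_def intro!: exI[of _ d])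
qed (auto simp: real_nspace_def abs_mult)

section \<open>Manifolds embedded into a normed space\<close>

text \<open>Every chart \<open>ch i\<close> is the restriction of a smooth map \<open>co i\<close> on an open subset \<open>nb i\<close> of the
  ambient space \<open>X\<close>, and its inverse is the parametrisation \<open>par i\<close>; \<open>emb\<close> is the embedding, with
  image \<open>S\<close>, and \<open>demb\<close> its differential. Two manifolds with the same image \<open>S\<close> are therefore
  diffeomorphic, and structures that are restricted from \<open>X\<close> correspond to each other.\<close>

locale embedded_manifold =
  fixes X :: "'x::real_vector nspace" and S :: "'x set"
    and M :: "('p, 'v::real_vector, 'e::real_vector) manifold"
    and I :: "'i set" and ch :: "'i \<Rightarrow> ('p, 'v, 'e) chart"
    and emb :: "'p \<Rightarrow> 'x" and demb :: "'p \<Rightarrow> 'v \<Rightarrow> 'x"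
    and par :: "'i \<Rightarrow> 'e \<Rightarrow> 'x" and dpar :: "'i \<Rightarrow> 'e \<Rightarrow> 'e \<Rightarrow> 'x" and d2par :: "'i \<Rightarrow> 'e \<Rightarrow> 'e \<Rightarrow> 'e \<Rightarrow> 'x"
    and nb :: "'i \<Rightarrow> 'x set" and co :: "'i \<Rightarrow> 'x \<Rightarrow> 'e" and dco :: "'i \<Rightarrow> 'x \<Rightarrow> 'x \<Rightarrow> 'e"
  assumes X: "normed_nspace X"
    and bij_emb: "bij_betw emb (points M) S"
    and atlas: "atlas M = ch ` I"
    and cover: "points M = (\<Union>i\<in>I. cdom (ch i))"
    and tangent_subspace: "p \<in> points M \<Longrightarrow> subspace (tangent M p)"
    and model: "i \<in> I \<Longrightarrow> banach_nspace (cmodel (ch i))"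
    and dom_open: "i \<in> I \<Longrightarrow> open_in (cmodel (ch i)) (cmap (ch i) ` cdom (ch i))"
    and nb_open: "i \<in> I \<Longrightarrow> open_in X (nb i)"
    and cdom_iff: "i \<in> I \<Longrightarrow> p \<in> cdom (ch i) \<longleftrightarrow> p \<in> points M \<and> emb p \<in> nb i"
    and cmap_eq: "i \<in> I \<Longrightarrow> p \<in> cdom (ch i) \<Longrightarrow> cmap (ch i) p = co i (emb p)"
    and par_cmap: "i \<in> I \<Longrightarrow> p \<in> cdom (ch i) \<Longrightarrow> par i (cmap (ch i) p) = emb p"
    and par_smooth: "i \<in> I \<Longrightarrow> smooth_deriv (cmodel (ch i)) X (cmap (ch i) ` cdom (ch i)) (par i) (dpar i)"
    and dpar_smooth: "i \<in> I \<Longrightarrow> smooth_deriv (prod_nspace (cmodel (ch i)) (cmodel (ch i))) X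
        (cmap (ch i) ` cdom (ch i) \<times> vecs (cmodel (ch i))) (\<lambda>z. dpar i (fst z) (snd z))
        (\<lambda>z v. d2par i (fst z) (fst v) (snd z) + dpar i (fst z) (snd v))"
    and d2par_sym: "i \<in> I \<Longrightarrow> x \<in> cmap (ch i) ` cdom (ch i) \<Longrightarrow> a \<in> vecs (cmodel (ch i)) \<Longrightarrow> b \<in> vecs (cmodel (ch i))
        \<Longrightarrow> d2par i x a b = d2par i x b a"
    and co_smooth: "i \<in> I \<Longrightarrow> smooth_deriv X (cmodel (ch i)) (nb i) (co i) (dco i)"
    and cdiff_lin: "i \<in> I \<Longrightarrow> p \<in> cdom (ch i) \<Longrightarrow> lin_on (tangent M p) (cdiff (ch i) p)"
    and cdiff_bij: "i \<in> I \<Longrightarrow> p \<in> cdom (ch i) \<Longrightarrow> bij_betw (cdiff (ch i) p) (tangent M p) (vecs (cmodel (ch i)))"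
    and demb_eq: "i \<in> I \<Longrightarrow> p \<in> cdom (ch i) \<Longrightarrow> v \<in> tangent M p \<Longrightarrow> demb p v = dpar i (cmap (ch i) p) (cdiff (ch i) p v)"
begin

section \<open>Charts, parametrisations and differentials of an embedded manifold\<close>

abbreviation "W i \<equiv> cmap (ch i) ` cdom (ch i)"
abbreviation "mo i \<equiv> cmodel (ch i)"

lemma nmodel: "i \<in> I \<Longrightarrow> normed_nspace (mo i)"
  using model by (rule banach_nspace_normed)

lemma W_vecs: "i \<in> I \<Longrightarrow> x \<in> W i \<Longrightarrow> x \<in> vecs (mo i)"
  using open_inD(1)[OF dom_open] .

lemma par_mem: "i \<in> I \<Longrightarrow> x \<in> W i \<Longrightarrow> par i x \<in> S \<inter> nb i"
  using par_cmap cdom_iff bij_betwE[OF bij_emb] by fastforce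

lemma co_par: "i \<in> I \<Longrightarrow> x \<in> W i \<Longrightarrow> co i (par i x) = x"
  using par_cmap cmap_eq by fastforce

text \<open>Off \<open>S\<close> the map \<open>co i\<close> is merely a smooth extension of the
  chart. On \<open>S\<close> it is the chart itself, since \<open>emb\<close> is a bijection onto
  \<open>S\<close> and \<open>cdom_iff\<close> recognises the chart domain by
  \<open>nb i\<close>.\<close>

lemma par_co: "i \<in> I \<Longrightarrow> s \<in> S \<inter> nb i \<Longrightarrow> par i (co i s) = s \<and> co i s \<in> W i"
proof -
  assume i: "i \<in> I" and s: "s \<in> S \<inter> nb i"
  then obtain p where p: "p \<in> points M" "emb p = s" using bij_emb by (auto simp: bij_betw_def)
  then have "p \<in> cdom (ch i)" using cdom_iff[OF i] s by simp
  then show ?thesis using par_cmap[OF i] cmap_eq[OF i] p by (metis image_eqI)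
qed

lemma inj_cmap: "i \<in> I \<Longrightarrow> inj_on (cmap (ch i)) (cdom (ch i))"
  using bij_emb by (intro inj_onI) (metis bij_betw_def cdom_iff inj_onD par_cmap)

lemma cinv_cmap: "i \<in> I \<Longrightarrow> p \<in> cdom (ch i) \<Longrightarrow> cinv (ch i) (cmap (ch i) p) = p"
  unfolding cinv_def using inv_into_f_f[OF inj_cmap] .

lemma cinv:
  assumes "i \<in> I" "x \<in> W i"
  shows "cinv (ch i) x \<in> cdom (ch i)" "cmap (ch i) (cinv (ch i) x) = x" "emb (cinv (ch i) x) = par i x"
    "cinv (ch i) x \<in> points M"
  using assms cinv_cmap[OF assms(1)] par_cmap[OF assms(1)] cdom_iff[OF assms(1)] by auto

lemma chart_at:
  assumes "p \<in> points M"
  obtains i where "i \<in> I" "chart_at M p = ch i" "p \<in> cdom (ch i)"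
proof -
  have "\<exists>c. c \<in> atlas M \<and> p \<in> cdom c" using assms cover atlas by auto
  then have "chart_at M p \<in> atlas M \<and> p \<in> cdom (chart_at M p)" unfolding chart_at_def by (rule someI_ex)
  then show ?thesis using atlas that by auto
qed

lemma dpar_lin: "i \<in> I \<Longrightarrow> x \<in> W i \<Longrightarrow> lin_on (vecs (mo i)) (dpar i x)"
  by (rule smooth_deriv_bounded[OF par_smooth _ nmodel])

lemma dpar_vecs: "i \<in> I \<Longrightarrow> x \<in> W i \<Longrightarrow> a \<in> vecs (mo i) \<Longrightarrow> dpar i x a \<in> vecs X"
  by (rule smooth_deriv_vecs(2)[OF par_smooth])

lemma identity_smooth: "i \<in> I \<Longrightarrow> smooth_deriv (mo i) (mo i) (W i) (\<lambda>x. x) (\<lambda>x a. a)"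
proof (rule smooth_deriv_linear)
  show "bounded_linear_on (mo i) (mo i) (\<lambda>x. x)"
    by (auto simp: bounded_linear_on_def intro: exI[of _ 1])
qed (auto simp: nmodel W_vecs)

text \<open>Obtained by differentiating \<open>co i (par i x) = x\<close>. The differential of the
  parametrisation thus has a left inverse, which makes \<open>demb\<close> injective on tangent
  spaces.\<close>

lemma dco_dpar:
  assumes i: "i \<in> I" and x: "x \<in> W i" and a: "a \<in> vecs (mo i)"
  shows "dco i (par i x) (dpar i x a) = a"
proof -
  note n = nmodel[OF i]
  have 1: "smooth_deriv (mo i) (mo i) (W i) (\<lambda>x. co i (par i x)) (\<lambda>x a. dco i (par i x) (dpar i x a))"
    by (rule smooth_deriv_compose[OF n X n par_smooth[OF i] co_smooth[OF i]]) (use par_mem[OF i] in auto)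
  show ?thesis
    by (rule smooth_deriv_unique[OF 1 identity_smooth[OF i] dom_open[OF i] dom_open[OF i] n n])
       (use co_par[OF i] x a in auto)
qed

lemma cdiff_mem: "i \<in> I \<Longrightarrow> p \<in> cdom (ch i) \<Longrightarrow> v \<in> tangent M p \<Longrightarrow> cdiff (ch i) p v \<in> vecs (mo i)"
  using bij_betwE[OF cdiff_bij] by blast

lemma demb_vecs: "p \<in> points M \<Longrightarrow> v \<in> tangent M p \<Longrightarrow> demb p v \<in> vecs X"
proof -
  assume "p \<in> points M" and v: "v \<in> tangent M p"
  then obtain i where i: "i \<in> I" "p \<in> cdom (ch i)" using cover by auto
  then show ?thesis using demb_eq[OF i v] dpar_vecs[OF i(1) _ cdiff_mem[OF i v]] by simp
qed

lemma emb_vecs: "p \<in> points M \<Longrightarrow> emb p \<in> vecs X"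
proof -
  assume "p \<in> points M"
  then obtain i where i: "i \<in> I" "p \<in> cdom (ch i)" using cover by auto
  then show ?thesis using par_cmap[OF i] smooth_deriv_vecs(1)[OF par_smooth[OF i(1)]] by (metis imageI)
qed

lemma demb_lin: "p \<in> points M \<Longrightarrow> lin_on (tangent M p) (demb p)"
proof -
  assume p: "p \<in> points M"
  then obtain i where i: "i \<in> I" "p \<in> cdom (ch i)" using cover by auto
  have "lin_on (tangent M p) (\<lambda>v. dpar i (cmap (ch i) p) (cdiff (ch i) p v))"
    by (rule lin_on_compose[OF cdiff_lin[OF i] _ dpar_lin[OF i(1)]]) (use cdiff_mem[OF i] i in auto)
  then show ?thesis
    using demb_eq[OF i] subspace_add[OF tangent_subspace[OF p]] subspace_scale[OF tangent_subspace[OF p]]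
    unfolding lin_on_def by simp
qed

lemma demb_eq_0: "p \<in> points M \<Longrightarrow> v \<in> tangent M p \<Longrightarrow> demb p v = 0 \<Longrightarrow> v = 0"
proof -
  assume p: "p \<in> points M" and v: "v \<in> tangent M p" "demb p v = 0"
  then obtain i where i: "i \<in> I" "p \<in> cdom (ch i)" using cover by auto
  let ?x = "cmap (ch i) p"
  have x: "?x \<in> W i" using i by blast
  have s: "subspace (vecs (mo i))" by (rule nspace_subspace[OF nmodel[OF i(1)]])
  have "dpar i ?x (cdiff (ch i) p v) = dpar i ?x 0"
    using demb_eq[OF i v(1)] v(2) lin_on_0[OF dpar_lin[OF i(1) x] s] by simp
  then have "cdiff (ch i) p v = 0"
    using dco_dpar[OF i(1) x cdiff_mem[OF i v(1)]] dco_dpar[OF i(1) x subspace_0[OF s]] by simp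
  also have "0 = cdiff (ch i) p 0"
    using lin_on_0[OF cdiff_lin[OF i] tangent_subspace[OF p]] by simp
  finally show ?thesis
    using cdiff_bij[OF i] v(1) subspace_0[OF tangent_subspace[OF p]] by (auto simp: bij_betw_def dest: inj_onD)
qed

lemma open_chart_preimage:
  assumes i: "i \<in> I" and V: "open_in X V"
  shows "open_in (mo i) (cmap (ch i) ` {p \<in> cdom (ch i). emb p \<in> V})"
proof -
  have "cmap (ch i) ` {p \<in> cdom (ch i). emb p \<in> V} = {x \<in> W i. par i x \<in> V}"
    using par_cmap[OF i] by auto
  then show ?thesis using smooth_deriv_open_preimage[OF par_smooth[OF i] nmodel[OF i] X dom_open[OF i] V] by simp
qed

lemma cvec:
  assumes i: "i \<in> I" and x: "x \<in> W i" and a: "a \<in> vecs (mo i)"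
  shows "cvec M (ch i) x a \<in> tangent M (cinv (ch i) x)" "demb (cinv (ch i) x) (cvec M (ch i) x a) = dpar i x a"
proof -
  have im: "a \<in> cdiff (ch i) (cinv (ch i) x) ` tangent M (cinv (ch i) x)"
    using cdiff_bij[OF i cinv(1)[OF i x]] a by (simp add: bij_betw_def)
  show t: "cvec M (ch i) x a \<in> tangent M (cinv (ch i) x)"
    unfolding cvec_def by (rule inv_into_into[OF im])
  have "cdiff (ch i) (cinv (ch i) x) (cvec M (ch i) x a) = a"
    unfolding cvec_def by (rule f_inv_into_f[OF im])
  then show "demb (cinv (ch i) x) (cvec M (ch i) x a) = dpar i x a"
    using demb_eq[OF i cinv(1)[OF i x] t] cinv(2)[OF i x] by simp
qed

text \<open>Vector fields constant in the chart are what \<open>closed_two_form\<close> and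
  \<open>ext_deriv\<close> differentiate. The summand \<open>dpar i y 0\<close> of the joint
  derivative vanishes by linearity.\<close>

lemma dpar_const_smooth:
  assumes i: "i \<in> I" and a: "a \<in> vecs (mo i)"
  shows "smooth_deriv (mo i) X (W i) (\<lambda>y. dpar i y a) (\<lambda>y v. d2par i y v a)"
proof -
  note n = nmodel[OF i]
  have "smooth_deriv (mo i) (prod_nspace (mo i) (mo i)) (W i) (\<lambda>y. (y, a)) (\<lambda>y v. (v, 0))"
    by (rule smooth_deriv_Pair[OF n n n identity_smooth[OF i] smooth_deriv_const[OF n n a]])
  then have "smooth_deriv (mo i) X (W i) (\<lambda>y. dpar i (fst (y, a)) (snd (y, a)))
      (\<lambda>y v. d2par i (fst (y, a)) (fst (v, 0::'e)) (snd (y, a)) + dpar i (fst (y, a)) (snd (v, 0::'e)))"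
    by (rule smooth_deriv_compose[OF n normed_nspace_prod[OF n n] X _ dpar_smooth[OF i]]) (use a in auto)
  then show ?thesis
    by (rule smooth_deriv_cong) (use lin_on_0[OF dpar_lin[OF i] nspace_subspace[OF n]] in auto)
qed

lemma d2par_vecs: "i \<in> I \<Longrightarrow> x \<in> W i \<Longrightarrow> v \<in> vecs (mo i) \<Longrightarrow> a \<in> vecs (mo i) \<Longrightarrow> d2par i x v a \<in> vecs X"
  by (rule smooth_deriv_vecs(2)[OF dpar_const_smooth])

subsection \<open>Bilinear forms restricted from the ambient space\<close>

context
  fixes B :: "'x \<Rightarrow> 'x \<Rightarrow> real" and b :: "('p, 'v) bilinear_field"
  assumes B: "bounded_bilinear_on X X real_nspace B"
    and b: "\<And>p v w. p \<in> points M \<Longrightarrow> v \<in> tangent M p \<Longrightarrow> w \<in> tangent M p \<Longrightarrow> b p v w = B (demb p v) (demb p w)"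
begin

lemma local_bilinear_eq:
  assumes "i \<in> I" "x \<in> W i" "a1 \<in> vecs (mo i)" "a2 \<in> vecs (mo i)"
  shows "local_bilinear M (ch i) b x a1 a2 = B (dpar i x a1) (dpar i x a2)"
  unfolding local_bilinear_def using b[OF cinv(4)] cvec assms by simp

text \<open>In a chart the field is \<open>B\<close> at two values of \<open>dpar\<close>, each
  smooth jointly in the base point and the vector; \<open>L1\<close> and \<open>L2\<close> pick the
  base point together with the first or the second vector.\<close>

lemma restricted_smooth_bilinear_field: "smooth_bilinear_field M b"
  unfolding smooth_bilinear_field_def
proof (intro conjI ballI)
  fix p v assume p: "p \<in> points M" and v: "v \<in> tangent M p"
  have B': "lin_on (vecs X) (B (demb p v))" "lin_on (vecs X) (\<lambda>w. B w (demb p v))"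
    using B demb_vecs[OF p v] by (auto simp: bounded_bilinear_on_def)
  have sub: "demb p ` tangent M p \<subseteq> vecs X" using demb_vecs[OF p] by blast
  note 1 = lin_on_compose[OF demb_lin[OF p] sub B'(1)] lin_on_compose[OF demb_lin[OF p] sub B'(2)]
  note s = tangent_subspace[OF p]
  show "lin_on (tangent M p) (\<lambda>w. b p v w)" "lin_on (tangent M p) (\<lambda>w. b p w v)"
    using 1 b[OF p] v subspace_add[OF s] subspace_scale[OF s] unfolding lin_on_def by simp_all
next
  fix c assume "c \<in> atlas M"
  then obtain i where i: "i \<in> I" "c = ch i" using atlas by auto
  note n = nmodel[OF i(1)]
  note n2 = normed_nspace_prod[OF n n]
  let ?P = "prod_nspace (mo i) (prod_nspace (mo i) (mo i))" and ?V = "W i \<times> vecs (mo i) \<times> vecs (mo i)"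
  have nP: "normed_nspace ?P" by (rule normed_nspace_prod[OF n n2])
  have V: "?V \<subseteq> vecs ?P" using W_vecs[OF i(1)] by auto
  have le: "vnorm (prod_nspace (mo i) (mo i)) (fst z, fst (snd z)) \<le> 1 * vnorm ?P z"
    "vnorm (prod_nspace (mo i) (mo i)) (fst z, snd (snd z)) \<le> 1 * vnorm ?P z" for z
    unfolding vnorm_prod by (auto intro!: real_sqrt_le_mono)
  have L1: "bounded_linear_on ?P (prod_nspace (mo i) (mo i)) (\<lambda>z. (fst z, fst (snd z)))"
    unfolding bounded_linear_on_def
    by (intro conjI exI[of _ 1] ballI le(1)) (auto simp: lin_on_def)
  have L2: "bounded_linear_on ?P (prod_nspace (mo i) (mo i)) (\<lambda>z. (fst z, snd (snd z)))"
    unfolding bounded_linear_on_def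
    by (intro conjI exI[of _ 1] ballI le(2)) (auto simp: lin_on_def)
  have D1: "smooth_deriv ?P X ?V (\<lambda>z. dpar i (fst (fst z, fst (snd z))) (snd (fst z, fst (snd z))))
     (\<lambda>z v. d2par i (fst (fst z, fst (snd z))) (fst (fst v, fst (snd v))) (snd (fst z, fst (snd z)))
       + dpar i (fst (fst z, fst (snd z))) (snd (fst v, fst (snd v))))"
    by (rule smooth_deriv_compose[OF nP n2 X smooth_deriv_linear[OF nP n2 L1 V] dpar_smooth[OF i(1)]]) auto
  have D2: "smooth_deriv ?P X ?V (\<lambda>z. dpar i (fst (fst z, snd (snd z))) (snd (fst z, snd (snd z))))
     (\<lambda>z v. d2par i (fst (fst z, snd (snd z))) (fst (fst v, snd (snd v))) (snd (fst z, snd (snd z)))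
       + dpar i (fst (fst z, snd (snd z))) (snd (fst v, snd (snd v))))"
    by (rule smooth_deriv_compose[OF nP n2 X smooth_deriv_linear[OF nP n2 L2 V] dpar_smooth[OF i(1)]]) auto
  note D = smooth_deriv_imp_smooth_on[OF nP smooth_deriv_cong[OF
    smooth_deriv_bilinear_compose[OF nP X X normed_nspace_real B D1 D2] _ refl]]
  have "smooth_on ?P real_nspace ?V (\<lambda>(x, a1, a2). local_bilinear M (ch i) b x a1 a2)"
    by (rule D) (auto simp: local_bilinear_eq[OF i(1)])
  then show "smooth_on (prod_nspace (cmodel c) (prod_nspace (cmodel c) (cmodel c))) real_nspace
          (cmap c ` cdom c \<times> vecs (cmodel c) \<times> vecs (cmodel c))
          (\<lambda>(x, a1, a2). local_bilinear M c b x a1 a2)"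
    using i(2) by simp
qed

text \<open>Definiteness is inherited because \<open>demb p\<close> is injective on the tangent
  space.\<close>

lemma restricted_riemannian_metric:
  assumes "\<And>x y. x \<in> vecs X \<Longrightarrow> y \<in> vecs X \<Longrightarrow> B x y = B y x" "\<And>x. x \<in> vecs X \<Longrightarrow> x \<noteq> 0 \<Longrightarrow> 0 < B x x"
  shows "riemannian_metric M b"
  unfolding riemannian_metric_def
proof (intro conjI ballI impI restricted_smooth_bilinear_field)
  fix p v assume p: "p \<in> points M" and v: "v \<in> tangent M p"
  show "b p v w = b p w v" if "w \<in> tangent M p" for w
    using assms(1)[OF demb_vecs[OF p v] demb_vecs[OF p that]] b[OF p] v that by simp
  show "0 < b p v v" if "v \<noteq> 0"
    using assms(2)[OF demb_vecs[OF p v]] demb_eq_0[OF p v] that b[OF p v v] by auto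
qed

text \<open>As \<open>B\<close> is constant, only the two \<open>dpar\<close> factors are
  differentiated. The cyclic sum has six terms in \<open>d2par\<close>, which cancel in pairs by the
  symmetry of \<open>d2par\<close> and the skewness of \<open>B\<close>.\<close>

lemma restricted_closed_two_form:
  assumes skew: "\<And>x y. x \<in> vecs X \<Longrightarrow> y \<in> vecs X \<Longrightarrow> B x y = - B y x"
  shows "closed_two_form M b"
  unfolding closed_two_form_def
proof (intro conjI ballI restricted_smooth_bilinear_field)
  fix p v assume p: "p \<in> points M" and v: "v \<in> tangent M p"
  show "b p v v = 0" using b[OF p v v] skew[OF demb_vecs[OF p v] demb_vecs[OF p v]] by simp
next
  fix c x a1 a2 a3
  assume "c \<in> atlas M" and x': "x \<in> cmap c ` cdom c"
    and a': "a1 \<in> vecs (cmodel c)" "a2 \<in> vecs (cmodel c)" "a3 \<in> vecs (cmodel c)"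
  then obtain i where i: "i \<in> I" "c = ch i" using atlas by auto
  have x: "x \<in> W i" and a: "a1 \<in> vecs (mo i)" "a2 \<in> vecs (mo i)" "a3 \<in> vecs (mo i)" using x' a' i by auto
  note n = nmodel[OF i(1)]
  have d: "dderiv real_nspace (\<lambda>y. local_bilinear M (ch i) b y u w) x v
     = B (d2par i x v u) (dpar i x w) + B (dpar i x u) (d2par i x v w)"
    if u: "u \<in> vecs (mo i)" and w: "w \<in> vecs (mo i)" and v: "v \<in> vecs (mo i)" for u v w
  proof (rule dderiv_eq[OF _ dom_open[OF i(1)] n normed_nspace_real x v])
    show "smooth_deriv (mo i) real_nspace (W i) (\<lambda>y. local_bilinear M (ch i) b y u w)
      (\<lambda>x v. B (d2par i x v u) (dpar i x w) + B (dpar i x u) (d2par i x v w))"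
      by (rule smooth_deriv_cong[OF smooth_deriv_bilinear_compose[OF n X X normed_nspace_real B
            dpar_const_smooth[OF i(1) u] dpar_const_smooth[OF i(1) w]]])
         (auto simp: local_bilinear_eq[OF i(1) _ u w])
  qed
  show "dderiv real_nspace (\<lambda>y. local_bilinear M c b y a2 a3) x a1
        + dderiv real_nspace (\<lambda>y. local_bilinear M c b y a3 a1) x a2
        + dderiv real_nspace (\<lambda>y. local_bilinear M c b y a1 a2) x a3 = 0"
    unfolding i(2) d[OF a(2,3,1)] d[OF a(3,1,2)] d[OF a(1,2,3)]
    using d2par_sym[OF i(1) x a(1,2)] d2par_sym[OF i(1) x a(1,3)] d2par_sym[OF i(1) x a(2,3)]
      skew[OF d2par_vecs[OF i(1) x a(1,2)] dpar_vecs[OF i(1) x a(3)]]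
      skew[OF d2par_vecs[OF i(1) x a(2,3)] dpar_vecs[OF i(1) x a(1)]]
      skew[OF d2par_vecs[OF i(1) x a(1,3)] dpar_vecs[OF i(1) x a(2)]]
    by simp
qed

end

text \<open>Differentiating \<open>A (par i x) (dpar i x u)\<close> gives a term with
  \<open>d2par\<close>, symmetric in the two directions, which the antisymmetrisation removes. What
  remains is twice the skew part of \<open>A\<close>.\<close>

lemma ext_deriv_restricted:
  fixes A :: "'x \<Rightarrow> 'x \<Rightarrow> real" and \<alpha> :: "'p \<Rightarrow> 'v \<Rightarrow> real"
  assumes A: "bounded_bilinear_on X X real_nspace A"
    and \<alpha>: "\<And>p v. p \<in> points M \<Longrightarrow> v \<in> tangent M p \<Longrightarrow> \<alpha> p v = A (emb p) (demb p v)"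
    and p: "p \<in> points M" and v: "v \<in> tangent M p" and w: "w \<in> tangent M p"
  shows "ext_deriv M \<alpha> p v w = A (demb p v) (demb p w) - A (demb p w) (demb p v)"
proof -
  obtain i where i: "i \<in> I" "chart_at M p = ch i" "p \<in> cdom (ch i)" using chart_at[OF p] .
  note n = nmodel[OF i(1)]
  let ?x = "cmap (ch i) p"
  have x: "?x \<in> W i" using i by blast
  have d: "dderiv real_nspace (\<lambda>y. \<alpha> (cinv (ch i) y) (cvec M (ch i) y u)) ?x z
     = A (dpar i ?x z) (dpar i ?x u) + A (par i ?x) (d2par i ?x z u)"
    if u: "u \<in> vecs (mo i)" and z: "z \<in> vecs (mo i)" for u z
  proof (rule dderiv_eq[OF _ dom_open[OF i(1)] n normed_nspace_real x z])
    show "smooth_deriv (mo i) real_nspace (W i) (\<lambda>y. \<alpha> (cinv (ch i) y) (cvec M (ch i) y u))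
       (\<lambda>x z. A (dpar i x z) (dpar i x u) + A (par i x) (d2par i x z u))"
      by (rule smooth_deriv_cong[OF smooth_deriv_bilinear_compose[OF n X X normed_nspace_real A
            par_smooth[OF i(1)] dpar_const_smooth[OF i(1) u]]])
         (auto simp: \<alpha>[OF cinv(4)[OF i(1)] cvec(1)[OF i(1) _ u]] cvec(2)[OF i(1) _ u] cinv(3)[OF i(1)])
  qed
  have a: "cdiff (ch i) p v \<in> vecs (mo i)" "cdiff (ch i) p w \<in> vecs (mo i)" using cdiff_mem[OF i(1,3)] v w by auto
  show ?thesis
    unfolding ext_deriv_def i(2) Let_def d[OF a] d[OF a(2,1)] demb_eq[OF i(1,3) v] demb_eq[OF i(1,3) w]
    using d2par_sym[OF i(1) x a] by simp
qed

end

subsection \<open>Two manifolds with the same image\<close>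

text \<open>Charts of the first manifold are compared with charts of the second through
  \<open>X\<close>. Taking one manifold twice yields its own transition maps, and exchanging the two
  yields the inverse of a diffeomorphism.\<close>

locale embedded_pair =
  M1: embedded_manifold X S M1 I1 ch1 emb1 demb1 par1 dpar1 d2par1 nb1 co1 dco1 +
  M2: embedded_manifold X S M2 I2 ch2 emb2 demb2 par2 dpar2 d2par2 nb2 co2 dco2
  for X :: "'x::real_vector nspace" and S
    and M1 :: "('p, 'v::real_vector, 'e::real_vector) manifold" and I1 :: "'i set" and ch1 emb1 demb1 par1 dpar1 d2par1 nb1 co1 dco1
    and M2 :: "('q, 'w::real_vector, 'f::real_vector) manifold" and I2 :: "'k set" and ch2 emb2 demb2 par2 dpar2 d2par2 nb2 co2 dco2
begin

abbreviation "overlap i k \<equiv> {x \<in> M1.W i. par1 i x \<in> nb2 k}"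

context
  fixes i k
  assumes i: "i \<in> I1" and k: "k \<in> I2"
begin

lemma overlap_open: "open_in (M1.mo i) (overlap i k)"
  by (rule smooth_deriv_open_preimage[OF M1.par_smooth[OF i] M1.nmodel[OF i] M1.X M1.dom_open[OF i] M2.nb_open[OF k]])

lemma overlap_par_smooth: "smooth_deriv (M1.mo i) X (overlap i k) (par1 i) (dpar1 i)"
  by (rule smooth_deriv_subset[OF M1.par_smooth[OF i]]) auto

lemma overlap_smooth:
  "smooth_deriv (M1.mo i) (M2.mo k) (overlap i k) (\<lambda>x. co2 k (par1 i x)) (\<lambda>x a. dco2 k (par1 i x) (dpar1 i x a))"
  by (rule smooth_deriv_compose[OF M1.nmodel[OF i] M1.X M2.nmodel[OF k] overlap_par_smooth M2.co_smooth[OF k]]) auto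

lemma overlap_co: "x \<in> overlap i k \<Longrightarrow> co2 k (par1 i x) \<in> M2.W k \<and> par2 k (co2 k (par1 i x)) = par1 i x"
  using M2.par_co[OF k] M1.par_mem[OF i] by auto

text \<open>In general \<open>dco2\<close> is only a left inverse of \<open>dpar2\<close>. On
  vectors tangent to \<open>S\<close> it is also a right inverse, as differentiating
  \<open>par2 k (co2 k (par1 i x)) = par1 i x\<close> shows.\<close>

lemma overlap_dpar:
  assumes x: "x \<in> overlap i k" and a: "a \<in> vecs (M1.mo i)"
  shows "dpar2 k (co2 k (par1 i x)) (dco2 k (par1 i x) (dpar1 i x a)) = dpar1 i x a"
proof -
  have 1: "smooth_deriv (M1.mo i) X (overlap i k) (\<lambda>x. par2 k (co2 k (par1 i x)))
      (\<lambda>x a. dpar2 k (co2 k (par1 i x)) (dco2 k (par1 i x) (dpar1 i x a)))"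
    by (rule smooth_deriv_compose[OF M1.nmodel[OF i] M2.nmodel[OF k] M1.X overlap_smooth M2.par_smooth[OF k]])
       (use overlap_co in blast)
  show ?thesis
    by (rule smooth_deriv_unique[OF 1 overlap_par_smooth overlap_open overlap_open M1.nmodel[OF i] M1.X])
       (use overlap_co x a in auto)
qed

end

text \<open>The coordinates of \<open>w\<close> are the image of the ambient vector under
  \<open>dco2\<close>; by \<open>overlap_dpar\<close> no normal component is lost. Tangent spaces
  inside \<open>X\<close> thus depend on \<open>S\<close> only.\<close>

lemma tangent_images:
  assumes p: "p \<in> points M1" and q: "q \<in> points M2" and pq: "emb1 p = emb2 q" and v: "v \<in> tangent M1 p"
  shows "\<exists>w\<in>tangent M2 q. demb2 q w = demb1 p v"
proof -
  obtain i where i: "i \<in> I1" "p \<in> cdom (ch1 i)" using p M1.cover by auto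
  obtain k where k: "k \<in> I2" "q \<in> cdom (ch2 k)" using q M2.cover by auto
  let ?x = "cmap (ch1 i) p" and ?a = "cdiff (ch1 i) p v"
  have a: "?a \<in> vecs (M1.mo i)" by (rule M1.cdiff_mem[OF i v])
  have par: "par1 i ?x = emb2 q" using M1.par_cmap[OF i] pq by simp
  have x: "?x \<in> overlap i k" using i par M2.cdom_iff[OF k(1)] k by auto
  have y: "co2 k (par1 i ?x) = cmap (ch2 k) q" unfolding par using M2.cmap_eq[OF k] by simp
  have "dco2 k (par1 i ?x) (dpar1 i ?x ?a) \<in> cdiff (ch2 k) q ` tangent M2 q"
    using smooth_deriv_vecs(2)[OF overlap_smooth[OF i(1) k(1)] x a] M2.cdiff_bij[OF k] by (simp add: bij_betw_def)
  then obtain w where w: "w \<in> tangent M2 q" "cdiff (ch2 k) q w = dco2 k (par1 i ?x) (dpar1 i ?x ?a)"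
    by auto
  have "demb2 q w = demb1 p v"
    using M2.demb_eq[OF k w(1)] overlap_dpar[OF i(1) k(1) x a] M1.demb_eq[OF i v] unfolding w(2) y by simp
  with w(1) show ?thesis by blast
qed

context
  fixes f
  assumes f: "\<And>p. p \<in> points M1 \<Longrightarrow> f p \<in> points M2 \<and> emb2 (f p) = emb1 p"
begin

lemma chart_rep:
  assumes i: "i \<in> I1" and k: "k \<in> I2"
  shows "cmap (ch1 i) ` {p \<in> cdom (ch1 i). f p \<in> cdom (ch2 k)} = overlap i k"
    and "x \<in> overlap i k \<Longrightarrow> (cmap (ch2 k) \<circ> f \<circ> cinv (ch1 i)) x = co2 k (par1 i x)"
proof -
  have iff: "f p \<in> cdom (ch2 k) \<longleftrightarrow> par1 i (cmap (ch1 i) p) \<in> nb2 k" if "p \<in> cdom (ch1 i)" for p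
    using M2.cdom_iff[OF k] f M1.cdom_iff[OF i] M1.par_cmap[OF i] that by simp
  then show "cmap (ch1 i) ` {p \<in> cdom (ch1 i). f p \<in> cdom (ch2 k)} = overlap i k" by auto
  assume x: "x \<in> overlap i k"
  let ?p = "cinv (ch1 i) x"
  have p: "?p \<in> cdom (ch1 i)" "?p \<in> points M1" "emb1 ?p = par1 i x" "cmap (ch1 i) ?p = x" using M1.cinv[OF i] x by auto
  then have "f ?p \<in> cdom (ch2 k)" using iff x by auto
  then show "(cmap (ch2 k) \<circ> f \<circ> cinv (ch1 i)) x = co2 k (par1 i x)"
    using M2.cmap_eq[OF k] f p by simp
qed

lemma chart_rep_smooth:
  assumes i: "i \<in> I1" and k: "k \<in> I2"
  shows "smooth_deriv (M1.mo i) (M2.mo k) (overlap i k) (cmap (ch2 k) \<circ> f \<circ> cinv (ch1 i))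
      (\<lambda>x a. dco2 k (par1 i x) (dpar1 i x a))"
  by (rule smooth_deriv_cong[OF overlap_smooth[OF i k]]) (use chart_rep(2)[OF i k] in auto)

text \<open>The derivative of the chart representation is \<open>dco2\<close> of the ambient vector,
  and \<open>dco_dpar\<close> for the second manifold turns this into the coordinates of
  \<open>w\<close>.\<close>

lemma dderiv_chart_rep:
  assumes i: "i \<in> I1" and k: "k \<in> I2" and p: "p \<in> cdom (ch1 i)" "f p \<in> cdom (ch2 k)"
    and v: "v \<in> tangent M1 p" and w: "w \<in> tangent M2 (f p)" "demb2 (f p) w = demb1 p v"
  shows "dderiv (M2.mo k) (cmap (ch2 k) \<circ> f \<circ> cinv (ch1 i)) (cmap (ch1 i) p) (cdiff (ch1 i) p v) = cdiff (ch2 k) (f p) w"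
proof -
  let ?x = "cmap (ch1 i) p" and ?q = "cmap (ch2 k) (f p)"
  have x: "?x \<in> overlap i k" using chart_rep(1)[OF i k] p by blast
  have P: "p \<in> points M1" using M1.cdom_iff[OF i] p by blast
  have "dderiv (M2.mo k) (cmap (ch2 k) \<circ> f \<circ> cinv (ch1 i)) ?x (cdiff (ch1 i) p v)
     = dco2 k (par1 i ?x) (dpar1 i ?x (cdiff (ch1 i) p v))"
    by (rule dderiv_eq[OF chart_rep_smooth[OF i k] overlap_open[OF i k] M1.nmodel[OF i] M2.nmodel[OF k] x M1.cdiff_mem[OF i p(1) v]])
  also have "\<dots> = dco2 k (par2 k ?q) (dpar2 k ?q (cdiff (ch2 k) (f p) w))"
    using M1.demb_eq[OF i p(1) v] M2.demb_eq[OF k p(2) w(1)] w(2) M1.par_cmap[OF i p(1)] M2.par_cmap[OF k p(2)] f[OF P] by simp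
  also have "\<dots> = cdiff (ch2 k) (f p) w"
    by (rule M2.dco_dpar[OF k _ M2.cdiff_mem[OF k p(2) w(1)]]) (use p in blast)
  finally show ?thesis .
qed

lemma smooth_map_same_image: "smooth_map M1 M2 f"
  unfolding smooth_map_def
proof (intro conjI ballI)
  show "f ` points M1 \<subseteq> points M2" using f by blast
  fix c d assume "c \<in> atlas M1" "d \<in> atlas M2"
  then obtain i k where ik: "i \<in> I1" "c = ch1 i" "k \<in> I2" "d = ch2 k" using M1.atlas M2.atlas by auto
  show "open_in (cmodel c) (cmap c ` {p \<in> cdom c. f p \<in> cdom d})"
    unfolding ik(2,4) chart_rep(1)[OF ik(1,3)] by (rule overlap_open[OF ik(1,3)])
  show "smooth_on (cmodel c) (cmodel d) (cmap c ` {p \<in> cdom c. f p \<in> cdom d}) (cmap d \<circ> f \<circ> cinv c)"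
    unfolding ik(2,4) chart_rep(1)[OF ik(1,3)]
    by (rule smooth_deriv_imp_smooth_on[OF M1.nmodel[OF ik(1)] chart_rep_smooth[OF ik(1,3)]])
qed

text \<open>Seen in \<open>X\<close> the map \<open>f\<close> is the identity on \<open>S\<close>,
  so its tangent map is the identity on ambient vectors, whichever charts \<open>tangent_map\<close>
  picks.\<close>

lemma tangent_map_same_image:
  assumes p: "p \<in> points M1" and v: "v \<in> tangent M1 p"
  shows "tangent_map M1 M2 f p v \<in> tangent M2 (f p) \<and> demb2 (f p) (tangent_map M1 M2 f p v) = demb1 p v"
proof -
  obtain i where i: "i \<in> I1" "chart_at M1 p = ch1 i" "p \<in> cdom (ch1 i)" using M1.chart_at[OF p] .
  have fp: "f p \<in> points M2" using f[OF p] by simp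
  obtain k where k: "k \<in> I2" "chart_at M2 (f p) = ch2 k" "f p \<in> cdom (ch2 k)" using M2.chart_at[OF fp] .
  have "emb1 p = emb2 (f p)" using f[OF p] by simp
  then obtain w where w: "w \<in> tangent M2 (f p)" "demb2 (f p) w = demb1 p v"
    using tangent_images[OF p fp _ v] by blast
  have "tangent_map M1 M2 f p v = inv_into (tangent M2 (f p)) (cdiff (ch2 k) (f p)) (cdiff (ch2 k) (f p) w)"
    unfolding tangent_map_def Let_def i(2) k(2) dderiv_chart_rep[OF i(1) k(1) i(3) k(3) v w] ..
  also have "\<dots> = w"
    using M2.cdiff_bij[OF k(1,3)] w(1) by (intro inv_into_f_f) (auto simp: bij_betw_def)
  finally show ?thesis using w by simp
qed

end

lemma diffeomorphism_same_image:
  assumes f: "\<And>p. p \<in> points M1 \<Longrightarrow> f p \<in> points M2 \<and> emb2 (f p) = emb1 p"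
  shows "diffeomorphism M1 M2 f"
  unfolding diffeomorphism_def
proof (intro conjI)
  show "smooth_map M1 M2 f" using f by (rule smooth_map_same_image)
  have inj1: "inj_on emb1 (points M1)" and inj2: "inj_on emb2 (points M2)"
    and im: "emb1 ` points M1 = S" "emb2 ` points M2 = S"
    using M1.bij_emb M2.bij_emb by (auto simp: bij_betw_def)
  have "inj_on f (points M1)" using f inj1 by (metis inj_on_def)
  moreover have "f ` points M1 = points M2"
  proof
    show "points M2 \<subseteq> f ` points M1"
    proof
      fix q assume q: "q \<in> points M2"
      then have "emb2 q \<in> emb1 ` points M1" using im by blast
      then obtain p where "p \<in> points M1" "emb2 q = emb1 p" by blast
      then show "q \<in> f ` points M1" using f inj2 q by (metis image_eqI inj_onD)
    qed
  qed (use f in blast)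
  ultimately show bij: "bij_betw f (points M1) (points M2)" by (simp add: bij_betw_def)
  \<comment> \<open>With the two manifolds exchanged, the smoothness result for \<open>f\<close>
    applies to its inverse.\<close>
  interpret R: embedded_pair X S M2 I2 ch2 emb2 demb2 par2 dpar2 d2par2 nb2 co2 dco2
     M1 I1 ch1 emb1 demb1 par1 dpar1 d2par1 nb1 co1 dco1 by unfold_locales
  show "smooth_map M2 M1 (inv_into (points M1) f)"
  proof (rule R.smooth_map_same_image)
    fix q assume q: "q \<in> points M2"
    then have "inv_into (points M1) f q \<in> points M1" "f (inv_into (points M1) f q) = q"
      using bij by (auto simp: bij_betw_def inv_into_into f_inv_into_f)
    then show "inv_into (points M1) f q \<in> points M1 \<and> emb1 (inv_into (points M1) f q) = emb2 q"
      using f by metis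
  qed
qed

end

context embedded_manifold
begin

text \<open>Transition maps are the chart representations of the identity in the pair formed by the
  manifold and itself. Points are separated by balls of \<open>X\<close>, whose preimages under the
  injective embedding are open in every chart.\<close>

lemma embedded_is_manifold: "is_manifold M"
proof -
  interpret self: embedded_pair X S M I ch emb demb par dpar d2par nb co dco M I ch emb demb par dpar d2par nb co dco
    by unfold_locales
  have id: "p \<in> points M \<Longrightarrow> id p \<in> points M \<and> emb (id p) = emb p" for p by simp
  show ?thesis
    unfolding is_manifold_def
  proof (intro conjI)
    show "points M = (\<Union>c\<in>atlas M. cdom c)" using cover atlas by auto
    show "\<forall>p\<in>points M. subspace (tangent M p)" using tangent_subspace by blast
    show "\<forall>c\<in>atlas M. banach_nspace (cmodel c) \<and> inj_on (cmap c) (cdom c) \<and>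
        (\<forall>p\<in>cdom c. lin_on (tangent M p) (cdiff c p) \<and> bij_betw (cdiff c p) (tangent M p) (vecs (cmodel c)))"
      using atlas model inj_cmap cdiff_lin cdiff_bij by auto
    show "\<forall>c\<in>atlas M. \<forall>d\<in>atlas M.
        open_in (cmodel c) (cmap c ` (cdom c \<inter> cdom d)) \<and>
        smooth_on (cmodel c) (cmodel d) (cmap c ` (cdom c \<inter> cdom d)) (cmap d \<circ> cinv c) \<and>
        (\<forall>p\<in>cdom c \<inter> cdom d. \<forall>v\<in>tangent M p.
           cdiff d p v = dderiv (cmodel d) (cmap d \<circ> cinv c) (cmap c p) (cdiff c p v))"
    proof (intro ballI conjI)
      fix c d assume "c \<in> atlas M" "d \<in> atlas M"
      then obtain i k where ik: "i \<in> I" "c = ch i" "k \<in> I" "d = ch k" using atlas by auto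
      note r = self.chart_rep[of id, OF id ik(1,3)]
      have o: "cmap c ` (cdom c \<inter> cdom d) = self.overlap i k" using r(1) unfolding ik by (simp add: Int_def)
      show "open_in (cmodel c) (cmap c ` (cdom c \<inter> cdom d))"
        unfolding o using self.overlap_open[OF ik(1,3)] ik by simp
      show "smooth_on (cmodel c) (cmodel d) (cmap c ` (cdom c \<inter> cdom d)) (cmap d \<circ> cinv c)"
        unfolding o using smooth_deriv_imp_smooth_on[OF nmodel[OF ik(1)] self.chart_rep_smooth[of id, OF id ik(1,3)]] ik by simp
      fix p v assume p: "p \<in> cdom c \<inter> cdom d" and v: "v \<in> tangent M p"
      show "cdiff d p v = dderiv (cmodel d) (cmap d \<circ> cinv c) (cmap c p) (cdiff c p v)"
        using self.dderiv_chart_rep[of id, OF id ik(1,3), of p v v] p v ik by simp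
    qed
    show "\<forall>p\<in>points M. \<forall>q\<in>points M. p \<noteq> q \<longrightarrow>
        (\<exists>A B. open_subset M A \<and> open_subset M B \<and> p \<in> A \<and> q \<in> B \<and> A \<inter> B = {})"
    proof (intro ballI impI)
      fix p q assume pq: "p \<in> points M" "q \<in> points M" "p \<noteq> q"
      then have ne: "emb p - emb q \<noteq> 0" using bij_emb by (auto simp: bij_betw_def dest: inj_onD)
      note v = emb_vecs[OF pq(1)] emb_vecs[OF pq(2)]
      \<comment> \<open>Half the distance makes the two balls disjoint by the triangle
        inequality.\<close>
      define r where "r = vnorm X (emb p - emb q) / 2"
      have r: "r > 0" using ne vnorm_eq_0[OF X nspace_diff[OF X v]] vnorm_nonneg[OF X nspace_diff[OF X v]] by (simp add: r_def)
      let ?B = "\<lambda>s. {x \<in> vecs X. vnorm X (x - s) < r}"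
      have ball: "open_in X (?B s)" if s: "s \<in> vecs X" for s
        unfolding open_in_def
      proof (intro conjI ballI)
        fix x assume x: "x \<in> ?B s"
        show "\<exists>\<epsilon>>0. \<forall>y\<in>vecs X. vnorm X (y - x) < \<epsilon> \<longrightarrow> y \<in> ?B s"
        proof (intro exI[of _ "r - vnorm X (x - s)"] conjI ballI impI)
          fix y assume y: "y \<in> vecs X" "vnorm X (y - x) < r - vnorm X (x - s)"
          have "vnorm X (y - s) \<le> vnorm X (y - x) + vnorm X (x - s)"
            using vnorm_add[OF X, of "y - x" "x - s"] nspace_diff[OF X] x y s by simp
          then show "y \<in> ?B s" using y by simp
        qed (use x in auto)
      qed auto
      have os: "open_subset M {p \<in> points M. emb p \<in> ?B s}" if s: "s \<in> vecs X" for s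
        unfolding open_subset_def
      proof (intro conjI ballI)
        fix c assume "c \<in> atlas M"
        then obtain i where i: "i \<in> I" "c = ch i" using atlas by auto
        have "{p \<in> points M. emb p \<in> ?B s} \<inter> cdom (ch i) = {p \<in> cdom (ch i). emb p \<in> ?B s}"
          using cdom_iff[OF i(1)] by blast
        then show "open_in (cmodel c) (cmap c ` ({p \<in> points M. emb p \<in> ?B s} \<inter> cdom c))"
          using open_chart_preimage[OF i(1) ball[OF s]] i(2) by simp
      qed auto
      have disj: "\<not> (vnorm X (x - emb p) < r \<and> vnorm X (x - emb q) < r)" if x: "x \<in> vecs X" for x
        using vnorm_add[OF X, of "emb p - x" "x - emb q"] vnorm_minus_commute[OF X x v(1)] nspace_diff[OF X] v x
        by (auto simp: r_def)
      show "\<exists>A B. open_subset M A \<and> open_subset M B \<and> p \<in> A \<and> q \<in> B \<and> A \<inter> B = {}"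
        using os[OF v(1)] os[OF v(2)] disj pq v r vnorm_0[OF X]
        by (intro exI[of _ "{x \<in> points M. emb x \<in> ?B (emb p)}"] exI[of _ "{x \<in> points M. emb x \<in> ?B (emb q)}"]) auto
    qed
  qed
qed

end

section \<open>Fourier coefficients\<close>

definition circle_fun :: "(real \<Rightarrow> complex) \<Rightarrow> bool" where
  "circle_fun f \<longleftrightarrow> continuous_on UNIV f \<and> (\<forall>x. f (x + 1) = f x)"

definition mode :: "int \<Rightarrow> real \<Rightarrow> complex" where
  "mode k x = cis (2 * pi * of_int k * x)"

lemma mode_add: "mode (j + k) x = mode j x * mode k x"
  by (simp add: mode_def cis_mult algebra_simps)

lemma mode_0 [simp]: "mode 0 x = 1"
  by (simp add: mode_def)

lemma norm_mode [simp]: "cmod (mode k x) = 1"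
  by (simp add: mode_def)

lemma cnj_mode: "cnj (mode k x) = mode (- k) x"
  by (simp add: mode_def cis_cnj)

lemma cis_of_int: "cis (2 * pi * of_int k) = 1"
  by (rule cis_multiple_2pi) simp

lemma circle_fun_mode [simp]: "circle_fun (mode k)"
  unfolding circle_fun_def
proof
  show "continuous_on UNIV (mode k)" unfolding mode_def by (intro continuous_intros)
  show "\<forall>x. mode k (x + 1) = mode k x"
    using cis_of_int[of k] by (simp add: mode_def distrib_left flip: cis_mult)
qed

lemma fourier_coeff_mode: "fourier_coeff f k = integral {0..1} (\<lambda>x. f x * mode (- k) x)"
  by (simp add: fourier_coeff_def mode_def)

lemma circle_fun_continuous: "circle_fun f \<Longrightarrow> continuous_on A f"
  by (auto simp: circle_fun_def intro: continuous_on_subset)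

lemma circle_fun_const [simp]: "circle_fun (\<lambda>x. c)"
  by (simp add: circle_fun_def)

lemma circle_fun_add: "circle_fun f \<Longrightarrow> circle_fun g \<Longrightarrow> circle_fun (\<lambda>x. f x + g x)"
  and circle_fun_diff: "circle_fun f \<Longrightarrow> circle_fun g \<Longrightarrow> circle_fun (\<lambda>x. f x - g x)"
  and circle_fun_mult: "circle_fun f \<Longrightarrow> circle_fun g \<Longrightarrow> circle_fun (\<lambda>x. f x * g x)"
  and circle_fun_cnj: "circle_fun f \<Longrightarrow> circle_fun (\<lambda>x. cnj (f x))"
  and circle_fun_sum: "(\<And>i. i \<in> J \<Longrightarrow> circle_fun (h i)) \<Longrightarrow> circle_fun (\<lambda>x. \<Sum>i\<in>J. h i x)"
  unfolding circle_fun_def by (auto intro!: continuous_intros)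

section \<open>Reduction of periodic functions to the unit interval\<close>

lemma periodic_int:
  fixes f :: "real \<Rightarrow> 'a"
  assumes "\<And>x. f (x + 1) = f x"
  shows "f (x + of_int k) = f x"
proof -
  have nat: "f (x + of_nat n) = f x" for x n
    by (induction n) (use assms in \<open>auto simp: add.assoc[symmetric] add.commute[of 1]\<close>)
  show ?thesis
  proof (cases "k \<ge> 0")
    case True
    then show ?thesis using nat[of x "nat k"] by simp
  next
    case False
    then show ?thesis using nat[of "x + of_int k" "nat (- k)"] by simp
  qed
qed

lemma periodic_frac:
  fixes f :: "real \<Rightarrow> 'a"
  assumes "\<And>x. f (x + 1) = f x"
  shows "f (frac x) = f x"
  using periodic_int[of f "frac x" "floor x", OF assms] by (simp add: frac_def)

lemma frac_unit: "frac x \<in> {0..1::real}"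
  using frac_ge_0[of x] frac_lt_1[of x] by simp

lemma circle_fun_eq:
  assumes "circle_fun f" "circle_fun g" "\<And>x. x \<in> {0..1} \<Longrightarrow> f x = g x"
  shows "f = g"
proof
  fix x show "f x = g x"
    using periodic_frac[of f x] periodic_frac[of g x] assms(1,2) assms(3)[OF frac_unit, of x] by (simp add: circle_fun_def)
qed

lemma circle_fun_bounded:
  assumes "circle_fun f"
  shows "\<exists>B>0. \<forall>x. cmod (f x) \<le> B"
proof -
  have "bounded (f ` {0..1})"
    by (intro compact_imp_bounded compact_continuous_image circle_fun_continuous assms compact_Icc)
  then obtain B where B: "B > 0" "\<And>x. x \<in> {0..1} \<Longrightarrow> cmod (f x) \<le> B"
    unfolding bounded_pos by auto
  have "cmod (f x) \<le> B" for x
    using B(2)[OF frac_unit, of x] periodic_frac[of f x] assms by (simp add: circle_fun_def)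
  with B(1) show ?thesis by blast
qed

lemma circle_fun_integrable: "circle_fun f \<Longrightarrow> f integrable_on {0..1}"
  by (intro integrable_continuous_real circle_fun_continuous)

lemma fourier_coeff_add:
  "circle_fun f \<Longrightarrow> circle_fun g \<Longrightarrow> fourier_coeff (\<lambda>x. f x + g x) k = fourier_coeff f k + fourier_coeff g k"
  unfolding fourier_coeff_mode by (simp add: distrib_right circle_fun_integrable circle_fun_mult integral_add)

lemma fourier_coeff_diff:
  "circle_fun f \<Longrightarrow> circle_fun g \<Longrightarrow> fourier_coeff (\<lambda>x. f x - g x) k = fourier_coeff f k - fourier_coeff g k"
  unfolding fourier_coeff_mode by (simp add: left_diff_distrib circle_fun_integrable circle_fun_mult integral_diff)

lemma fourier_coeff_cmult: "fourier_coeff (\<lambda>x. c * f x) k = c * fourier_coeff f k"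
  unfolding fourier_coeff_mode by (simp add: mult.assoc)

lemma fourier_coeff_sum:
  "(\<And>i. i \<in> J \<Longrightarrow> circle_fun (h i)) \<Longrightarrow> fourier_coeff (\<lambda>x. \<Sum>i\<in>J. h i x) k = (\<Sum>i\<in>J. fourier_coeff (h i) k)"
proof (induction J rule: infinite_finite_induct)
  case (insert i J)
  then show ?case by (simp add: fourier_coeff_add circle_fun_sum)
qed (simp_all add: fourier_coeff_def)

lemma fourier_coeff_bound:
  assumes "circle_fun f" "\<And>x. cmod (f x) \<le> B"
  shows "cmod (fourier_coeff f k) \<le> B"
proof -
  have "cmod (integral {0..1} (\<lambda>x. f x * mode (- k) x)) \<le> B * (1 - 0)"
    using assms by (intro integral_bound circle_fun_continuous circle_fun_mult) (auto simp: norm_mult)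
  then show ?thesis by (simp add: fourier_coeff_mode)
qed

lemma fourier_coeff_mult_mode: "fourier_coeff (\<lambda>x. mode j x * f x) k = fourier_coeff f (k - j)"
proof -
  have "mode j x * mode (- k) x = mode (- (k - j)) x" for x
    using mode_add[of j "- k" x] by simp
  then have "mode j x * f x * mode (- k) x = f x * mode (- (k - j)) x" for x
    by (metis mult.assoc mult.commute)
  then show ?thesis unfolding fourier_coeff_mode by presburger
qed

lemma fourier_coeff_cnj: "fourier_coeff (\<lambda>x. cnj (f x)) k = cnj (fourier_coeff f (- k))"
proof -
  have "fourier_coeff (\<lambda>x. cnj (f x)) k = integral {0..1} (\<lambda>x. cnj (f x * mode k x))"
    by (simp add: fourier_coeff_mode cnj_mode)
  also have "\<dots> = cnj (integral {0..1} (\<lambda>x. f x * mode k x))"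
    by (rule integral_cnj[symmetric])
  finally show ?thesis by (simp add: fourier_coeff_mode)
qed

lemma mode_has_vector_derivative: "(mode k has_vector_derivative (2 * pi * of_int k) *\<^sub>R (\<i> * mode k x)) (at x within A)"
proof -
  have "((\<lambda>z. exp (2 * pi * \<i> * of_int k * z)) has_field_derivative 2 * pi * \<i> * of_int k * exp (2 * pi * \<i> * of_int k * of_real x)) (at (of_real x))"
    by (auto intro!: derivative_eq_intros)
  from has_vector_derivative_real_field[OF this]
  show ?thesis by (simp add: mode_def[abs_def] cis_conv_exp scaleR_conv_of_real mult_ac)
qed

text \<open>Integration by parts: the boundary terms of f times a mode cancel by
  periodicity.\<close>

lemma fourier_coeff_deriv:
  assumes f: "circle_fun f" and f': "circle_fun f'" and d: "\<And>x. (f has_vector_derivative f' x) (at x)"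
  shows "fourier_coeff f' k = 2 * pi * \<i> * of_int k * fourier_coeff f k"
proof -
  let ?h = "\<lambda>x. f x * mode (- k) x"
  have "(?h has_vector_derivative (f x * ((2 * pi * of_int (- k)) *\<^sub>R (\<i> * mode (- k) x)) + f' x * mode (- k) x)) (at x within {0..1})" for x
    by (intro has_vector_derivative_mult has_vector_derivative_at_within[OF d] mode_has_vector_derivative)
  then have "((\<lambda>x. f x * ((2 * pi * of_int (- k)) *\<^sub>R (\<i> * mode (- k) x)) + f' x * mode (- k) x) has_integral (?h 1 - ?h 0)) {0..1}"
    by (intro fundamental_theorem_of_calculus) auto
  moreover have "circle_fun ?h" by (intro circle_fun_mult f circle_fun_mode)
  then have "?h 1 = ?h (0 + 1)" "?h (0 + 1) = ?h 0" by (simp, unfold circle_fun_def, blast)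
  then have "?h 1 - ?h 0 = 0" by (simp only: diff_self)
  ultimately have 0: "((\<lambda>x. f x * ((2 * pi * of_int (- k)) *\<^sub>R (\<i> * mode (- k) x)) + f' x * mode (- k) x) has_integral 0) {0..1}"
    by metis
  have "((\<lambda>x. (- 2 * pi * \<i> * of_int k) * (f x * mode (- k) x) + f' x * mode (- k) x) has_integral
     ((- 2 * pi * \<i> * of_int k) * fourier_coeff f k + fourier_coeff f' k)) {0..1}"
    unfolding fourier_coeff_mode
    by (intro has_integral_add has_integral_mult_right integrable_integral circle_fun_integrable circle_fun_mult f f' circle_fun_mode)
  also have "(\<lambda>x. (- 2 * pi * \<i> * of_int k) * (f x * mode (- k) x) + f' x * mode (- k) x)
     = (\<lambda>x. f x * ((2 * pi * of_int (- k)) *\<^sub>R (\<i> * mode (- k) x)) + f' x * mode (- k) x)"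
    by (simp add: fun_eq_iff scaleR_conv_of_real)
  finally have "(- 2 * pi * \<i> * of_int k) * fourier_coeff f k + fourier_coeff f' k = 0"
    by (rule has_integral_unique[OF _ 0])
  then show ?thesis by (simp add: algebra_simps add_eq_0_iff)
qed

text \<open>The constant 1 has derivative 0, so \<open>fourier_coeff_deriv\<close> makes all
  coefficients with nonzero index vanish. Orthogonality of the modes then follows by shifting the
  index.\<close>

lemma fourier_coeff_1: "fourier_coeff (\<lambda>x. 1) k = (if k = 0 then 1 else 0)"
proof -
  have "fourier_coeff (\<lambda>x. 0) k = 2 * pi * \<i> * of_int k * fourier_coeff (\<lambda>x. 1) k"
    by (rule fourier_coeff_deriv) auto
  then show ?thesis by (auto simp: fourier_coeff_mode)
qed

lemma fourier_coeff_const: "fourier_coeff (\<lambda>x. c) k = (if k = 0 then c else 0)"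
  using fourier_coeff_cmult[of c "\<lambda>x. 1" k] by (simp add: fourier_coeff_1)

lemma fourier_coeff_of_mode: "fourier_coeff (mode j) k = (if k = j then 1 else 0)"
  using fourier_coeff_mult_mode[of j "\<lambda>x. 1" k] by (simp add: fourier_coeff_1)

section \<open>The L2 product and the inequality of Bessel\<close>

lemma Re_L2_inner_self:
  assumes "circle_fun f"
  shows "Re (L2_inner f f) = integral {0..1} (\<lambda>x. (cmod (f x))\<^sup>2)" "L2_inner f f = of_real (integral {0..1} (\<lambda>x. (cmod (f x))\<^sup>2))"
proof -
  have "L2_inner f f = integral {0..1} (\<lambda>x. of_real ((cmod (f x))\<^sup>2))"
    unfolding L2_inner_def by (simp flip: complex_norm_square)
  also have "\<dots> = of_real (integral {0..1} (\<lambda>x. (cmod (f x))\<^sup>2))"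
    by (rule integral_unique, rule has_integral_of_real, rule integrable_integral)
       (intro integrable_continuous_real continuous_intros circle_fun_continuous assms)
  finally show "L2_inner f f = of_real (integral {0..1} (\<lambda>x. (cmod (f x))\<^sup>2))" .
  then show "Re (L2_inner f f) = integral {0..1} (\<lambda>x. (cmod (f x))\<^sup>2)" by simp
qed

lemma Re_L2_inner_self_nonneg: "circle_fun f \<Longrightarrow> 0 \<le> Re (L2_inner f f)"
  by (simp add: Re_L2_inner_self(1) integral_nonneg integrable_continuous_real continuous_intros circle_fun_continuous)

lemma L2_inner_self_eq_0:
  assumes f: "circle_fun f" and 0: "Re (L2_inner f f) = 0"
  shows "f = (\<lambda>x. 0)"
proof (rule circle_fun_eq[OF f circle_fun_const])
  fix x :: real assume x: "x \<in> {0..1}"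
  have "continuous_on {0..1} (\<lambda>x. (cmod (f x))\<^sup>2)" by (intro continuous_intros circle_fun_continuous f)
  then have "(\<lambda>x. (cmod (f x))\<^sup>2) x = 0"
    using integral_eq_0_iff[of 0 1 "\<lambda>x. (cmod (f x))\<^sup>2"] 0 Re_L2_inner_self(1)[OF f] x by auto
  then show "f x = 0" by simp
qed

text \<open>The residue \<open>r\<close> left by the partial sum \<open>g\<close> is orthogonal to
  \<open>g\<close>, so the squared norm of \<open>r\<close> is that of f minus the sum of squared
  coefficients. The bound by the supremum is what later starts the scale of norms at exponent
  0.\<close>

lemma bessel:
  assumes f: "circle_fun f" and B: "\<And>x. cmod (f x) \<le> B" and F: "finite F"
  shows "(\<Sum>k\<in>F. (cmod (fourier_coeff f k))\<^sup>2) \<le> B\<^sup>2"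
proof -
  define g where "g x = (\<Sum>k\<in>F. fourier_coeff f k * mode k x)" for x
  define r where "r x = f x - g x" for x
  have g: "circle_fun g" unfolding g_def by (intro circle_fun_sum circle_fun_mult) auto
  have r: "circle_fun r" unfolding r_def by (intro circle_fun_diff f g)
  have "fourier_coeff g k = fourier_coeff f k" if "k \<in> F" for k
    unfolding g_def using F that
    by (subst fourier_coeff_sum) (auto simp: circle_fun_mult fourier_coeff_cmult fourier_coeff_of_mode if_distrib cong: if_cong)
  then have rk: "fourier_coeff r k = 0" if "k \<in> F" for k
    unfolding r_def using that by (simp add: fourier_coeff_diff f g)
  have int: "(\<lambda>x. u x * v x) integrable_on {0..1}" if "circle_fun u" "circle_fun v" for u v
    by (intro circle_fun_integrable circle_fun_mult that)
  have "L2_inner r g = integral {0..1} (\<lambda>x. \<Sum>k\<in>F. cnj (fourier_coeff f k) * (r x * mode (- k) x))"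
    unfolding L2_inner_def g_def by (simp add: sum_distrib_left cnj_mode mult_ac)
  also have "\<dots> = (\<Sum>k\<in>F. cnj (fourier_coeff f k) * fourier_coeff r k)"
    unfolding fourier_coeff_mode[of r] using F int[OF r] by (subst integral_sum) (auto intro!: integrable_on_mult_right)
  finally have rg: "L2_inner r g = 0" using rk by simp
  have "L2_inner g f = integral {0..1} (\<lambda>x. \<Sum>k\<in>F. fourier_coeff f k * (cnj (f x) * mode k x))"
    unfolding L2_inner_def g_def sum_distrib_right by (simp only: mult_ac)
  also have "\<dots> = (\<Sum>k\<in>F. fourier_coeff f k * fourier_coeff (\<lambda>x. cnj (f x)) (- k))"
    unfolding fourier_coeff_mode[of "\<lambda>x. cnj (f x)"] using F int[OF circle_fun_cnj[OF f] circle_fun_mode]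
    by (subst integral_sum) (auto intro!: integrable_on_mult_right)
  also have "\<dots> = of_real (\<Sum>k\<in>F. (cmod (fourier_coeff f k))\<^sup>2)"
    by (simp add: fourier_coeff_cnj flip: complex_norm_square)
  finally have gf: "L2_inner g f = of_real (\<Sum>k\<in>F. (cmod (fourier_coeff f k))\<^sup>2)" .
  have "L2_inner r r = L2_inner r f - L2_inner r g"
    unfolding L2_inner_def using int[OF r circle_fun_cnj[OF f]] int[OF r circle_fun_cnj[OF g]]
    by (subst integral_diff[symmetric]) (auto simp: r_def algebra_simps)
  also have "\<dots> = L2_inner f f - L2_inner g f"
    unfolding rg unfolding L2_inner_def using int[OF f circle_fun_cnj[OF f]] int[OF g circle_fun_cnj[OF f]]
    by (subst integral_diff[symmetric]) (auto simp: r_def algebra_simps)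
  finally have "(\<Sum>k\<in>F. (cmod (fourier_coeff f k))\<^sup>2) \<le> integral {0..1} (\<lambda>x. (cmod (f x))\<^sup>2)"
    using Re_L2_inner_self_nonneg[OF r] unfolding gf Re_L2_inner_self(2)[OF f] by simp
  also have "\<dots> \<le> integral {0..1} (\<lambda>x::real. B\<^sup>2)"
    using B by (intro integral_le integrable_continuous_real continuous_intros circle_fun_continuous f) (auto intro: power_mono)
  finally show ?thesis by simp
qed

text \<open>By the theorem of Stone and Weierstrass the functions \<open>p (mode 1 x)\<close>, with \<open>p\<close> a polynomial on the plane,
  are dense. The condition below on \<open>h\<close> is stable under products.\<close>

lemma annihilated_real_polynomial:
  fixes p :: "complex \<Rightarrow> real"
  assumes "real_polynomial_function p" "circle_fun f" "\<And>k. fourier_coeff f k = 0"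
  shows "circle_fun (\<lambda>x. of_real (p (mode 1 x)) * f x) \<and> (\<forall>k. fourier_coeff (\<lambda>x. of_real (p (mode 1 x)) * f x) k = 0)"
  using assms
proof (induction arbitrary: f rule: real_polynomial_function.induct)
  case (linear l)
  note f = linear.prems
  interpret bounded_linear l by fact
  let ?a = "of_real (l 1) :: complex" and ?b = "of_real (l \<i>) :: complex"
  have l: "l z = Re z * l 1 + Im z * l \<i>" for z
  proof -
    have "z = Re z *\<^sub>R 1 + Im z *\<^sub>R \<i>" by (simp add: complex_eq_iff)
    then have "l z = l (Re z *\<^sub>R 1) + l (Im z *\<^sub>R \<i>)" by (metis add)
    then show ?thesis by (simp only: scale real_scaleR_def)
  qed
  \<comment> \<open>A real-linear functional on the plane is A z plus B times the conjugate of z. On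
    the circle these are multiples of \<open>mode 1\<close> and \<open>mode (- 1)\<close>, and
    multiplication by a mode only shifts the coefficients.\<close>
  define A B where "A = ?a / 2 - \<i> * ?b / 2" and "B = ?a / 2 + \<i> * ?b / 2"
  have L: "of_real (l z) = A * z + B * cnj z" for z
    unfolding l[of z] A_def B_def by (simp add: complex_eq_iff algebra_simps)
  have eq: "(\<lambda>x. of_real (l (mode 1 x)) * f x) = (\<lambda>x. A * (mode 1 x * f x) + B * (mode (- 1) x * f x))"
    by (simp only: L cnj_mode distrib_right mult.assoc)
  have c: "circle_fun (\<lambda>x. d * (mode j x * f x))" for d j
    by (rule circle_fun_mult[OF circle_fun_const circle_fun_mult[OF circle_fun_mode f(1)]])
  note c2 = c[of A 1] c[of B "- 1"]
  show ?case
    unfolding eq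
  proof (intro conjI allI circle_fun_add c2)
    fix k
    show "fourier_coeff (\<lambda>x. A * (mode 1 x * f x) + B * (mode (- 1) x * f x)) k = 0"
      unfolding fourier_coeff_add[OF c2] fourier_coeff_cmult fourier_coeff_mult_mode f(2) by simp
  qed
next
  case (const d)
  then show ?case by (auto intro!: circle_fun_mult simp: fourier_coeff_cmult)
next
  case (add p q)
  show ?case using add.IH(1)[OF add.prems] add.IH(2)[OF add.prems]
    by (simp add: distrib_right circle_fun_add fourier_coeff_add)
next
  case (mult p q)
  then show ?case using mult.IH(1)[of "\<lambda>x. of_real (q (mode 1 x)) * f x"] by (simp add: mult.assoc)
qed

text \<open>A function with vanishing coefficients integrates to 0 against every polynomial in
  \<open>mode 1 x\<close>. Approximating its conjugate by such a polynomial up to \<open>e\<close>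
  bounds its squared L2 norm by \<open>B * e\<close>.\<close>

lemma fourier_coeff_unique_0:
  assumes f: "circle_fun f" and 0: "\<And>k. fourier_coeff f k = 0"
  shows "f = (\<lambda>x. 0)"
proof (rule L2_inner_self_eq_0[OF f])
  obtain B where B: "B > 0" "\<And>x. cmod (f x) \<le> B" using circle_fun_bounded[OF f] by blast
  let ?p = "\<lambda>x. cnj (f x)"
  \<comment> \<open>Stone and Weierstrass ask for a continuous function on the unit circle. A loop
    composed with the normalised angle is one although \<open>Arg2pi\<close> jumps; the continuity
    is extracted from the passage between homotopies of loops and of circle maps, applied to the
    trivial homotopy.\<close>
  have "path ?p" unfolding path_def by (intro continuous_intros circle_fun_continuous f)
  moreover have "f (0 + 1) = f 0" using f unfolding circle_fun_def by blast
  then have "pathfinish ?p = pathstart ?p" by (simp add: pathfinish_def pathstart_def)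
  ultimately have "homotopic_loops UNIV ?p ?p" by (simp add: homotopic_loops_refl)
  from homotopic_with_imp_continuous[OF homotopic_loops_imp_homotopic_circlemaps[OF this]]
  have cont: "continuous_on (sphere 0 1) (?p \<circ> (\<lambda>z. Arg2pi z / (2 * pi)))" by blast
  have small: "cmod (L2_inner f f) \<le> B * e" if e: "e > 0" for e
  proof -
    obtain g where g: "polynomial_function g" "\<And>z. z \<in> sphere 0 1 \<Longrightarrow> cmod ((?p \<circ> (\<lambda>z. Arg2pi z / (2 * pi))) z - g z) < e"
      using Stone_Weierstrass_polynomial_function[OF compact_sphere cont e] by blast
    have approx: "cmod (cnj (f x) - g (mode 1 x)) \<le> e" for x
    proof -
      have "mode 1 x = mode 1 (frac x)" using periodic_frac[of "mode 1" x] circle_fun_mode[of 1] unfolding circle_fun_def by metis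
      also have "\<dots> = of_real 1 * exp (\<i> * of_real (2 * pi * frac x))" by (simp add: mode_def cis_conv_exp)
      finally have "Arg2pi (mode 1 x) = 2 * pi * frac x"
        using Arg2pi_unique[of 1 "2 * pi * frac x" "mode 1 x"] frac_ge_0[of x] frac_lt_1[of x] by simp
      then have "(?p \<circ> (\<lambda>z. Arg2pi z / (2 * pi))) (mode 1 x) = cnj (f x)"
        using periodic_frac[of f x] f by (simp add: circle_fun_def)
      then show ?thesis using g(2)[of "mode 1 x"] by simp
    qed
    have "real_polynomial_function (Re \<circ> g)" "real_polynomial_function (Im \<circ> g)"
      using g(1) bounded_linear_Re bounded_linear_Im unfolding polynomial_function_def by blast+
    note a = annihilated_real_polynomial[OF this(1) f 0] annihilated_real_polynomial[OF this(2) f 0]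
    have eq: "(\<lambda>x. g (mode 1 x) * f x) = (\<lambda>x. of_real ((Re \<circ> g) (mode 1 x)) * f x + \<i> * (of_real ((Im \<circ> g) (mode 1 x)) * f x))"
      by (simp add: fun_eq_iff complex_eq_iff)
    have c: "circle_fun (\<lambda>x. g (mode 1 x) * f x)"
      unfolding eq by (intro circle_fun_add circle_fun_mult[OF circle_fun_const]) (use a in auto)
    have "fourier_coeff (\<lambda>x. g (mode 1 x) * f x) 0 = 0"
      unfolding eq using a by (subst fourier_coeff_add) (auto intro!: circle_fun_mult[OF circle_fun_const] simp: fourier_coeff_cmult)
    then have "L2_inner f f = integral {0..1} (\<lambda>x. f x * cnj (f x)) - integral {0..1} (\<lambda>x. g (mode 1 x) * f x)"
      by (simp add: L2_inner_def fourier_coeff_mode)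
    also have "\<dots> = integral {0..1} (\<lambda>x. f x * (cnj (f x) - g (mode 1 x)))"
      using circle_fun_integrable[OF circle_fun_mult[OF f circle_fun_cnj[OF f]]] circle_fun_integrable[OF c]
      by (subst integral_diff[symmetric]) (auto simp: algebra_simps)
    finally have "L2_inner f f = integral {0..1} (\<lambda>x. f x * (cnj (f x) - g (mode 1 x)))" .
    moreover have "cmod (integral {0..1} (\<lambda>x. f x * (cnj (f x) - g (mode 1 x)))) \<le> (B * e) * (1 - 0)"
    proof (rule integral_bound)
      have "continuous_on {0..1} (\<lambda>x. f x * cnj (f x) - g (mode 1 x) * f x)"
        by (intro circle_fun_continuous circle_fun_diff circle_fun_mult circle_fun_cnj f c)
      then show "continuous_on {0..1} (\<lambda>x. f x * (cnj (f x) - g (mode 1 x)))" by (simp add: algebra_simps)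
      show "cmod (f x * (cnj (f x) - g (mode 1 x))) \<le> B * e" for x
        unfolding norm_mult using B approx by (intro mult_mono) auto
    qed simp
    ultimately show ?thesis by simp
  qed
  have "cmod (L2_inner f f) \<le> 0 + e" if "e > 0" for e
    using small[of "e / B"] B(1) that by simp
  then have "cmod (L2_inner f f) \<le> 0" by (rule field_le_epsilon)
  then show "Re (L2_inner f f) = 0" by simp
qed

lemma fourier_coeff_unique:
  assumes "circle_fun f" "circle_fun g" "\<And>k. fourier_coeff f k = fourier_coeff g k"
  shows "f = g"
proof -
  have "(\<lambda>x. f x - g x) = (\<lambda>x. 0)"
    by (rule fourier_coeff_unique_0) (use assms in \<open>auto simp: circle_fun_diff fourier_coeff_diff\<close>)
  then show ?thesis by (simp add: fun_eq_iff)
qed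

subsection \<open>Absolutely convergent Fourier series\<close>

definition fourier_series :: "(int \<Rightarrow> complex) \<Rightarrow> real \<Rightarrow> complex" where
  "fourier_series a x = (\<Sum>\<^sub>\<infinity>k. a k * mode k x)"

lemma fourier_series_uniform:
  assumes "(\<lambda>k. cmod (a k)) summable_on UNIV"
  shows "uniform_limit UNIV (\<lambda>J x. \<Sum>k\<in>J. a k * mode k x) (fourier_series a) (finite_subsets_at_top UNIV)"
  unfolding fourier_series_def
  by (rule Weierstrass_m_test_general[where M = "\<lambda>k. cmod (a k)"]) (use assms in \<open>auto simp: norm_mult\<close>)

lemma fourier_series:
  assumes a: "(\<lambda>k. cmod (a k)) summable_on UNIV"
  shows "circle_fun (fourier_series a)" "fourier_coeff (fourier_series a) k = a k"
    "cmod (fourier_series a x) \<le> (\<Sum>\<^sub>\<infinity>k. cmod (a k))"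
proof -
  have per: "fourier_series a (x + 1) = fourier_series a x" for x
    using circle_fun_mode unfolding fourier_series_def circle_fun_def by simp
  have "continuous_on UNIV (fourier_series a)"
    by (rule uniform_limit_theorem[OF _ fourier_series_uniform[OF a]])
       (auto intro!: always_eventually circle_fun_continuous circle_fun_sum circle_fun_mult)
  then show c: "circle_fun (fourier_series a)" using per by (simp add: circle_fun_def)
  \<comment> \<open>A coefficient is bounded by the supremum, so it passes to the uniform limit; the
    k-th coefficient of the partial sums is eventually constant.\<close>
  have "((\<lambda>J. fourier_coeff (\<lambda>x. \<Sum>k\<in>J. a k * mode k x) k) \<longlongrightarrow> fourier_coeff (fourier_series a) k) (finite_subsets_at_top UNIV)"
  proof (rule tendstoI)
    fix e :: real assume e: "e > 0"
    then have "e / 2 > 0" by simp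
    from uniform_limitD[OF fourier_series_uniform[OF a] this]
    show "\<forall>\<^sub>F J in finite_subsets_at_top UNIV. dist (fourier_coeff (\<lambda>x. \<Sum>k\<in>J. a k * mode k x) k) (fourier_coeff (fourier_series a) k) < e"
    proof eventually_elim
      case (elim J)
      have cJ: "circle_fun (\<lambda>x. \<Sum>k\<in>J. a k * mode k x)" by (intro circle_fun_sum circle_fun_mult) auto
      have "cmod (fourier_coeff (\<lambda>x. (\<Sum>k\<in>J. a k * mode k x) - fourier_series a x) k) \<le> e / 2"
        using elim by (intro fourier_coeff_bound circle_fun_diff cJ c) (auto simp: dist_norm intro: less_imp_le)
      then show ?case using e by (simp add: fourier_coeff_diff cJ c dist_norm)
    qed
  qed
  moreover have "\<forall>\<^sub>F J in finite_subsets_at_top UNIV. fourier_coeff (\<lambda>x. \<Sum>k\<in>J. a k * mode k x) k = a k"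
    unfolding eventually_finite_subsets_at_top
  proof (intro exI[of _ "{k}"] conjI allI impI)
    fix J :: "int set" assume "finite J \<and> {k} \<subseteq> J \<and> J \<subseteq> UNIV"
    then show "fourier_coeff (\<lambda>x. \<Sum>k\<in>J. a k * mode k x) k = a k"
      by (subst fourier_coeff_sum) (auto simp: circle_fun_mult fourier_coeff_cmult fourier_coeff_of_mode if_distrib cong: if_cong)
  qed auto
  ultimately have "((\<lambda>J. a k) \<longlongrightarrow> fourier_coeff (fourier_series a) k) (finite_subsets_at_top (UNIV :: int set))"
    by (rule Lim_transform_eventually)
  then show "fourier_coeff (fourier_series a) k = a k"
    using tendsto_unique[OF _ _ tendsto_const] finite_subsets_at_top_neq_bot by blast
  have "(\<lambda>k. norm (a k * mode k x)) summable_on UNIV" using a by (simp add: norm_mult)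
  from norm_infsum_bound[OF this] show "cmod (fourier_series a x) \<le> (\<Sum>\<^sub>\<infinity>k. cmod (a k))"
    by (simp add: fourier_series_def norm_mult)
qed

section \<open>Sobolev spaces\<close>

text \<open>The exponent is s/2, so that the square of \<open>wcoeff\<close> is the summand of the
  Sobolev norm and finite pieces of the norm are values of \<open>L2_set\<close>.\<close>

definition weight :: "real \<Rightarrow> int \<Rightarrow> real" where
  "weight s k = (1 + (2 * pi * of_int k)\<^sup>2) powr (s / 2)"

definition wcoeff :: "real \<Rightarrow> (real \<Rightarrow> complex) \<Rightarrow> int \<Rightarrow> real" where
  "wcoeff s f k = weight s k * cmod (fourier_coeff f k)"

abbreviation "Hs s \<equiv> vecs (sobolev_complex s)"
abbreviation "hnorm s \<equiv> vnorm (sobolev_complex s)"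

lemma one_le_bracket: "1 \<le> 1 + (2 * pi * of_int k)\<^sup>2"
  by simp

lemma weight_pos: "0 < weight s k"
  unfolding weight_def powr_gt_zero using one_le_bracket[of k] by linarith

lemma weight_nonneg [simp]: "0 \<le> weight s k"
  using weight_pos[of s k] by simp

lemma weight_mono: "s \<le> t \<Longrightarrow> weight s k \<le> weight t k"
  unfolding weight_def by (intro powr_mono) auto

lemma weight_0 [simp]: "weight 0 k = 1" "weight s 0 = 1"
  using one_le_bracket[of k] by (simp_all add: weight_def add_nonneg_eq_0_iff)

lemma weight_add: "weight (s + t) k = weight s k * weight t k"
  by (simp add: weight_def add_divide_distrib powr_add)

lemma wcoeff_nonneg [simp]: "0 \<le> wcoeff s f k"
  using weight_pos[of s k] by (simp add: wcoeff_def)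

lemma sobolev_term_eq: "sobolev_term s f k = (wcoeff s f k)\<^sup>2"
proof -
  have "(weight s k)\<^sup>2 = (1 + (2 * pi * of_int k)\<^sup>2) powr s"
    by (simp add: weight_def power2_eq_square flip: powr_add)
  then show ?thesis by (simp add: sobolev_term_def wcoeff_def power_mult_distrib)
qed

lemma Hs_iff: "f \<in> Hs s \<longleftrightarrow> circle_fun f \<and> (\<lambda>k. (wcoeff s f k)\<^sup>2) summable_on UNIV"
proof -
  have "sobolev_term s f = (\<lambda>k. (wcoeff s f k)\<^sup>2)" by (simp add: fun_eq_iff sobolev_term_eq)
  then show ?thesis by (auto simp: sobolev_complex_def circle_fun_def)
qed

lemma hnorm_eq: "hnorm s f = sqrt (\<Sum>\<^sub>\<infinity>k. (wcoeff s f k)\<^sup>2)"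
proof -
  have "sobolev_term s f = (\<lambda>k. (wcoeff s f k)\<^sup>2)" by (simp add: fun_eq_iff sobolev_term_eq)
  then show ?thesis by (simp add: sobolev_complex_def)
qed

lemma Hs_circle: "f \<in> Hs s \<Longrightarrow> circle_fun f"
  by (simp add: Hs_iff)

lemma hnorm_nonneg: "0 \<le> hnorm s f"
  by (simp add: hnorm_eq infsum_nonneg)

lemma L2_set_le_hnorm:
  assumes "f \<in> Hs s" "finite F"
  shows "L2_set (wcoeff s f) F \<le> hnorm s f"
  unfolding L2_set_def hnorm_eq using assms by (intro real_sqrt_le_mono finite_sum_le_infsum) (auto simp: Hs_iff)

text \<open>Norm estimates are thereby made on finite index sets, where the triangle inequality of
  \<open>L2_set\<close> is at hand; \<open>L2_set_le_hnorm\<close> is the way back.\<close>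

lemma Hs_boundI:
  assumes f: "circle_fun f" and b: "\<And>F. finite F \<Longrightarrow> L2_set (wcoeff s f) F \<le> B"
  shows "f \<in> Hs s" "hnorm s f \<le> B"
proof -
  have B: "0 \<le> B" using b[of "{}"] by simp
  have le: "(\<Sum>k\<in>F. (wcoeff s f k)\<^sup>2) \<le> B\<^sup>2" if "finite F" for F
    using b[OF that] unfolding L2_set_def by (rule sqrt_le_D)
  have sum: "(\<lambda>k. (wcoeff s f k)\<^sup>2) summable_on UNIV"
    by (rule nonneg_bdd_above_summable_on) (auto intro!: bdd_aboveI2[where M = "B\<^sup>2"] le)
  then show "f \<in> Hs s" using f by (simp add: Hs_iff)
  have "(\<Sum>\<^sub>\<infinity>k. (wcoeff s f k)\<^sup>2) \<le> B\<^sup>2" by (rule infsum_le_finite_sums[OF sum]) (rule le)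
  then show "hnorm s f \<le> B" unfolding hnorm_eq using B by (intro real_le_lsqrt) (auto intro: infsum_nonneg)
qed

lemma wcoeff_le_hnorm: "f \<in> Hs s \<Longrightarrow> wcoeff s f k \<le> hnorm s f"
  using L2_set_le_hnorm[of f s "{k}"] by simp

lemma Hs_dominated:
  assumes g: "circle_fun g" and f: "f \<in> Hs s" and C: "0 \<le> C" "\<And>k. wcoeff t g k \<le> C * wcoeff s f k"
  shows "g \<in> Hs t" "hnorm t g \<le> C * hnorm s f"
proof -
  have "L2_set (wcoeff t g) F \<le> C * hnorm s f" if F: "finite F" for F
  proof -
    have "L2_set (wcoeff t g) F \<le> L2_set (\<lambda>k. C * wcoeff s f k) F" by (rule L2_set_mono) (use C in auto)
    also have "\<dots> = C * L2_set (wcoeff s f) F" using C by (simp add: L2_set_right_distrib)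
    finally show ?thesis using mult_left_mono[OF L2_set_le_hnorm[OF f F] C(1)] by linarith
  qed
  then show "g \<in> Hs t" "hnorm t g \<le> C * hnorm s f" using Hs_boundI[OF g] by blast+
qed

lemma Hs_mono:
  assumes "f \<in> Hs s" "t \<le> s"
  shows "f \<in> Hs t" "hnorm t f \<le> hnorm s f"
proof -
  have "wcoeff t f k \<le> 1 * wcoeff s f k" for k
    unfolding wcoeff_def using mult_right_mono[OF weight_mono[OF assms(2)], of "cmod (fourier_coeff f k)" k] by simp
  from Hs_dominated[OF Hs_circle[OF assms(1)] assms(1) _ this] show "f \<in> Hs t" "hnorm t f \<le> hnorm s f" by auto
qed

lemma Hs_0:
  assumes "circle_fun f" "\<And>x. cmod (f x) \<le> B"
  shows "f \<in> Hs 0" "hnorm 0 f \<le> B"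
proof -
  have "0 \<le> B" using assms(2)[of 0] by (rule order_trans[OF norm_ge_zero])
  then have "L2_set (wcoeff 0 f) F \<le> B" if "finite F" for F
    unfolding L2_set_def wcoeff_def using bessel[OF assms that] by (intro real_le_lsqrt) (auto simp: sum_nonneg)
  then show "f \<in> Hs 0" "hnorm 0 f \<le> B" using Hs_boundI[OF assms(1)] by blast+
qed

lemma Hs_const: "(\<lambda>x. c) \<in> Hs s" "hnorm s (\<lambda>x. c) \<le> cmod c"
proof -
  have "L2_set (wcoeff s (\<lambda>x. c)) F \<le> cmod c" if "finite F" for F
  proof -
    have "L2_set (wcoeff s (\<lambda>x. c)) F \<le> (\<Sum>k\<in>F. if k = 0 then cmod c else 0)"
      by (rule order_trans[OF L2_set_le_sum]) (auto simp: wcoeff_def fourier_coeff_const intro!: sum_mono)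
    also have "\<dots> \<le> cmod c" using that by auto
    finally show ?thesis .
  qed
  then show "(\<lambda>x. c) \<in> Hs s" "hnorm s (\<lambda>x. c) \<le> cmod c" using Hs_boundI[OF circle_fun_const] by blast+
qed

lemma Hs_mode: "mode j \<in> Hs s"
proof -
  have "L2_set (wcoeff s (mode j)) F \<le> weight s j" if "finite F" for F
  proof -
    have "L2_set (wcoeff s (mode j)) F \<le> (\<Sum>k\<in>F. if k = j then weight s j else 0)"
      by (rule order_trans[OF L2_set_le_sum]) (auto simp: wcoeff_def fourier_coeff_of_mode intro!: sum_mono)
    also have "\<dots> \<le> weight s j" using that by auto
    finally show ?thesis .
  qed
  then show ?thesis using Hs_boundI[OF circle_fun_mode] by blast
qed

lemma Hs_add:
  assumes f: "f \<in> Hs s" and g: "g \<in> Hs s"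
  shows "(\<lambda>x. f x + g x) \<in> Hs s" "hnorm s (\<lambda>x. f x + g x) \<le> hnorm s f + hnorm s g"
proof -
  note c = Hs_circle[OF f] Hs_circle[OF g]
  have w: "wcoeff s (\<lambda>x. f x + g x) k \<le> wcoeff s f k + wcoeff s g k" for k
    unfolding wcoeff_def fourier_coeff_add[OF c] distrib_left[symmetric]
    using weight_pos[of s k] by (intro mult_left_mono norm_triangle_ineq) auto
  have "L2_set (wcoeff s (\<lambda>x. f x + g x)) F \<le> hnorm s f + hnorm s g" if F: "finite F" for F
  proof -
    have "L2_set (wcoeff s (\<lambda>x. f x + g x)) F \<le> L2_set (\<lambda>k. wcoeff s f k + wcoeff s g k) F"
      by (rule L2_set_mono) (use w in auto)
    also have "\<dots> \<le> L2_set (wcoeff s f) F + L2_set (wcoeff s g) F" by (rule L2_set_triangle_ineq)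
    also have "\<dots> \<le> hnorm s f + hnorm s g" by (intro add_mono L2_set_le_hnorm f g F)
    finally show ?thesis .
  qed
  then show "(\<lambda>x. f x + g x) \<in> Hs s" "hnorm s (\<lambda>x. f x + g x) \<le> hnorm s f + hnorm s g"
    using Hs_boundI[OF circle_fun_add[OF c]] by blast+
qed

lemma wcoeff_cmult: "wcoeff s (\<lambda>x. c * f x) k = cmod c * wcoeff s f k"
  by (simp add: wcoeff_def fourier_coeff_cmult norm_mult)

lemma Hs_cmult:
  assumes "f \<in> Hs s"
  shows "(\<lambda>x. c * f x) \<in> Hs s" "hnorm s (\<lambda>x. c * f x) = cmod c * hnorm s f"
proof -
  show "(\<lambda>x. c * f x) \<in> Hs s"
    by (rule Hs_dominated(1)[OF circle_fun_mult[OF circle_fun_const Hs_circle[OF assms]] assms, of "cmod c"])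
       (auto simp: wcoeff_cmult)
  have "(\<Sum>\<^sub>\<infinity>k. (wcoeff s (\<lambda>x. c * f x) k)\<^sup>2) = (cmod c)\<^sup>2 * (\<Sum>\<^sub>\<infinity>k. (wcoeff s f k)\<^sup>2)"
    unfolding wcoeff_cmult power_mult_distrib by (rule infsum_cmult_right')
  then show "hnorm s (\<lambda>x. c * f x) = cmod c * hnorm s f"
    by (simp add: hnorm_eq real_sqrt_mult)
qed

lemma Hs_cnj:
  assumes "f \<in> Hs s"
  shows "(\<lambda>x. cnj (f x)) \<in> Hs s" "hnorm s (\<lambda>x. cnj (f x)) \<le> hnorm s f"
proof -
  have w: "wcoeff s (\<lambda>x. cnj (f x)) k = wcoeff s f (- k)" for k
    by (simp add: wcoeff_def fourier_coeff_cnj weight_def)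
  have "L2_set (wcoeff s (\<lambda>x. cnj (f x))) F \<le> hnorm s f" if F: "finite F" for F
  proof -
    have "L2_set (wcoeff s (\<lambda>x. cnj (f x))) F = L2_set (wcoeff s f) (uminus ` F)"
      unfolding L2_set_def w by (subst sum.reindex) auto
    then show ?thesis using L2_set_le_hnorm[OF assms, of "uminus ` F"] F by simp
  qed
  then show "(\<lambda>x. cnj (f x)) \<in> Hs s" "hnorm s (\<lambda>x. cnj (f x)) \<le> hnorm s f"
    using Hs_boundI[OF circle_fun_cnj[OF Hs_circle[OF assms]]] by blast+
qed

text \<open>Definiteness of the norm rests on the uniqueness theorem for Fourier
  coefficients.\<close>

lemma Hs_hnorm_0:
  assumes "f \<in> Hs s" "hnorm s f = 0"
  shows "f = (\<lambda>x. 0)"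
proof (rule fourier_coeff_unique_0[OF Hs_circle[OF assms(1)]])
  fix k
  have "wcoeff s f k \<le> 0" using wcoeff_le_hnorm[OF assms(1), of k] assms(2) by simp
  then have "wcoeff s f k = 0" using wcoeff_nonneg[of s f k] by linarith
  then show "fourier_coeff f k = 0" using weight_pos[of s k] by (simp add: wcoeff_def)
qed

lemma normed_sobolev_complex: "normed_nspace (sobolev_complex s)"
  unfolding normed_nspace_def
proof (intro conjI ballI allI)
  have sc: "r *\<^sub>R f = (\<lambda>x. of_real r * f x)" for r and f :: "real \<Rightarrow> complex"
    by (simp add: fun_eq_iff scaleR_conv_of_real)
  have pl: "f + g = (\<lambda>x. f x + g x)" for f g :: "real \<Rightarrow> complex" by (simp add: fun_eq_iff)
  have z: "(0 :: real \<Rightarrow> complex) = (\<lambda>x. 0)" by (simp add: fun_eq_iff)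
  show "subspace (Hs s)"
    unfolding subspace_def using Hs_add(1) Hs_cmult(1) Hs_const(1)[of 0] by (simp add: sc pl z)
  fix f assume f: "f \<in> Hs s"
  show "0 \<le> hnorm s f" by (rule hnorm_nonneg)
  show "(hnorm s f = 0) = (f = 0)"
    using Hs_hnorm_0[OF f] Hs_const(2)[of s 0] hnorm_nonneg[of s "\<lambda>x. 0"] by (auto simp: z)
  show "hnorm s (r *\<^sub>R f) = \<bar>r\<bar> * hnorm s f" for r using Hs_cmult(2)[OF f, of "of_real r"] by (simp add: sc)
  show "hnorm s (f + g) \<le> hnorm s f + hnorm s g" if "g \<in> Hs s" for g using Hs_add(2)[OF f that] by (simp add: pl)
qed

lemma L2_set_sum:
  "L2_set (\<lambda>k. \<Sum>j\<in>J. c j k) F \<le> (\<Sum>j\<in>J. L2_set (c j) F)"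
proof (induction J rule: infinite_finite_induct)
  case (insert j J)
  then show ?case using L2_set_triangle_ineq[of "c j" "\<lambda>k. \<Sum>j\<in>J. c j k" F] by simp
qed (simp_all add: L2_set_def)

subsection \<open>Embedding into continuous functions and the algebra property\<close>

lemma summable_weight:
  assumes "s > 1/2"
  shows "(\<lambda>k. (weight (- s) k)\<^sup>2) summable_on UNIV"
proof -
  have w: "(weight (- s) k)\<^sup>2 = (1 + (2 * pi * of_int k)\<^sup>2) powr (- s)" for k
    by (simp add: weight_def power2_eq_square flip: powr_add)
  have "summable (\<lambda>n. (weight (- s) (int n))\<^sup>2)"
  proof (rule summable_comparison_test'[where N = 1])
    show "summable (\<lambda>n. real n powr (- 2 * s))" using assms by (simp add: summable_real_powr_iff)
    fix n :: nat assume n: "n \<ge> 1"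
    have "1 \<le> 2 * pi" using pi_gt3 by simp
    then have "(real n)\<^sup>2 \<le> (2 * pi * real n)\<^sup>2"
      using mult_right_mono[of 1 "2 * pi" "real n"] by (intro power_mono) auto
    moreover have "0 < (real n)\<^sup>2" using n by simp
    ultimately have "(1 + (2 * pi * real n)\<^sup>2) powr (- s) \<le> ((real n)\<^sup>2) powr (- s)"
      using n assms by (intro powr_mono2') linarith+
    also have "\<dots> = real n powr (- 2 * s)" using n by (simp add: powr_powr flip: powr_numeral)
    finally show "norm ((weight (- s) (int n))\<^sup>2) \<le> real n powr (- 2 * s)" by (simp add: w)
  qed
  then have nat: "(\<lambda>n. (weight (- s) (int n))\<^sup>2) summable_on UNIV"
    by (subst summable_on_UNIV_nonneg_real_iff) auto
  have 1: "(\<lambda>k. (weight (- s) k)\<^sup>2) summable_on range int"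
    using nat by (subst summable_on_reindex) (auto simp: o_def)
  have "inj (\<lambda>n. - int n)" by (auto simp: inj_def)
  then have 2: "(\<lambda>k. (weight (- s) k)\<^sup>2) summable_on range (\<lambda>n. - int n)"
    using nat by (subst summable_on_reindex) (auto simp: o_def weight_def)
  have "k \<in> range int \<union> range (\<lambda>n. - int n)" for k :: int
    by (cases k rule: int_cases2) auto
  \<comment> \<open>Zero lies in both half lines and is removed from the second.\<close>
  then have "UNIV = range int \<union> (range (\<lambda>n. - int n) - range int)" by blast
  then show ?thesis
    using summable_on_Un_disjoint[OF 1 summable_on_subset_banach[OF 2, of "range (\<lambda>n. - int n) - range int"]] by auto
qed

text \<open>The l2 norm of the inverse weights, hence the constant of the Cauchy-Schwarz estimate
  below and of the Sobolev embedding for s > 1/2.\<close>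

definition embedding_const :: "real \<Rightarrow> real" where
  "embedding_const s = sqrt (\<Sum>\<^sub>\<infinity>k. (weight (- s) k)\<^sup>2)"

lemma embedding_const_nonneg: "0 \<le> embedding_const s"
  by (simp add: embedding_const_def infsum_nonneg)

text \<open>Cauchy-Schwarz after inserting \<open>weight (- s) k * weight s k = 1\<close>.\<close>

lemma sum_coeff_le:
  assumes s: "s > 1/2" and F: "finite F" and B: "L2_set (\<lambda>k. weight s k * cmod (a k)) F \<le> B"
  shows "(\<Sum>k\<in>F. cmod (a k)) \<le> embedding_const s * B"
proof -
  have "weight (- s) k * weight s k = 1" for k using weight_add[of "- s" s k] by simp
  then have "(\<Sum>k\<in>F. cmod (a k)) = (\<Sum>k\<in>F. \<bar>weight (- s) k\<bar> * \<bar>weight s k * cmod (a k)\<bar>)"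
    using weight_pos by (simp add: abs_mult abs_of_pos mult.assoc[symmetric])
  also have "\<dots> \<le> L2_set (weight (- s)) F * L2_set (\<lambda>k. weight s k * cmod (a k)) F"
    by (rule L2_set_mult_ineq)
  also have "L2_set (weight (- s)) F \<le> embedding_const s"
    unfolding L2_set_def embedding_const_def using summable_weight[OF s] F
    by (intro real_sqrt_le_mono finite_sum_le_infsum) auto
  then have "L2_set (weight (- s)) F * L2_set (\<lambda>k. weight s k * cmod (a k)) F \<le> embedding_const s * B"
    using B embedding_const_nonneg by (intro mult_mono) auto
  finally show ?thesis .
qed

text \<open>Coefficients with finite weighted norm are summable, so their series converges
  uniformly. Derivatives and limits of Cauchy sequences are constructed from their coefficients in
  this way.\<close>

lemma Hs_synthesis:
  assumes s: "s > 1/2" and B: "\<And>F. finite F \<Longrightarrow> L2_set (\<lambda>k. weight s k * cmod (a k)) F \<le> B"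
  shows "(\<lambda>k. cmod (a k)) summable_on UNIV" "fourier_series a \<in> Hs s" "hnorm s (fourier_series a) \<le> B"
    "cmod (fourier_series a x) \<le> embedding_const s * B"
proof -
  note le = sum_coeff_le[OF s _ B]
  show sum: "(\<lambda>k. cmod (a k)) summable_on UNIV"
    by (rule nonneg_bdd_above_summable_on) (auto intro!: bdd_aboveI2[where M = "embedding_const s * B"] le)
  note fs = fourier_series[OF sum]
  have w: "wcoeff s (fourier_series a) = (\<lambda>k. weight s k * cmod (a k))" by (simp add: fun_eq_iff wcoeff_def fs)
  show "fourier_series a \<in> Hs s" "hnorm s (fourier_series a) \<le> B"
    using Hs_boundI[OF fs(1), of s B] B by (simp_all add: w)
  have "(\<Sum>\<^sub>\<infinity>k. cmod (a k)) \<le> embedding_const s * B"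
    by (rule infsum_le_finite_sums[OF sum]) (rule le)
  then show "cmod (fourier_series a x) \<le> embedding_const s * B" using fs(3)[of x] by linarith
qed

text \<open>The sum of the series has the coefficients of f, and these determine a continuous
  periodic function. The bound for the sum is then the Sobolev embedding.\<close>

lemma Hs_fourier_series:
  assumes s: "s > 1/2" and f: "f \<in> Hs s"
  shows "(\<lambda>k. cmod (fourier_coeff f k)) summable_on UNIV" "fourier_series (fourier_coeff f) = f"
    "cmod (f x) \<le> embedding_const s * hnorm s f" "finite F \<Longrightarrow> (\<Sum>k\<in>F. cmod (fourier_coeff f k)) \<le> embedding_const s * hnorm s f"
proof -
  have B: "L2_set (\<lambda>k. weight s k * cmod (fourier_coeff f k)) F \<le> hnorm s f" if "finite F" for F
    using L2_set_le_hnorm[OF f that] by (simp add: wcoeff_def[abs_def])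
  note syn = Hs_synthesis[OF s B]
  show sum: "(\<lambda>k. cmod (fourier_coeff f k)) summable_on UNIV" by (rule syn(1))
  show eq: "fourier_series (fourier_coeff f) = f"
    by (rule fourier_coeff_unique) (use fourier_series[OF sum] Hs_circle[OF f] in auto)
  show "cmod (f x) \<le> embedding_const s * hnorm s f" using syn(4)[of x] by (simp add: eq)
  show "finite F \<Longrightarrow> (\<Sum>k\<in>F. cmod (fourier_coeff f k)) \<le> embedding_const s * hnorm s f" using sum_coeff_le[OF s _ B] .
qed

text \<open>One of j and k - j has at least half the modulus of k, so the bracket of k is at most 4
  times the larger of the two brackets; 4 to the power s/2 is the constant.\<close>

lemma weight_triangle:
  assumes "0 \<le> s"
  shows "weight s k \<le> 2 powr s * (weight s j + weight s (k - j))"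
proof -
  let ?b = "\<lambda>k::int. 1 + (2 * pi * real_of_int k)\<^sup>2"
  have "(x + y)\<^sup>2 \<le> 2 * x\<^sup>2 + 2 * y\<^sup>2" for x y :: real
    using sum_squares_bound[of x y] by (simp add: power2_sum)
  from this[of "2 * pi * of_int j" "2 * pi * of_int (k - j)"]
  have "?b k \<le> 4 * max (?b j) (?b (k - j))" by (simp add: algebra_simps max_def)
  then have "?b k powr (s / 2) \<le> (4 * max (?b j) (?b (k - j))) powr (s / 2)"
    using assms by (intro powr_mono2) auto
  also have "\<dots> = 2 powr s * max (?b j) (?b (k - j)) powr (s / 2)"
    using powr_powr[of 2 2 "s / 2"] by (simp add: powr_mult)
  also have "max (?b j) (?b (k - j)) powr (s / 2) \<le> ?b j powr (s / 2) + ?b (k - j) powr (s / 2)"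
    by (simp add: max_def)
  finally show ?thesis by (simp add: weight_def)
qed

text \<open>Coefficients of the product are a convolution. By \<open>weight_triangle\<close> the
  weight falls on one factor, whose weighted coefficients are in l2, while those of the other factor
  are summable; Young's inequality for l1 and l2 gives the bound.\<close>

lemma Hs_mult:
  assumes s: "s > 1/2" and f: "f \<in> Hs s" and g: "g \<in> Hs s"
  shows "(\<lambda>x. f x * g x) \<in> Hs s"
    "hnorm s (\<lambda>x. f x * g x) \<le> (2 powr s * 2 * embedding_const s) * hnorm s f * hnorm s g"
proof -
  define C where "C = embedding_const s"
  note cf = Hs_circle[OF f] and cg = Hs_circle[OF g]
  note Hf = Hs_fourier_series[OF s f] and Hg = Hs_fourier_series[OF s g]
  let ?f = "fourier_coeff f" and ?g = "fourier_coeff g"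
  obtain B where B: "B > 0" "\<And>x. cmod (g x) \<le> B" using circle_fun_bounded[OF cg] by blast
  \<comment> \<open>The convolution is the limit over finite sets \<open>J\<close> of modes of f,
    because the partial sums of f converge uniformly and g is bounded.\<close>
  have conv: "((\<lambda>J. \<Sum>j\<in>J. ?f j * ?g (k - j)) \<longlongrightarrow> fourier_coeff (\<lambda>x. f x * g x) k) (finite_subsets_at_top UNIV)" for k
  proof (rule tendstoI)
    fix e :: real assume e: "e > 0"
    then have "e / (2 * B) > 0" using B by simp
    from uniform_limitD[OF fourier_series_uniform[OF Hf(1)] this]
    show "\<forall>\<^sub>F J in finite_subsets_at_top UNIV. dist (\<Sum>j\<in>J. ?f j * ?g (k - j)) (fourier_coeff (\<lambda>x. f x * g x) k) < e"
    proof eventually_elim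
      case (elim J)
      let ?p = "\<lambda>x. \<Sum>j\<in>J. ?f j * mode j x"
      have cp: "circle_fun ?p" by (intro circle_fun_sum circle_fun_mult) auto
      have "cmod ((?p x - f x) * g x) \<le> e / (2 * B) * B" for x
        unfolding norm_mult using elim B Hf(2) e by (intro mult_mono) (auto simp: dist_norm intro: less_imp_le)
      then have "cmod (fourier_coeff (\<lambda>x. (?p x - f x) * g x) k) \<le> e / (2 * B) * B"
        by (intro fourier_coeff_bound circle_fun_mult circle_fun_diff cp cf cg)
      moreover have "fourier_coeff (\<lambda>x. (?p x - f x) * g x) k = fourier_coeff (\<lambda>x. ?p x * g x) k - fourier_coeff (\<lambda>x. f x * g x) k"
        unfolding left_diff_distrib by (rule fourier_coeff_diff) (intro circle_fun_mult cp cf cg)+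
      moreover have "fourier_coeff (\<lambda>x. ?p x * g x) k = (\<Sum>j\<in>J. ?f j * ?g (k - j))"
        unfolding sum_distrib_right mult.assoc
        by (subst fourier_coeff_sum) (auto intro!: circle_fun_mult cg simp: fourier_coeff_cmult fourier_coeff_mult_mode)
      ultimately show ?case using e B by (simp add: dist_norm)
    qed
  qed
  have young: "L2_set (\<lambda>k. \<Sum>j\<in>J. cmod (fourier_coeff u j) * wcoeff s v (k - j)) F \<le> C * hnorm s u * hnorm s v"
    if F: "finite F" and J: "finite J" and u: "u \<in> Hs s" and v: "v \<in> Hs s" for F J u v
  proof -
    have "L2_set (\<lambda>k. \<Sum>j\<in>J. cmod (fourier_coeff u j) * wcoeff s v (k - j)) F
       \<le> (\<Sum>j\<in>J. L2_set (\<lambda>k. cmod (fourier_coeff u j) * wcoeff s v (k - j)) F)" by (rule L2_set_sum)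
    also have "\<dots> \<le> (\<Sum>j\<in>J. cmod (fourier_coeff u j) * hnorm s v)"
    proof (rule sum_mono)
      fix j
      have "L2_set (\<lambda>k. wcoeff s v (k - j)) F = L2_set (wcoeff s v) ((\<lambda>k. k - j) ` F)"
        unfolding L2_set_def by (subst sum.reindex) (auto simp: inj_on_def)
      then have "L2_set (\<lambda>k. wcoeff s v (k - j)) F \<le> hnorm s v"
        using L2_set_le_hnorm[OF v, of "(\<lambda>k. k - j) ` F"] F by simp
      then show "L2_set (\<lambda>k. cmod (fourier_coeff u j) * wcoeff s v (k - j)) F \<le> cmod (fourier_coeff u j) * hnorm s v"
        by (simp add: mult_left_mono flip: L2_set_right_distrib)
    qed
    also have "\<dots> \<le> (C * hnorm s u) * hnorm s v"
      unfolding sum_distrib_right[symmetric] C_def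
      by (intro mult_right_mono Hs_fourier_series(4)[OF s u J] hnorm_nonneg)
    finally show ?thesis .
  qed
  define K where "K = 2 powr s * (C * hnorm s g * hnorm s f + C * hnorm s f * hnorm s g)"
  have partial: "L2_set (\<lambda>k. weight s k * cmod (\<Sum>j\<in>J. ?f j * ?g (k - j))) F \<le> K"
    if F: "finite F" and J: "finite J" for F J
  proof -
    \<comment> \<open>The range of l = k - j depends on k; \<open>L\<close> contains all of these
      ranges, so that the finite Young estimate applies with one index set.\<close>
    define L where "L = (\<lambda>(k, j). k - j) ` (F \<times> J)"
    have L: "finite L" unfolding L_def using F J by simp
    have "weight s k * cmod (\<Sum>j\<in>J. ?f j * ?g (k - j))
       \<le> 2 powr s * ((\<Sum>l\<in>L. cmod (?g l) * wcoeff s f (k - l)) + (\<Sum>j\<in>J. cmod (?f j) * wcoeff s g (k - j)))"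
      if k: "k \<in> F" for k
    proof -
      have "weight s k * cmod (\<Sum>j\<in>J. ?f j * ?g (k - j)) \<le> weight s k * (\<Sum>j\<in>J. cmod (?f j) * cmod (?g (k - j)))"
        using weight_pos[of s k] by (intro mult_left_mono order_trans[OF norm_sum]) (auto simp: norm_mult)
      also have "\<dots> = (\<Sum>j\<in>J. weight s k * (cmod (?f j) * cmod (?g (k - j))))" by (rule sum_distrib_left)
      also have "\<dots> \<le> (\<Sum>j\<in>J. (2 powr s * (weight s j + weight s (k - j))) * (cmod (?f j) * cmod (?g (k - j))))"
        using s by (intro sum_mono mult_right_mono weight_triangle) auto
      also have "\<dots> = 2 powr s * ((\<Sum>j\<in>J. cmod (?g (k - j)) * wcoeff s f j) + (\<Sum>j\<in>J. cmod (?f j) * wcoeff s g (k - j)))"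
        by (simp add: wcoeff_def sum_distrib_left algebra_simps sum.distrib)
      also have "(\<Sum>j\<in>J. cmod (?g (k - j)) * wcoeff s f j) = (\<Sum>l\<in>(\<lambda>j. k - j) ` J. cmod (?g l) * wcoeff s f (k - l))"
        by (subst sum.reindex) (auto simp: inj_on_def)
      also have "\<dots> \<le> (\<Sum>l\<in>L. cmod (?g l) * wcoeff s f (k - l))"
        using k L by (intro sum_mono2) (auto simp: L_def)
      finally show ?thesis by (simp add: mult_left_mono)
    qed
    then have "L2_set (\<lambda>k. weight s k * cmod (\<Sum>j\<in>J. ?f j * ?g (k - j))) F
      \<le> L2_set (\<lambda>k. 2 powr s * ((\<Sum>l\<in>L. cmod (?g l) * wcoeff s f (k - l)) + (\<Sum>j\<in>J. cmod (?f j) * wcoeff s g (k - j)))) F"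
      using weight_pos by (intro L2_set_mono) (auto intro!: mult_nonneg_nonneg less_imp_le)
    also have "\<dots> = 2 powr s * L2_set (\<lambda>k. (\<Sum>l\<in>L. cmod (?g l) * wcoeff s f (k - l)) + (\<Sum>j\<in>J. cmod (?f j) * wcoeff s g (k - j))) F"
      by (simp add: L2_set_right_distrib)
    also have "\<dots> \<le> K"
      unfolding K_def
      by (intro mult_left_mono order_trans[OF L2_set_triangle_ineq] add_mono young F J L f g) auto
    finally show ?thesis .
  qed
  have bound: "L2_set (wcoeff s (\<lambda>x. f x * g x)) F \<le> K" if F: "finite F" for F
  proof (rule tendsto_upperbound)
    show "((\<lambda>J. L2_set (\<lambda>k. weight s k * cmod (\<Sum>j\<in>J. ?f j * ?g (k - j))) F) \<longlongrightarrow> L2_set (wcoeff s (\<lambda>x. f x * g x)) F) (finite_subsets_at_top UNIV)"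
      unfolding L2_set_def wcoeff_def by (intro tendsto_intros conv)
    show "\<forall>\<^sub>F J in finite_subsets_at_top UNIV. L2_set (\<lambda>k. weight s k * cmod (\<Sum>j\<in>J. ?f j * ?g (k - j))) F \<le> K"
      unfolding eventually_finite_subsets_at_top using partial[OF F] by (intro exI[of _ "{}"]) auto
  qed (simp add: finite_subsets_at_top_neq_bot)
  note fin = Hs_boundI[OF circle_fun_mult[OF cf cg] bound]
  show "(\<lambda>x. f x * g x) \<in> Hs s" by (rule fin)
  have "K = (2 powr s * 2 * embedding_const s) * hnorm s f * hnorm s g" by (simp add: K_def C_def)
  then show "hnorm s (\<lambda>x. f x * g x) \<le> (2 powr s * 2 * embedding_const s) * hnorm s f * hnorm s g"
    using fin(2) by simp
qed

definition algebra_const :: "real \<Rightarrow> real" where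
  "algebra_const s = 2 powr s * 2 * embedding_const s"

lemma algebra_const_nonneg: "0 \<le> algebra_const s"
  using embedding_const_nonneg[of s] by (simp add: algebra_const_def)

lemmas Hs_mult' = Hs_mult[folded algebra_const_def]

subsection \<open>Completeness\<close>

text \<open>Each coefficient converges. On finite index sets the second index of the Cauchy
  condition can tend to infinity, which bounds the distance to the limit uniformly;
  \<open>Hs_synthesis\<close> turns the limit coefficients into a function.\<close>

lemma banach_sobolev_complex:
  assumes s: "s > 1/2"
  shows "banach_nspace (sobolev_complex s)"
proof (rule banach_nspaceI[OF normed_sobolev_complex])
  fix X assume X: "\<And>n::nat. X n \<in> Hs s" and cauchy: "\<And>\<epsilon>. \<epsilon> > 0 \<Longrightarrow> \<exists>N. \<forall>i\<ge>N. \<forall>j\<ge>N. hnorm s (X i - X j) < \<epsilon>"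
  note n = normed_sobolev_complex[of s]
  note c = Hs_circle[OF X]
  have df: "fourier_coeff (X i - X j) k = fourier_coeff (X i) k - fourier_coeff (X j) k" for i j k
    using fourier_coeff_diff[OF c c, of i j k] by (simp add: fun_diff_def)
  have D: "X i - X j \<in> Hs s" for i j by (rule nspace_diff[OF n X X])
  have "convergent (\<lambda>i. fourier_coeff (X i) k)" for k
  proof (rule Cauchy_convergent, rule CauchyI)
    fix e :: real assume "e > 0"
    then have "weight s k * e > 0" using weight_pos by simp
    from cauchy[OF this] obtain N where N: "\<And>i j. i \<ge> N \<Longrightarrow> j \<ge> N \<Longrightarrow> hnorm s (X i - X j) < weight s k * e" by blast
    have "cmod (fourier_coeff (X i) k - fourier_coeff (X j) k) < e" if "i \<ge> N" "j \<ge> N" for i j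
    proof -
      have "weight s k * cmod (fourier_coeff (X i) k - fourier_coeff (X j) k) < weight s k * e"
        using wcoeff_le_hnorm[OF D, of i j k] N[OF that] by (simp add: wcoeff_def df)
      then show ?thesis using weight_pos[of s k] by simp
    qed
    then show "\<exists>M. \<forall>m\<ge>M. \<forall>n\<ge>M. cmod (fourier_coeff (X m) k - fourier_coeff (X n) k) < e" by blast
  qed
  then obtain a where a: "\<And>k. (\<lambda>i. fourier_coeff (X i) k) \<longlonglongrightarrow> a k" unfolding convergent_def by metis
  have tail: "L2_set (\<lambda>k. weight s k * cmod (fourier_coeff (X i) k - a k)) F \<le> e"
    if F: "finite F" and N: "\<And>j. j \<ge> N \<Longrightarrow> hnorm s (X i - X j) < e" for F i e N
  proof (rule tendsto_upperbound)
    show "(\<lambda>j. L2_set (wcoeff s (X i - X j)) F) \<longlonglongrightarrow> L2_set (\<lambda>k. weight s k * cmod (fourier_coeff (X i) k - a k)) F"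
      unfolding L2_set_def wcoeff_def df by (intro tendsto_intros a)
    show "\<forall>\<^sub>F j in sequentially. L2_set (wcoeff s (X i - X j)) F \<le> e"
      using eventually_ge_at_top[of N]
      by eventually_elim (rule order_trans[OF L2_set_le_hnorm[OF D F] less_imp_le[OF N]])
  qed simp
  obtain N1 where N1: "\<And>i j. i \<ge> N1 \<Longrightarrow> j \<ge> N1 \<Longrightarrow> hnorm s (X i - X j) < 1" using cauchy[of 1] by auto
  have B: "L2_set (\<lambda>k. weight s k * cmod (a k)) F \<le> hnorm s (X N1) + 1" if F: "finite F" for F
  proof -
    have "L2_set (\<lambda>k. weight s k * cmod (a k)) F \<le> L2_set (\<lambda>k. wcoeff s (X N1) k + weight s k * cmod (fourier_coeff (X N1) k - a k)) F"
    proof (rule L2_set_mono)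
      fix k
      have "cmod (a k) \<le> cmod (fourier_coeff (X N1) k) + cmod (fourier_coeff (X N1) k - a k)"
        using norm_triangle_ineq4[of "fourier_coeff (X N1) k" "fourier_coeff (X N1) k - a k"] by simp
      then show "weight s k * cmod (a k) \<le> wcoeff s (X N1) k + weight s k * cmod (fourier_coeff (X N1) k - a k)"
        unfolding wcoeff_def distrib_left[symmetric] using weight_pos[of s k] by simp
      show "0 \<le> weight s k * cmod (a k)" using weight_pos[of s k] by simp
    qed
    also have "\<dots> \<le> L2_set (wcoeff s (X N1)) F + L2_set (\<lambda>k. weight s k * cmod (fourier_coeff (X N1) k - a k)) F"
      by (rule L2_set_triangle_ineq)
    also have "\<dots> \<le> hnorm s (X N1) + 1"
      by (intro add_mono L2_set_le_hnorm X F tail[OF F, of N1]) (use N1 in auto)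
    finally show ?thesis .
  qed
  note syn = Hs_synthesis[OF s B]
  note fs = fourier_series[OF syn(1)]
  let ?f = "fourier_series a"
  have wd: "wcoeff s (X i - ?f) = (\<lambda>k. weight s k * cmod (fourier_coeff (X i) k - a k))" for i
    using fourier_coeff_diff[OF c fs(1), of i] fs(2) by (simp add: fun_eq_iff wcoeff_def fun_diff_def)
  have "(\<lambda>i. hnorm s (X i - ?f)) \<longlonglongrightarrow> 0"
  proof (rule LIMSEQ_I)
    fix e :: real assume e: "e > 0"
    then obtain N where N: "\<And>i j. i \<ge> N \<Longrightarrow> j \<ge> N \<Longrightarrow> hnorm s (X i - X j) < e / 2" using cauchy[of "e / 2"] by auto
    have "hnorm s (X i - ?f) \<le> e / 2" if "i \<ge> N" for i
    proof (rule Hs_boundI(2))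
      show "circle_fun (X i - ?f)" using circle_fun_diff[OF c fs(1)] by (simp add: fun_diff_def)
      show "L2_set (wcoeff s (X i - ?f)) F \<le> e / 2" if "finite F" for F
        unfolding wd by (rule tail[OF that]) (rule N[OF \<open>i \<ge> N\<close>])
    qed
    then have "hnorm s (X i - ?f) < e" if "i \<ge> N" for i using that e by fastforce
    then show "\<exists>no. \<forall>n\<ge>no. norm (hnorm s (X n - ?f) - 0) < e"
      using hnorm_nonneg by (intro exI[of _ N]) auto
  qed
  then show "\<exists>x\<in>Hs s. (\<lambda>n. hnorm s (X n - x)) \<longlonglongrightarrow> 0" using syn(2) by blast
qed

subsection \<open>Derivatives and primitives\<close>

text \<open>The signed integral from 0 to x: at least one of the two intervals is empty or a
  point.\<close>

definition primitive :: "(real \<Rightarrow> 'a::banach) \<Rightarrow> real \<Rightarrow> 'a" where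
  "primitive g x = integral {0..x} g - integral {x..0} g"

lemma primitive_0 [simp]: "primitive g 0 = 0"
  by (simp add: primitive_def)

lemma primitive_has_vector_derivative:
  assumes g: "continuous_on UNIV g"
  shows "(primitive g has_vector_derivative g x) (at x)"
proof -
  \<comment> \<open>An interval with 0 and x in its interior, so that for either sign the primitive
    becomes an integral from one fixed left end, up to a constant.\<close>
  let ?a = "- \<bar>x\<bar> - 1" and ?b = "\<bar>x\<bar> + 1"
  have c: "continuous_on A g" for A using g by (rule continuous_on_subset) simp
  have i: "g integrable_on {u..v}" for u v by (intro integrable_continuous_real c)
  have eq: "primitive g y = integral {?a..y} g - integral {?a..0} g" if "y \<in> {?a..?b}" for y
  proof (cases "0 \<le> y")
    case True
    then show ?thesis
      using Henstock_Kurzweil_Integration.integral_combine[of ?a 0 y g] i that by (cases "y = 0") (auto simp: primitive_def algebra_simps)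
  next
    case False
    then show ?thesis
      using Henstock_Kurzweil_Integration.integral_combine[of ?a y 0 g] i that by (auto simp: primitive_def algebra_simps)
  qed
  have x: "x \<in> {?a..?b}" "x \<in> interior {?a..?b}" by (auto simp: abs_if)
  have "((\<lambda>y. integral {?a..y} g - integral {?a..0} g) has_vector_derivative g x - 0) (at x within {?a..?b})"
    by (intro has_vector_derivative_diff has_vector_derivative_const integral_has_vector_derivative c x)
  then have "(primitive g has_vector_derivative g x) (at x within {?a..?b})"
    unfolding has_vector_derivative_def by (intro has_derivative_transform[OF x(1) eq]) simp_all
  then show ?thesis using at_within_interior[OF x(2)] by metis
qed

lemma has_vector_derivative_continuous_on:
  assumes "\<And>x. (f has_vector_derivative f' x) (at x)"
  shows "continuous_on A f"
  by (intro continuous_at_imp_continuous_on ballI has_vector_derivative_continuous[OF assms])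

lemma vector_derivative_zero_const:
  fixes f :: "real \<Rightarrow> 'a::real_normed_vector"
  assumes "\<And>x. (f has_vector_derivative 0) (at x)"
  shows "f x = f y"
proof -
  have "(f has_derivative (\<lambda>h. 0)) (at x within UNIV)" for x
    using assms[of x] by (simp add: has_vector_derivative_def)
  from has_derivative_zero_constant[OF convex_UNIV this] obtain c where "\<forall>x\<in>UNIV. f x = c" ..
  then show ?thesis by simp
qed

lemma derivative_unique_const:
  fixes f g :: "real \<Rightarrow> 'a::real_normed_vector"
  assumes "\<And>x. (f has_vector_derivative d x) (at x)" "\<And>x. (g has_vector_derivative d x) (at x)"
  shows "f x - g x = f y - g y"
proof (rule vector_derivative_zero_const)
  show "((\<lambda>x. f x - g x) has_vector_derivative 0) (at x)" for x
    using has_vector_derivative_diff[OF assms(1)[of x] assms(2)[of x]] by simp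
qed

lemma shift_has_vector_derivative:
  fixes f :: "real \<Rightarrow> 'a::real_normed_vector"
  assumes "\<And>x. (f has_vector_derivative f' x) (at x)"
  shows "((\<lambda>x. f (x + c)) has_vector_derivative f' (x + c)) (at x)"
proof -
  have "((\<lambda>x. x + c) has_vector_derivative 1) (at x)"
    by (auto intro!: derivative_eq_intros simp flip: has_real_derivative_iff_has_vector_derivative)
  from vector_diff_chain_at[OF this assms] show ?thesis by (simp add: o_def)
qed

lemma primitive_unit: "continuous_on UNIV g \<Longrightarrow> primitive g 1 = integral {0..1} g"
  by (simp add: primitive_def)

lemma primitive_periodic:
  assumes g: "continuous_on UNIV g" "\<And>x. g (x + 1) = g x"
  shows "primitive g (x + 1) = primitive g x + integral {0..1} g"
proof -
  have "((\<lambda>x. primitive g (x + 1)) has_vector_derivative g x) (at x)" for x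
    using shift_has_vector_derivative[OF primitive_has_vector_derivative[OF g(1)], of 1 x] g(2) by simp
  from derivative_unique_const[OF this primitive_has_vector_derivative[OF g(1)], of x 0]
  show ?thesis using primitive_unit[OF g(1)] by (simp add: algebra_simps)
qed

text \<open>Compares \<open>weight 1\<close> with the modulus of the multiplier 2 pi i k of
  differentiation. The factor 2 absorbs the summand 1 of the bracket, which is possible for nonzero
  k.\<close>

lemma weight_1: "2 * pi * \<bar>of_int k\<bar> \<le> weight 1 k" "k \<noteq> 0 \<Longrightarrow> weight 1 k \<le> 2 * (2 * pi * \<bar>of_int k\<bar>)"
proof -
  have w: "(weight 1 k)\<^sup>2 = 1 + (2 * pi * of_int k)\<^sup>2"
    using one_le_bracket[of k] by (simp add: weight_def power2_eq_square flip: powr_add)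
  show "2 * pi * \<bar>of_int k\<bar> \<le> weight 1 k"
    by (rule power2_le_imp_le) (simp_all add: w power_mult_distrib)
  assume "k \<noteq> 0"
  then have "1 \<le> \<bar>real_of_int k\<bar>" by linarith
  then have "1 * 1 \<le> (2 * pi) * \<bar>real_of_int k\<bar>" using pi_gt3 by (intro mult_mono) auto
  then have "1\<^sup>2 \<le> (2 * pi * \<bar>real_of_int k\<bar>)\<^sup>2" by (intro power_mono) auto
  moreover have "(2 * pi * real_of_int k)\<^sup>2 = (2 * pi * \<bar>real_of_int k\<bar>)\<^sup>2" by (simp add: power_mult_distrib)
  moreover have "(2 * (2 * pi * \<bar>real_of_int k\<bar>))\<^sup>2 = 4 * (2 * pi * \<bar>real_of_int k\<bar>)\<^sup>2"
    unfolding power_mult_distrib[of 2 "2 * pi * \<bar>real_of_int k\<bar>"] by simp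
  ultimately have "(weight 1 k)\<^sup>2 \<le> (2 * (2 * pi * \<bar>of_int k\<bar>))\<^sup>2" unfolding w by simp
  then show "weight 1 k \<le> 2 * (2 * pi * \<bar>of_int k\<bar>)"
    by (rule power2_le_imp_le) simp
qed

text \<open>For nonzero k a coefficient of f is that of f' divided by 2 pi i k; the mean of f is
  controlled by the supremum. As \<open>t\<close> is arbitrary, the step can start at exponent
  0.\<close>

lemma Hs_raise:
  assumes f: "circle_fun f" and f': "f' \<in> Hs t" and d: "\<And>x. (f has_vector_derivative f' x) (at x)"
    and B: "\<And>x. cmod (f x) \<le> B"
  shows "f \<in> Hs (t + 1)" "hnorm (t + 1) f \<le> B + 2 * hnorm t f'"
proof -
  have w: "wcoeff (t + 1) f k \<le> (if k = 0 then B else 0) + 2 * wcoeff t f' k" for k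
  proof (cases "k = 0")
    case True
    then show ?thesis using fourier_coeff_bound[OF f B, of 0] by (simp add: wcoeff_def add_increasing2)
  next
    case False
    have "wcoeff (t + 1) f k = weight t k * (weight 1 k * cmod (fourier_coeff f k))"
      by (simp add: wcoeff_def weight_add)
    also have "\<dots> \<le> weight t k * (2 * (2 * pi * \<bar>of_int k\<bar>) * cmod (fourier_coeff f k))"
      by (intro mult_left_mono mult_right_mono weight_1(2) False) auto
    also have "\<dots> = 2 * wcoeff t f' k"
      by (simp add: wcoeff_def fourier_coeff_deriv[OF f Hs_circle[OF f'] d] norm_mult)
    finally show ?thesis using False by simp
  qed
  have B0: "0 \<le> B" using B[of 0] by (rule order_trans[OF norm_ge_zero])
  have "L2_set (wcoeff (t + 1) f) F \<le> B + 2 * hnorm t f'" if F: "finite F" for F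
  proof -
    have "L2_set (wcoeff (t + 1) f) F \<le> L2_set (\<lambda>k. (if k = 0 then B else 0) + 2 * wcoeff t f' k) F"
      by (rule L2_set_mono) (use w in auto)
    also have "\<dots> \<le> L2_set (\<lambda>k. if k = 0 then B else 0) F + L2_set (\<lambda>k. 2 * wcoeff t f' k) F"
      by (rule L2_set_triangle_ineq)
    also have "L2_set (\<lambda>k. if k = 0 then B else 0) F \<le> (\<Sum>k\<in>F. if k = 0 then B else 0)"
      by (rule L2_set_le_sum) (use B0 in auto)
    also have "\<dots> \<le> B" using F B0 by auto
    also have "L2_set (\<lambda>k. 2 * wcoeff t f' k) F = 2 * L2_set (wcoeff t f') F" by (simp add: L2_set_right_distrib)
    finally show ?thesis using L2_set_le_hnorm[OF f' F] by simp
  qed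
  then show "f \<in> Hs (t + 1)" "hnorm (t + 1) f \<le> B + 2 * hnorm t f'" using Hs_boundI[OF f] by blast+
qed

text \<open>A continuous candidate is synthesised from the coefficients multiplied by 2 pi i k, at
  exponent s - 1 > 1/2. Its primitive has the coefficients of f except for the mean, so it equals f
  up to a constant.\<close>

lemma Hs_deriv:
  assumes s: "s > 3/2" and f: "f \<in> Hs s"
  shows "\<exists>g\<in>Hs (s - 1). hnorm (s - 1) g \<le> hnorm s f \<and> (\<forall>x. (f has_vector_derivative g x) (at x))"
proof -
  define a where "a k = 2 * pi * \<i> * of_int k * fourier_coeff f k" for k
  have "L2_set (\<lambda>k. weight (s - 1) k * cmod (a k)) F \<le> hnorm s f" if F: "finite F" for F
  proof -
    have "weight (s - 1) k * cmod (a k) \<le> wcoeff s f k" for k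
    proof -
      have "weight (s - 1) k * cmod (a k) = weight (s - 1) k * (2 * pi * \<bar>of_int k\<bar> * cmod (fourier_coeff f k))"
        by (simp add: a_def norm_mult)
      also have "\<dots> \<le> weight (s - 1) k * (weight 1 k * cmod (fourier_coeff f k))"
        by (intro mult_left_mono mult_right_mono weight_1(1)) auto
      also have "\<dots> = wcoeff s f k" using weight_add[of "s - 1" 1 k] by (simp add: wcoeff_def)
      finally show ?thesis .
    qed
    then have "L2_set (\<lambda>k. weight (s - 1) k * cmod (a k)) F \<le> L2_set (wcoeff s f) F" by (intro L2_set_mono) auto
    then show ?thesis using L2_set_le_hnorm[OF f F] by linarith
  qed
  note syn = Hs_synthesis[of "s - 1" a, OF _ this]
  let ?g = "fourier_series a"
  have g: "?g \<in> Hs (s - 1)" "hnorm (s - 1) ?g \<le> hnorm s f" and ga: "fourier_coeff ?g k = a k" for k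
    using syn(2,3) fourier_series(2)[OF syn(1)] s by auto
  note cg = Hs_circle[OF g(1)] and cf = Hs_circle[OF f]
  have cont: "continuous_on UNIV ?g" and per: "?g (x + 1) = ?g x" for x using cg by (auto simp: circle_fun_def)
  let ?P = "primitive ?g"
  have d: "(?P has_vector_derivative ?g x) (at x)" for x by (rule primitive_has_vector_derivative[OF cont])
  \<comment> \<open>The candidate has mean 0, which makes its primitive periodic.\<close>
  have "integral {0..1} ?g = a 0" using ga[of 0] by (simp add: fourier_coeff_mode)
  then have "circle_fun ?P"
    using has_vector_derivative_continuous_on[OF d] primitive_periodic[OF cont per] by (simp add: circle_fun_def a_def)
  note cP = this
  have k: "fourier_coeff ?P k = fourier_coeff f k" if "k \<noteq> 0" for k
    using fourier_coeff_deriv[OF cP cg d, of k] ga[of k] that by (simp add: a_def)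
  define c where "c = fourier_coeff f 0 - fourier_coeff ?P 0"
  have "f = (\<lambda>x. ?P x + c)"
  proof (rule fourier_coeff_unique[OF cf circle_fun_add[OF cP circle_fun_const]])
    fix k show "fourier_coeff f k = fourier_coeff (\<lambda>x. ?P x + c) k"
      using k[of k] by (cases "k = 0") (auto simp: fourier_coeff_add[OF cP circle_fun_const] fourier_coeff_const c_def)
  qed
  moreover have "((\<lambda>x. ?P x + c) has_vector_derivative ?g x + 0) (at x)" for x
    by (intro has_vector_derivative_add d has_vector_derivative_const)
  ultimately have "(f has_vector_derivative ?g x) (at x)" for x by (metis add_0_right)
  then show ?thesis using g by blast
qed

section \<open>Composition with holomorphic functions\<close>

text \<open>Taylor remainders of \<open>f \<mapsto> n \<circ> f\<close> have the right order in the increment \<open>h\<close> first in the supremum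
  norm. As the derivative of such a remainder is a sum of products of remainders for \<open>n'\<close> with \<open>f'\<close> or \<open>h'\<close>,
  the Sobolev exponent of the norm in which the order is known can be raised by one, until it reaches \<open>s\<close>.\<close>

context
  fixes s \<delta> :: real
  assumes s: "s > 3/2" and \<delta>: "\<delta> \<le> 1"
begin

section \<open>Orders of vanishing for families indexed by an increment\<close>

definition small :: "(real \<Rightarrow> complex) set" where
  "small = {h \<in> Hs s. hnorm s h < \<delta>}"

text \<open>O-notation, uniform on \<open>small\<close>, for families indexed by the increment h. As
  \<delta> is at most 1, a higher order implies every lower one.\<close>

definition Hs_order :: "real \<Rightarrow> nat \<Rightarrow> ((real \<Rightarrow> complex) \<Rightarrow> real \<Rightarrow> complex) \<Rightarrow> bool" where
  "Hs_order t p \<phi> \<longleftrightarrow> (\<exists>C\<ge>0. \<forall>h\<in>small. \<phi> h \<in> Hs t \<and> hnorm t (\<phi> h) \<le> C * hnorm s h ^ p)"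

definition sup_order :: "nat \<Rightarrow> ((real \<Rightarrow> complex) \<Rightarrow> real \<Rightarrow> complex) \<Rightarrow> bool" where
  "sup_order p \<phi> \<longleftrightarrow> (\<exists>C\<ge>0. \<forall>h\<in>small. circle_fun (\<phi> h) \<and> (\<forall>x. cmod (\<phi> h x) \<le> C * hnorm s h ^ p))"

lemma Hs_order_add:
  assumes "Hs_order t p \<phi>" "Hs_order t p \<psi>"
  shows "Hs_order t p (\<lambda>h x. \<phi> h x + \<psi> h x)"
proof -
  obtain C D where C: "C \<ge> 0" "\<forall>h\<in>small. \<phi> h \<in> Hs t \<and> hnorm t (\<phi> h) \<le> C * hnorm s h ^ p"
    and D: "D \<ge> 0" "\<forall>h\<in>small. \<psi> h \<in> Hs t \<and> hnorm t (\<psi> h) \<le> D * hnorm s h ^ p"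
    using assms unfolding Hs_order_def by blast
  have "(\<lambda>x. \<phi> h x + \<psi> h x) \<in> Hs t \<and> hnorm t (\<lambda>x. \<phi> h x + \<psi> h x) \<le> (C + D) * hnorm s h ^ p" if "h \<in> small" for h
    using Hs_add[of "\<phi> h" t "\<psi> h"] C(2) D(2) that by (fastforce simp: distrib_right)
  then show ?thesis unfolding Hs_order_def using C(1) D(1) by (intro exI[of _ "C + D"]) auto
qed

lemma sup_order_add:
  assumes "sup_order p \<phi>" "sup_order p \<psi>"
  shows "sup_order p (\<lambda>h x. \<phi> h x + \<psi> h x)"
proof -
  obtain C D where C: "C \<ge> 0" "\<forall>h\<in>small. circle_fun (\<phi> h) \<and> (\<forall>x. cmod (\<phi> h x) \<le> C * hnorm s h ^ p)"
    and D: "D \<ge> 0" "\<forall>h\<in>small. circle_fun (\<psi> h) \<and> (\<forall>x. cmod (\<psi> h x) \<le> D * hnorm s h ^ p)"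
    using assms unfolding sup_order_def by blast
  have "cmod (\<phi> h x + \<psi> h x) \<le> (C + D) * hnorm s h ^ p" if "h \<in> small" for h x
  proof -
    have "cmod (\<phi> h x) \<le> C * hnorm s h ^ p" "cmod (\<psi> h x) \<le> D * hnorm s h ^ p" using C(2) D(2) that by auto
    then show ?thesis using norm_triangle_ineq[of "\<phi> h x" "\<psi> h x"] by (simp add: distrib_right)
  qed
  then show ?thesis unfolding sup_order_def using C D by (intro exI[of _ "C + D"]) (auto intro: circle_fun_add)
qed

lemma Hs_order_mult:
  assumes t: "t > 1/2" and "Hs_order t p \<phi>" "Hs_order t q \<psi>"
  shows "Hs_order t (p + q) (\<lambda>h x. \<phi> h x * \<psi> h x)"
proof -
  obtain C D where C: "C \<ge> 0" "\<forall>h\<in>small. \<phi> h \<in> Hs t \<and> hnorm t (\<phi> h) \<le> C * hnorm s h ^ p"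
    and D: "D \<ge> 0" "\<forall>h\<in>small. \<psi> h \<in> Hs t \<and> hnorm t (\<psi> h) \<le> D * hnorm s h ^ q"
    using assms unfolding Hs_order_def by blast
  let ?A = "algebra_const t"
  have "(\<lambda>x. \<phi> h x * \<psi> h x) \<in> Hs t \<and> hnorm t (\<lambda>x. \<phi> h x * \<psi> h x) \<le> (?A * C * D) * hnorm s h ^ (p + q)" if h: "h \<in> small" for h
  proof
    have m: "\<phi> h \<in> Hs t" "\<psi> h \<in> Hs t" using C D h by auto
    show "(\<lambda>x. \<phi> h x * \<psi> h x) \<in> Hs t" by (rule Hs_mult(1)[OF t m])
    have "hnorm t (\<lambda>x. \<phi> h x * \<psi> h x) \<le> ?A * hnorm t (\<phi> h) * hnorm t (\<psi> h)" by (rule Hs_mult'(2)[OF t m])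
    also have "\<dots> \<le> ?A * (C * hnorm s h ^ p) * (D * hnorm s h ^ q)"
      using C D h algebra_const_nonneg[of t] hnorm_nonneg by (intro mult_mono mult_left_mono) auto
    finally show "hnorm t (\<lambda>x. \<phi> h x * \<psi> h x) \<le> (?A * C * D) * hnorm s h ^ (p + q)"
      by (simp add: power_add mult_ac)
  qed
  then show ?thesis unfolding Hs_order_def using C D algebra_const_nonneg[of t] by (intro exI[of _ "?A * C * D"]) auto
qed

lemma sup_order_mult:
  assumes "sup_order p \<phi>" "sup_order q \<psi>"
  shows "sup_order (p + q) (\<lambda>h x. \<phi> h x * \<psi> h x)"
proof -
  obtain C D where C: "C \<ge> 0" "\<forall>h\<in>small. circle_fun (\<phi> h) \<and> (\<forall>x. cmod (\<phi> h x) \<le> C * hnorm s h ^ p)"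
    and D: "D \<ge> 0" "\<forall>h\<in>small. circle_fun (\<psi> h) \<and> (\<forall>x. cmod (\<psi> h x) \<le> D * hnorm s h ^ q)"
    using assms unfolding sup_order_def by blast
  have "cmod (\<phi> h x * \<psi> h x) \<le> (C * D) * hnorm s h ^ (p + q)" if "h \<in> small" for h x
  proof -
    have "cmod (\<phi> h x * \<psi> h x) \<le> (C * hnorm s h ^ p) * (D * hnorm s h ^ q)"
      unfolding norm_mult using C D that hnorm_nonneg by (intro mult_mono) auto
    then show ?thesis by (simp add: power_add mult_ac)
  qed
  then show ?thesis unfolding sup_order_def using C D by (intro exI[of _ "C * D"]) (auto intro: circle_fun_mult)
qed

lemma Hs_order_mono: "Hs_order t p \<phi> \<Longrightarrow> t' \<le> t \<Longrightarrow> Hs_order t' p \<phi>"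
  unfolding Hs_order_def using Hs_mono by (meson order_trans)

lemma small_power: "h \<in> small \<Longrightarrow> q \<le> p \<Longrightarrow> hnorm s h ^ p \<le> hnorm s h ^ q"
  using \<delta> hnorm_nonneg[of s h] by (intro power_decreasing) (auto simp: small_def)

lemma Hs_order_lower: "Hs_order t p \<phi> \<Longrightarrow> q \<le> p \<Longrightarrow> Hs_order t q \<phi>"
  unfolding Hs_order_def using small_power by (meson mult_left_mono order_trans)

lemma sup_order_lower: "sup_order p \<phi> \<Longrightarrow> q \<le> p \<Longrightarrow> sup_order q \<phi>"
  unfolding sup_order_def using small_power by (meson mult_left_mono order_trans)

lemma sup_order_Hs_0: "sup_order p \<phi> \<Longrightarrow> Hs_order 0 p \<phi>"
  unfolding sup_order_def Hs_order_def using Hs_0 by meson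

lemma Hs_order_sup:
  assumes t: "t > 1/2" and "Hs_order t p \<phi>"
  shows "sup_order p \<phi>"
proof -
  obtain C where C: "C \<ge> 0" "\<forall>h\<in>small. \<phi> h \<in> Hs t \<and> hnorm t (\<phi> h) \<le> C * hnorm s h ^ p"
    using assms unfolding Hs_order_def by blast
  have "cmod (\<phi> h x) \<le> (embedding_const t * C) * hnorm s h ^ p" if "h \<in> small" for h x
  proof -
    have "cmod (\<phi> h x) \<le> embedding_const t * hnorm t (\<phi> h)" using Hs_fourier_series(3)[OF t] C that by blast
    also have "\<dots> \<le> embedding_const t * (C * hnorm s h ^ p)"
      using C that embedding_const_nonneg[of t] by (intro mult_left_mono) auto
    finally show ?thesis by (simp add: mult.assoc)
  qed
  then show ?thesis unfolding sup_order_def using C embedding_const_nonneg[of t] Hs_circle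
    by (intro exI[of _ "embedding_const t * C"]) auto
qed

text \<open>One rung of the ladder, by \<open>Hs_raise\<close>: the supremum norm controls the mean,
  the derivative controls the other coefficients.\<close>

lemma Hs_order_raise:
  assumes "sup_order p \<phi>" "Hs_order t p \<phi>'" "\<And>h x. h \<in> small \<Longrightarrow> (\<phi> h has_vector_derivative \<phi>' h x) (at x)"
  shows "Hs_order (t + 1) p \<phi>"
proof -
  obtain C D where C: "C \<ge> 0" "\<forall>h\<in>small. circle_fun (\<phi> h) \<and> (\<forall>x. cmod (\<phi> h x) \<le> C * hnorm s h ^ p)"
    and D: "D \<ge> 0" "\<forall>h\<in>small. \<phi>' h \<in> Hs t \<and> hnorm t (\<phi>' h) \<le> D * hnorm s h ^ p"
    using assms unfolding sup_order_def Hs_order_def by blast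
  have "\<phi> h \<in> Hs (t + 1) \<and> hnorm (t + 1) (\<phi> h) \<le> (C + 2 * D) * hnorm s h ^ p" if h: "h \<in> small" for h
    using Hs_raise[of "\<phi> h" "\<phi>' h" t "C * hnorm s h ^ p"] C(2) D(2) h assms(3)[OF h] by (fastforce simp: algebra_simps)
  then show ?thesis unfolding Hs_order_def using C D by (intro exI[of _ "C + 2 * D"]) auto
qed

end

text \<open>A whole chain of derivatives is fixed because the derivative of a Taylor remainder for
  \<open>n k\<close> involves that for \<open>n (Suc k)\<close>; the induction on the Sobolev
  exponent has to treat all k together.\<close>

locale holomorphic_composition =
  fixes s :: real and n :: "nat \<Rightarrow> complex \<Rightarrow> complex" and \<Omega> :: "complex set"
  assumes s: "s > 3/2" and \<Omega>: "open \<Omega>"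
    and n: "\<And>k z. z \<in> \<Omega> \<Longrightarrow> (n k has_field_derivative n (Suc k) z) (at z)"
begin

definition dom :: "(real \<Rightarrow> complex) set" where
  "dom = {f \<in> Hs s. \<forall>x. f x \<in> \<Omega>}"

lemma sup_le: "f \<in> Hs s \<Longrightarrow> cmod (f x) \<le> embedding_const s * hnorm s f"
  using Hs_fourier_series(3)[of s f x] s by simp

text \<open>Every \<open>n k\<close> is bounded on a compact neighbourhood of the range of f inside
  \<Omega>. Periodicity reduces the range to the unit interval, and the union of balls is compact as
  the sum of two compact sets.\<close>

lemma tube:
  assumes f: "f \<in> dom"
  obtains r where "r > 0" "compact (\<Union>x\<in>{0..1}. cball (f x) r)" "\<And>x w. cmod w \<le> r \<Longrightarrow> f x + w \<in> (\<Union>x\<in>{0..1}. cball (f x) r)"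
    "(\<Union>x\<in>{0..1}. cball (f x) r) \<subseteq> \<Omega>"
proof -
  have c: "circle_fun f" using f by (auto simp: dom_def Hs_circle)
  let ?K = "f ` {0..1}"
  have K: "compact ?K" "?K \<subseteq> \<Omega>"
    using f by (auto simp: dom_def intro!: compact_continuous_image circle_fun_continuous c)
  obtain r where r: "r > 0" "(\<Union>z\<in>?K. cball z r) \<subseteq> \<Omega>"
    using compact_subset_open_imp_cball_epsilon_subset[OF K(1) \<Omega> K(2)] by blast
  have "(\<Union>x\<in>{0..1}. cball (f x) r) = (\<lambda>p. fst p + snd p) ` (?K \<times> cball 0 r)"
  proof (intro set_eqI iffI)
    fix z assume "z \<in> (\<Union>x\<in>{0..1}. cball (f x) r)"
    then obtain x where "x \<in> {0..1}" "cmod (z - f x) \<le> r" by (auto simp: dist_norm norm_minus_commute)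
    then show "z \<in> (\<lambda>p. fst p + snd p) ` (?K \<times> cball 0 r)"
      by (intro image_eqI[of _ _ "(f x, z - f x)"]) auto
  next
    fix z assume "z \<in> (\<lambda>p. fst p + snd p) ` (?K \<times> cball 0 r)"
    then obtain x w where "x \<in> {0..1}" "cmod w \<le> r" "z = f x + w" by auto
    then show "z \<in> (\<Union>x\<in>{0..1}. cball (f x) r)" by (intro UN_I[of x]) (auto simp: dist_norm)
  qed
  moreover have "compact ((\<lambda>p. fst p + snd p) ` (?K \<times> cball 0 r))"
    by (intro compact_continuous_image compact_Times K compact_cball continuous_intros)
  ultimately have "compact (\<Union>x\<in>{0..1}. cball (f x) r)" by simp
  moreover have "f x + w \<in> (\<Union>x\<in>{0..1}. cball (f x) r)" if "cmod w \<le> r" for x w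
  proof -
    have "f (frac x) = f x" using c periodic_frac[of f x] by (simp add: circle_fun_def)
    then show ?thesis using that by (intro UN_I[OF frac_unit[of x]]) (simp add: dist_norm)
  qed
  ultimately show ?thesis using r that by auto
qed

lemma dom_frechet:
  assumes f: "f \<in> dom"
  obtains \<delta> C where "\<delta> > 0" "C \<ge> 0" "\<And>h. h \<in> Hs s \<Longrightarrow> hnorm s h < \<delta> \<Longrightarrow> (\<lambda>x. f x + h x) \<in> dom"
    "(\<lambda>x. n k (f x)) \<in> Hs s"
    "\<And>h. h \<in> Hs s \<Longrightarrow> hnorm s h < \<delta> \<Longrightarrow>
      hnorm s (\<lambda>x. n k (f x + h x) - n k (f x) - n (Suc k) (f x) * h x) \<le> C * (hnorm s h)\<^sup>2"
proof -
  have fH: "f \<in> Hs s" and f\<Omega>: "\<And>x. f x \<in> \<Omega>" using f by (auto simp: dom_def)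
  have cf: "circle_fun f" by (rule Hs_circle[OF fH])
  obtain r where r: "r > 0" "compact (\<Union>x\<in>{0..1}. cball (f x) r)"
    "\<And>x w. cmod w \<le> r \<Longrightarrow> f x + w \<in> (\<Union>x\<in>{0..1}. cball (f x) r)" "(\<Union>x\<in>{0..1}. cball (f x) r) \<subseteq> \<Omega>"
    by (rule tube[OF f]) (rule that)
  define T where "T = (\<Union>x\<in>{0..1}. cball (f x) r)"
  note T = r(2-4)[folded T_def]
  have nc: "continuous_on \<Omega> (n k)" for k
    by (rule DERIV_continuous_on) (use n has_field_derivative_at_within in blast)
  have "\<exists>M>0. \<forall>z\<in>T. cmod (n k z) \<le> M" for k
    using compact_imp_bounded[OF compact_continuous_image[OF continuous_on_subset[OF nc T(3)] T(1)], of k]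
    unfolding bounded_pos by blast
  then obtain M where M: "\<And>k. M k > 0" "\<And>k z. z \<in> T \<Longrightarrow> cmod (n k z) \<le> M k" by metis
  have ball: "cball (f x) r \<subseteq> T" for x
    using T(2)[of "_ - f x" x] by (auto simp: dist_norm norm_minus_commute)
  have D: "cmod (n k (f x + w) - n k (f x)) \<le> M (Suc k) * cmod w" if "cmod w \<le> r" for k x w
  proof -
    have "cmod (n k (f x + w) - n k (f x)) \<le> M (Suc k) * cmod (f x + w - f x)"
    proof (rule field_differentiable_bound[of "cball (f x) r"])
      fix z assume "z \<in> cball (f x) r"
      then have z: "z \<in> T" using ball by blast
      show "(n k has_field_derivative n (Suc k) z) (at z within cball (f x) r)"
        by (rule has_field_derivative_at_within[OF n]) (use z T(3) in blast)
      show "cmod (n (Suc k) z) \<le> M (Suc k)" by (rule M(2)[OF z])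
    qed (use that r(1) in \<open>auto simp: dist_norm\<close>)
    then show ?thesis by simp
  qed
  have R: "cmod (n k (f x + w) - n k (f x) - n (Suc k) (f x) * w) \<le> M (Suc (Suc k)) * (cmod w)\<^sup>2" if w: "cmod w \<le> r" for k x w
  proof -
    \<comment> \<open>The mean value estimate is applied to \<open>n k\<close> minus its linear part
      on the ball of radius |w|, where the derivative is at most \<open>M (Suc (Suc k))\<close>
      times |w|.\<close>
    let ?g = "\<lambda>z. n k z - n (Suc k) (f x) * z"
    have sub: "cball (f x) (cmod w) \<subseteq> T" using ball[of x] w by (auto simp: dist_norm subset_iff)
    have "cmod (?g (f x + w) - ?g (f x)) \<le> (M (Suc (Suc k)) * cmod w) * cmod (f x + w - f x)"
    proof (rule field_differentiable_bound[of "cball (f x) (cmod w)"])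
      fix z assume z: "z \<in> cball (f x) (cmod w)"
      then have "z \<in> \<Omega>" using sub T(3) by blast
      then have "(?g has_field_derivative n (Suc k) z - n (Suc k) (f x) * 1) (at z)"
        by (intro DERIV_diff n DERIV_cmult DERIV_ident)
      then show "(?g has_field_derivative n (Suc k) z - n (Suc k) (f x)) (at z within cball (f x) (cmod w))"
        by (auto intro: has_field_derivative_at_within)
      have z': "cmod (z - f x) \<le> cmod w" using z by (simp add: dist_norm norm_minus_commute)
      then have "cmod (n (Suc k) (f x + (z - f x)) - n (Suc k) (f x)) \<le> M (Suc (Suc k)) * cmod (z - f x)"
        by (intro D) (use w in linarith)
      also have "\<dots> \<le> M (Suc (Suc k)) * cmod w" using z' M(1)[of "Suc (Suc k)"] by (intro mult_left_mono) auto
      finally show "cmod (n (Suc k) z - n (Suc k) (f x)) \<le> M (Suc (Suc k)) * cmod w" by simp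
    qed (auto simp: dist_norm)
    then show ?thesis by (simp add: algebra_simps power2_eq_square)
  qed
  \<comment> \<open>The quotient keeps the values of h below \<open>r\<close>, hence f + h in the
    tube; the bound 1 is what the comparison of orders requires.\<close>
  define \<delta> where "\<delta> = min 1 (r / (embedding_const s + 1))"
  have \<delta>: "\<delta> > 0" "\<delta> \<le> 1" using r(1) embedding_const_nonneg[of s] by (auto simp: \<delta>_def)
  let ?S = "small s \<delta>"
  note ord = Hs_order_def[OF s \<delta>(2)] sup_order_def[OF s \<delta>(2)]
  have small: "h \<in> Hs s" "circle_fun h" "cmod (h x) \<le> r" "cmod (h x) \<le> embedding_const s * hnorm s h" if "h \<in> ?S" for h x
  proof -
    show h: "h \<in> Hs s" using that by (simp add: small_def[OF s \<delta>(2)])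
    then show "circle_fun h" by (rule Hs_circle)
    show b: "cmod (h x) \<le> embedding_const s * hnorm s h" by (rule sup_le[OF h])
    have "hnorm s h < r / (embedding_const s + 1)" using that unfolding small_def[OF s \<delta>(2)] by (simp add: \<delta>_def)
    then have "(embedding_const s + 1) * hnorm s h \<le> r" using embedding_const_nonneg[of s] by (simp add: field_simps)
    then show "cmod (h x) \<le> r" using b hnorm_nonneg[of s h] by (simp add: distrib_right)
  qed
  obtain f' where f': "f' \<in> Hs (s - 1)" "\<And>x. (f has_vector_derivative f' x) (at x)"
    using Hs_deriv[OF s fH] by blast
  \<comment> \<open>A derivative is chosen for every h. As a family in h it is of order 1, because
    its norm is at most that of h.\<close>
  have "\<forall>h\<in>Hs s. \<exists>g\<in>Hs (s - 1). hnorm (s - 1) g \<le> hnorm s h \<and> (\<forall>x. (h has_vector_derivative g x) (at x))"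
    using Hs_deriv[OF s] by blast
  then obtain dv where dv: "\<And>h. h \<in> Hs s \<Longrightarrow> dv h \<in> Hs (s - 1)" "\<And>h. h \<in> Hs s \<Longrightarrow> hnorm (s - 1) (dv h) \<le> hnorm s h"
    "\<And>h x. h \<in> Hs s \<Longrightarrow> (h has_vector_derivative dv h x) (at x)" by metis
  let ?N = "\<lambda>k (h :: real \<Rightarrow> complex) x. n k (f x)"
  let ?D = "\<lambda>k h x. n k (f x + h x) - n k (f x)"
  let ?R = "\<lambda>k h x. n k (f x + h x) - n k (f x) - n (Suc k) (f x) * h x"
  have cnf: "circle_fun (\<lambda>x. n k (g x))" if "circle_fun g" "\<And>x. g x \<in> \<Omega>" for k g
    using that continuous_on_compose2[OF nc, of UNIV g k] by (auto simp: circle_fun_def)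
  have fh\<Omega>: "f x + h x \<in> \<Omega>" if "h \<in> ?S" for h x using T small(3)[OF that] by blast
  have cN: "circle_fun (\<lambda>x. n k (f x))" for k by (rule cnf[OF cf f\<Omega>])
  have cNh: "circle_fun (\<lambda>x. n k (f x + h x))" if "h \<in> ?S" for k h
    by (rule cnf[OF circle_fun_add[OF cf small(2)[OF that]] fh\<Omega>[OF that]])
  have fT: "f x \<in> T" for x using T(2)[of 0 x] r(1) by simp
  let ?e = "embedding_const s"
  have e0: "0 \<le> ?e" by (rule embedding_const_nonneg)
  have supN: "sup_order s \<delta> 0 (?N k)" for k
    unfolding ord using M cN fT by (intro exI[of _ "M k"]) (auto intro: less_imp_le)
  have supD: "sup_order s \<delta> 1 (?D k)" for k
    unfolding ord
  proof (intro exI[of _ "M (Suc k) * ?e"] conjI ballI allI)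
    show "0 \<le> M (Suc k) * ?e" using M(1)[of "Suc k"] e0 by simp
    fix h x assume h: "h \<in> ?S"
    show "circle_fun (?D k h)" by (intro circle_fun_diff cN cNh h)
    have "cmod (?D k h x) \<le> M (Suc k) * cmod (h x)" by (rule D[OF small(3)[OF h]])
    also have "\<dots> \<le> M (Suc k) * (?e * hnorm s h)" using small(4)[OF h] M(1)[of "Suc k"] by (intro mult_left_mono) auto
    finally show "cmod (?D k h x) \<le> M (Suc k) * ?e * hnorm s h ^ 1" by (simp add: mult.assoc)
  qed
  have supR: "sup_order s \<delta> 2 (?R k)" for k
    unfolding ord
  proof (intro exI[of _ "M (Suc (Suc k)) * ?e\<^sup>2"] conjI ballI allI)
    show "0 \<le> M (Suc (Suc k)) * ?e\<^sup>2" using M(1)[of "Suc (Suc k)"] by simp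
    fix h x assume h: "h \<in> ?S"
    show "circle_fun (?R k h)" by (intro circle_fun_diff circle_fun_mult cN cNh small(2) h)
    have "cmod (?R k h x) \<le> M (Suc (Suc k)) * (cmod (h x))\<^sup>2" by (rule R[OF small(3)[OF h]])
    also have "\<dots> \<le> M (Suc (Suc k)) * (?e * hnorm s h)\<^sup>2"
      using small(4)[OF h] M(1)[of "Suc (Suc k)"] by (intro mult_left_mono power_mono) auto
    finally show "cmod (?R k h x) \<le> M (Suc (Suc k)) * ?e\<^sup>2 * (hnorm s h)\<^sup>2" by (simp add: power_mult_distrib mult.assoc)
  qed
  have Hf': "Hs_order s \<delta> (s - 1) 0 (\<lambda>h. f')"
    unfolding ord using f'(1) hnorm_nonneg by (intro exI[of _ "hnorm (s - 1) f'"]) auto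
  have H_dv: "Hs_order s \<delta> (s - 1) 1 dv"
    unfolding ord using dv small(1) by (intro exI[of _ 1]) auto
  have s1: "s - 1 > 1/2" using s by simp
  note supf' = Hs_order_sup[OF s \<delta>(2) s1 Hf'] and sup_dv = Hs_order_sup[OF s \<delta>(2) s1 H_dv]
  have dN: "((\<lambda>x. n k (g x)) has_vector_derivative n (Suc k) (g x) * g' ) (at x)"
    if "(g has_vector_derivative g') (at x)" "g x \<in> \<Omega>" for k g g' x
    using field_vector_diff_chain_at[OF that(1) n[OF that(2)], of k] by (simp add: o_def mult.commute)
  have dfh: "((\<lambda>x. f x + h x) has_vector_derivative f' x + dv h x) (at x)" if "h \<in> ?S" for h x
    by (intro has_vector_derivative_add f' dv(3) small(1) that)
  \<comment> \<open>The derivatives in x of the value, the difference and the remainder. Each term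
    is one of these for \<open>Suc k\<close> times f' or h', of total order at least 0, 1 and 2
    respectively.\<close>
  let ?N' = "\<lambda>k h x. ?N (Suc k) h x * f' x"
  let ?D' = "\<lambda>k h x. ?D (Suc k) h x * f' x + ?D (Suc k) h x * dv h x + ?N (Suc k) h x * dv h x"
  let ?R' = "\<lambda>k h x. ?R (Suc k) h x * f' x + ?D (Suc k) h x * dv h x"
  have dN': "(?N k h has_vector_derivative ?N' k h x) (at x)" for k h x by (rule dN[OF f'(2) f\<Omega>])
  have dD': "(?D k h has_vector_derivative ?D' k h x) (at x)" if h: "h \<in> ?S" for k h x
    using has_vector_derivative_diff[OF dN[OF dfh[OF h] fh\<Omega>[OF h], of k] dN[OF f'(2) f\<Omega>, of k]] by (simp add: algebra_simps)
  have dR': "(?R k h has_vector_derivative ?R' k h x) (at x)" if h: "h \<in> ?S" for k h x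
    using has_vector_derivative_diff[OF dD'[OF h, of k]
       has_vector_derivative_mult[OF dN[OF f'(2) f\<Omega>, of "Suc k"] dv(3)[OF small(1)[OF h], of x]]] by (simp add: algebra_simps)
  have raise: "\<forall>k. Hs_order s \<delta> (t + 1) 0 (?N k) \<and> Hs_order s \<delta> (t + 1) 1 (?D k) \<and> Hs_order s \<delta> (t + 1) 2 (?R k)"
    if "\<And>k. Hs_order s \<delta> t 0 (?N' k)" "\<And>k. Hs_order s \<delta> t 1 (?D' k)" "\<And>k. Hs_order s \<delta> t 2 (?R' k)" for t
    by (intro allI conjI; rule Hs_order_raise[OF s \<delta>(2)]) (use that supN supD supR dN' dD' dR' in auto)
  \<comment> \<open>The exponent climbs by 1 from 1 and is capped at s, as f' and h' lie only in
    H^(s-1).\<close>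
  have main: "\<forall>k. Hs_order s \<delta> (min (1 + real j) s) 0 (?N k) \<and> Hs_order s \<delta> (min (1 + real j) s) 1 (?D k)
      \<and> Hs_order s \<delta> (min (1 + real j) s) 2 (?R k)" for j
  proof (induction j)
    case 0
    \<comment> \<open>The algebra property starts above 1/2, so at exponent 0 the products are
      estimated in the supremum norm.\<close>
    note add = sup_order_add[OF s \<delta>(2)] and mult = sup_order_mult[OF s \<delta>(2)] and lower = sup_order_lower[OF s \<delta>(2)]
    have "Hs_order s \<delta> 0 0 (?N' k)" for k
      by (rule sup_order_Hs_0[OF s \<delta>(2)]) (use mult[OF supN[of "Suc k"] supf'] in simp)
    moreover have "Hs_order s \<delta> 0 1 (?D' k)" for k
    proof (rule sup_order_Hs_0[OF s \<delta>(2)], intro add)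
      show "sup_order s \<delta> 1 (\<lambda>h x. ?D (Suc k) h x * f' x)" using mult[OF supD[of "Suc k"] supf'] by simp
      show "sup_order s \<delta> 1 (\<lambda>h x. ?D (Suc k) h x * dv h x)" by (rule lower[OF mult[OF supD[of "Suc k"] sup_dv]]) simp
      show "sup_order s \<delta> 1 (\<lambda>h x. ?N (Suc k) h x * dv h x)" using mult[OF supN[of "Suc k"] sup_dv] by simp
    qed
    moreover have "Hs_order s \<delta> 0 2 (?R' k)" for k
    proof (rule sup_order_Hs_0[OF s \<delta>(2)], intro add)
      show "sup_order s \<delta> 2 (\<lambda>h x. ?R (Suc k) h x * f' x)" using mult[OF supR[of "Suc k"] supf'] by simp
      show "sup_order s \<delta> 2 (\<lambda>h x. ?D (Suc k) h x * dv h x)"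
        using mult[OF supD[of "Suc k"] sup_dv] by (simp add: numeral_2_eq_2)
    qed
    ultimately have "\<forall>k. Hs_order s \<delta> (0 + 1) 0 (?N k) \<and> Hs_order s \<delta> (0 + 1) 1 (?D k) \<and> Hs_order s \<delta> (0 + 1) 2 (?R k)"
      by (rule raise)
    then show ?case using s by simp
  next
    case (Suc j)
    \<comment> \<open>Products are formed at exponent \<open>q\<close>, available for the remainders
      and for f' and h' alike; \<open>q > 1/2\<close> makes H^q an algebra.\<close>
    define q where "q = min (min (1 + real j) s) (s - 1)"
    have q: "q > 1/2" "q + 1 = min (1 + real (Suc j)) s" using s by (auto simp: q_def)
    have ql: "q \<le> min (1 + real j) s" unfolding q_def by (rule min.cobounded1)
    note add = Hs_order_add[OF s \<delta>(2)] and mult = Hs_order_mult[OF s \<delta>(2) q(1)] and lower = Hs_order_lower[OF s \<delta>(2)]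
    have IH: "Hs_order s \<delta> q 0 (?N k)" "Hs_order s \<delta> q 1 (?D k)" "Hs_order s \<delta> q 2 (?R k)" for k
      using Suc.IH[rule_format, of k] Hs_order_mono[OF s \<delta>(2) _ ql] by blast+
    have qf': "Hs_order s \<delta> q 0 (\<lambda>h. f')" and q_dv: "Hs_order s \<delta> q 1 dv"
      using Hs_order_mono[OF s \<delta>(2) Hf', of q] Hs_order_mono[OF s \<delta>(2) H_dv, of q] by (auto simp: q_def)
    have "Hs_order s \<delta> q 0 (?N' k)" for k
      using mult[OF IH(1)[of "Suc k"] qf'] by simp
    moreover have "Hs_order s \<delta> q 1 (?D' k)" for k
    proof (intro add)
      show "Hs_order s \<delta> q 1 (\<lambda>h x. ?D (Suc k) h x * f' x)" using mult[OF IH(2)[of "Suc k"] qf'] by simp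
      show "Hs_order s \<delta> q 1 (\<lambda>h x. ?D (Suc k) h x * dv h x)" by (rule lower[OF mult[OF IH(2)[of "Suc k"] q_dv]]) simp
      show "Hs_order s \<delta> q 1 (\<lambda>h x. ?N (Suc k) h x * dv h x)" using mult[OF IH(1)[of "Suc k"] q_dv] by simp
    qed
    moreover have "Hs_order s \<delta> q 2 (?R' k)" for k
    proof (intro add)
      show "Hs_order s \<delta> q 2 (\<lambda>h x. ?R (Suc k) h x * f' x)" using mult[OF IH(3)[of "Suc k"] qf'] by simp
      show "Hs_order s \<delta> q 2 (\<lambda>h x. ?D (Suc k) h x * dv h x)"
        using mult[OF IH(2)[of "Suc k"] q_dv] by (simp add: numeral_2_eq_2)
    qed
    ultimately show ?case unfolding q(2)[symmetric] by (rule raise)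
  qed
  obtain j where "s \<le> real j" using real_arch_simple by blast
  then have "min (1 + real j) s = s" by simp
  then have fin: "Hs_order s \<delta> s 0 (?N k)" "Hs_order s \<delta> s 2 (?R k)" using main[of j] by auto
  obtain C where C: "C \<ge> 0" "\<forall>h\<in>?S. hnorm s (?R k h) \<le> C * hnorm s h ^ 2" using fin(2) unfolding ord by blast
  have "(\<lambda>x. 0) \<in> ?S" using Hs_const(1)[of 0 s] Hs_const(2)[of s 0] \<delta>(1) by (simp add: small_def[OF s \<delta>(2)])
  then have 1: "(\<lambda>x. n k (f x)) \<in> Hs s" using fin(1) unfolding ord by blast
  have 2: "(\<lambda>x. f x + h x) \<in> dom" if "h \<in> Hs s" "hnorm s h < \<delta>" for h
    using that Hs_add(1)[OF fH that(1)] fh\<Omega>[of h] by (simp add: dom_def small_def[OF s \<delta>(2)])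
  have 3: "hnorm s (?R k h) \<le> C * (hnorm s h)\<^sup>2" if "h \<in> Hs s" "hnorm s h < \<delta>" for h
    using C(2) that by (simp add: small_def[OF s \<delta>(2)])
  show ?thesis by (rule that[OF \<delta>(1) C(1) 2 1 3])
qed

end

text \<open>Makes \<open>smooth_deriv_algebra\<close> applicable to functions with the pointwise
  product.\<close>

instance "fun" :: (type, real_algebra) real_algebra
  by standard (simp_all add: fun_eq_iff)

context holomorphic_composition
begin

text \<open>The quadratic remainder of \<open>dom_frechet\<close> is available for every member of
  the chain \<open>n k\<close>, which is what \<open>smooth_deriv_algebra\<close> asks for.\<close>

lemma composition_smooth:
  "smooth_deriv (sobolev_complex s) (sobolev_complex s) dom (\<lambda>f x. n 0 (f x)) (\<lambda>f h x. n 1 (f x) * h x)"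
proof -
  let ?N = "\<lambda>k f (x :: real). n k (f x)"
  note E = normed_sobolev_complex[of s]
  have "smooth_deriv (sobolev_complex s) (sobolev_complex s) dom (?N 0) (\<lambda>f h. ?N 1 f * h)"
  proof (rule smooth_deriv_algebra[OF E, where M = "algebra_const s"])
    show "1 \<in> Hs s" using Hs_const(1)[of 1 s] by (simp add: one_fun_def)
    fix f g assume "f \<in> Hs s" "g \<in> Hs s"
    then show "f * g \<in> Hs s \<and> hnorm s (f * g) \<le> algebra_const s * hnorm s f * hnorm s g"
      using Hs_mult'[of s f g] s by (simp add: times_fun_def)
  next
    fix k f assume f: "f \<in> dom"
    show "?N k f \<in> Hs s" by (rule dom_frechet[OF f, of k])
    fix \<epsilon> :: real assume \<epsilon>: "\<epsilon> > 0"
    obtain \<delta> C where \<delta>: "\<delta> > 0" "C \<ge> 0" "\<And>h. h \<in> Hs s \<Longrightarrow> hnorm s h < \<delta> \<Longrightarrow> (\<lambda>x. f x + h x) \<in> dom"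
      "(\<lambda>x. n k (f x)) \<in> Hs s"
      "\<And>h. h \<in> Hs s \<Longrightarrow> hnorm s h < \<delta> \<Longrightarrow>
        hnorm s (\<lambda>x. n k (f x + h x) - n k (f x) - n (Suc k) (f x) * h x) \<le> C * (hnorm s h)\<^sup>2"
      by (rule dom_frechet[OF f, of k]) (rule that)
    show "eventually (\<lambda>h. hnorm s (?N k (f + h) - ?N k f - ?N (Suc k) f * h) \<le> \<epsilon> * hnorm s h)
        (increments (sobolev_complex s) dom f)"
      unfolding eventually_increments[OF E]
    proof (intro exI[of _ "min \<delta> (\<epsilon> / (C + 1))"] conjI ballI impI)
      show "min \<delta> (\<epsilon> / (C + 1)) > 0" using \<delta>(1,2) \<epsilon> by simp
      fix h assume h: "h \<in> Hs s" "hnorm s h < min \<delta> (\<epsilon> / (C + 1))"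
      have "?N k (f + h) - ?N k f - ?N (Suc k) f * h = (\<lambda>x. n k (f x + h x) - n k (f x) - n (Suc k) (f x) * h x)"
        by (simp add: fun_eq_iff)
      then have "hnorm s (?N k (f + h) - ?N k f - ?N (Suc k) f * h) \<le> C * (hnorm s h)\<^sup>2"
        using \<delta>(5)[OF h(1)] h(2) by simp
      also have "\<dots> \<le> (C + 1) * hnorm s h * hnorm s h" using \<delta>(2) by (simp add: power2_eq_square algebra_simps)
      also have "\<dots> \<le> \<epsilon> * hnorm s h"
        using h(2) \<delta>(2) hnorm_nonneg[of s h] by (intro mult_right_mono) (auto simp: field_simps)
      finally show "hnorm s (?N k (f + h) - ?N k f - ?N (Suc k) f * h) \<le> \<epsilon> * hnorm s h" .
    qed
  qed
  then show ?thesis by (simp add: times_fun_def)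
qed

lemma dom_is_open: "open_in (sobolev_complex s) dom"
  unfolding open_in_def
proof (intro conjI ballI)
  show "dom \<subseteq> Hs s" by (auto simp: dom_def)
  fix f assume f: "f \<in> dom"
  obtain \<delta> C where \<delta>: "\<delta> > 0" "C \<ge> 0" "\<And>h. h \<in> Hs s \<Longrightarrow> hnorm s h < \<delta> \<Longrightarrow> (\<lambda>x. f x + h x) \<in> dom"
    "(\<lambda>x. n 0 (f x)) \<in> Hs s"
    "\<And>h. h \<in> Hs s \<Longrightarrow> hnorm s h < \<delta> \<Longrightarrow>
      hnorm s (\<lambda>x. n 0 (f x + h x) - n 0 (f x) - n (Suc 0) (f x) * h x) \<le> C * (hnorm s h)\<^sup>2"
    by (rule dom_frechet[OF f, of 0]) (rule that)
  have "g \<in> dom" if g: "g \<in> Hs s" "hnorm s (g - f) < \<delta>" for g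
  proof -
    have "g - f \<in> Hs s" using nspace_diff[OF normed_sobolev_complex g(1)] f by (simp add: dom_def)
    from \<delta>(3)[OF this g(2)] show ?thesis by simp
  qed
  then show "\<exists>\<epsilon>>0. \<forall>y\<in>Hs s. hnorm s (y - f) < \<epsilon> \<longrightarrow> y \<in> dom" using \<delta>(1) by blast
qed

end

section \<open>Real Sobolev functions\<close>

abbreviation cplx :: "(real \<Rightarrow> real) \<Rightarrow> real \<Rightarrow> complex" where
  "cplx u \<equiv> \<lambda>x. complex_of_real (u x)"

lemma sobolev_real_simps [simp]:
  "u \<in> vecs (sobolev_real s) \<longleftrightarrow> cplx u \<in> Hs s" "vnorm (sobolev_real s) u = hnorm s (cplx u)"
  "u \<in> vecs (sobolev_real0 s) \<longleftrightarrow> cplx u \<in> Hs s \<and> u 0 = 0" "vnorm (sobolev_real0 s) u = hnorm s (cplx u)"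
  by (auto simp: sobolev_real_def sobolev_real0_def)

lemma cplx_ops: "cplx (u + v) = cplx u + cplx v" "cplx (u - v) = cplx u - cplx v" "cplx (r *\<^sub>R u) = r *\<^sub>R cplx u" "cplx 0 = 0"
  by (simp_all add: fun_eq_iff scaleR_conv_of_real)

lemma cplx_eq_0: "cplx u = 0 \<longleftrightarrow> u = 0"
  by (simp add: fun_eq_iff)

lemma normed_sobolev_real: "normed_nspace (sobolev_real s)"
proof -
  note n = normed_sobolev_complex[of s]
  show ?thesis
    unfolding normed_nspace_def subspace_def sobolev_real_simps cplx_ops
    using nspace_0[OF n] nspace_add[OF n] nspace_scale[OF n] vnorm_nonneg[OF n] vnorm_eq_0[OF n] vnorm_scale[OF n] vnorm_add[OF n]
    by (auto simp: cplx_eq_0)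
qed

lemma normed_sobolev_real0: "normed_nspace (sobolev_real0 s)"
proof -
  note n = normed_sobolev_complex[of s]
  show ?thesis
    unfolding normed_nspace_def subspace_def sobolev_real_simps cplx_ops
    using nspace_0[OF n] nspace_add[OF n] nspace_scale[OF n] vnorm_nonneg[OF n] vnorm_eq_0[OF n] vnorm_scale[OF n] vnorm_add[OF n]
    by (auto simp: cplx_eq_0)
qed

lemma Hs_Re:
  assumes "f \<in> Hs s"
  shows "cplx (\<lambda>x. Re (f x)) \<in> Hs s" "hnorm s (cplx (\<lambda>x. Re (f x))) \<le> hnorm s f"
proof -
  have eq: "cplx (\<lambda>x. Re (f x)) = (\<lambda>x. (1 / 2) * (f x + cnj (f x)))"
    by (simp add: fun_eq_iff complex_eq_iff)
  note a = Hs_add[OF assms Hs_cnj(1)[OF assms]]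
  show "cplx (\<lambda>x. Re (f x)) \<in> Hs s" unfolding eq by (rule Hs_cmult(1)[OF a(1)])
  show "hnorm s (cplx (\<lambda>x. Re (f x))) \<le> hnorm s f"
    unfolding eq Hs_cmult(2)[OF a(1)] using a(2) Hs_cnj(2)[OF assms] by simp
qed

lemma Hs_Im:
  assumes "f \<in> Hs s"
  shows "cplx (\<lambda>x. Im (f x)) \<in> Hs s" "hnorm s (cplx (\<lambda>x. Im (f x))) \<le> hnorm s f"
  using Hs_Re[OF Hs_cmult(1)[OF assms, of "- \<i>"]] Hs_cmult(2)[OF assms, of "- \<i>"] by simp_all

lemma bounded_linear_on_cplx: "bounded_linear_on (sobolev_real s) (sobolev_complex s) cplx"
  unfolding bounded_linear_on_def lin_on_def
  by (intro conjI exI[of _ 1]) (auto simp: cplx_ops fun_eq_iff scaleR_conv_of_real)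

lemma bounded_linear_on_Re: "bounded_linear_on (sobolev_complex s) (sobolev_real s) (\<lambda>f x. Re (f x))"
  unfolding bounded_linear_on_def lin_on_def
  by (intro conjI exI[of _ 1]) (auto simp: Hs_Re fun_eq_iff)

lemma bounded_linear_on_Im: "bounded_linear_on (sobolev_complex s) (sobolev_real s) (\<lambda>f x. Im (f x))"
  unfolding bounded_linear_on_def lin_on_def
  by (intro conjI exI[of _ 1]) (auto simp: Hs_Im fun_eq_iff)

lemma bounded_linear_on_cnj: "bounded_linear_on (sobolev_complex s) (sobolev_complex s) (\<lambda>f x. cnj (f x))"
  unfolding bounded_linear_on_def lin_on_def
  by (intro conjI exI[of _ 1]) (auto simp: Hs_cnj fun_eq_iff)

lemma bounded_linear_on_cmult: "bounded_linear_on (sobolev_complex s) (sobolev_complex s) (\<lambda>f x. c * f x)"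
  unfolding bounded_linear_on_def lin_on_def
  by (intro conjI exI[of _ "cmod c"]) (auto simp: Hs_cmult fun_eq_iff algebra_simps)

lemma bounded_bilinear_times:
  "s > 1/2 \<Longrightarrow> bounded_bilinear_on (sobolev_complex s) (sobolev_complex s) (sobolev_complex s) (\<lambda>f g x. f x * g x)"
  unfolding bounded_bilinear_on_def lin_on_def
  by (intro conjI exI[of _ "algebra_const s"])
     (use Hs_mult'(2)[of s] in \<open>auto simp: Hs_mult'(1) fun_eq_iff algebra_simps\<close>)

lemma bounded_linear_on_mult:
  assumes "s > 1/2" "g \<in> Hs s"
  shows "bounded_linear_on (sobolev_complex s) (sobolev_complex s) (\<lambda>f x. g x * f x)"
  unfolding bounded_linear_on_def lin_on_def
proof (intro conjI exI[of _ "algebra_const s * hnorm s g"] ballI)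
  show "hnorm s (\<lambda>x. g x * f x) \<le> algebra_const s * hnorm s g * hnorm s f" if "f \<in> Hs s" for f
    by (rule Hs_mult'(2)[OF assms that])
qed (use assms in \<open>auto simp: Hs_mult'(1) fun_eq_iff algebra_simps\<close>)

lemma bounded_linear_on_compose:
  assumes "bounded_linear_on E F L" "bounded_linear_on F G K" "normed_nspace F"
  shows "bounded_linear_on E G (\<lambda>x. K (L x))"
proof -
  obtain C D where C: "\<forall>x\<in>vecs E. vnorm F (L x) \<le> C * vnorm E x" and D: "\<forall>y\<in>vecs F. vnorm G (K y) \<le> D * vnorm F y"
    using assms unfolding bounded_linear_on_def by blast
  have m: "L ` vecs E \<subseteq> vecs F" "K ` vecs F \<subseteq> vecs G" "lin_on (vecs E) L" "lin_on (vecs F) K"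
    using assms unfolding bounded_linear_on_def by auto
  have "vnorm G (K (L x)) \<le> (\<bar>D\<bar> * C) * vnorm E x" if x: "x \<in> vecs E" for x
  proof -
    have Lx: "L x \<in> vecs F" using m x by blast
    have "vnorm G (K (L x)) \<le> \<bar>D\<bar> * vnorm F (L x)"
      using D Lx vnorm_nonneg[OF assms(3) Lx] mult_right_mono[OF abs_ge_self[of D]] by (meson order_trans)
    also have "\<dots> \<le> \<bar>D\<bar> * (C * vnorm E x)" using C x by (intro mult_left_mono) auto
    finally show ?thesis by (simp add: mult.assoc)
  qed
  then show ?thesis
    unfolding bounded_linear_on_def using m lin_on_compose[OF m(3,1,4)] by (auto intro!: exI[of _ "\<bar>D\<bar> * C"])
qed

text \<open>The real part of the complex limit is again a limit, as taking real parts does not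
  increase the norm. The condition at 0 is closed because evaluation is continuous by the Sobolev
  embedding.\<close>

lemma banach_sobolev_real:
  assumes s: "s > 1/2"
  shows "banach_nspace (sobolev_real s)" "banach_nspace (sobolev_real0 s)"
proof -
  have lim: "\<exists>x. cplx x \<in> Hs s \<and> (\<lambda>n. hnorm s (cplx (X n) - cplx x)) \<longlonglongrightarrow> 0"
    if X: "\<And>n. cplx (X n) \<in> Hs s" "\<And>\<epsilon>. \<epsilon> > 0 \<Longrightarrow> \<exists>N. \<forall>i\<ge>N. \<forall>j\<ge>N. hnorm s (cplx (X i) - cplx (X j)) < \<epsilon>"
    for X :: "nat \<Rightarrow> real \<Rightarrow> real"
  proof -
    obtain f where f: "f \<in> Hs s" "(\<lambda>n. hnorm s (cplx (X n) - f)) \<longlonglongrightarrow> 0"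
      using banach_nspace_complete[OF banach_sobolev_complex[OF s], of "\<lambda>n. cplx (X n)", OF X] by blast
    have "hnorm s (cplx (X n) - cplx (\<lambda>x. Re (f x))) \<le> hnorm s (cplx (X n) - f)" for n
    proof -
      have "cplx (X n) - f \<in> Hs s" by (rule nspace_diff[OF normed_sobolev_complex X(1) f(1)])
      from Hs_Re(2)[OF this] show ?thesis by (simp add: fun_diff_def)
    qed
    then have "(\<lambda>n. hnorm s (cplx (X n) - cplx (\<lambda>x. Re (f x)))) \<longlonglongrightarrow> 0"
      by (intro tendsto_sandwich[OF _ _ tendsto_const f(2)] always_eventually allI) (auto simp: hnorm_nonneg)
    then show ?thesis using Hs_Re(1)[OF f(1)] by (intro exI[of _ "\<lambda>x. Re (f x)"] conjI)
  qed
  show "banach_nspace (sobolev_real s)"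
  proof (rule banach_nspaceI[OF normed_sobolev_real])
    fix X assume X: "\<And>n::nat. X n \<in> vecs (sobolev_real s)" "\<And>\<epsilon>. \<epsilon> > 0 \<Longrightarrow> \<exists>N. \<forall>i\<ge>N. \<forall>j\<ge>N. vnorm (sobolev_real s) (X i - X j) < \<epsilon>"
    from lim[of X] X show "\<exists>x\<in>vecs (sobolev_real s). (\<lambda>n. vnorm (sobolev_real s) (X n - x)) \<longlonglongrightarrow> 0"
      unfolding sobolev_real_simps cplx_ops by (metis sobolev_real_simps(1))
  qed
  show "banach_nspace (sobolev_real0 s)"
  proof (rule banach_nspaceI[OF normed_sobolev_real0])
    fix X assume X: "\<And>n::nat. X n \<in> vecs (sobolev_real0 s)" "\<And>\<epsilon>. \<epsilon> > 0 \<Longrightarrow> \<exists>N. \<forall>i\<ge>N. \<forall>j\<ge>N. vnorm (sobolev_real0 s) (X i - X j) < \<epsilon>"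
    have X': "\<And>n. cplx (X n) \<in> Hs s" "\<And>n. X n 0 = 0" using X(1) by auto
    have X2: "\<exists>N. \<forall>i\<ge>N. \<forall>j\<ge>N. hnorm s (cplx (X i) - cplx (X j)) < \<epsilon>" if "\<epsilon> > 0" for \<epsilon>
      using X(2)[OF that] unfolding sobolev_real_simps cplx_ops .
    obtain x where x: "cplx x \<in> Hs s" "(\<lambda>n. hnorm s (cplx (X n) - cplx x)) \<longlonglongrightarrow> 0" using lim[OF X'(1) X2] by blast
    have "\<bar>x 0\<bar> \<le> embedding_const s * hnorm s (cplx (X n) - cplx x)" for n
      using Hs_fourier_series(3)[OF s nspace_diff[OF normed_sobolev_complex X'(1) x(1)], where x = 0] X'(2) by simp
    moreover have "(\<lambda>n. embedding_const s * hnorm s (cplx (X n) - cplx x)) \<longlonglongrightarrow> embedding_const s * 0"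
      by (intro tendsto_intros x(2))
    ultimately have "\<bar>x 0\<bar> \<le> embedding_const s * 0" by (intro tendsto_lowerbound[of _ _ sequentially]) auto
    then have "x 0 = 0" by simp
    with x show "\<exists>x\<in>vecs (sobolev_real0 s). (\<lambda>n. vnorm (sobolev_real0 s) (X n - x)) \<longlonglongrightarrow> 0"
      by (intro bexI[of _ x]) (simp_all only: sobolev_real_simps cplx_ops simp_thms)
  qed
qed

lemma Hs_real_deriv:
  assumes s: "s > 3/2" and u: "cplx u \<in> Hs s"
  shows "(u has_real_derivative deriv u x) (at x)" "cplx (deriv u) \<in> Hs (s - 1)"
    "hnorm (s - 1) (cplx (deriv u)) \<le> hnorm s (cplx u)"
proof -
  obtain g where g: "g \<in> Hs (s - 1)" "hnorm (s - 1) g \<le> hnorm s (cplx u)" "\<And>x. (cplx u has_vector_derivative g x) (at x)"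
    using Hs_deriv[OF s u] by blast
  have re: "(u has_vector_derivative Re (g x)) (at x)" for x
    using bounded_linear.has_vector_derivative[OF bounded_linear_Re g(3)[of x]] by simp
  \<comment> \<open>The imaginary part of the derivative is the derivative of the zero
    function.\<close>
  have "((\<lambda>x. 0) has_vector_derivative Im (g x)) (at x)" for x
    using bounded_linear.has_vector_derivative[OF bounded_linear_Im g(3)[of x]] by simp
  then have "Im (g x) = 0" for x using vector_derivative_unique_at[OF _ has_vector_derivative_const] by blast
  moreover have d: "(u has_real_derivative Re (g x)) (at x)" for x
    using re by (simp add: has_real_derivative_iff_has_vector_derivative)
  then have "deriv u x = Re (g x)" for x by (rule DERIV_imp_deriv)
  ultimately have "g = cplx (deriv u)" by (simp add: fun_eq_iff complex_eq_iff)
  then show "(u has_real_derivative deriv u x) (at x)" "cplx (deriv u) \<in> Hs (s - 1)"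
    "hnorm (s - 1) (cplx (deriv u)) \<le> hnorm s (cplx u)"
    using g d by auto
qed

lemma bounded_linear_on_deriv:
  assumes "s > 3/2"
  shows "bounded_linear_on (sobolev_real0 s) (sobolev_real (s - 1)) deriv"
  unfolding bounded_linear_on_def lin_on_def
proof (intro conjI exI[of _ 1] ballI allI)
  show "deriv ` vecs (sobolev_real0 s) \<subseteq> vecs (sobolev_real (s - 1))"
    using Hs_real_deriv(2)[OF assms] by auto
  fix u assume u: "u \<in> vecs (sobolev_real0 s)"
  then have du: "(u has_real_derivative deriv u x) (at x)" for x using Hs_real_deriv(1)[OF assms] by simp
  show "deriv (u + v) = deriv u + deriv v" if "v \<in> vecs (sobolev_real0 s)" for v
  proof
    fix x
    have "(v has_real_derivative deriv v x) (at x)" using Hs_real_deriv(1)[OF assms] that by simp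
    from DERIV_imp_deriv[OF DERIV_add[OF du this]] show "deriv (u + v) x = (deriv u + deriv v) x"
      by (simp add: plus_fun_def)
  qed
  show "deriv (r *\<^sub>R u) = r *\<^sub>R deriv u" for r
  proof
    fix x show "deriv (r *\<^sub>R u) x = (r *\<^sub>R deriv u) x"
      using DERIV_imp_deriv[OF DERIV_cmult[OF du, of r x]] by (simp add: scaleR_fun_def)
  qed
  show "vnorm (sobolev_real (s - 1)) (deriv u) \<le> 1 * vnorm (sobolev_real0 s) u"
    using Hs_real_deriv(3)[OF assms] u by simp
qed

text \<open>Subtracting the mean makes the primitive periodic for every g. For g = \<phi>', whose
  mean is 1, the result is \<phi> - id; being linear on the whole space, the map recovers \<phi>
  from |f|^2 and is also defined off the unit sphere.\<close>

definition mean_free_primitive :: "(real \<Rightarrow> real) \<Rightarrow> real \<Rightarrow> real" where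
  "mean_free_primitive g = primitive (\<lambda>x. g x - integral {0..1} g)"

lemma cplx_circle: "circle_fun (cplx u) \<longleftrightarrow> continuous_on UNIV u \<and> (\<forall>x. u (x + 1) = u x)"
proof -
  have "continuous_on UNIV u" if "continuous_on UNIV (cplx u)"
    using continuous_on_Re[OF that] by simp
  then show ?thesis by (auto simp: circle_fun_def intro!: continuous_intros)
qed

text \<open>Let E be the embedding bound for the supremum of g. The integrand is at most 2 E, and so
  is its primitive on the unit interval; \<open>Hs_raise\<close> then gives 2 E plus twice the norm
  of the integrand, which is at most that of g plus E.\<close>

lemma mean_free_primitive:
  assumes t: "t > 1/2" and g: "cplx g \<in> Hs t"
  shows "(mean_free_primitive g has_real_derivative g x - integral {0..1} g) (at x)"
    "mean_free_primitive g \<in> vecs (sobolev_real0 (t + 1))"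
    "hnorm (t + 1) (cplx (mean_free_primitive g)) \<le> (4 * embedding_const t + 2) * hnorm t (cplx g)"
proof -
  let ?m = "integral {0..1} g" and ?E = "embedding_const t * hnorm t (cplx g)"
  let ?h = "\<lambda>x. g x - ?m" and ?P = "mean_free_primitive g"
  have cg: "continuous_on UNIV g" "g (x + 1) = g x" for x using Hs_circle[OF g] by (auto simp: cplx_circle)
  have ch: "continuous_on UNIV ?h" "?h (x + 1) = ?h x" for x using cg by (auto intro!: continuous_intros)
  have d: "(?P has_vector_derivative ?h x) (at x)" for x
    unfolding mean_free_primitive_def by (rule primitive_has_vector_derivative[OF ch(1)])
  then show "(?P has_real_derivative ?h x) (at x)" for x
    by (simp add: has_real_derivative_iff_has_vector_derivative)
  have int: "g integrable_on {0..1}" by (intro integrable_continuous_real continuous_on_subset[OF cg(1)]) auto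
  have "integral {0..1} ?h = 0" using int by (subst integral_diff) auto
  then have per: "?P (x + 1) = ?P x" for x
    unfolding mean_free_primitive_def using primitive_periodic[OF ch] by simp
  have c: "circle_fun (cplx ?P)"
    unfolding cplx_circle using has_vector_derivative_continuous_on[OF d] per by blast
  have gE: "\<bar>g x\<bar> \<le> ?E" for x using Hs_fourier_series(3)[OF t g, of x] by simp
  have "norm ?m \<le> ?E * (1 - 0)"
    using gE by (intro integral_bound continuous_on_subset[OF cg(1)]) auto
  then have m: "\<bar>?m\<bar> \<le> ?E" by simp
  have hE: "\<bar>?h x\<bar> \<le> 2 * ?E" for x using gE[of x] m by (auto simp: abs_le_iff)
  have E0: "0 \<le> ?E" using embedding_const_nonneg hnorm_nonneg by simp
  have "\<bar>?P x\<bar> \<le> 2 * ?E" if x: "x \<in> {0..1}" for x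
  proof -
    have "?P x = integral {0..x} ?h" using x by (cases "x = 0") (auto simp: mean_free_primitive_def primitive_def)
    moreover have "norm (integral {0..x} ?h) \<le> 2 * ?E * (x - 0)"
      using hE x by (intro integral_bound continuous_on_subset[OF ch(1)]) auto
    moreover have "2 * ?E * (x - 0) \<le> 2 * ?E * 1" using x E0 by (intro mult_left_mono) auto
    ultimately show ?thesis by simp
  qed
  then have PE: "cmod (cplx ?P x) \<le> 2 * ?E" for x
    using periodic_frac[of ?P x, OF per] frac_unit[of x] by (metis norm_of_real)
  have h: "cplx ?h \<in> Hs t" "hnorm t (cplx ?h) \<le> hnorm t (cplx g) + ?E"
  proof -
    have eq: "cplx ?h = (\<lambda>x. cplx g x + of_real (- ?m))" by simp
    show "cplx ?h \<in> Hs t" unfolding eq by (rule Hs_add(1)[OF g Hs_const(1)])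
    have "hnorm t (cplx ?h) \<le> hnorm t (cplx g) + hnorm t (\<lambda>x. of_real (- ?m))"
      unfolding eq by (rule Hs_add(2)[OF g Hs_const(1)])
    also have "hnorm t (\<lambda>x. of_real (- ?m)) \<le> cmod (of_real (- ?m))" by (rule Hs_const(2))
    finally show "hnorm t (cplx ?h) \<le> hnorm t (cplx g) + ?E" using m by simp
  qed
  have dc: "(cplx ?P has_vector_derivative cplx ?h x) (at x)" for x
    using bounded_linear.has_vector_derivative[OF bounded_linear_of_real d[of x]] .
  note r = Hs_raise[OF c h(1) dc PE]
  show "?P \<in> vecs (sobolev_real0 (t + 1))" using r(1) by (simp add: mean_free_primitive_def)
  show "hnorm (t + 1) (cplx ?P) \<le> (4 * embedding_const t + 2) * hnorm t (cplx g)"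
    using r(2) h(2) by (simp add: algebra_simps)
qed

text \<open>Both functions have the same derivative and vanish at 0. Linearity of the primitive and
  the recovery of \<phi> - id follow from this.\<close>

lemma mean_free_primitive_eqI:
  assumes t: "t > 1/2" and g: "cplx g \<in> Hs t"
    and u: "\<And>x. (u has_real_derivative g x - integral {0..1} g) (at x)" "u 0 = 0"
  shows "mean_free_primitive g = u"
proof
  fix x
  have "mean_free_primitive g x - u x = mean_free_primitive g 0 - u 0"
    by (rule derivative_unique_const)
       (use mean_free_primitive(1)[OF t g] u(1) in \<open>auto simp: has_real_derivative_iff_has_vector_derivative\<close>)
  then show "mean_free_primitive g x = u x" using u(2) by (simp add: mean_free_primitive_def)
qed

lemma bounded_linear_on_mean_free_primitive:
  assumes t: "t > 1/2"
  shows "bounded_linear_on (sobolev_real t) (sobolev_real0 (t + 1)) mean_free_primitive"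
  unfolding bounded_linear_on_def lin_on_def
proof (intro conjI exI ballI allI)
  let ?P = mean_free_primitive
  show "?P ` vecs (sobolev_real t) \<subseteq> vecs (sobolev_real0 (t + 1))" using mean_free_primitive(2)[OF t] by auto
  fix g assume "g \<in> vecs (sobolev_real t)"
  then have g: "cplx g \<in> Hs t" by simp
  show "vnorm (sobolev_real0 (t + 1)) (?P g) \<le> (4 * embedding_const t + 2) * vnorm (sobolev_real t) g"
    using mean_free_primitive(3)[OF t g] by simp
  have int: "u integrable_on {0..1}" if "cplx u \<in> Hs t" for u
    using Hs_circle[OF that] by (intro integrable_continuous_real) (auto simp: cplx_circle intro: continuous_on_subset)
  have P0: "?P g 0 = 0" for g by (simp add: mean_free_primitive_def)
  show "?P (g + h) = ?P g + ?P h" if "h \<in> vecs (sobolev_real t)" for h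
  proof -
    have h: "cplx h \<in> Hs t" using that by simp
    have gh: "cplx (g + h) \<in> Hs t" unfolding cplx_ops by (rule nspace_add[OF normed_sobolev_complex g h])
    have I: "integral {0..1} (g + h) = integral {0..1} g + integral {0..1} h"
      using integral_add[OF int[OF g] int[OF h]] by (simp add: plus_fun_def)
    show ?thesis
    proof (rule mean_free_primitive_eqI[OF t gh])
      fix x show "(?P g + ?P h has_real_derivative (g + h) x - integral {0..1} (g + h)) (at x)"
        using DERIV_add[OF mean_free_primitive(1)[OF t g] mean_free_primitive(1)[OF t h], of x] unfolding I
        by (simp add: plus_fun_def algebra_simps)
    qed (simp add: P0)
  qed
  show "?P (r *\<^sub>R g) = r *\<^sub>R ?P g" for r
  proof -
    have rg: "cplx (r *\<^sub>R g) \<in> Hs t" unfolding cplx_ops by (rule nspace_scale[OF normed_sobolev_complex g])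
    have I: "integral {0..1} (r *\<^sub>R g) = r * integral {0..1} g" by (simp add: scaleR_fun_def)
    show ?thesis
    proof (rule mean_free_primitive_eqI[OF t rg])
      fix x show "(r *\<^sub>R ?P g has_real_derivative (r *\<^sub>R g) x - integral {0..1} (r *\<^sub>R g)) (at x)"
        using DERIV_cmult[OF mean_free_primitive(1)[OF t g], of r x] unfolding I
        by (simp add: scaleR_fun_def algebra_simps)
    qed (simp add: P0)
  qed
qed

section \<open>The inner product and the symplectic form\<close>

lemma L2_inner_Re_bilinear:
  assumes s: "s > 1/2"
  shows "bounded_bilinear_on (sobolev_complex s) (sobolev_complex s) real_nspace (\<lambda>f g. Re (L2_inner f g))"
proof -
  have int: "(\<lambda>x. f x * cnj (g x)) integrable_on {0..1}" if "f \<in> Hs s" "g \<in> Hs s" for f g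
    by (rule circle_fun_integrable[OF circle_fun_mult[OF Hs_circle[OF that(1)] circle_fun_cnj[OF Hs_circle[OF that(2)]]]])
  have add: "L2_inner (f + f') g = L2_inner f g + L2_inner f' g" "L2_inner g (f + f') = L2_inner g f + L2_inner g f'"
    if "f \<in> Hs s" "f' \<in> Hs s" "g \<in> Hs s" for f f' g
    unfolding L2_inner_def using int that by (simp_all add: distrib_left distrib_right integral_add)
  have scale: "L2_inner (r *\<^sub>R f) g = r *\<^sub>R L2_inner f g" "L2_inner g (r *\<^sub>R f) = r *\<^sub>R L2_inner g f" for f g r
    unfolding L2_inner_def by (simp_all add: complex_cnj_scaleR)
  have bound: "\<bar>Re (L2_inner f g)\<bar> \<le> (embedding_const s)\<^sup>2 * hnorm s f * hnorm s g" if f: "f \<in> Hs s" and g: "g \<in> Hs s" for f g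
  proof -
    have "cmod (integral {0..1} (\<lambda>x. f x * cnj (g x))) \<le> (embedding_const s * hnorm s f) * (embedding_const s * hnorm s g) * (1 - 0)"
    proof (rule integral_bound)
      show "continuous_on {0..1} (\<lambda>x. f x * cnj (g x))" by (intro circle_fun_continuous circle_fun_mult circle_fun_cnj Hs_circle[OF f] Hs_circle[OF g])
      show "cmod (f x * cnj (g x)) \<le> (embedding_const s * hnorm s f) * (embedding_const s * hnorm s g)" for x
        unfolding norm_mult using Hs_fourier_series(3)[OF s f, of x] Hs_fourier_series(3)[OF s g, of x] embedding_const_nonneg[of s] hnorm_nonneg
        by (intro mult_mono) auto
    qed simp
    then show ?thesis using abs_Re_le_cmod[of "L2_inner f g"] by (simp add: L2_inner_def power2_eq_square mult_ac)
  qed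
  show ?thesis
    unfolding bounded_bilinear_on_def lin_on_def
    using bound by (auto simp: real_nspace_def add scale)
qed

lemma L2_inner_commute: "L2_inner g f = cnj (L2_inner f g)"
  unfolding L2_inner_def by (simp add: integral_cnj mult.commute)

text \<open>The constant symplectic form of L2, equal to minus the imaginary part of the complex
  product.\<close>

definition L2_symplectic :: "(real \<Rightarrow> complex) \<Rightarrow> (real \<Rightarrow> complex) \<Rightarrow> real" where
  "L2_symplectic f g = Re (L2_inner (\<lambda>x. \<i> * f x) g)"

lemma L2_symplectic_eq: "L2_symplectic f g = - Im (L2_inner f g)"
  by (simp add: L2_symplectic_def L2_inner_def mult.assoc)

lemma L2_symplectic_skew: "L2_symplectic f g = - L2_symplectic g f"
  by (simp add: L2_symplectic_eq L2_inner_commute[of g f])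

lemma L2_symplectic_bilinear:
  assumes s: "s > 1/2"
  shows "bounded_bilinear_on (sobolev_complex s) (sobolev_complex s) real_nspace L2_symplectic"
proof -
  note B = L2_inner_Re_bilinear[OF s]
  have i: "(\<lambda>x. \<i> * f x) \<in> Hs s" "hnorm s (\<lambda>x. \<i> * f x) = hnorm s f" if "f \<in> Hs s" for f
    using Hs_cmult[OF that, of \<i>] by auto
  have ops: "(\<lambda>x. \<i> * (f + g) x) = (\<lambda>x. \<i> * f x) + (\<lambda>x. \<i> * g x)" "(\<lambda>x. \<i> * (r *\<^sub>R f) x) = r *\<^sub>R (\<lambda>x. \<i> * f x)"
    for f g :: "real \<Rightarrow> complex" and r by (simp_all add: fun_eq_iff algebra_simps)
  obtain C where "\<forall>x\<in>Hs s. \<forall>y\<in>Hs s. vnorm real_nspace (Re (L2_inner x y)) \<le> C * hnorm s x * hnorm s y"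
    using B unfolding bounded_bilinear_on_def by blast
  then have "\<forall>x\<in>Hs s. \<forall>y\<in>Hs s. vnorm real_nspace (L2_symplectic x y) \<le> C * hnorm s x * hnorm s y"
    using i unfolding L2_symplectic_def by metis
  then show ?thesis
    using B i unfolding bounded_bilinear_on_def lin_on_def L2_symplectic_def ops by (auto simp: real_nspace_def)
qed

section \<open>Composition operators on open subsets of H^s\<close>

lemma holomorphic_composition_higher_deriv:
  assumes "s > 3/2" "open \<Omega>" "g holomorphic_on \<Omega>"
  shows "holomorphic_composition s (\<lambda>k. (deriv ^^ k) g) \<Omega>"
proof
  fix k z assume "z \<in> \<Omega>"
  then show "((deriv ^^ k) g has_field_derivative (deriv ^^ Suc k) g z) (at z)"
    using holomorphic_derivI[OF holomorphic_higher_deriv[OF assms(3,2)] assms(2)] by simp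
qed (use assms in auto)

text \<open>The set \<open>dom\<close> of the composition locale as a constant of its own, so that
  one open set can serve several holomorphic functions.\<close>

definition Hs_into :: "real \<Rightarrow> complex set \<Rightarrow> (real \<Rightarrow> complex) set" where
  "Hs_into s \<Omega> = {f \<in> Hs s. \<forall>x. f x \<in> \<Omega>}"

lemma open_Hs_into: "s > 3/2 \<Longrightarrow> open \<Omega> \<Longrightarrow> open_in (sobolev_complex s) (Hs_into s \<Omega>)"
  using holomorphic_composition.dom_is_open[OF holomorphic_composition_higher_deriv[of s \<Omega> "\<lambda>z. z"]]
    holomorphic_composition.dom_def[OF holomorphic_composition_higher_deriv[of s \<Omega> "\<lambda>z. z"]]
  by (simp add: Hs_into_def holomorphic_on_ident)

lemma smooth_deriv_holomorphic:
  assumes "s > 3/2" "open \<Omega>" "g holomorphic_on \<Omega>"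
  shows "smooth_deriv (sobolev_complex s) (sobolev_complex s) (Hs_into s \<Omega>) (\<lambda>f x. g (f x)) (\<lambda>f h x. deriv g (f x) * h x)"
  using holomorphic_composition.composition_smooth[OF holomorphic_composition_higher_deriv[OF assms]]
    holomorphic_composition.dom_def[OF holomorphic_composition_higher_deriv[OF assms]]
  by (simp add: Hs_into_def)

lemma Hs_holomorphic: "s > 3/2 \<Longrightarrow> open \<Omega> \<Longrightarrow> g holomorphic_on \<Omega> \<Longrightarrow> f \<in> Hs_into s \<Omega> \<Longrightarrow> (\<lambda>x. g (f x)) \<in> Hs s"
  using smooth_deriv_vecs(1)[OF smooth_deriv_holomorphic] .

section \<open>The sphere\<close>

abbreviation ip :: "(real \<Rightarrow> complex) \<Rightarrow> (real \<Rightarrow> complex) \<Rightarrow> real" where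
  "ip f g \<equiv> Re (L2_inner f g)"

lemma smooth_deriv_powr:
  "smooth_deriv real_nspace real_nspace {..<1} (\<lambda>t. (1 - t) powr a) (\<lambda>t v. - a * (1 - t) powr (a - 1) * v)"
proof -
  define N where "N k t = (\<Prod>i<k. - (a - real i)) * (1 - t) powr (a - real k)" for k and t :: real
  have "smooth_deriv real_nspace real_nspace {..<1} (N 0) (\<lambda>x v. N 1 x * v)"
  proof (rule smooth_deriv_real)
    fix k and x :: real assume x: "x \<in> {..<1}"
    have "((\<lambda>t. 1 - t) has_real_derivative -1) (at x)" by (auto intro!: derivative_eq_intros)
    moreover have "((\<lambda>z. z powr (a - real k)) has_real_derivative (a - real k) * (1 - x) powr (a - real k - 1)) (at (1 - x))"
      by (rule has_real_derivative_powr) (use x in simp)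
    ultimately have "((\<lambda>t. (1 - t) powr (a - real k)) has_real_derivative (a - real k) * (1 - x) powr (a - real k - 1) * (-1)) (at x)"
      by (rule DERIV_chain2[rotated])
    from DERIV_cmult[OF this, of "\<Prod>i<k. - (a - real i)"]
    show "(N k has_real_derivative N (Suc k) x) (at x)"
      unfolding N_def by (simp add: algebra_simps)
  qed
  then show ?thesis by (simp add: N_def[abs_def])
qed

lemma bounded_bilinear_on_real_times: "bounded_bilinear_on real_nspace real_nspace real_nspace (*)"
  by (auto simp: bounded_bilinear_on_def lin_on_def real_nspace_def algebra_simps abs_mult intro!: exI[of _ 1])

lemma bounded_linear_on_scaleR:
  "normed_nspace E \<Longrightarrow> c \<in> vecs E \<Longrightarrow> bounded_linear_on real_nspace E (\<lambda>t. t *\<^sub>R c)"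
  unfolding bounded_linear_on_def
  by (intro conjI exI[of _ "vnorm E c"])
     (auto simp: lin_on_def real_nspace_def scaleR_left_distrib nspace_scale vnorm_scale mult.commute)

lemma open_in_real: "open A \<Longrightarrow> open_in real_nspace A"
  unfolding open_in_def open_dist by (auto simp: real_nspace_def dist_real_def)

locale sobolev_sphere =
  fixes s :: real
  assumes s: "s > 3/2"
begin

abbreviation X where "X \<equiv> sobolev_complex s"

lemma s_half: "s > 1/2" using s by simp

lemmas nX = normed_sobolev_complex[of s]
lemmas ip_bilinear = L2_inner_Re_bilinear[OF s_half]

lemma ip_add: "f \<in> Hs s \<Longrightarrow> f' \<in> Hs s \<Longrightarrow> g \<in> Hs s \<Longrightarrow> ip (f + f') g = ip f g + ip f' g"
  "f \<in> Hs s \<Longrightarrow> f' \<in> Hs s \<Longrightarrow> g \<in> Hs s \<Longrightarrow> ip g (f + f') = ip g f + ip g f'"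
  using ip_bilinear unfolding bounded_bilinear_on_def lin_on_def by auto

lemma ip_scale: "f \<in> Hs s \<Longrightarrow> g \<in> Hs s \<Longrightarrow> ip (r *\<^sub>R f) g = r * ip f g"
  "f \<in> Hs s \<Longrightarrow> g \<in> Hs s \<Longrightarrow> ip g (r *\<^sub>R f) = r * ip g f"
  using ip_bilinear unfolding bounded_bilinear_on_def lin_on_def by auto

lemma ip_diff:
  assumes "f \<in> Hs s" "f' \<in> Hs s" "g \<in> Hs s"
  shows "ip (f - f') g = ip f g - ip f' g" "ip g (f - f') = ip g f - ip g f'"
proof -
  have "lin_on (Hs s) (\<lambda>f. ip f g)" "lin_on (Hs s) (\<lambda>f. ip g f)"
    using ip_bilinear assms(3) unfolding bounded_bilinear_on_def by auto
  then show "ip (f - f') g = ip f g - ip f' g" "ip g (f - f') = ip g f - ip g f'"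
    using lin_on_diff[OF _ nspace_subspace[OF nX] assms(1,2)] by blast+
qed

lemma ip_commute: "ip f g = ip g f"
  using L2_inner_commute[of f g] by simp

lemma ip_pos:
  assumes "f \<in> Hs s" "f \<noteq> 0"
  shows "0 < ip f f"
proof -
  have "ip f f \<noteq> 0" using L2_inner_self_eq_0[OF Hs_circle[OF assms(1)]] assms(2) by (auto simp: zero_fun_def)
  then show ?thesis using Re_L2_inner_self_nonneg[OF Hs_circle[OF assms(1)]] by linarith
qed

lemma ip_bound: "\<exists>C. \<forall>f\<in>Hs s. \<forall>g\<in>Hs s. \<bar>ip f g\<bar> \<le> C * hnorm s f * hnorm s g"
  using ip_bilinear unfolding bounded_bilinear_on_def by (simp add: real_nspace_def)

lemma U_points_iff: "f \<in> U_points s \<longleftrightarrow> f \<in> Hs s \<and> ip f f = 1 \<and> (\<forall>x. f x \<noteq> 0)"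
  by (auto simp: U_points_def)

section \<open>Graph charts of the unit sphere\<close>

definition model :: "(real \<Rightarrow> complex) \<Rightarrow> (real \<Rightarrow> complex) nspace" where
  "model f0 = \<lparr>vecs = U_tangent s f0, vnorm = hnorm s\<rparr>"

lemma model_simps [simp]: "y \<in> vecs (model f0) \<longleftrightarrow> y \<in> Hs s \<and> ip f0 y = 0" "vnorm (model f0) = hnorm s"
  by (auto simp: model_def U_tangent_def)

lemma vecs_model: "vecs (model f0) = U_tangent s f0"
  by (simp add: model_def)

lemma nmodel: "f0 \<in> Hs s \<Longrightarrow> normed_nspace (model f0)"
  using nspace_0[OF nX] nspace_add[OF nX] nspace_scale[OF nX] vnorm_nonneg[OF nX] vnorm_eq_0[OF nX]
    vnorm_scale[OF nX] vnorm_add[OF nX] ip_scale(2)[of f0 f0 0]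
  unfolding normed_nspace_def subspace_def by (auto simp: ip_add ip_scale)

text \<open>The model space is the kernel of a continuous functional on a complete space.\<close>

lemma banach_model:
  assumes f0: "f0 \<in> Hs s"
  shows "banach_nspace (model f0)"
proof (rule banach_nspaceI[OF nmodel[OF f0]])
  fix Y assume Y: "\<And>n::nat. Y n \<in> vecs (model f0)" "\<And>\<epsilon>. \<epsilon> > 0 \<Longrightarrow> \<exists>N. \<forall>i\<ge>N. \<forall>j\<ge>N. vnorm (model f0) (Y i - Y j) < \<epsilon>"
  have YH: "Y n \<in> Hs s" "ip f0 (Y n) = 0" for n using Y(1)[of n] by auto
  obtain y where y: "y \<in> Hs s" "(\<lambda>n. hnorm s (Y n - y)) \<longlonglongrightarrow> 0"
    using banach_nspace_complete[OF banach_sobolev_complex[OF s_half], of Y] YH(1) Y(2) by auto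
  obtain C where C: "\<And>x y. x \<in> Hs s \<Longrightarrow> y \<in> Hs s \<Longrightarrow> \<bar>ip x y\<bar> \<le> C * hnorm s x * hnorm s y"
    using ip_bound by blast
  have "\<bar>ip f0 y\<bar> \<le> C * hnorm s f0 * hnorm s (Y n - y)" for n
    using C[OF f0 nspace_diff[OF nX YH(1) y(1)], of n] ip_diff(2)[OF YH(1) y(1) f0, of n] YH(2)[of n] by simp
  moreover have "(\<lambda>n. C * hnorm s f0 * hnorm s (Y n - y)) \<longlonglongrightarrow> C * hnorm s f0 * 0"
    by (intro tendsto_intros y(2))
  ultimately have "\<bar>ip f0 y\<bar> \<le> C * hnorm s f0 * 0" by (intro tendsto_lowerbound[of _ _ sequentially]) auto
  then show "\<exists>x\<in>vecs (model f0). (\<lambda>n. vnorm (model f0) (Y n - x)) \<longlonglongrightarrow> 0"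
    using y by (intro bexI[of _ y]) auto
qed

text \<open>The sphere as a graph over the hyperplane orthogonal to \<open>f0\<close>. Writing the
  root with \<open>powr\<close> keeps its derivatives within the family of
  \<open>radial_smooth\<close>.\<close>

definition U_par :: "(real \<Rightarrow> complex) \<Rightarrow> (real \<Rightarrow> complex) \<Rightarrow> real \<Rightarrow> complex" where
  "U_par f0 y = y + (1 - ip y y) powr (1/2) *\<^sub>R f0"

definition U_dpar :: "(real \<Rightarrow> complex) \<Rightarrow> (real \<Rightarrow> complex) \<Rightarrow> (real \<Rightarrow> complex) \<Rightarrow> real \<Rightarrow> complex" where
  "U_dpar f0 y b = b + (- ((1 - ip y y) powr (-1/2) * ip y b)) *\<^sub>R f0"

text \<open>The derivative of \<open>U_dpar f0 y b\<close> in y along a, written so that the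
  symmetry in a and b is visible.\<close>

definition U_d2par :: "(real \<Rightarrow> complex) \<Rightarrow> (real \<Rightarrow> complex) \<Rightarrow> (real \<Rightarrow> complex) \<Rightarrow> (real \<Rightarrow> complex) \<Rightarrow> real \<Rightarrow> complex" where
  "U_d2par f0 y a b = (- ((1 - ip y y) powr (-1/2) * ip a b + (1 - ip y y) powr (-3/2) * ip y a * ip y b)) *\<^sub>R f0"

definition cap :: "(real \<Rightarrow> complex) \<Rightarrow> (real \<Rightarrow> complex) set" where
  "cap f0 = {y \<in> vecs (model f0). ip y y < 1}"

context
  fixes f0
  assumes f0: "f0 \<in> Hs s"
begin

lemma model_inclusion: "bounded_linear_on (model f0) X (\<lambda>y. y)"
  unfolding bounded_linear_on_def by (intro conjI exI[of _ 1]) auto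

lemma model_identity: "smooth_deriv (model f0) X (vecs (model f0)) (\<lambda>y. y) (\<lambda>y v. v)"
  by (rule smooth_deriv_linear[OF nmodel[OF f0] nX model_inclusion order_refl])

lemma square_smooth: "smooth_deriv (model f0) real_nspace (vecs (model f0)) (\<lambda>y. ip y y) (\<lambda>y v. ip v y + ip y v)"
  by (rule smooth_deriv_bilinear_compose[OF nmodel[OF f0] nX nX normed_nspace_real ip_bilinear model_identity model_identity])

lemma vecs_model_open: "open_in (model f0) (vecs (model f0))"
  by (auto simp: open_in_def intro: exI[of _ 1])

lemma cap_open: "open_in (model f0) (cap f0)"
  using smooth_deriv_open_preimage[OF square_smooth nmodel[OF f0] normed_nspace_real vecs_model_open open_in_real[of "{..<1}"]]
  by (simp add: cap_def)

lemma radial_smooth: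
  "smooth_deriv (model f0) real_nspace (cap f0) (\<lambda>y. (1 - ip y y) powr a) (\<lambda>y v. - a * (1 - ip y y) powr (a - 1) * (ip v y + ip y v))"
  by (rule smooth_deriv_compose[OF nmodel[OF f0] normed_nspace_real normed_nspace_real
        smooth_deriv_subset[OF square_smooth] smooth_deriv_powr]) (auto simp: cap_def)

lemma U_par_smooth: "smooth_deriv (model f0) X (cap f0) (U_par f0) (U_dpar f0)"
proof -
  have 1: "smooth_deriv (model f0) X (cap f0) (\<lambda>y. y) (\<lambda>y v. v)"
    by (rule smooth_deriv_subset[OF model_identity]) (auto simp: cap_def)
  note 2 = smooth_deriv_linear_compose[OF nmodel[OF f0] normed_nspace_real nX bounded_linear_on_scaleR[OF nX f0] radial_smooth[of "1/2"]]
  show ?thesis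
    by (rule smooth_deriv_cong[OF smooth_deriv_add[OF nmodel[OF f0] nX 1 2]])
       (auto simp: U_par_def U_dpar_def ip_commute[of _ "_ :: real \<Rightarrow> complex"])
qed

lemma U_dpar_smooth:
  "smooth_deriv (prod_nspace (model f0) (model f0)) X (cap f0 \<times> vecs (model f0)) (\<lambda>z. U_dpar f0 (fst z) (snd z))
     (\<lambda>z v. U_d2par f0 (fst z) (fst v) (snd z) + U_dpar f0 (fst z) (snd v))"
proof -
  note n = nmodel[OF f0]
  let ?P = "prod_nspace (model f0) (model f0)" and ?W = "cap f0 \<times> vecs (model f0)"
  have nP: "normed_nspace ?P" by (rule normed_nspace_prod[OF n n])
  have W: "?W \<subseteq> vecs ?P" by (auto simp: cap_def)
  have L: "bounded_linear_on ?P (model f0) fst" "bounded_linear_on ?P X fst" "bounded_linear_on ?P X snd"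
    unfolding bounded_linear_on_def lin_on_def using vnorm_fst_le[of "model f0" _ "model f0"] vnorm_snd_le[of "model f0" _ "model f0"]
    by (auto intro!: exI[of _ 1])
  have f1: "smooth_deriv ?P (model f0) ?W fst (\<lambda>z v. fst v)" by (rule smooth_deriv_linear[OF nP n L(1) W])
  have f2: "smooth_deriv ?P X ?W fst (\<lambda>z v. fst v)" by (rule smooth_deriv_linear[OF nP nX L(2) W])
  have f3: "smooth_deriv ?P X ?W snd (\<lambda>z v. snd v)" by (rule smooth_deriv_linear[OF nP nX L(3) W])
  have r: "smooth_deriv ?P real_nspace ?W (\<lambda>z. (1 - ip (fst z) (fst z)) powr (-1/2))
      (\<lambda>z v. - (-1/2) * (1 - ip (fst z) (fst z)) powr (-1/2 - 1) * (ip (fst v) (fst z) + ip (fst z) (fst v)))"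
    by (rule smooth_deriv_compose[OF nP n normed_nspace_real f1 radial_smooth]) auto
  note b = smooth_deriv_bilinear_compose[OF nP nX nX normed_nspace_real ip_bilinear f2 f3]
  note rb = smooth_deriv_bilinear_compose[OF nP normed_nspace_real normed_nspace_real normed_nspace_real bounded_bilinear_on_real_times r b]
  \<comment> \<open>The minus sign goes into the vector, so that the scalar factor is a plain
    product of the radial factor and the inner product.\<close>
  have mf0: "- f0 \<in> Hs s" using nspace_scale[OF nX f0, of "-1"] by simp
  note lrb = smooth_deriv_linear_compose[OF nP normed_nspace_real nX bounded_linear_on_scaleR[OF nX mf0] rb]
  show ?thesis
  proof (rule smooth_deriv_cong[OF smooth_deriv_add[OF nP nX f3 lrb]])
    fix z v assume z: "z \<in> ?W" and v: "v \<in> vecs ?P"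
    have c: "ip (fst v) (fst z) = ip (fst z) (fst v)" by (rule ip_commute)
    show "snd v + (- (- 1 / 2) * (1 - ip (fst z) (fst z)) powr (- 1 / 2 - 1) * (ip (fst v) (fst z) + ip (fst z) (fst v)) * ip (fst z) (snd z) +
        (1 - ip (fst z) (fst z)) powr (- 1 / 2) * (ip (fst v) (snd z) + ip (fst z) (snd v))) *\<^sub>R - f0
      = U_d2par f0 (fst z) (fst v) (snd z) + U_dpar f0 (fst z) (snd v)"
      unfolding U_d2par_def U_dpar_def c
      by (simp add: fun_eq_iff algebra_simps scaleR_conv_of_real)
  qed (auto simp: U_dpar_def)
qed

end

lemma U_par_props:
  assumes f0: "f0 \<in> Hs s" "ip f0 f0 = 1" and y: "y \<in> cap f0"
  shows "U_par f0 y \<in> Hs s" "ip (U_par f0 y) (U_par f0 y) = 1" "ip f0 (U_par f0 y) = (1 - ip y y) powr (1/2)"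
    "proj_perp f0 (U_par f0 y) = y" "0 < ip f0 (U_par f0 y)"
proof -
  let ?r = "(1 - ip y y) powr (1/2)"
  have yH: "y \<in> Hs s" "ip f0 y = 0" "ip y f0 = 0" "ip y y < 1" using y by (auto simp: cap_def ip_commute[of y f0])
  have r2: "?r * ?r = 1 - ip y y" using yH by (simp flip: powr_add)
  have sH: "?r *\<^sub>R f0 \<in> Hs s" by (rule nspace_scale[OF nX f0(1)])
  show "U_par f0 y \<in> Hs s" unfolding U_par_def by (rule nspace_add[OF nX yH(1) sH])
  show i: "ip f0 (U_par f0 y) = ?r" unfolding U_par_def using yH f0 sH by (simp add: ip_add ip_scale)
  show "ip (U_par f0 y) (U_par f0 y) = 1"
    unfolding U_par_def using yH f0 sH nspace_add[OF nX yH(1) sH] r2 by (simp add: ip_add ip_scale)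
  show "proj_perp f0 (U_par f0 y) = y" unfolding proj_perp_def i by (simp add: U_par_def)
  show "0 < ip f0 (U_par f0 y)" unfolding i using yH by simp
qed

text \<open>Pythagoras: the squared norm of the projection is 1 minus the square of
  \<open>ip f0 f\<close>, and positivity of \<open>ip f0 f\<close> selects the root.\<close>

lemma proj_perp_props:
  assumes f0: "f0 \<in> Hs s" "ip f0 f0 = 1" and f: "f \<in> Hs s"
  shows "proj_perp f0 f \<in> vecs (model f0)"
    "ip f f = 1 \<Longrightarrow> 0 < ip f0 f \<Longrightarrow> proj_perp f0 f \<in> cap f0 \<and> U_par f0 (proj_perp f0 f) = f \<and> (1 - ip (proj_perp f0 f) (proj_perp f0 f)) powr (1/2) = ip f0 f"
proof -
  let ?c = "ip f0 f"
  have cH: "?c *\<^sub>R f0 \<in> Hs s" by (rule nspace_scale[OF nX f0(1)])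
  have pH: "proj_perp f0 f \<in> Hs s" unfolding proj_perp_def by (rule nspace_diff[OF nX f cH])
  show m: "proj_perp f0 f \<in> vecs (model f0)"
    using pH f0 f cH unfolding proj_perp_def by (simp add: ip_diff ip_scale)
  assume 1: "ip f f = 1" "0 < ?c"
  have "ip (proj_perp f0 f) (proj_perp f0 f) = 1 - ?c\<^sup>2"
    using f0 f cH 1 pH ip_commute[of f f0] unfolding proj_perp_def by (simp add: ip_diff ip_scale power2_eq_square)
  moreover have "0 < ?c\<^sup>2" using 1(2) by simp
  moreover have "(?c\<^sup>2) powr (1/2) = ?c" using 1(2) by (simp add: powr_half_sqrt)
  ultimately show "proj_perp f0 f \<in> cap f0 \<and> U_par f0 (proj_perp f0 f) = f \<and> (1 - ip (proj_perp f0 f) (proj_perp f0 f)) powr (1/2) = ?c"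
    using m by (simp add: cap_def U_par_def) (simp add: proj_perp_def)
qed

definition U_nb :: "(real \<Rightarrow> complex) \<Rightarrow> (real \<Rightarrow> complex) set" where
  "U_nb f0 = {f \<in> Hs_into s (- {0}). ip f0 f \<in> {0<..}}"

lemma bounded_linear_on_ip: "f0 \<in> Hs s \<Longrightarrow> bounded_linear_on X real_nspace (\<lambda>f. ip f0 f)"
proof -
  assume f0: "f0 \<in> Hs s"
  obtain C where "\<And>x y. x \<in> Hs s \<Longrightarrow> y \<in> Hs s \<Longrightarrow> \<bar>ip x y\<bar> \<le> C * hnorm s x * hnorm s y"
    using ip_bound by blast
  then have "\<forall>y\<in>Hs s. \<bar>ip f0 y\<bar> \<le> (C * hnorm s f0) * hnorm s y" using f0 by blast
  then show ?thesis
    unfolding bounded_linear_on_def lin_on_def using f0 by (auto simp: real_nspace_def ip_add ip_scale)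
qed

lemma U_nb_open: "f0 \<in> Hs s \<Longrightarrow> open_in X (U_nb f0)"
  unfolding U_nb_def
proof (rule smooth_deriv_open_preimage[OF _ nX normed_nspace_real])
  assume f0: "f0 \<in> Hs s"
  show "smooth_deriv X real_nspace (Hs_into s (- {0})) (\<lambda>f. ip f0 f) (\<lambda>f v. ip f0 v)"
    by (rule smooth_deriv_linear[OF nX normed_nspace_real bounded_linear_on_ip[OF f0]]) (auto simp: Hs_into_def)
  show "open_in X (Hs_into s (- {0}))" by (rule open_Hs_into[OF s]) auto
  show "open_in real_nspace {0::real<..}" by (rule open_in_real) simp
qed

lemma bounded_linear_on_proj_perp:
  assumes f0: "f0 \<in> Hs s" "ip f0 f0 = 1"
  shows "bounded_linear_on X (model f0) (proj_perp f0)"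
  unfolding bounded_linear_on_def
proof (intro conjI)
  show "proj_perp f0 ` Hs s \<subseteq> vecs (model f0)" using proj_perp_props(1)[OF f0] by blast
  show "lin_on (Hs s) (proj_perp f0)"
    unfolding lin_on_def proj_perp_def using f0 by (auto simp: ip_add ip_scale fun_eq_iff algebra_simps)
  obtain C where C: "\<And>x. x \<in> Hs s \<Longrightarrow> \<bar>ip f0 x\<bar> \<le> C * hnorm s x"
    using bounded_linear_on_ip[OF f0(1)] unfolding bounded_linear_on_def by (auto simp: real_nspace_def)
  have "hnorm s (proj_perp f0 f) \<le> (1 + C * hnorm s f0) * hnorm s f" if f: "f \<in> Hs s" for f
  proof -
    have "hnorm s (proj_perp f0 f) \<le> hnorm s f + \<bar>ip f0 f\<bar> * hnorm s f0"
      unfolding proj_perp_def using vnorm_diff[OF nX f nspace_scale[OF nX f0(1)], of "ip f0 f"] vnorm_scale[OF nX f0(1)] by simp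
    also have "\<dots> \<le> hnorm s f + (C * hnorm s f) * hnorm s f0"
      using C[OF f] hnorm_nonneg by (intro add_left_mono mult_right_mono) auto
    finally show ?thesis by (simp add: algebra_simps)
  qed
  then show "\<exists>C. \<forall>x\<in>Hs s. vnorm (model f0) (proj_perp f0 x) \<le> C * hnorm s x" by auto
qed

lemma U_chart_simps [simp]:
  "cdom (U_chart s f0) = {f \<in> U_points s. 0 < ip f0 f}" "cmap (U_chart s f0) = proj_perp f0"
  "cdiff (U_chart s f0) p = proj_perp f0" "cmodel (U_chart s f0) = model f0"
  by (simp_all add: U_chart_def model_def)

lemma U_chart_image:
  assumes f0: "f0 \<in> U_points s"
  shows "proj_perp f0 ` {f \<in> U_points s. 0 < ip f0 f} = {y \<in> cap f0. U_par f0 y \<in> Hs_into s (- {0})}"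
proof (intro set_eqI iffI)
  have f0': "f0 \<in> Hs s" "ip f0 f0 = 1" using f0 by (auto simp: U_points_iff)
  fix y
  {
    assume "y \<in> proj_perp f0 ` {f \<in> U_points s. 0 < ip f0 f}"
    then obtain f where f: "f \<in> Hs s" "ip f f = 1" "\<forall>x. f x \<noteq> 0" "0 < ip f0 f" "y = proj_perp f0 f"
      by (auto simp: U_points_iff)
    then show "y \<in> {y \<in> cap f0. U_par f0 y \<in> Hs_into s (- {0})}"
      using proj_perp_props(2)[OF f0' f(1,2,4)] by (simp add: Hs_into_def)
  next
    assume "y \<in> {y \<in> cap f0. U_par f0 y \<in> Hs_into s (- {0})}"
    then have y: "y \<in> cap f0" "\<forall>x. U_par f0 y x \<noteq> 0" by (auto simp: Hs_into_def)
    note p = U_par_props[OF f0' y(1)]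
    show "y \<in> proj_perp f0 ` {f \<in> U_points s. 0 < ip f0 f}"
      by (rule image_eqI[of _ _ "U_par f0 y"]) (use p y in \<open>auto simp: U_points_iff\<close>)
  }
qed

text \<open>Let y and b be the projections of f and v, and c = \<open>ip f0 f\<close>. As f = y + c
  f0, the condition \<open>ip f v = 0\<close> gives \<open>ip y b = - c * ip f0 v\<close>; dividing
  by c restores the component of v along \<open>f0\<close>.\<close>

lemma U_dpar_proj_perp:
  assumes f0: "f0 \<in> U_points s" and f: "f \<in> U_points s" "0 < ip f0 f" and v: "v \<in> U_tangent s f"
  shows "U_dpar f0 (proj_perp f0 f) (proj_perp f0 v) = v"
proof -
  have f0': "f0 \<in> Hs s" "ip f0 f0 = 1" and f': "f \<in> Hs s" "ip f f = 1" and v': "v \<in> Hs s" "ip f v = 0"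
    using assms by (auto simp: U_points_iff U_tangent_def)
  let ?y = "proj_perp f0 f" and ?b = "proj_perp f0 v" and ?c = "ip f0 f"
  have y: "?y \<in> cap f0" "(1 - ip ?y ?y) powr (1/2) = ?c" using proj_perp_props(2)[OF f0' f' (1,2) f(2)] by auto
  have "(1 - ip ?y ?y) powr (-1/2) = inverse ((1 - ip ?y ?y) powr (1/2))" by (simp flip: powr_minus)
  then have r: "(1 - ip ?y ?y) powr (-1/2) = inverse ?c" using y(2) by simp
  have sH: "ip f0 v *\<^sub>R f0 \<in> Hs s" "?c *\<^sub>R f0 \<in> Hs s" using nspace_scale[OF nX f0'(1)] by auto
  have "ip ?y ?b = - (?c * ip f0 v)"
    unfolding proj_perp_def using f0' f' v' sH nspace_diff[OF nX] ip_commute[of f f0]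
    by (simp add: ip_diff ip_scale)
  then show ?thesis
    unfolding U_dpar_def r using f(2) by (simp add: proj_perp_def)
qed

lemma U_dpar_tangent:
  assumes f0: "f0 \<in> U_points s" and f: "f \<in> U_points s" "0 < ip f0 f" and b: "b \<in> vecs (model f0)"
  shows "U_dpar f0 (proj_perp f0 f) b \<in> U_tangent s f" "proj_perp f0 (U_dpar f0 (proj_perp f0 f) b) = b"
proof -
  have f0': "f0 \<in> Hs s" "ip f0 f0 = 1" and f': "f \<in> Hs s" "ip f f = 1" and b': "b \<in> Hs s" "ip f0 b = 0"
    using assms by (auto simp: U_points_iff)
  let ?y = "proj_perp f0 f" and ?c = "ip f0 f"
  have y: "?y \<in> cap f0" "(1 - ip ?y ?y) powr (1/2) = ?c" using proj_perp_props(2)[OF f0' f' (1,2) f(2)] by auto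
  have "(1 - ip ?y ?y) powr (-1/2) = inverse ((1 - ip ?y ?y) powr (1/2))" by (simp flip: powr_minus)
  then have r: "(1 - ip ?y ?y) powr (-1/2) = inverse ?c" using y(2) by simp
  have sH: "t *\<^sub>R f0 \<in> Hs s" for t by (rule nspace_scale[OF nX f0'(1)])
  have yb: "ip ?y b = ip f b" unfolding proj_perp_def using f0' f' b' sH by (simp add: ip_diff ip_scale)
  have eq: "U_dpar f0 ?y b = b + (- (inverse ?c * ip f b)) *\<^sub>R f0" unfolding U_dpar_def r yb ..
  show "U_dpar f0 ?y b \<in> U_tangent s f"
    unfolding eq U_tangent_def using f0' f' b' sH f(2) nspace_add[OF nX b'(1) sH] ip_commute[of f f0]
    by (simp add: ip_add ip_scale ip_diff nspace_diff[OF nX])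
  show "proj_perp f0 (U_dpar f0 ?y b) = b"
  proof -
    have "proj_perp f0 (b + t *\<^sub>R f0) = b" for t
      unfolding proj_perp_def using f0' b' sH by (simp add: ip_add ip_scale)
    then show ?thesis unfolding eq .
  qed
qed

lemma U_pointsD: "f \<in> U_points s \<Longrightarrow> f \<in> Hs s" "f \<in> U_points s \<Longrightarrow> ip f f = 1"
  by (simp_all add: U_points_iff)

text \<open>The embedding is the inclusion. The chart extends to the bounded linear map
  \<open>proj_perp f0\<close> on H^s, which is its own derivative.\<close>

lemma embedded_sphere:
  "embedded_manifold X (U_points s) (U_manifold s) (U_points s) (U_chart s) (\<lambda>f. f) (\<lambda>f v. v)
     U_par U_dpar U_d2par U_nb proj_perp (\<lambda>f0 f. proj_perp f0)"
proof unfold_locales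
  show "normed_nspace X" by (rule nX)
  show "bij_betw (\<lambda>f. f) (points (U_manifold s)) (U_points s)" by (simp add: U_manifold_def bij_betw_def)
  show "atlas (U_manifold s) = U_chart s ` U_points s" by (simp add: U_manifold_def)
  show "points (U_manifold s) = (\<Union>i\<in>U_points s. cdom (U_chart s i))"
    by (auto simp: U_manifold_def U_pointsD)
  fix p assume "p \<in> points (U_manifold s)"
  then have p: "p \<in> U_points s" by (simp add: U_manifold_def)
  show "subspace (tangent (U_manifold s) p)"
    using nspace_subspace[OF nmodel[OF U_pointsD(1)[OF p]]] by (simp add: U_manifold_def vecs_model)
next
  fix f0 assume f0: "f0 \<in> U_points s"
  then have f0': "f0 \<in> Hs s" "ip f0 f0 = 1" by (auto simp: U_points_iff)
  have W: "cmap (U_chart s f0) ` cdom (U_chart s f0) = {y \<in> cap f0. U_par f0 y \<in> Hs_into s (- {0})}"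
    using U_chart_image[OF f0] by simp
  show "banach_nspace (cmodel (U_chart s f0))" using banach_model[OF f0'(1)] by simp
  show "open_in (cmodel (U_chart s f0)) (cmap (U_chart s f0) ` cdom (U_chart s f0))"
    unfolding W unfolding U_chart_simps
    by (rule smooth_deriv_open_preimage[OF U_par_smooth[OF f0'(1)] nmodel[OF f0'(1)] nX cap_open[OF f0'(1)] open_Hs_into[OF s]]) auto
  show "open_in X (U_nb f0)" by (rule U_nb_open[OF f0'(1)])
  show "p \<in> cdom (U_chart s f0) \<longleftrightarrow> p \<in> points (U_manifold s) \<and> p \<in> U_nb f0" for p
    by (auto simp: U_manifold_def U_nb_def Hs_into_def U_points_iff)
  show "smooth_deriv (cmodel (U_chart s f0)) X (cmap (U_chart s f0) ` cdom (U_chart s f0)) (U_par f0) (U_dpar f0)"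
    unfolding W unfolding U_chart_simps by (rule smooth_deriv_subset[OF U_par_smooth[OF f0'(1)]]) auto
  show "smooth_deriv (prod_nspace (cmodel (U_chart s f0)) (cmodel (U_chart s f0))) X
        (cmap (U_chart s f0) ` cdom (U_chart s f0) \<times> vecs (cmodel (U_chart s f0))) (\<lambda>z. U_dpar f0 (fst z) (snd z))
        (\<lambda>z v. U_d2par f0 (fst z) (fst v) (snd z) + U_dpar f0 (fst z) (snd v))"
    unfolding W unfolding U_chart_simps by (rule smooth_deriv_subset[OF U_dpar_smooth[OF f0'(1)]]) auto
  show "U_d2par f0 x a b = U_d2par f0 x b a" for x a b
    by (simp add: U_d2par_def ip_commute[of b a] mult.assoc mult.left_commute mult.commute)
  show "smooth_deriv X (cmodel (U_chart s f0)) (U_nb f0) (proj_perp f0) (\<lambda>f. proj_perp f0)"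
    unfolding U_chart_simps
    by (rule smooth_deriv_linear[OF nX nmodel[OF f0'(1)] bounded_linear_on_proj_perp[OF f0']]) (auto simp: U_nb_def Hs_into_def)
  fix p assume "p \<in> cdom (U_chart s f0)"
  then have p: "p \<in> U_points s" "0 < ip f0 p" by auto
  show "cmap (U_chart s f0) p = proj_perp f0 p" by simp
  show "U_par f0 (cmap (U_chart s f0) p) = p" using proj_perp_props(2)[OF f0' U_pointsD[OF p(1)] p(2)] by simp
  have T: "tangent (U_manifold s) p = U_tangent s p" by (simp add: U_manifold_def)
  have sub: "U_tangent s p \<subseteq> Hs s" by (auto simp: U_tangent_def)
  show "lin_on (tangent (U_manifold s) p) (cdiff (U_chart s f0) p)"
    unfolding T U_chart_simps
    by (rule lin_on_subset[OF _ sub]) (use bounded_linear_on_proj_perp[OF f0'] in \<open>simp add: bounded_linear_on_def\<close>)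
  show "bij_betw (cdiff (U_chart s f0) p) (tangent (U_manifold s) p) (vecs (cmodel (U_chart s f0)))"
    unfolding T U_chart_simps
  proof (rule bij_betw_byWitness[where f' = "U_dpar f0 (proj_perp f0 p)"])
    show "\<forall>v\<in>U_tangent s p. U_dpar f0 (proj_perp f0 p) (proj_perp f0 v) = v" using U_dpar_proj_perp[OF f0 p] by blast
    show "\<forall>b\<in>vecs (model f0). proj_perp f0 (U_dpar f0 (proj_perp f0 p) b) = b" using U_dpar_tangent(2)[OF f0 p] by blast
    show "proj_perp f0 ` U_tangent s p \<subseteq> vecs (model f0)" using proj_perp_props(1)[OF f0'] sub by blast
    show "U_dpar f0 (proj_perp f0 p) ` vecs (model f0) \<subseteq> U_tangent s p" using U_dpar_tangent(1)[OF f0 p] by blast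
  qed
  show "v = U_dpar f0 (cmap (U_chart s f0) p) (cdiff (U_chart s f0) p v)" if "v \<in> tangent (U_manifold s) p" for v
    using U_dpar_proj_perp[OF f0 p] that by (simp add: T)
qed

end

section \<open>The group of diffeomorphisms and the Madelung transform\<close>

text \<open>Differentiability of the inverse forces \<phi>' to be nonzero by the chain rule, and
  monotonicity fixes its sign. Conversely a positive derivative yields a bijection with
  differentiable inverse, so the group is described by a pointwise condition on the
  derivative.\<close>

lemma Diff0_iff:
  assumes m: "m > 3/2"
  shows "\<phi> \<in> Diff0 m \<longleftrightarrow> (\<lambda>x. \<phi> x - x) \<in> vecs (sobolev_real0 m) \<and> (\<forall>x. 0 < 1 + deriv (\<lambda>x. \<phi> x - x) x)"
    (is "_ \<longleftrightarrow> ?R")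
proof -
  let ?u = "\<lambda>x. \<phi> x - x"
  have d: "(\<phi> has_real_derivative 1 + deriv ?u x) (at x)" if "cplx ?u \<in> Hs m" for x
    using DERIV_add[OF DERIV_ident Hs_real_deriv(1)[OF m that], of x] by simp
  show ?thesis
  proof
    assume \<phi>: "\<phi> \<in> Diff0 m"
    then have u: "cplx ?u \<in> Hs m" "\<phi> 0 = 0" and mono: "strict_mono \<phi>" and bij: "bij \<phi>"
      and inv: "inv \<phi> differentiable_on UNIV"
      by (auto simp: Diff0_def)
    have "0 < 1 + deriv ?u x" for x
    proof -
      have "mono_on UNIV \<phi>" using strict_mono_mono[OF mono] .
      then have "0 \<le> 1 + deriv ?u x"
        by (rule mono_on_imp_deriv_nonneg[OF _ d[OF u(1)]]) simp
      moreover have "1 + deriv ?u x \<noteq> 0"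
      proof
        assume 0: "1 + deriv ?u x = 0"
        have "inv \<phi> differentiable (at (\<phi> x))" using inv by (simp add: differentiable_on_def)
        then obtain D where "(inv \<phi> has_real_derivative D) (at (\<phi> x))"
          using real_differentiable_def by blast
        from DERIV_chain2[OF this d[OF u(1)]]
        have "((\<lambda>y. inv \<phi> (\<phi> y)) has_real_derivative 0) (at x)" using 0 by simp
        moreover have "(\<lambda>y. inv \<phi> (\<phi> y)) = (\<lambda>y. y)" using bij by (simp add: bij_is_inj fun_eq_iff)
        ultimately have "((\<lambda>y. y) has_real_derivative 0) (at x)" by simp
        then show False using DERIV_unique[OF _ DERIV_ident] by fastforce
      qed
      ultimately show ?thesis by simp
    qed
    then show ?R using u by simp
  next
    assume ?R
    then have u: "cplx ?u \<in> Hs m" "\<phi> 0 = 0" and pos: "\<And>x. 0 < 1 + deriv ?u x" by auto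
    note d = d[OF u(1)]
    have mono: "strict_mono \<phi>"
      by (rule strict_monoI) (use DERIV_pos_imp_increasing d pos in blast)
    have cont: "isCont \<phi> x" for x using d DERIV_isCont by blast
    have per: "?u (x + 1) = ?u x" for x using Hs_circle[OF u(1)] unfolding cplx_circle by blast
    \<comment> \<open>With all integers fixed, every y lies between two values of \<phi>, and the
      intermediate value theorem gives surjectivity.\<close>
    have int: "\<phi> (of_int k) = of_int k" for k using periodic_int[of ?u 0 k, OF per] u(2) by simp
    have "surj \<phi>"
    proof (rule surjI)
      fix y
      have "\<exists>x\<ge>of_int (floor y). x \<le> of_int (floor y + 1) \<and> \<phi> x = y"
      proof (rule IVT)
        show "\<phi> (of_int \<lfloor>y\<rfloor>) \<le> y" unfolding int by simp
        show "y \<le> \<phi> (of_int (\<lfloor>y\<rfloor> + 1))" unfolding int by linarith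
      qed (use cont in auto)
      then show "\<phi> (SOME x. \<phi> x = y) = y" by (metis (mono_tags, lifting) someI)
    qed
    then have bij: "bij \<phi>" using strict_mono_imp_inj_on[OF mono] by (simp add: bij_def)
    have inv: "inv \<phi> (\<phi> x) = x" "\<phi> (inv \<phi> y) = y" for x y
      using bij by (simp_all add: bij_is_inj bij_is_surj surj_f_inv_f)
    have icont: "isCont (inv \<phi>) y" for y
      using isCont_inverse_function[of 1 "inv \<phi> y" "inv \<phi>" \<phi>] inv cont by simp
    have "(inv \<phi> has_real_derivative inverse (1 + deriv ?u (inv \<phi> y))) (at y)" for y
    proof (rule DERIV_inverse_function[where f = \<phi> and g = "inv \<phi>" and a = "y - 1" and b = "y + 1" and x = y])
      show "(\<phi> has_real_derivative 1 + deriv ?u (inv \<phi> y)) (at (inv \<phi> y))" by (rule d)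
      show "1 + deriv ?u (inv \<phi> y) \<noteq> 0" using pos[of "inv \<phi> y"] by simp
    qed (use inv icont in auto)
    then have "inv \<phi> differentiable_on UNIV"
      unfolding differentiable_on_def using real_differentiable_def differentiable_at_withinI by blast
    moreover have "\<phi> differentiable_on UNIV"
      unfolding differentiable_on_def using d real_differentiable_def differentiable_at_withinI by blast
    ultimately show "\<phi> \<in> Diff0 m" using u mono bij by (simp add: Diff0_def)
  qed
qed

lemma Diff0_deriv:
  assumes m: "m > 3/2" and \<phi>: "\<phi> \<in> Diff0 m"
  shows "(\<phi> has_real_derivative deriv \<phi> x) (at x)" "0 < deriv \<phi> x" "1 + deriv (\<lambda>x. \<phi> x - x) x = deriv \<phi> x"
    "cplx (\<lambda>x. \<phi> x - x) \<in> Hs m" "\<phi> 0 = 0"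
proof -
  have u: "cplx (\<lambda>x. \<phi> x - x) \<in> Hs m" "\<phi> 0 = 0" and pos: "\<And>x. 0 < 1 + deriv (\<lambda>x. \<phi> x - x) x"
    using \<phi> unfolding Diff0_iff[OF m] by auto
  have d: "(\<phi> has_real_derivative 1 + deriv (\<lambda>x. \<phi> x - x) x) (at x)" for x
    using DERIV_add[OF DERIV_ident Hs_real_deriv(1)[OF m u(1)], of x] by simp
  from DERIV_imp_deriv[OF this] have e: "deriv \<phi> x = 1 + deriv (\<lambda>x. \<phi> x - x) x" for x .
  show "(\<phi> has_real_derivative deriv \<phi> x) (at x)" using d e by simp
  show "0 < deriv \<phi> x" "1 + deriv (\<lambda>x. \<phi> x - x) x = deriv \<phi> x" using pos e by simp_all
  show "cplx (\<lambda>x. \<phi> x - x) \<in> Hs m" "\<phi> 0 = 0" by (rule u)+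
qed

section \<open>Polar coordinates and the circle of length 4 pi\<close>

lemma cis_eq_iff: "cis a = cis b \<longleftrightarrow> (\<exists>k::int. a - b = 2 * pi * of_int k)"
proof -
  have "cis a = cis b \<longleftrightarrow> cis (a - b) = 1" by (simp add: cis_divide[symmetric])
  also have "\<dots> \<longleftrightarrow> (\<exists>k::int. a - b = 2 * pi * of_int k)"
    using exp_eq_1[of "\<i> * of_real (a - b)"] by (simp add: cis_conv_exp mult_ac)
  finally show ?thesis .
qed

lemma half_exp_abs: "half_exp (abs_circle4pi t) = cis (t / 2)"
  by (simp add: half_exp.abs_eq)

text \<open>The length 4 pi of the circle is exactly the period of exp(i t/2).\<close>

lemma half_exp_eq_iff: "half_exp a = half_exp b \<longleftrightarrow> a = b"
proof -
  have "\<exists>s. a = abs_circle4pi s" "\<exists>t. b = abs_circle4pi t"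
    using Quotient_abs_rep[OF Quotient_circle4pi] by metis+
  then obtain s t where st: "a = abs_circle4pi s" "b = abs_circle4pi t" by blast
  have "cis (s / 2) = cis (t / 2) \<longleftrightarrow> (\<exists>k::int. s - t = 4 * pi * of_int k)"
    unfolding cis_eq_iff by (intro ex_cong1) (auto simp: field_simps)
  then show ?thesis unfolding st half_exp_abs circle4pi.abs_eq_iff .
qed

lemma norm_half_exp [simp]: "cmod (half_exp a) = 1"
proof -
  have "\<exists>s. a = abs_circle4pi s" using Quotient_abs_rep[OF Quotient_circle4pi] by metis
  then show ?thesis by (auto simp: half_exp_abs)
qed

text \<open>A coordinate with |h| < 2 pi has |h/2| < pi, so the principal logarithm reads it off
  without ambiguity.\<close>

lemma Ln_polar: "0 < r \<Longrightarrow> \<bar>t\<bar> < pi \<Longrightarrow> Ln (of_real r * cis t) = of_real (ln r) + \<i> * of_real t"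
  using Ln_exp[of "of_real (ln r) + \<i> * of_real t"] by (simp add: exp_add cis_conv_exp abs_less_iff exp_of_real)

lemma polar_slit:
  assumes r: "0 < r" and t: "\<bar>t\<bar> < pi"
  shows "of_real r * cis t \<notin> \<real>\<^sub>\<le>\<^sub>0"
proof
  assume "of_real r * cis t \<in> \<real>\<^sub>\<le>\<^sub>0"
  then have 0: "r * cos t \<le> 0" "sin t = 0" using r by (auto simp: complex_nonpos_Reals_iff)
  then have "t = 0" using sin_eq_0_pi[of t] t by (simp add: abs_less_iff)
  then show False using 0 r by simp
qed

locale madelung_setting =
  fixes m :: real
  assumes m: "m > 5/2"

sublocale madelung_setting \<subseteq> sobolev_sphere "m - 1"
  using m by unfold_locales simp

context madelung_setting
begin

lemma m': "m > 3/2" using m by simp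

abbreviation "s \<equiv> m - 1"
abbreviation "GP \<equiv> prod_nspace (sobolev_real0 m) (sobolev_real s)"

lemma nGP: "normed_nspace GP"
  by (rule normed_nspace_prod[OF normed_sobolev_real0 normed_sobolev_real])

section \<open>The parametrisation of the group and its derivatives\<close>

lemma bounded_linear_on_deriv_fst: "bounded_linear_on GP X (\<lambda>z. cplx (deriv (fst z)))"
proof -
  have "bounded_linear_on GP (sobolev_real0 m) fst"
    unfolding bounded_linear_on_def lin_on_def using vnorm_fst_le[of "sobolev_real0 m" _ "sobolev_real s"]
    by (auto intro!: exI[of _ 1])
  from bounded_linear_on_compose[OF bounded_linear_on_compose[OF this bounded_linear_on_deriv[OF m'] normed_sobolev_real0]
      bounded_linear_on_cplx normed_sobolev_real] show ?thesis .
qed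

lemma bounded_linear_on_snd: "bounded_linear_on GP X (\<lambda>z. cplx (snd z))"
proof -
  have "bounded_linear_on GP (sobolev_real s) snd"
    unfolding bounded_linear_on_def lin_on_def using vnorm_snd_le[of "sobolev_real s" _ "sobolev_real0 m"]
    by (auto intro!: exI[of _ 1])
  from bounded_linear_on_compose[OF this bounded_linear_on_cplx normed_sobolev_real] show ?thesis .
qed

lemma bounded_linear_on_half_snd: "bounded_linear_on GP X (\<lambda>z x. \<i> / 2 * of_real (snd z x))"
  by (rule bounded_linear_on_compose[OF bounded_linear_on_snd bounded_linear_on_cmult nX])

definition rho :: "G_vector \<Rightarrow> real \<Rightarrow> complex" where
  "rho z x = of_real (1 + deriv (fst z) x)"

text \<open>Common domain of the holomorphic branches of square root and logarithm.\<close>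

definition slit :: "complex set" where
  "slit = - \<real>\<^sub>\<le>\<^sub>0"

lemma open_slit: "open slit"
  unfolding slit_def by (simp add: closed_nonpos_Reals_complex open_Compl)

definition G_dom :: "G_vector set" where
  "G_dom = {z \<in> vecs GP. (\<forall>x. 0 < 1 + deriv (fst z) x) \<and> (\<forall>x. \<bar>snd z x\<bar> < 2 * pi)}"

lemma rho_smooth: "smooth_deriv GP X (vecs GP) rho (\<lambda>z v. cplx (deriv (fst v)))"
proof -
  have one: "(\<lambda>x. 1) \<in> Hs s" by (rule Hs_const)
  show ?thesis
    by (rule smooth_deriv_cong[OF smooth_deriv_add[OF nGP nX smooth_deriv_const[OF nGP nX one] smooth_deriv_linear[OF nGP nX bounded_linear_on_deriv_fst order_refl]]])
       (auto simp: rho_def[abs_def] fun_eq_iff)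
qed

text \<open>The real inequalities become values in open sets of the plane, the slit plane and a
  strip, so that openness follows from \<open>open_Hs_into\<close>.\<close>

lemma G_dom_iff: "z \<in> G_dom \<longleftrightarrow> z \<in> vecs GP \<and> rho z \<in> Hs_into s slit \<and> cplx (snd z) \<in> Hs_into s {w. \<bar>Re w\<bar> < 2 * pi}"
proof -
  have "rho z \<in> Hs s" "cplx (snd z) \<in> Hs s" if "z \<in> vecs GP"
    using smooth_deriv_vecs(1)[OF rho_smooth that] that by auto
  moreover have "of_real t \<in> slit \<longleftrightarrow> 0 < t" for t :: real
    by (auto simp: slit_def complex_nonpos_Reals_iff)
  ultimately show ?thesis by (auto simp: G_dom_def Hs_into_def rho_def simp del: of_real_add)
qed

lemma G_dom_open: "open_in GP G_dom"
proof -
  have vo: "open_in GP (vecs GP)" by (auto simp: open_in_def intro: exI[of _ 1])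
  note o1 = smooth_deriv_open_preimage[OF rho_smooth nGP nX vo open_Hs_into[OF s open_slit]]
  have "open {w. \<bar>Re w\<bar> < 2 * pi}" by (intro open_Collect_less continuous_intros)
  note o2 = smooth_deriv_open_preimage[OF smooth_deriv_linear[OF nGP nX bounded_linear_on_snd order_refl] nGP nX vo open_Hs_into[OF s this]]
  have "G_dom = {z \<in> vecs GP. rho z \<in> Hs_into s slit} \<inter> {z \<in> vecs GP. cplx (snd z) \<in> Hs_into s {w. \<bar>Re w\<bar> < 2 * pi}}"
    using G_dom_iff by auto
  then show ?thesis using open_in_Int[OF o1 o2] by simp
qed

lemma G_dom_vecs: "G_dom \<subseteq> vecs GP"
  by (auto simp: G_dom_def)

lemma Hs_exp: "f \<in> Hs s \<Longrightarrow> (\<lambda>x. exp (f x)) \<in> Hs s"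
  by (rule Hs_holomorphic[OF s open_UNIV holomorphic_on_exp]) (simp add: Hs_into_def)

text \<open>A lift of winding number n is 4 pi n x plus a periodic H^s function, and half of 4 pi n
  x is the argument of \<open>mode n\<close>. So cis(\<theta>/2) is a mode times the exponential of
  an H^s function.\<close>

lemma Hs_half_exp:
  assumes "\<theta> \<in> circle_lifts s"
  shows "(\<lambda>x. cis (\<theta> x / 2)) \<in> Hs s" "(\<lambda>x. cis (- \<theta> x / 2)) \<in> Hs s"
proof -
  obtain n :: int where n: "cplx (\<lambda>x. \<theta> x - 4 * pi * of_int n * x) \<in> Hs s"
    using assms by (auto simp: circle_lifts_def)
  let ?p = "\<lambda>x. \<theta> x - 4 * pi * of_int n * x"
  have "(\<lambda>x. exp (\<i> / 2 * of_real (?p x))) \<in> Hs s" by (rule Hs_exp[OF Hs_cmult(1)[OF n]])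
  from Hs_mult(1)[OF s_half Hs_mode this]
  have "(\<lambda>x. mode n x * exp (\<i> / 2 * of_real (?p x))) \<in> Hs s" .
  also have "(\<lambda>x. mode n x * exp (\<i> / 2 * of_real (?p x))) = (\<lambda>x. cis (\<theta> x / 2))"
  proof
    fix x
    have "exp (\<i> / 2 * of_real (?p x)) = cis (?p x / 2)" by (simp add: cis_conv_exp)
    then show "mode n x * exp (\<i> / 2 * of_real (?p x)) = cis (\<theta> x / 2)"
      unfolding mode_def by (simp only: cis_mult) (simp add: field_simps)
  qed
  finally show 1: "(\<lambda>x. cis (\<theta> x / 2)) \<in> Hs s" .
  show "(\<lambda>x. cis (- \<theta> x / 2)) \<in> Hs s" using Hs_cnj(1)[OF 1] by (simp add: cis_cnj)
qed

definition G_par :: "(real \<Rightarrow> real) \<Rightarrow> G_vector \<Rightarrow> real \<Rightarrow> complex" where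
  "G_par \<theta> z x = csqrt (rho z x) * (cis (\<theta> x / 2) * exp (\<i> / 2 * of_real (snd z x)))"

text \<open>The logarithmic derivative of \<open>G_par\<close> at z along v, with one summand from
  the square root and one from the phase. It makes \<open>G_dpar\<close> a product;
  \<open>G_d2par\<close> is the product rule, its second term being the derivative of
  1/\<rho>.\<close>

definition kappa :: "G_vector \<Rightarrow> G_vector \<Rightarrow> real \<Rightarrow> complex" where
  "kappa z v x = 1 / 2 * (of_real (deriv (fst v) x) * inverse (rho z x)) + \<i> / 2 * of_real (snd v x)"

definition G_dpar :: "(real \<Rightarrow> real) \<Rightarrow> G_vector \<Rightarrow> G_vector \<Rightarrow> real \<Rightarrow> complex" where
  "G_dpar \<theta> z v x = kappa z v x * G_par \<theta> z x"

definition G_d2par :: "(real \<Rightarrow> real) \<Rightarrow> G_vector \<Rightarrow> G_vector \<Rightarrow> G_vector \<Rightarrow> real \<Rightarrow> complex" where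
  "G_d2par \<theta> z v w x = (kappa z v x * kappa z w x
     - 1 / 2 * of_real (deriv (fst v) x) * of_real (deriv (fst w) x) * (inverse (rho z x))\<^sup>2) * G_par \<theta> z x"

lemma rho_nonzero: "z \<in> G_dom \<Longrightarrow> rho z x \<noteq> 0" "z \<in> G_dom \<Longrightarrow> rho z x \<in> slit"
proof -
  assume "z \<in> G_dom"
  then show "rho z x \<in> slit" by (simp add: G_dom_iff Hs_into_def)
  then show "rho z x \<noteq> 0" by (auto simp: slit_def)
qed

lemma rho_smooth_dom: "smooth_deriv GP X G_dom rho (\<lambda>z v. cplx (deriv (fst v)))"
  by (rule smooth_deriv_subset[OF rho_smooth G_dom_vecs])

lemma G_par_smooth:
  assumes \<theta>: "\<theta> \<in> circle_lifts s"
  shows "smooth_deriv GP X G_dom (G_par \<theta>) (G_dpar \<theta>)"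
proof -
  have hc: "csqrt holomorphic_on slit" unfolding slit_def by (rule holomorphic_on_csqrt)
  have 1: "smooth_deriv GP X G_dom (\<lambda>z x. csqrt (rho z x)) (\<lambda>z v x. deriv csqrt (rho z x) * of_real (deriv (fst v) x))"
    by (rule smooth_deriv_compose[OF nGP nX nX rho_smooth_dom smooth_deriv_holomorphic[OF s open_slit hc]])
       (auto simp: G_dom_iff)
  have 2: "smooth_deriv GP X G_dom (\<lambda>z x. exp (\<i> / 2 * of_real (snd z x)))
      (\<lambda>z v x. deriv exp (\<i> / 2 * of_real (snd z x)) * (\<i> / 2 * of_real (snd v x)))"
    by (rule smooth_deriv_compose[OF nGP nX nX smooth_deriv_linear[OF nGP nX bounded_linear_on_half_snd G_dom_vecs]
          smooth_deriv_holomorphic[OF s open_UNIV holomorphic_on_exp]])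
       (use bounded_linear_on_half_snd G_dom_vecs in \<open>auto simp: Hs_into_def bounded_linear_on_def\<close>)
  note 3 = smooth_deriv_linear_compose[OF nGP nX nX bounded_linear_on_mult[OF s_half Hs_half_exp(1)[OF \<theta>]] 2]
  show ?thesis
  proof (rule smooth_deriv_cong[OF smooth_deriv_bilinear_compose[OF nGP nX nX nX bounded_bilinear_times[OF s_half] 1 3]])
    fix z v assume z: "z \<in> G_dom"
    show "(\<lambda>x. deriv csqrt (rho z x) * of_real (deriv (fst v) x) * (cis (\<theta> x / 2) * exp (\<i> / 2 * of_real (snd z x)))) +
       (\<lambda>x. csqrt (rho z x) * (cis (\<theta> x / 2) * (deriv exp (\<i> / 2 * of_real (snd z x)) * (\<i> / 2 * of_real (snd v x)))))
       = G_dpar \<theta> z v"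
    proof
      fix x
      have "deriv csqrt (rho z x) = inverse (2 * csqrt (rho z x))"
        using rho_nonzero(2)[OF z, of x] by (intro DERIV_imp_deriv has_field_derivative_csqrt) (simp add: slit_def)
      moreover have "csqrt (rho z x) * csqrt (rho z x) = rho z x" "csqrt (rho z x) \<noteq> 0"
        using rho_nonzero(1)[OF z, of x] by (simp_all flip: power2_eq_square)
      \<comment> \<open>With c the square root of \<rho>, the derivative 1/(2 c) is 1/(2 c^2) times
        c, which exhibits the factor \<open>G_par\<close>.\<close>
      moreover have "inverse (2 * c) * d * (e * q) = (1 / 2 * (d * inverse (c * c))) * (c * (e * q))" if "c \<noteq> 0" for c d e q :: complex
        using that by (simp add: field_simps)
      ultimately have "deriv csqrt (rho z x) * of_real (deriv (fst v) x) * (cis (\<theta> x / 2) * exp (\<i> / 2 * of_real (snd z x)))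
         = (1 / 2 * (of_real (deriv (fst v) x) * inverse (rho z x))) * G_par \<theta> z x"
        unfolding G_par_def by metis
      moreover have "deriv exp w = exp w" for w :: complex by (rule DERIV_imp_deriv) (rule DERIV_exp)
      ultimately show "((\<lambda>x. deriv csqrt (rho z x) * of_real (deriv (fst v) x) * (cis (\<theta> x / 2) * exp (\<i> / 2 * of_real (snd z x)))) +
       (\<lambda>x. csqrt (rho z x) * (cis (\<theta> x / 2) * (deriv exp (\<i> / 2 * of_real (snd z x)) * (\<i> / 2 * of_real (snd v x)))))) x
       = G_dpar \<theta> z v x"
        by (simp add: G_dpar_def kappa_def G_par_def algebra_simps)
    qed
  qed (auto simp: G_par_def[abs_def])
qed

lemma G_dpar_smooth:
  assumes \<theta>: "\<theta> \<in> circle_lifts s"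
  shows "smooth_deriv (prod_nspace GP GP) X (G_dom \<times> vecs GP) (\<lambda>z. G_dpar \<theta> (fst z) (snd z))
     (\<lambda>z v. G_d2par \<theta> (fst z) (fst v) (snd z) + G_dpar \<theta> (fst z) (snd v))"
proof -
  let ?P = "prod_nspace GP GP" and ?W = "G_dom \<times> vecs GP"
  have nP: "normed_nspace ?P" by (rule normed_nspace_prod[OF nGP nGP])
  have W: "?W \<subseteq> vecs ?P" using G_dom_vecs by auto
  have F: "bounded_linear_on ?P GP fst" "bounded_linear_on ?P GP snd"
    unfolding bounded_linear_on_def lin_on_def using vnorm_fst_le[of GP _ GP] vnorm_snd_le[of GP _ GP]
    by (auto intro!: exI[of _ 1])
  have f1: "smooth_deriv ?P GP ?W fst (\<lambda>z v. fst v)" by (rule smooth_deriv_linear[OF nP nGP F(1) W])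
  have hi: "inverse holomorphic_on slit" by (rule holomorphic_on_inverse) (auto simp: slit_def)
  have r: "smooth_deriv ?P X ?W (\<lambda>z. rho (fst z)) (\<lambda>z v. cplx (deriv (fst (fst v))))"
    by (rule smooth_deriv_compose[OF nP nGP nX f1 rho_smooth_dom]) auto
  have i: "smooth_deriv ?P X ?W (\<lambda>z x. inverse (rho (fst z) x)) (\<lambda>z v x. deriv inverse (rho (fst z) x) * of_real (deriv (fst (fst v)) x))"
    by (rule smooth_deriv_compose[OF nP nX nX r smooth_deriv_holomorphic[OF s open_slit hi]]) (auto simp: G_dom_iff)
  have a: "smooth_deriv ?P X ?W (\<lambda>z. cplx (deriv (fst (snd z)))) (\<lambda>z v. cplx (deriv (fst (snd v))))"
    by (rule smooth_deriv_linear[OF nP nX bounded_linear_on_compose[OF F(2) bounded_linear_on_deriv_fst nGP] W])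
  have b: "smooth_deriv ?P X ?W (\<lambda>z x. \<i> / 2 * of_real (snd (snd z) x)) (\<lambda>z v x. \<i> / 2 * of_real (snd (snd v) x))"
    by (rule smooth_deriv_linear[OF nP nX bounded_linear_on_compose[OF F(2) bounded_linear_on_half_snd nGP] W])
  note ai = smooth_deriv_linear_compose[OF nP nX nX bounded_linear_on_cmult[of s "1/2"]
    smooth_deriv_bilinear_compose[OF nP nX nX nX bounded_bilinear_times[OF s_half] a i]]
  note k = smooth_deriv_add[OF nP nX ai b]
  have p: "smooth_deriv ?P X ?W (\<lambda>z. G_par \<theta> (fst z)) (\<lambda>z v. G_dpar \<theta> (fst z) (fst v))"
    by (rule smooth_deriv_compose[OF nP nGP nX f1 G_par_smooth[OF \<theta>]]) auto
  show ?thesis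
  proof (rule smooth_deriv_cong[OF smooth_deriv_bilinear_compose[OF nP nX nX nX bounded_bilinear_times[OF s_half] k p]])
    fix z v assume z: "z \<in> ?W"
    have inv: "deriv inverse (rho (fst z) x) = - ((inverse (rho (fst z) x))\<^sup>2)" for x
      using DERIV_imp_deriv[OF DERIV_inverse[of "rho (fst z) x"]] rho_nonzero(1)[of "fst z" x] z by (auto simp: numeral_2_eq_2)
    show "(\<lambda>x. ((\<lambda>x. 1 / 2 * ((\<lambda>x. of_real (deriv (fst (snd v)) x) * inverse (rho (fst z) x)) +
              (\<lambda>x. of_real (deriv (fst (snd z)) x) * (deriv inverse (rho (fst z) x) * of_real (deriv (fst (fst v)) x)))) x) +
          (\<lambda>x. \<i> / 2 * of_real (snd (snd v) x))) x * G_par \<theta> (fst z) x) +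
      (\<lambda>x. ((\<lambda>x. 1 / 2 * (of_real (deriv (fst (snd z)) x) * inverse (rho (fst z) x))) + (\<lambda>x. \<i> / 2 * of_real (snd (snd z) x))) x * G_dpar \<theta> (fst z) (fst v) x)
      = G_d2par \<theta> (fst z) (fst v) (snd z) + G_dpar \<theta> (fst z) (snd v)"
      by (simp add: fun_eq_iff inv G_d2par_def G_dpar_def kappa_def algebra_simps)
  qed (auto simp: G_dpar_def kappa_def fun_eq_iff)
qed

text \<open>A left inverse of the parametrisation, defined for functions of any norm: the modulus
  enters through f times its conjugate, a smooth expression, and \<open>Ln\<close> measures the
  phase relative to \<theta>. The factor 2 undoes the half angle.\<close>

definition G_ret :: "(real \<Rightarrow> real) \<Rightarrow> (real \<Rightarrow> complex) \<Rightarrow> G_vector" where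
  "G_ret \<theta> f = (mean_free_primitive (\<lambda>x. Re (f x * cnj (f x))), \<lambda>x. Im (2 * Ln (cis (- \<theta> x / 2) * f x)))"

definition G_nb :: "(real \<Rightarrow> real) \<Rightarrow> (real \<Rightarrow> complex) set" where
  "G_nb \<theta> = {f \<in> Hs s. (\<lambda>x. cis (- \<theta> x / 2) * f x) \<in> Hs_into s slit}"

lemma G_nb_open:
  assumes \<theta>: "\<theta> \<in> circle_lifts s"
  shows "open_in X (G_nb \<theta>)"
proof -
  have vo: "open_in X (Hs s)" by (auto simp: open_in_def intro: exI[of _ 1])
  show ?thesis
    unfolding G_nb_def
    by (rule smooth_deriv_open_preimage[OF smooth_deriv_linear[OF nX nX bounded_linear_on_mult[OF s_half Hs_half_exp(2)[OF \<theta>]] order_refl]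
          nX nX vo open_Hs_into[OF s open_slit]])
qed

text \<open>The derivative stays implicit: an embedded manifold asks for some \<open>dco\<close>,
  and on tangent vectors it is determined by \<open>dco_dpar\<close>.\<close>

lemma G_ret_smooth:
  assumes \<theta>: "\<theta> \<in> circle_lifts s"
  shows "\<exists>d. smooth_deriv X GP (G_nb \<theta>) (G_ret \<theta>) d"
proof -
  have nb: "G_nb \<theta> \<subseteq> Hs s" by (auto simp: G_nb_def)
  have id: "bounded_linear_on X X (\<lambda>f. f)" unfolding bounded_linear_on_def by (intro conjI exI[of _ 1]) auto
  note 1 = smooth_deriv_linear[OF nX nX id nb]
  note 2 = smooth_deriv_linear[OF nX nX bounded_linear_on_cnj[of s] nb]
  note 3 = smooth_deriv_bilinear_compose[OF nX nX nX nX bounded_bilinear_times[OF s_half] 1 2]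
  note 4 = smooth_deriv_linear_compose[OF nX nX normed_sobolev_real bounded_linear_on_Re 3]
  have P: "bounded_linear_on (sobolev_real s) (sobolev_real0 m) mean_free_primitive"
    using bounded_linear_on_mean_free_primitive[OF s_half] by simp
  note 5 = smooth_deriv_linear_compose[OF nX normed_sobolev_real normed_sobolev_real0 P 4]
  have hl: "Ln holomorphic_on slit" unfolding slit_def by (rule holomorphic_on_Ln) auto
  note 6 = smooth_deriv_linear[OF nX nX bounded_linear_on_mult[OF s_half Hs_half_exp(2)[OF \<theta>]] nb]
  note 7 = smooth_deriv_compose[OF nX nX nX 6 smooth_deriv_holomorphic[OF s open_slit hl]]
  have im: "(\<lambda>f x. cis (- \<theta> x / 2) * f x) ` G_nb \<theta> \<subseteq> Hs_into s slit" by (auto simp: G_nb_def)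
  note 8 = smooth_deriv_linear_compose[OF nX nX normed_sobolev_real bounded_linear_on_Im
      smooth_deriv_linear_compose[OF nX nX nX bounded_linear_on_cmult[of s 2] 7[OF im]]]
  have eq: "(\<lambda>f. (mean_free_primitive (\<lambda>x. Re (f x * cnj (f x))), \<lambda>x. Im (2 * Ln (cis (- \<theta> x / 2) * f x)))) = G_ret \<theta>"
    by (simp add: fun_eq_iff G_ret_def)
  show ?thesis
    using smooth_deriv_Pair[OF nX normed_sobolev_real0 normed_sobolev_real 5 8] unfolding eq by blast
qed

end

context madelung_setting
begin

section \<open>The transform in the charts of the group\<close>

lemma madelung_apply: "madelung (\<phi>, \<tau>) x = of_real (sqrt (deriv \<phi> x)) * half_exp (\<tau> x)"
  by (simp add: madelung_def)

lemma norm_madelung: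
  assumes "\<phi> \<in> Diff0 m"
  shows "madelung (\<phi>, \<tau>) x * cnj (madelung (\<phi>, \<tau>) x) = of_real (deriv \<phi> x)"
    "(cmod (madelung (\<phi>, \<tau>) x))\<^sup>2 = deriv \<phi> x" "madelung (\<phi>, \<tau>) x \<noteq> 0"
proof -
  have p: "0 < deriv \<phi> x" by (rule Diff0_deriv(2)[OF m' assms])
  show 2: "(cmod (madelung (\<phi>, \<tau>) x))\<^sup>2 = deriv \<phi> x"
    using p by (simp add: madelung_apply norm_mult)
  show "madelung (\<phi>, \<tau>) x * cnj (madelung (\<phi>, \<tau>) x) = of_real (deriv \<phi> x)"
    unfolding complex_norm_square[symmetric] 2 ..
  show "madelung (\<phi>, \<tau>) x \<noteq> 0" using 2 p by force
qed

text \<open>Periodicity of \<phi> - id and \<phi> 0 = 0 give \<phi> 1 = 1, so \<phi>' has mean 1 and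
  its mean free primitive is \<phi> - id.\<close>

lemma Diff0_deriv_Hs:
  assumes "\<phi> \<in> Diff0 m"
  shows "cplx (deriv \<phi>) \<in> Hs s" "integral {0..1} (deriv \<phi>) = 1" "mean_free_primitive (deriv \<phi>) = (\<lambda>x. \<phi> x - x)"
proof -
  note D = Diff0_deriv[OF m' assms]
  have "cplx (deriv \<phi>) = (\<lambda>x. 1 + cplx (deriv (\<lambda>x. \<phi> x - x)) x)"
    unfolding D(3)[symmetric] of_real_add of_real_1 ..
  then show H: "cplx (deriv \<phi>) \<in> Hs s"
    using Hs_add(1)[OF Hs_const(1)[of 1] Hs_real_deriv(2)[OF m' D(4)]] by simp
  have "circle_fun (cplx (\<lambda>x. \<phi> x - x))" by (rule Hs_circle[OF D(4)])
  then have "\<phi> (0 + 1) - (0 + 1) = \<phi> 0 - 0" unfolding cplx_circle by blast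
  then have 1: "\<phi> 1 = 1" using D(5) by simp
  have "(deriv \<phi> has_integral (\<phi> 1 - \<phi> 0)) {0..1}"
    by (rule fundamental_theorem_of_calculus)
       (use D(1) in \<open>auto simp flip: has_real_derivative_iff_has_vector_derivative intro: has_field_derivative_at_within\<close>)
  then show I: "integral {0..1} (deriv \<phi>) = 1" using 1 D(5) by (simp add: integral_unique)
  show "mean_free_primitive (deriv \<phi>) = (\<lambda>x. \<phi> x - x)"
    by (rule mean_free_primitive_eqI[OF s_half H]) (auto simp: I D(5) intro!: DERIV_diff D(1))
qed

lemma G_par_madelung:
  assumes "\<phi> \<in> Diff0 m" "\<tau> = (\<lambda>x. abs_circle4pi (\<theta> x + h x))"
  shows "G_par \<theta> (\<lambda>x. \<phi> x - x, h) = madelung (\<phi>, \<tau>)"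
proof
  fix x
  note D = Diff0_deriv(2,3)[OF m' assms(1), of x]
  have "rho (\<lambda>x. \<phi> x - x, h) x = of_real (deriv \<phi> x)" unfolding rho_def fst_conv D(2) ..
  then have "csqrt (rho (\<lambda>x. \<phi> x - x, h) x) = of_real (sqrt (deriv \<phi> x))"
    using csqrt_of_real_nonneg[of "of_real (deriv \<phi> x)"] D(1) by simp
  moreover have "exp (\<i> / 2 * of_real (h x)) = cis (h x / 2)" by (simp add: cis_conv_exp)
  ultimately show "G_par \<theta> (\<lambda>x. \<phi> x - x, h) x = madelung (\<phi>, \<tau>) x"
    by (simp add: G_par_def madelung_apply assms(2) half_exp_abs cis_mult add_divide_distrib)
qed

lemma coord_dom: "\<phi> \<in> Diff0 m \<Longrightarrow> circle_coord s \<theta> \<tau> h \<Longrightarrow> (\<lambda>x. \<phi> x - x, h) \<in> G_dom"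
  using Diff0_iff[OF m'] unfolding circle_coord_def G_dom_def by auto

lemma coord_circle:
  assumes "\<theta> \<in> circle_lifts s" "circle_coord s \<theta> \<tau> h"
  shows "\<tau> \<in> sobolev_circle s"
proof -
  obtain n :: int where n: "cplx (\<lambda>x. \<theta> x - 4 * pi * of_int n * x) \<in> Hs s"
    using assms(1) by (auto simp: circle_lifts_def)
  have h: "cplx h \<in> Hs s" using assms(2) by (simp add: circle_coord_def)
  have "cplx (\<lambda>x. \<theta> x + h x - 4 * pi * of_int n * x) \<in> Hs s"
    using Hs_add(1)[OF n h] by (simp add: algebra_simps)
  then have "(\<lambda>x. \<theta> x + h x) \<in> circle_lifts s" unfolding circle_lifts_def by auto
  then show ?thesis
    using assms(2) unfolding sobolev_circle_def circle_coord_def by (auto simp: o_def intro!: bexI[of _ "\<lambda>x. \<theta> x + h x"])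
qed

lemma madelung_lift_Hs:
  assumes "\<phi> \<in> Diff0 m" "\<theta> \<in> circle_lifts s" "circle_coord s \<theta> \<tau> h"
  shows "madelung (\<phi>, \<tau>) \<in> Hs s"
  using smooth_deriv_vecs(1)[OF G_par_smooth[OF assms(2)] coord_dom[OF assms(1,3)]]
    G_par_madelung[OF assms(1), of \<tau> \<theta> h] assms(3) by (simp add: circle_coord_def)

lemma coord_0: "circle_coord s \<theta> (abs_circle4pi \<circ> \<theta>) (\<lambda>x. 0)"
  using Hs_const(1)[of 0 s] by (simp add: circle_coord_def o_def)

lemma madelung_U_points:
  assumes "\<phi> \<in> Diff0 m" "\<tau> \<in> sobolev_circle s"
  shows "madelung (\<phi>, \<tau>) \<in> U_points s"
proof -
  obtain \<theta> where \<theta>: "\<theta> \<in> circle_lifts s" "\<tau> = abs_circle4pi \<circ> \<theta>" using assms(2) by (auto simp: sobolev_circle_def)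
  have H: "madelung (\<phi>, \<tau>) \<in> Hs s" unfolding \<theta>(2) by (rule madelung_lift_Hs[OF assms(1) \<theta>(1) coord_0])
  have "ip (madelung (\<phi>, \<tau>)) (madelung (\<phi>, \<tau>)) = 1"
    using Re_L2_inner_self(1)[OF Hs_circle[OF H]] norm_madelung(2)[OF assms(1)] Diff0_deriv_Hs(2)[OF assms(1)] by simp
  then show ?thesis using H norm_madelung(3)[OF assms(1)] by (simp add: U_points_iff)
qed

lemma madelung_polar:
  assumes "\<phi> \<in> Diff0 m" "circle_coord s \<theta> \<tau> h"
  shows "cis (- \<theta> x / 2) * madelung (\<phi>, \<tau>) x = of_real (sqrt (deriv \<phi> x)) * cis (h x / 2)"
    "0 < sqrt (deriv \<phi> x)" "\<bar>h x / 2\<bar> < pi"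
proof -
  have "madelung (\<phi>, \<tau>) x = of_real (sqrt (deriv \<phi> x)) * cis ((\<theta> x + h x) / 2)"
    using assms(2) by (simp add: madelung_apply circle_coord_def half_exp_abs)
  moreover have "cis (- \<theta> x / 2) * cis ((\<theta> x + h x) / 2) = cis (h x / 2)" by (simp add: cis_mult add_divide_distrib)
  ultimately show "cis (- \<theta> x / 2) * madelung (\<phi>, \<tau>) x = of_real (sqrt (deriv \<phi> x)) * cis (h x / 2)"
    by (metis mult.left_commute)
  show "0 < sqrt (deriv \<phi> x)" using Diff0_deriv(2)[OF m' assms(1)] by simp
  have "\<bar>h x\<bar> < 2 * pi" using assms(2) by (simp add: circle_coord_def)
  then show "\<bar>h x / 2\<bar> < pi" by simp
qed

lemma G_ret_madelung:
  assumes \<phi>: "\<phi> \<in> Diff0 m" and h: "circle_coord s \<theta> \<tau> h"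
  shows "G_ret \<theta> (madelung (\<phi>, \<tau>)) = (\<lambda>x. \<phi> x - x, h)"
proof -
  have "Im (2 * Ln (cis (- \<theta> x / 2) * madelung (\<phi>, \<tau>) x)) = h x" for x
    unfolding madelung_polar(1)[OF \<phi> h] Ln_polar[OF madelung_polar(2,3)[OF \<phi> h]] by simp
  then show ?thesis
    unfolding G_ret_def norm_madelung(1)[OF \<phi>] using Diff0_deriv_Hs(3)[OF \<phi>] by simp
qed

lemma madelung_G_nb:
  assumes \<phi>: "\<phi> \<in> Diff0 m" and \<theta>: "\<theta> \<in> circle_lifts s" and h: "circle_coord s \<theta> \<tau> h"
  shows "madelung (\<phi>, \<tau>) \<in> G_nb \<theta>"
proof -
  note H = madelung_lift_Hs[OF \<phi> \<theta> h]
  have "cis (- \<theta> x / 2) * madelung (\<phi>, \<tau>) x \<in> slit" for x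
    unfolding madelung_polar(1)[OF \<phi> h] slit_def using polar_slit[OF madelung_polar(2,3)[OF \<phi> h]] by simp
  then show ?thesis
    using H Hs_mult(1)[OF s_half Hs_half_exp(2)[OF \<theta>] H] by (simp add: G_nb_def Hs_into_def)
qed

text \<open>Any coordinate of a point is returned by \<open>G_ret\<close> at its image, so there is
  only one.\<close>

lemma the_coord:
  assumes "\<phi> \<in> Diff0 m" "circle_coord s \<theta> \<tau> h"
  shows "(THE h. circle_coord s \<theta> \<tau> h) = h"
proof (rule the_equality[where P = "circle_coord s \<theta> \<tau>", OF assms(2)])
  fix k assume "circle_coord s \<theta> \<tau> k"
  from G_ret_madelung[OF assms(1) this] show "k = h" using G_ret_madelung[OF assms] by simp
qed

text \<open>Off the cut, the principal argument of cis(-\<theta>/2) times the transform lies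
  strictly between -pi and pi; twice it is the coordinate, since \<open>half_exp\<close> is
  injective. With \<open>madelung_G_nb\<close> this identifies the chart domain as a preimage of
  \<open>G_nb \<theta>\<close>.\<close>

lemma coord_exists:
  assumes \<phi>: "\<phi> \<in> Diff0 m" and \<theta>: "\<theta> \<in> circle_lifts s" and \<tau>: "\<tau> \<in> sobolev_circle s" and nb: "madelung (\<phi>, \<tau>) \<in> G_nb \<theta>"
  shows "circle_coord s \<theta> \<tau> (snd (G_ret \<theta> (madelung (\<phi>, \<tau>))))"
proof -
  obtain \<theta>' where \<theta>': "\<theta>' \<in> circle_lifts s" "\<tau> = abs_circle4pi \<circ> \<theta>'" using \<tau> by (auto simp: sobolev_circle_def)
  let ?z = "\<lambda>x. cis (- \<theta> x / 2) * madelung (\<phi>, \<tau>) x"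
  define h where "h = snd (G_ret \<theta> (madelung (\<phi>, \<tau>)))"
  have h: "h x = Im (2 * Ln (?z x))" for x by (simp add: h_def G_ret_def)
  obtain d where "smooth_deriv X GP (G_nb \<theta>) (G_ret \<theta>) d" using G_ret_smooth[OF \<theta>] by blast
  from smooth_deriv_vecs(1)[OF this nb] have H: "cplx h \<in> Hs s" by (simp add: h_def mem_Times_iff)
  have slit: "?z x \<notin> \<real>\<^sub>\<le>\<^sub>0" "?z x \<noteq> 0" for x
    using nb norm_madelung(3)[OF \<phi>, of \<tau> x] by (auto simp: G_nb_def Hs_into_def slit_def)
  have bound: "\<bar>h x\<bar> < 2 * pi" for x
    using Im_Ln_less_pi[OF slit(1)[of x]] mpi_less_Im_Ln[OF slit(2)[of x]] by (simp add: h abs_mult abs_less_iff)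
  have "half_exp (\<tau> x) = half_exp (abs_circle4pi (\<theta> x + h x))" for x
  proof -
    let ?r = "of_real (sqrt (deriv \<phi> x)) :: complex"
    have r: "cmod ?r = sqrt (deriv \<phi> x)" "?r \<noteq> 0" using Diff0_deriv(2)[OF m' \<phi>, of x] by auto
    have "?z x = ?r * (cis (- \<theta> x / 2) * half_exp (\<tau> x))" by (simp add: madelung_apply mult.left_commute)
    moreover have "?z x = of_real (cmod (?z x)) * cis (h x / 2)"
    proof -
      have "?z x = exp (Ln (?z x))" using slit(2) by simp
      also have "\<dots> = exp (of_real (ln (cmod (?z x))) + \<i> * of_real (Im (Ln (?z x))))"
        using slit(2) by (metis Re_Ln complex_eq)
      also have "\<dots> = of_real (cmod (?z x)) * cis (h x / 2)"
        using slit(2)[of x] by (simp add: exp_add exp_of_real cis_conv_exp h)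
      finally show ?thesis .
    qed
    moreover have "cmod (?z x) = sqrt (deriv \<phi> x)" using r by (simp add: norm_mult madelung_apply)
    ultimately have "?r * (cis (- \<theta> x / 2) * half_exp (\<tau> x)) = ?r * cis (h x / 2)" by metis
    then have "cis (- \<theta> x / 2) * half_exp (\<tau> x) = cis (h x / 2)" using r(2) by simp
    then have "cis (\<theta> x / 2) * (cis (- \<theta> x / 2) * half_exp (\<tau> x)) = cis ((\<theta> x + h x) / 2)"
      by (simp only: cis_mult add_divide_distrib)
    then show ?thesis by (simp add: half_exp_abs cis_mult mult.assoc[symmetric])
  qed
  then have "\<tau> = (\<lambda>x. abs_circle4pi (\<theta> x + h x))" by (simp add: half_exp_eq_iff fun_eq_iff)
  then have "circle_coord s \<theta> \<tau> h" using H bound by (simp add: circle_coord_def)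
  then show ?thesis unfolding h_def .
qed

lemma Diff0_of_dom:
  assumes "z \<in> G_dom"
  shows "(\<lambda>x. x + fst z x) \<in> Diff0 m" "(\<lambda>x. (x + fst z x) - x) = fst z"
proof -
  show eq: "(\<lambda>x. (x + fst z x) - x) = fst z" by simp
  show "(\<lambda>x. x + fst z x) \<in> Diff0 m"
    unfolding Diff0_iff[OF m'] using assms by (auto simp: G_dom_def)
qed

lemma G_chart_simps [simp]:
  "cdom (G_chart m \<theta>) = {(\<phi>, \<tau>). \<phi> \<in> Diff0 m \<and> (\<exists>h. circle_coord s \<theta> \<tau> h)}"
  "cmap (G_chart m \<theta>) = (\<lambda>(\<phi>, \<tau>). (\<lambda>x. \<phi> x - x, THE h. circle_coord s \<theta> \<tau> h))"
  "cdiff (G_chart m \<theta>) p = (\<lambda>U. U)" "cmodel (G_chart m \<theta>) = GP"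
  by (simp_all add: G_chart_def)

lemma G_chart_image:
  "cmap (G_chart m \<theta>) ` cdom (G_chart m \<theta>) = G_dom"
proof
  show "cmap (G_chart m \<theta>) ` cdom (G_chart m \<theta>) \<subseteq> G_dom"
    using coord_dom the_coord by fastforce
  show "G_dom \<subseteq> cmap (G_chart m \<theta>) ` cdom (G_chart m \<theta>)"
  proof
    fix z assume z: "z \<in> G_dom"
    let ?\<phi> = "\<lambda>x. x + fst z x" and ?\<tau> = "\<lambda>x. abs_circle4pi (\<theta> x + snd z x)"
    note \<phi> = Diff0_of_dom[OF z]
    have c: "circle_coord s \<theta> ?\<tau> (snd z)" using z by (auto simp: circle_coord_def G_dom_def)
    show "z \<in> cmap (G_chart m \<theta>) ` cdom (G_chart m \<theta>)"
    proof (rule image_eqI[of _ _ "(?\<phi>, ?\<tau>)"])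
      show "z = cmap (G_chart m \<theta>) (?\<phi>, ?\<tau>)" using \<phi>(2) the_coord[OF \<phi>(1) c] by (simp add: prod_eq_iff)
      show "(?\<phi>, ?\<tau>) \<in> cdom (G_chart m \<theta>)" using \<phi>(1) c by auto
    qed
  qed
qed

text \<open>The differential of the transform without reference to a chart: \<open>kappa\<close>
  with \<rho> replaced by \<phi>'.\<close>

definition G_demb :: "G_point \<Rightarrow> G_vector \<Rightarrow> real \<Rightarrow> complex" where
  "G_demb p v x = (1 / 2 * (of_real (deriv (fst v) x) * inverse (of_real (deriv (fst p) x))) + \<i> / 2 * of_real (snd v x)) * madelung p x"

section \<open>Bijectivity of the transform\<close>

lemma madelung_inj: "inj_on madelung (Diff0 m \<times> sobolev_circle s)"
proof (rule inj_onI)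
  fix p q assume p: "p \<in> Diff0 m \<times> sobolev_circle s" and q: "q \<in> Diff0 m \<times> sobolev_circle s" and eq: "madelung p = madelung q"
  obtain \<phi> \<tau> \<psi> \<sigma> where pq: "p = (\<phi>, \<tau>)" "q = (\<psi>, \<sigma>)" by fastforce
  have \<phi>: "\<phi> \<in> Diff0 m" and \<psi>: "\<psi> \<in> Diff0 m" using p q pq by auto
  have d: "deriv \<phi> = deriv \<psi>"
    using norm_madelung(2)[OF \<phi>, of \<tau>] norm_madelung(2)[OF \<psi>, of \<sigma>] eq unfolding pq by (simp add: fun_eq_iff)
  then have "(\<lambda>x. \<phi> x - x) = (\<lambda>x. \<psi> x - x)" using Diff0_deriv_Hs(3)[OF \<phi>] Diff0_deriv_Hs(3)[OF \<psi>] by simp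
  then have "\<phi> = \<psi>" by (simp add: fun_eq_iff)
  moreover have "\<tau> x = \<sigma> x" for x
  proof -
    have "of_real (sqrt (deriv \<psi> x)) * half_exp (\<tau> x) = of_real (sqrt (deriv \<psi> x)) * half_exp (\<sigma> x)"
      using fun_cong[OF eq, of x] d unfolding pq by (simp add: madelung_apply)
    moreover have "sqrt (deriv \<psi> x) \<noteq> 0" using Diff0_deriv(2)[OF m' \<psi>, of x] by simp
    ultimately show ?thesis by (simp add: half_exp_eq_iff)
  qed
  ultimately show "p = q" by (simp add: pq fun_eq_iff)
qed

text \<open>The argument of a nowhere vanishing \<open>f\<close> is lifted by integrating \<open>f' / f\<close>.\<close>

lemma phase_lift:
  assumes f: "f \<in> Hs s" "\<And>x. f x \<noteq> 0"
  shows "\<exists>\<theta>\<in>circle_lifts s. \<forall>x. f x = of_real (cmod (f x)) * cis (\<theta> x / 2)"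
proof -
  obtain f' where f': "f' \<in> Hs (s - 1)" "\<And>x. (f has_vector_derivative f' x) (at x)"
    using Hs_deriv[OF s f(1)] by blast
  have "open (- {0 :: complex})" "inverse holomorphic_on - {0 :: complex}"
    by (auto intro!: holomorphic_intros)
  from Hs_holomorphic[OF s this] have inv: "(\<lambda>x. inverse (f x)) \<in> Hs s" using f by (simp add: Hs_into_def)
  have s1: "s - 1 > 1/2" using m by simp
  define q where "q x = f' x * inverse (f x)" for x
  have qH: "q \<in> Hs (s - 1)"
    unfolding q_def[abs_def] by (rule Hs_mult(1)[OF s1 f'(1) Hs_mono(1)[OF inv]]) simp
  have cq: "circle_fun q" by (rule Hs_circle[OF qH])
  then have q: "continuous_on UNIV q" "q (x + 1) = q x" for x by (auto simp: circle_fun_def)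
  let ?g = "primitive q"
  have dg: "(?g has_vector_derivative q x) (at x)" for x by (rule primitive_has_vector_derivative[OF q(1)])
  \<comment> \<open>The exponential of a primitive of f'/f has the same logarithmic derivative as f,
    so the quotient is constant.\<close>
  have "((\<lambda>x. exp (- ?g x) * f x) has_vector_derivative 0) (at x)" for x
  proof -
    have "((\<lambda>x. exp (- ?g x)) has_vector_derivative - q x * exp (- ?g x)) (at x)"
      using field_vector_diff_chain_at[OF has_vector_derivative_minus[OF dg[of x]] DERIV_exp] by (simp add: o_def)
    note d = has_vector_derivative_mult[OF this f'(2)[of x]]
    have "exp (- ?g x) * f' x + - q x * exp (- ?g x) * f x = 0" using f(2)[of x] by (simp add: q_def)
    with d show ?thesis by simp
  qed
  from vector_derivative_zero_const[OF this] have "exp (- ?g x) * f x = exp (- ?g 0) * f 0" for x .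
  then have 0: "exp (- ?g x) * f x = f 0" for x by simp
  have "f x = (exp (- ?g x) * f x) * exp (?g x)" for x by (simp add: exp_minus)
  then have F: "f x = f 0 * exp (?g x)" for x unfolding 0 .
  have L: "exp (Ln (f 0)) = f 0" using f(2) by simp
  have fx: "f x = exp (Ln (f 0) + ?g x)" for x unfolding exp_add L by (rule F)
  define c where "c = integral {0..1} q"
  have per: "?g (x + 1) = ?g x + c" for x unfolding c_def by (rule primitive_periodic[OF q])
  have "f (0 + 1) = f 0" using Hs_circle[OF f(1)] unfolding circle_fun_def by blast
  moreover have "f 1 = f 0 * exp c" using F[of 1] per[of 0] by simp
  ultimately have "exp c = 1" using f(2)[of 0] by simp
  \<comment> \<open>The increment of the primitive over one period is a logarithm of 1; its
    imaginary part is 2 pi times the winding number.\<close>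
  then obtain n :: int where n: "Im c = 2 * pi * of_int n" unfolding exp_eq_1 by (auto simp: mult_ac)
  \<comment> \<open>Twice the argument of f, since the phase takes values in the circle of length 4
    pi; over one period it grows by 4 pi n.\<close>
  define \<theta> where "\<theta> x = 2 * Im (Ln (f 0) + ?g x)" for x
  define p where "p x = \<theta> x - 4 * pi * of_int n * x" for x
  have "((\<lambda>x. Im (Ln (f 0) + ?g x)) has_vector_derivative Im (0 + q x)) (at x)" for x
    by (intro bounded_linear.has_vector_derivative[OF bounded_linear_Im] has_vector_derivative_add has_vector_derivative_const dg)
  then have dI: "((\<lambda>x. Im (Ln (f 0) + ?g x)) has_real_derivative Im (q x)) (at x)" for x
    by (simp add: has_real_derivative_iff_has_vector_derivative)
  have "(p has_real_derivative 2 * Im (q x) - 4 * pi * of_int n) (at x)" for x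
    unfolding p_def \<theta>_def
    by (intro DERIV_diff DERIV_cmult) (rule dI DERIV_cmult_Id)+
  then have dp: "(p has_vector_derivative 2 * Im (q x) - 4 * pi * of_int n) (at x)" for x
    by (simp add: has_real_derivative_iff_has_vector_derivative)
  then have dcp: "(cplx p has_vector_derivative cplx (\<lambda>x. 2 * Im (q x) - 4 * pi * of_int n) x) (at x)" for x
    using bounded_linear.has_vector_derivative[OF bounded_linear_of_real] by blast
  have "p (x + 1) = p x" for x
    unfolding p_def \<theta>_def per by (simp add: n algebra_simps)
  then have cp: "circle_fun (cplx p)"
    unfolding cplx_circle using has_vector_derivative_continuous_on[OF dp] by blast
  obtain B where B: "\<And>x. cmod (cplx p x) \<le> B" using circle_fun_bounded[OF cp] by blast
  have "(\<lambda>x. 2 * cplx (\<lambda>x. Im (q x)) x + of_real (- 4 * pi * of_int n)) \<in> Hs (s - 1)"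
    by (intro Hs_add(1) Hs_const(1) Hs_cmult(1) Hs_Im(1) qH)
  then have dH: "cplx (\<lambda>x. 2 * Im (q x) - 4 * pi * of_int n) \<in> Hs (s - 1)" by simp
  \<comment> \<open>The periodic part has its derivative in H^(s-1), so \<open>Hs_raise\<close>
    brings it back to H^s.\<close>
  have "cplx p \<in> Hs s" using Hs_raise(1)[OF cp dH dcp B] by simp
  then have "\<theta> \<in> circle_lifts s" unfolding circle_lifts_def by (auto simp: p_def[abs_def])
  moreover have "f x = of_real (cmod (f x)) * cis (\<theta> x / 2)" for x
  proof -
    have "f x = of_real (exp (Re (Ln (f 0) + ?g x))) * cis (Im (Ln (f 0) + ?g x))"
      using fx[of x] exp_eq_polar by metis
    moreover have "cmod (f x) = exp (Re (Ln (f 0) + ?g x))" using fx[of x] norm_exp_eq_Re by metis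
    moreover have "\<theta> x / 2 = Im (Ln (f 0) + ?g x)" unfolding \<theta>_def by linarith
    ultimately show ?thesis by metis
  qed
  ultimately show ?thesis by blast
qed

lemma madelung_surj:
  assumes f: "f \<in> U_points s"
  shows "f \<in> madelung ` (Diff0 m \<times> sobolev_circle s)"
proof -
  have fH: "f \<in> Hs s" "\<And>x. f x \<noteq> 0" and 1: "ip f f = 1" using f by (auto simp: U_points_iff)
  obtain \<theta> where \<theta>: "\<theta> \<in> circle_lifts s" "\<And>x. f x = of_real (cmod (f x)) * cis (\<theta> x / 2)"
    using phase_lift[OF fH] by blast
  let ?g = "\<lambda>x. (cmod (f x))\<^sup>2"
  have "cplx ?g = (\<lambda>x. f x * cnj (f x))" by (simp only: complex_norm_square)
  then have gH: "cplx ?g \<in> Hs s" using Hs_mult(1)[OF s_half fH(1) Hs_cnj(1)[OF fH(1)]] by simp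
  have I: "integral {0..1} ?g = 1" using Re_L2_inner_self(1)[OF Hs_circle[OF fH(1)]] 1 by simp
  let ?u = "mean_free_primitive ?g"
  note P = mean_free_primitive[OF s_half gH]
  \<comment> \<open>The unit norm of f says that |f|^2 has mean 1, so id + u has derivative
    |f|^2.\<close>
  have du: "deriv ?u x = ?g x - 1" for x using DERIV_imp_deriv[OF P(1)[of x]] I by simp
  define \<phi> where "\<phi> x = x + ?u x" for x
  have u: "(\<lambda>x. \<phi> x - x) = ?u" by (simp add: \<phi>_def fun_eq_iff)
  have \<phi>: "\<phi> \<in> Diff0 m"
    unfolding Diff0_iff[OF m'] u using P(2) du fH(2) by simp
  have d\<phi>: "deriv \<phi> x = ?g x" for x using Diff0_deriv(3)[OF m' \<phi>, of x] du[of x] unfolding u by simp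
  have "madelung (\<phi>, abs_circle4pi \<circ> \<theta>) x = f x" for x
    using \<theta>(2)[of x] by (simp add: madelung_apply d\<phi> half_exp_abs)
  then have "f = madelung (\<phi>, abs_circle4pi \<circ> \<theta>)" by (simp add: fun_eq_iff)
  moreover have "abs_circle4pi \<circ> \<theta> \<in> sobolev_circle s" using \<theta>(1) by (auto simp: sobolev_circle_def)
  ultimately show ?thesis using \<phi> by blast
qed

lemma madelung_bij: "bij_betw madelung (Diff0 m \<times> sobolev_circle s) (U_points s)"
  unfolding bij_betw_def using madelung_inj madelung_U_points madelung_surj by auto

lemma G_manifold_simps [simp]:
  "points (G_manifold m) = Diff0 m \<times> sobolev_circle s" "tangent (G_manifold m) p = vecs GP"
  "atlas (G_manifold m) = G_chart m ` circle_lifts s"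
  by (auto simp: G_manifold_def)

lemma embedded_group:
  "\<exists>d. embedded_manifold X (U_points s) (G_manifold m) (circle_lifts s) (G_chart m) madelung G_demb
     G_par G_dpar G_d2par G_nb G_ret d"
proof -
  \<comment> \<open>A derivative of \<open>G_ret \<theta>\<close> is chosen for every \<theta>,
    since the locale takes \<open>dco\<close> as a function of the index.\<close>
  have "\<forall>\<theta>. \<exists>d. \<theta> \<in> circle_lifts s \<longrightarrow> smooth_deriv X GP (G_nb \<theta>) (G_ret \<theta>) d" using G_ret_smooth by blast
  then obtain d where d: "\<And>\<theta>. \<theta> \<in> circle_lifts s \<Longrightarrow> smooth_deriv X GP (G_nb \<theta>) (G_ret \<theta>) (d \<theta>)" by metis
  have "embedded_manifold X (U_points s) (G_manifold m) (circle_lifts s) (G_chart m) madelung G_demb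
     G_par G_dpar G_d2par G_nb G_ret d"
  proof unfold_locales
    show "normed_nspace X" by (rule nX)
    show "bij_betw madelung (points (G_manifold m)) (U_points s)" using madelung_bij by simp
    show "atlas (G_manifold m) = G_chart m ` circle_lifts s" by simp
    show "points (G_manifold m) = (\<Union>i\<in>circle_lifts s. cdom (G_chart m i))"
    proof
      show "points (G_manifold m) \<subseteq> (\<Union>i\<in>circle_lifts s. cdom (G_chart m i))"
        using coord_0 by (auto simp: sobolev_circle_def)
      show "(\<Union>i\<in>circle_lifts s. cdom (G_chart m i)) \<subseteq> points (G_manifold m)"
        using coord_circle by auto
    qed
    show "subspace (tangent (G_manifold m) p)" for p using nspace_subspace[OF nGP] by simp
  next
    fix \<theta> assume \<theta>: "\<theta> \<in> circle_lifts s"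
    note W = G_chart_image[of \<theta>]
    show "banach_nspace (cmodel (G_chart m \<theta>))"
      using banach_nspace_prod[OF banach_sobolev_real(2)[of m] banach_sobolev_real(1)[OF s_half]] m by simp
    show "open_in (cmodel (G_chart m \<theta>)) (cmap (G_chart m \<theta>) ` cdom (G_chart m \<theta>))"
      unfolding W using G_dom_open by simp
    show "open_in X (G_nb \<theta>)" by (rule G_nb_open[OF \<theta>])
    show "p \<in> cdom (G_chart m \<theta>) \<longleftrightarrow> p \<in> points (G_manifold m) \<and> madelung p \<in> G_nb \<theta>" for p
    proof -
      obtain \<phi> \<tau> where p: "p = (\<phi>, \<tau>)" by (cases p)
      have "(\<exists>h. circle_coord s \<theta> \<tau> h) \<longleftrightarrow> \<tau> \<in> sobolev_circle s \<and> madelung (\<phi>, \<tau>) \<in> G_nb \<theta>" if "\<phi> \<in> Diff0 m"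
        using madelung_G_nb[OF that \<theta>] coord_circle[OF \<theta>] coord_exists[OF that \<theta>, of \<tau>] by blast
      then show ?thesis unfolding p by auto
    qed
    show "smooth_deriv (cmodel (G_chart m \<theta>)) X (cmap (G_chart m \<theta>) ` cdom (G_chart m \<theta>)) (G_par \<theta>) (G_dpar \<theta>)"
      unfolding W using G_par_smooth[OF \<theta>] by simp
    show "smooth_deriv (prod_nspace (cmodel (G_chart m \<theta>)) (cmodel (G_chart m \<theta>))) X
        (cmap (G_chart m \<theta>) ` cdom (G_chart m \<theta>) \<times> vecs (cmodel (G_chart m \<theta>))) (\<lambda>z. G_dpar \<theta> (fst z) (snd z))
        (\<lambda>z v. G_d2par \<theta> (fst z) (fst v) (snd z) + G_dpar \<theta> (fst z) (snd v))"
      unfolding W using G_dpar_smooth[OF \<theta>] by simp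
    show "G_d2par \<theta> x a b = G_d2par \<theta> x b a" for x a b
      by (simp add: G_d2par_def fun_eq_iff mult_ac)
    show "smooth_deriv X (cmodel (G_chart m \<theta>)) (G_nb \<theta>) (G_ret \<theta>) (d \<theta>)" using d[OF \<theta>] by simp
    fix p assume "p \<in> cdom (G_chart m \<theta>)"
    then obtain \<phi> \<tau> h where p: "p = (\<phi>, \<tau>)" "\<phi> \<in> Diff0 m" "circle_coord s \<theta> \<tau> h" by auto
    have cm: "cmap (G_chart m \<theta>) p = (\<lambda>x. \<phi> x - x, h)" using the_coord[OF p(2,3)] by (simp add: p(1))
    show "cmap (G_chart m \<theta>) p = G_ret \<theta> (madelung p)" unfolding cm using G_ret_madelung[OF p(2,3)] by (simp add: p(1))
    have par: "G_par \<theta> (\<lambda>x. \<phi> x - x, h) = madelung p"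
      using G_par_madelung[OF p(2), of \<tau> \<theta> h] p(1,3) by (simp add: circle_coord_def)
    then show "G_par \<theta> (cmap (G_chart m \<theta>) p) = madelung p" unfolding cm .
    show "lin_on (tangent (G_manifold m) p) (cdiff (G_chart m \<theta>) p)" by simp
    show "bij_betw (cdiff (G_chart m \<theta>) p) (tangent (G_manifold m) p) (vecs (cmodel (G_chart m \<theta>)))"
      by (simp add: bij_betw_def)
    fix v assume "v \<in> tangent (G_manifold m) p"
    have "rho (\<lambda>x. \<phi> x - x, h) x = of_real (deriv \<phi> x)" for x
      unfolding rho_def fst_conv Diff0_deriv(3)[OF m' p(2)] ..
    then show "G_demb p v = G_dpar \<theta> (cmap (G_chart m \<theta>) p) (cdiff (G_chart m \<theta>) p v)"
      unfolding cm by (simp add: fun_eq_iff G_dpar_def kappa_def par G_demb_def p(1))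
  qed
  then show ?thesis by (rule exI[of _ d])
qed

text \<open>The squared modulus of the transform is \<phi>', so the product of two differentials is
  \<phi>' times that of the factors U1'/(2 \<phi>') + i U2/2. Its real part splits into the two
  summands of the metric, and the two halves give 1/4.\<close>

lemma H1_metric_eq:
  assumes p: "p \<in> points (G_manifold m)" and H: "G_demb p v \<in> Hs s" "G_demb p w \<in> Hs s"
  shows "H1_metric p v w = ip (G_demb p v) (G_demb p w)"
proof -
  obtain \<phi> \<tau> a b a' b' where eq: "p = (\<phi>, \<tau>)" "v = (a, b)" "w = (a', b')" by (metis surj_pair)
  have \<phi>: "\<phi> \<in> Diff0 m" using p eq by auto
  have "(\<lambda>x. Re (G_demb p v x * cnj (G_demb p w x))) = (\<lambda>x. 1 / 4 * (deriv a x * deriv a' x / deriv \<phi> x + b x * b' x * deriv \<phi> x))"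
  proof
    fix x
    have pos: "0 < deriv \<phi> x" by (rule Diff0_deriv(2)[OF m' \<phi>])
    let ?k = "\<lambda>a b. 1 / 2 * (of_real (deriv a x) * inverse (of_real (deriv \<phi> x))) + \<i> / 2 * of_real (b x) :: complex"
    have "G_demb p v x * cnj (G_demb p w x) = (?k a b * cnj (?k a' b')) * (madelung (\<phi>, \<tau>) x * cnj (madelung (\<phi>, \<tau>) x))"
      by (simp add: G_demb_def eq mult_ac)
    also have "\<dots> = of_real (deriv \<phi> x) * (?k a b * cnj (?k a' b'))" unfolding norm_madelung(1)[OF \<phi>] by (simp add: mult.commute)
    finally have 1: "Re (G_demb p v x * cnj (G_demb p w x)) = deriv \<phi> x * Re (?k a b * cnj (?k a' b'))" by simp
    have 2: "?k a b = Complex (deriv a x / (2 * deriv \<phi> x)) (b x / 2)" for a b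
    proof -
      have "1 / 2 * (of_real (deriv a x) * inverse (of_real (deriv \<phi> x))) = complex_of_real (deriv a x / (2 * deriv \<phi> x))"
        using pos by (simp add: field_simps)
      then show ?thesis by (simp add: Complex_eq)
    qed
    show "Re (G_demb p v x * cnj (G_demb p w x)) = 1 / 4 * (deriv a x * deriv a' x / deriv \<phi> x + b x * b' x * deriv \<phi> x)"
      unfolding 1 2 using pos by (simp add: field_simps power2_eq_square)
  qed
  moreover have "ip (G_demb p v) (G_demb p w) = integral {0..1} (\<lambda>x. Re (G_demb p v x * cnj (G_demb p w x)))"
    unfolding L2_inner_def
    using integral_linear[OF circle_fun_integrable[OF circle_fun_mult[OF Hs_circle[OF H(1)] circle_fun_cnj[OF Hs_circle[OF H(2)]]]] bounded_linear_Re]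
    by (simp add: o_def)
  ultimately have "ip (G_demb p v) (G_demb p w)
      = integral {0..1} (\<lambda>x. 1 / 4 * (deriv a x * deriv a' x / deriv \<phi> x + b x * b' x * deriv \<phi> x))" by simp
  then show ?thesis by (simp add: H1_metric_def eq)
qed

end

theorem theorem4p1:
  fixes m :: real
  assumes "m > 5 / 2"
  shows "magnetomorphism
    (G_manifold m, H1_metric,
     pullback (G_manifold m) (U_manifold (m - 1)) madelung (ext_deriv (U_manifold (m - 1)) alpha))
    (U_manifold (m - 1), L2_metric, ext_deriv (U_manifold (m - 1)) alpha)
    madelung"
proof -
  interpret madelung_setting m using assms by unfold_locales
  let ?G = "G_manifold m" and ?U = "U_manifold s"
  let ?\<sigma> = "ext_deriv ?U alpha"
  obtain d where "embedded_manifold X (U_points s) ?G (circle_lifts s) (G_chart m) madelung G_demb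
     G_par G_dpar G_d2par G_nb G_ret d" using embedded_group by blast
  then interpret P: embedded_pair X "U_points s" ?G "circle_lifts s" "G_chart m" madelung G_demb G_par G_dpar G_d2par G_nb G_ret d
     ?U "U_points s" "U_chart s" "\<lambda>f. f" "\<lambda>f v. v" U_par U_dpar U_d2par U_nb proj_perp "\<lambda>f0 f. proj_perp f0"
    using embedded_sphere by (rule embedded_pair.intro)
  \<comment> \<open>The group is embedded by the transform itself and the sphere by inclusion, so
    the transform is compatible with the two embeddings by construction.\<close>
  have f: "madelung p \<in> points ?U \<and> madelung p = madelung p" if "p \<in> points ?G" for p
    using madelung_U_points that by (auto simp: U_manifold_def)
  have tangent_map: "tangent_map ?G ?U madelung p v \<in> tangent ?U (madelung p) \<and> tangent_map ?G ?U madelung p v = G_demb p v"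
    if "p \<in> points ?G" "v \<in> tangent ?G p" for p v
    by (rule P.tangent_map_same_image[OF _ that]) (rule f)
  \<comment> \<open>\<open>alpha\<close> is half the symplectic form in the base point and the
    vector. The exterior derivative doubles the skew part, which yields the symplectic form
    itself.\<close>
  have A: "bounded_bilinear_on X X real_nspace (\<lambda>f g. 1 / 2 * L2_symplectic f g)"
  proof -
    note \<Omega> = L2_symplectic_bilinear[OF s_half, unfolded bounded_bilinear_on_def]
    from \<Omega> obtain C where "\<forall>f\<in>Hs s. \<forall>g\<in>Hs s. vnorm real_nspace (L2_symplectic f g) \<le> C * hnorm s f * hnorm s g"
      by blast
    then have "\<exists>C. \<forall>f\<in>Hs s. \<forall>g\<in>Hs s. vnorm real_nspace (1 / 2 * L2_symplectic f g) \<le> C * hnorm s f * hnorm s g"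
      by (intro exI[of _ "C / 2"]) (simp add: real_nspace_def abs_mult)
    moreover have "\<forall>f\<in>Hs s. lin_on (Hs s) (\<lambda>g. 1 / 2 * L2_symplectic f g)" "\<forall>g\<in>Hs s. lin_on (Hs s) (\<lambda>f. 1 / 2 * L2_symplectic f g)"
      using \<Omega> by (simp_all add: lin_on_def distrib_left)
    ultimately show ?thesis
      unfolding bounded_bilinear_on_def by (intro conjI) (simp_all add: real_nspace_def)
  qed
  have \<sigma>: "?\<sigma> p v w = L2_symplectic v w" if "p \<in> points ?U" "v \<in> tangent ?U p" "w \<in> tangent ?U p" for p v w
    using P.M2.ext_deriv_restricted[OF A, of alpha, OF _ that] L2_symplectic_skew[of w v]
    by (simp add: alpha_def L2_symplectic_def)
  \<comment> \<open>The tangent map is the identity on ambient vectors, so the pullback of a form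
    restricted from H^s is that form at the values of \<open>G_demb\<close>.\<close>
  have pull: "pullback ?G ?U madelung B p v w = C (G_demb p v) (G_demb p w)"
    if "\<And>p v w. p \<in> points ?U \<Longrightarrow> v \<in> tangent ?U p \<Longrightarrow> w \<in> tangent ?U p \<Longrightarrow> B p v w = C v w"
      "p \<in> points ?G" "v \<in> tangent ?G p" "w \<in> tangent ?G p" for B C p v w
  proof -
    note T = tangent_map[OF that(2,3)] tangent_map[OF that(2,4)]
    from that(1)[OF conjunct1[OF f[OF that(2)]] conjunct1[OF T(1)] conjunct1[OF T(2)]]
    show ?thesis unfolding pullback_def using T by simp
  qed
  note B = L2_inner_Re_bilinear[OF s_half] and \<Omega> = L2_symplectic_bilinear[OF s_half]
  have H1: "H1_metric p v w = ip (G_demb p v) (G_demb p w)"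
    if "p \<in> points ?G" "v \<in> tangent ?G p" "w \<in> tangent ?G p" for p v w
    by (rule H1_metric_eq[OF that(1)]) (use P.M1.demb_vecs that in auto)
  have pull\<sigma>: "pullback ?G ?U madelung ?\<sigma> p v w = L2_symplectic (G_demb p v) (G_demb p w)"
    if "p \<in> points ?G" "v \<in> tangent ?G p" "w \<in> tangent ?G p" for p v w
    by (rule pull[of ?\<sigma> L2_symplectic, OF \<sigma> that])
  have pullg: "pullback ?G ?U madelung L2_metric p v w = ip (G_demb p v) (G_demb p w)"
    if "p \<in> points ?G" "v \<in> tangent ?G p" "w \<in> tangent ?G p" for p v w
    by (rule pull[of L2_metric "\<lambda>v w. ip v w", OF _ that]) (simp add: L2_metric_def)
  have G: "magnetic_system (?G, H1_metric, pullback ?G ?U madelung ?\<sigma>)"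
    unfolding magnetic_system_def prod.case
  proof (intro conjI)
    show "is_manifold ?G" by (rule P.M1.embedded_is_manifold)
    show "riemannian_metric ?G H1_metric"
      by (rule P.M1.restricted_riemannian_metric[OF B H1]) (simp_all add: ip_commute ip_pos)
    show "closed_two_form ?G (pullback ?G ?U madelung ?\<sigma>)"
      by (rule P.M1.restricted_closed_two_form[OF \<Omega> pull\<sigma> L2_symplectic_skew])
  qed
  have U: "magnetic_system (?U, L2_metric, ?\<sigma>)"
    unfolding magnetic_system_def prod.case
  proof (intro conjI)
    show "is_manifold ?U" by (rule P.M2.embedded_is_manifold)
    show "riemannian_metric ?U L2_metric"
      by (rule P.M2.restricted_riemannian_metric[OF B]) (simp_all add: L2_metric_def ip_commute ip_pos)
    show "closed_two_form ?U ?\<sigma>"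
      by (rule P.M2.restricted_closed_two_form[OF \<Omega> \<sigma> L2_symplectic_skew])
  qed
  have "diffeomorphism ?G ?U madelung" by (rule P.diffeomorphism_same_image) (rule f)
  then show ?thesis
    unfolding magnetomorphism_def prod.case using G U pullg H1 by simp
qed

end
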